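(* Let $\mathbb{K}\subset\overline{\mathbb{Q}}$ be a number field and let $f\in\mathbb{K}[[x]]$ be an $E$-function which is a solution of a differential equation $Ay'=By+C$ with $A,B,C\in\mathbb{K}[x]$, $A\neq 0$. Assume that $f$ is transcendental over $\overline{\mathbb{Q}}(x)$. Let $\alpha\in\overline{\mathbb{Q}}$ be such that $\alpha A(\alpha)\neq 0$ and set $d:=[\mathbb{K}(\alpha):\mathbb{Q}]\ge 1$. Then for any $\varepsilon>0$ and any integer $\delta\ge 1$, there exists a constant $c=c(\varepsilon,\alpha,\delta,\mathbb{K})>0$ (the function $f$ being fixed) such that for all $H\ge 1$ we have $$\left|P\big(f(\alpha)\big)\right|>\frac{c}{H^{\mu(d,\delta)+\varepsilon}}$$ for every polynomial $P\in\mathbb{Z}[X]\setminus\{0\}$ of degree $\le\delta$ and height $H(P)\le H$.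
   Context: The field $\overline{\mathbb{Q}}$ of algebraic numbers is embedded into $\mathbb{C}$. House and denominator: for an algebraic number $a$, its house is the maximum of the moduli of $a$ and of all its Galois conjugates over $\mathbb{Q}$. For algebraic numbers $a_0,\dots,a_n$, $\mathrm{den}(a_0,\dots,a_n)$ is the least integer $D\ge 1$ such that $Da_0,\dots,Da_n$ are all algebraic integers. $E$-function (in Siegel's original sense): a power series $f(x)=\sum_{n=0}^\infty a_n x^n/n!$ with all $a_n\in\overline{\mathbb{Q}}$ such that $f$ satisfies a (nonzero) linear differential equation over $\overline{\mathbb{Q}}(x)$ and, for every $\varepsilon>0$, there exists $c(\varepsilon)>0$ such that for all $n\ge 0$ the house of $a_n$ is at most $c(\varepsilon)\,n!^{\varepsilon}$ and $\mathrm{den}(a_0,\dots,a_n)\le c(\varepsilon)\,n!^{\varepsilon}$. Such a series defines an entire function on $\mathbb{C}$, and $f(\alpha)$ denotes the value of this function at $\alpha$. Height: for $P(X)=\sum_j a_jX^j\in\mathbb{Z}[X]$, $H(P):=\max_j|a_j|$. The exponent $\mu(d,\delta)$: for integers $d,\delta,N\ge 1$ with $N\ge\delta d$, put $$\psi(d,\delta,N):=\frac{\delta d^2(N-\delta+1)}{N-\delta d+1}+d(N-\delta+1)-1.$$ If $d=1$, set $\lambda:=\delta$. If $d\ge 2$, set $N_1:=\delta d-1+\lfloor\delta\sqrt{d^2-d}\rfloor$ and $N_2:=N_1+1$ (both are $\ge\delta d$), and let $\lambda:=N_1$ if $\psi(d,\delta,N_1)\le\psi(d,\delta,N_2)$ and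 $\lambda:=N_2$ if $\psi(d,\delta,N_2)<\psi(d,\delta,N_1)$. Then $\mu(d,\delta):=\psi(d,\delta,\lambda)$. In particular $\mu(1,\delta)=\delta$. *)

theory Defs
  imports "HOL-Analysis.Analysis" "HOL-Computational_Algebra.Computational_Algebra"
begin

definition is_subfield :: "complex set \<Rightarrow> bool" where
  "is_subfield K \<longleftrightarrow> 0 \<in> K \<and> 1 \<in> K \<and> (\<forall>x\<in>K. \<forall>y\<in>K. x - y \<in> K \<and> x * y \<in> K) \<and>
     (\<forall>x\<in>K. inverse x \<in> K)"

global_interpretation rat_vs: vector_space "\<lambda>(q::rat) (z::complex). of_rat q * z"
  by unfold_locales (simp_all add: algebra_simps of_rat_add of_rat_mult)

definition number_field :: "complex set \<Rightarrow> bool" where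
  "number_field K \<longleftrightarrow> is_subfield K \<and> (\<exists>B. finite B \<and> rat_vs.span B = K)"

definition adjoin :: "complex set \<Rightarrow> complex \<Rightarrow> complex set" where
  "adjoin K \<alpha> = is_subfield hull (insert \<alpha> K)"

definition field_degree :: "complex set \<Rightarrow> nat" where
  "field_degree L = rat_vs.dim L"

text \<open>The Galois conjugates of \<open>a\<close> (including \<open>a\<close> itself) are the roots of its minimal polynomial
  over the rationals, which is up to a scalar the only irreducible rational polynomial
  that vanishes at \<open>a\<close>.\<close>

definition galois_conjugates :: "complex \<Rightarrow> complex set" where
  "galois_conjugates a = {b. \<exists>p::rat poly. irreducible p \<and>
     poly (map_poly of_rat p) a = 0 \<and> poly (map_poly of_rat p) b = 0}"

definition house :: "complex \<Rightarrow> real" where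
  "house a = Max (norm ` galois_conjugates a)"

definition den :: "complex set \<Rightarrow> nat" where
  "den S = (LEAST D. D \<ge> 1 \<and> (\<forall>x\<in>S. algebraic_int (of_nat D * x)))"

text \<open>The field of rational functions with algebraic coefficients, as a subfield of the
  field of formal Laurent series.\<close>

definition alg_rat_functions :: "complex fls set" where
  "alg_rat_functions = {fps_to_fls (fps_of_poly p) / fps_to_fls (fps_of_poly q) | p q.
     (\<forall>i. algebraic (coeff p i)) \<and> (\<forall>i. algebraic (coeff q i)) \<and> q \<noteq> 0}"

definition satisfies_linear_ode :: "complex fps \<Rightarrow> bool" where
  "satisfies_linear_ode f \<longleftrightarrow> (\<exists>(m::nat) (r :: nat \<Rightarrow> complex fls).
     (\<forall>k\<le>m. r k \<in> alg_rat_functions) \<and> (\<exists>k\<le>m. r k \<noteq> 0) \<and>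
     (\<Sum>k\<le>m. r k * (fls_deriv ^^ k) (fps_to_fls f)) = 0)"

definition transcendental_series :: "complex fps \<Rightarrow> bool" where
  "transcendental_series f \<longleftrightarrow> \<not> (\<exists>P :: complex fls poly. P \<noteq> 0 \<and>
     (\<forall>i. coeff P i \<in> alg_rat_functions) \<and> poly P (fps_to_fls f) = 0)"

text \<open>The conditions are on the numbers \<open>a n = fact n * fps_nth f n\<close>, for which
  \<open>f(x) = (\<Sum>n. a n * x ^ n / fact n)\<close>.\<close>

definition E_function :: "complex fps \<Rightarrow> bool" where
  "E_function f \<longleftrightarrow> (let a = (\<lambda>n. fact n * fps_nth f n) in
     (\<forall>n. algebraic (a n)) \<and> satisfies_linear_ode f \<and>
     (\<forall>\<epsilon>>0. \<exists>c>0. \<forall>n. house (a n) \<le> c * fact n powr \<epsilon> \<and>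
        real (den (a ` {..n})) \<le> c * fact n powr \<epsilon>))"

definition poly_height :: "int poly \<Rightarrow> int" where
  "poly_height P = Max ((\<lambda>j. \<bar>coeff P j\<bar>) ` {..degree P})"

definition \<psi> :: "nat \<Rightarrow> nat \<Rightarrow> nat \<Rightarrow> real" where
  "\<psi> d \<delta> N = real \<delta> * real d ^ 2 * (real N - real \<delta> + 1) / (real N - real \<delta> * real d + 1)
     + real d * (real N - real \<delta> + 1) - 1"

text \<open>For \<open>d \<ge> 1\<close> and \<open>\<delta> \<ge> 1\<close> the subtraction on naturals does not truncate.\<close>

definition N1 :: "nat \<Rightarrow> nat \<Rightarrow> nat" where
  "N1 d \<delta> = \<delta> * d - 1 + nat \<lfloor>real \<delta> * sqrt (real d ^ 2 - real d)\<rfloor>"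

definition N2 :: "nat \<Rightarrow> nat \<Rightarrow> nat" where
  "N2 d \<delta> = N1 d \<delta> + 1"

definition opt_N :: "nat \<Rightarrow> nat \<Rightarrow> nat" where
  "opt_N d \<delta> = (if d = 1 then \<delta>
     else if \<psi> d \<delta> (N1 d \<delta>) \<le> \<psi> d \<delta> (N2 d \<delta>) then N1 d \<delta> else N2 d \<delta>)"

definition \<mu> :: "nat \<Rightarrow> nat \<Rightarrow> real" where
  "\<mu> d \<delta> = \<psi> d \<delta> (opt_N d \<delta>)"

lemma mu_1: "\<mu> 1 \<delta> = real \<delta>"
  by (simp add: \<mu>_def \<psi>_def opt_N_def)

end

theory Submission
  imports Defs "Jordan_Normal_Form.Char_Poly" "HOL-Computational_Algebra.Field_as_Ring"
begin

text \<open>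
  The proof follows Siegel and Shidlovskii. Put \<open>y = f(\<alpha>)\<close> and let \<open>d\<close> be the degree of the field
  generated by \<open>K\<close> and \<open>\<alpha>\<close>. All powers of \<open>n!\<close> with an arbitrarily small exponent are neglected here.

  For a large integer \<open>n\<close>, Siegel's lemma yields a polynomial \<open>Q\<close> in \<open>x\<close> and \<open>Y\<close>, of degree less than \<open>n\<close>
  in \<open>x\<close> and at most \<open>N\<close> in \<open>Y\<close>, with coefficients of size \<open>n!\<close>, such that \<open>Q(x, f(x))\<close> vanishes at \<open>0\<close> to
  an order slightly smaller than \<open>(N + 1) * n\<close> (\<open>siegel_form\<close>). Its Taylor coefficients are therefore as
  small as \<open>n! ^ (- N)\<close>. The equation \<open>A * f' = B * f + C\<close> turns \<open>A * d/dx\<close> into an operator on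
  polynomials in \<open>Y\<close> (\<open>dop\<close>). The derivatives of \<open>Q\<close> at \<open>x = \<alpha>\<close> are polynomials in \<open>Y\<close> of degree at most
  \<open>N\<close>, with coefficients of size \<open>n!\<close>, whose values at \<open>y\<close> have size \<open>n! ^ (- N)\<close>. Few of them span all
  polynomials of degree at most \<open>N\<close> (\<open>small_forms\<close>).

  The spanning property is a zero estimate in two steps. The determinant of the first \<open>N + 1\<close>
  derivatives is not identically zero (\<open>zero_estimate\<close>): for an equation of first order, the only
  possible degeneration comes from a rational solution \<open>w\<close>, it is controlled by the expansion in
  powers of \<open>Y - w\<close>, and it is incompatible with the high order of vanishing because \<open>f\<close> is
  transcendental. As this determinant vanishes at \<open>0\<close> to nearly its degree, it vanishes at \<open>\<alpha>\<close> to a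
  low order only, and a few more differentiations give a spanning set at \<open>\<alpha>\<close>
  (\<open>derivatives_span_at_point\<close>).

  Now let \<open>P\<close> be an integer polynomial of degree at most \<open>\<delta>\<close> and height at most \<open>H\<close>. The multiples
  \<open>X ^ i * P\<close> with \<open>i \<le> N - \<delta>\<close> are completed by \<open>\<delta>\<close> of the small forms to a basis of the polynomials of
  degree at most \<open>N\<close>. The determinant of the basis is a nonzero algebraic number of bounded
  denominator and of size \<open>H ^ (N - \<delta> + 1) * n! ^ \<delta>\<close>, hence Liouville's inequality bounds it from
  below. It is also a combination of the values at \<open>y\<close> of the basis, so it is small unless \<open>P(y)\<close> is
  large (\<open>determinant_inequality\<close>). For \<open>N \<ge> \<delta> * d\<close> the contribution of the small forms tends to zero
  as \<open>n\<close> grows. The least \<open>n\<close> for which it is negligible, \<open>n!\<close> being about \<open>H\<close> to the power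
  \<open>d * (N - \<delta> + 1) / (N + 1 - \<delta> * d)\<close>, gives the lower bound with the exponent \<open>\<psi> d \<delta> N\<close>
  (\<open>optimal_index\<close>, \<open>lower_bound\<close>). The value of \<open>N\<close> that defines \<open>\<mu>\<close> is admissible by \<open>opt_N_ge\<close>.

  Sizes are measured throughout by coordinates: the field is generated by an algebraic integer
  \<open>\<theta>\<close> of degree \<open>d\<close>, and \<open>sized T x\<close> bounds the integer coordinates of an element \<open>x\<close> of \<open>\<int>[\<theta>]\<close>. The
  hypotheses on houses and denominators enter through \<open>house_imp_sized\<close>.
\<close>

hide_const (open) Module.smult

section \<open>Determinants of matrices given as functions\<close>

text \<open>Entries are indexed by functions on the naturals, so that rows can be replaced by function
  update and ring homomorphisms can be applied entrywise.\<close>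

definition dt :: "nat \<Rightarrow> (nat \<Rightarrow> nat \<Rightarrow> 'a::comm_ring_1) \<Rightarrow> 'a" where
  "dt n M = Determinant.det (Matrix.mat n n (\<lambda>(i,j). M i j))"

text \<open>The \<open>(k, i)\<close> cofactor, as the determinant in which row \<open>k\<close> is replaced by a unit vector.\<close>

definition cof :: "nat \<Rightarrow> (nat \<Rightarrow> nat \<Rightarrow> 'a::comm_ring_1) \<Rightarrow> nat \<Rightarrow> nat \<Rightarrow> 'a" where
  "cof n M k i = dt n (M(k := (\<lambda>c. if c = i then 1 else 0)))"

lemma dt_expand:
  "dt n M = (\<Sum>p | p permutes {0..<n}. signof p * (\<Prod>i = 0..<n. M i (p i)))"
proof -
  have "dt n M = (\<Sum>p | p permutes {0..<n}. signof p *
      (\<Prod>i = 0..<n. Matrix.mat n n (\<lambda>(i,j). M i j) $$ (i, p i)))"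
    unfolding dt_def by (rule det_def') simp
  also have "\<dots> = (\<Sum>p | p permutes {0..<n}. signof p * (\<Prod>i = 0..<n. M i (p i)))"
    by (intro sum.cong refl arg_cong2[where f = "(*)"] prod.cong)
      (auto simp: permutes_in_image)
  finally show ?thesis .
qed

lemma dt_cong:
  assumes "\<And>i j. i < n \<Longrightarrow> j < n \<Longrightarrow> M i j = M' i j"
  shows "dt n M = dt n M'"
  unfolding dt_def using assms by (intro arg_cong[where f = Determinant.det] eq_matI) auto

lemma dt_hom:
  assumes "comm_ring_hom h"
  shows "dt n (\<lambda>i j. h (M i j)) = h (dt n M)"
proof -
  interpret comm_ring_hom h by fact
  have "map_mat h (Matrix.mat n n (\<lambda>(i,j). M i j)) = Matrix.mat n n (\<lambda>(i,j). h (M i j))"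
    by (intro eq_matI) auto
  then show ?thesis unfolding dt_def by (metis hom_det)
qed

lemma cof_hom:
  assumes "comm_ring_hom h"
  shows "cof n (\<lambda>i j. h (M i j)) k i = h (cof n M k i)"
proof -
  interpret comm_ring_hom h by fact
  show ?thesis unfolding cof_def
    by (subst dt_hom[OF assms, symmetric], rule dt_cong) (auto simp: fun_upd_def)
qed

lemma dt_mult:
  "dt n (\<lambda>i j. \<Sum>k<n. M i k * U k j) = dt n M * dt n U"
proof -
  let ?A = "Matrix.mat n n (\<lambda>(i,j). M i j)" and ?B = "Matrix.mat n n (\<lambda>(i,j). U i j)"
  have "Matrix.mat n n (\<lambda>(i,j). \<Sum>k<n. M i k * U k j) = ?A * ?B"
    by (intro eq_matI) (auto simp: scalar_prod_def lessThan_atLeast0)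
  then show ?thesis unfolding dt_def by (metis det_mult mat_carrier)
qed

lemma dt_eq_0_imp_kernel:
  fixes M :: "nat \<Rightarrow> nat \<Rightarrow> 'a::idom"
  assumes "dt n M = 0"
  shows "\<exists>v. (\<exists>i<n. v i \<noteq> 0) \<and> (\<forall>k<n. (\<Sum>j<n. M k j * v j) = 0)"
proof -
  let ?A = "Matrix.mat n n (\<lambda>(i,j). M i j)"
  obtain v where v: "v \<in> carrier_vec n" "v \<noteq> 0\<^sub>v n" "?A *\<^sub>v v = 0\<^sub>v n"
    using assms det_0_iff_vec_prod_zero[of ?A n] unfolding dt_def by auto
  have "(\<Sum>j<n. M k j * vec_index v j) = 0" if "k < n" for k
  proof -
    have "vec_index (?A *\<^sub>v v) k = 0" using v that by simp
    then show ?thesis using that v(1) by (simp add: scalar_prod_def lessThan_atLeast0)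
  qed
  moreover have "\<exists>i<n. vec_index v i \<noteq> 0" using v(1,2) by (auto intro!: eq_vecI)
  ultimately show ?thesis by blast
qed

lemma dt_0_transpose:
  "dt n (\<lambda>i j. M j i) = dt n M"
proof -
  have "Matrix.mat n n (\<lambda>(i,j). M j i) = transpose_mat (Matrix.mat n n (\<lambda>(i,j). M i j))"
    by (intro eq_matI) auto
  then show ?thesis unfolding dt_def by (metis det_transpose mat_carrier)
qed

lemma cof_eq_cofactor:
  assumes "k < n" "i < n"
  shows "cof n M k i = cofactor (Matrix.mat n n (\<lambda>(i,j). M i j)) k i"
proof -
  let ?R = "M(k := (\<lambda>c. if c = i then 1 else 0))"
  let ?B = "Matrix.mat n n (\<lambda>(i,j). ?R i j)"
  have "cof n M k i = (\<Sum>j<n. ?B $$ (k,j) * cofactor ?B k j)"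
    unfolding cof_def dt_def by (rule laplace_expansion_row) (use assms in auto)
  also have "\<dots> = (\<Sum>j<n. if j = i then cofactor ?B k j else 0)"
    using assms by (intro sum.cong) auto
  also have "\<dots> = cofactor ?B k i" using assms by (simp del: fun_upd_apply)
  also have "\<dots> = cofactor (Matrix.mat n n (\<lambda>(i,j). M i j)) k i"
    unfolding cofactor_def mat_delete_def
    by (intro arg_cong2[where f = "(*)"] arg_cong[where f = Determinant.det] eq_matI refl) auto
  finally show ?thesis .
qed

lemma cof_mult_column:
  assumes "i < n" "j < n"
  shows "(\<Sum>k<n. cof n M k i * M k j) = (if i = j then dt n M else 0)"
proof -
  let ?A = "Matrix.mat n n (\<lambda>(i,j). M i j)"
  have "adj_mat ?A * ?A = Determinant.det ?A \<cdot>\<^sub>m 1\<^sub>m n"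
    using adj_mat[of ?A n] by simp
  then have "(adj_mat ?A * ?A) $$ (i,j) = (Determinant.det ?A \<cdot>\<^sub>m 1\<^sub>m n) $$ (i,j)" by simp
  then show ?thesis using assms
    by (simp add: adj_mat_def scalar_prod_def lessThan_atLeast0 dt_def cof_eq_cofactor)
qed

text \<open>Cramer's rule. It is used both for upper bounds of a determinant (the rows have small values at
  \<open>t\<close>) and for orders of vanishing (the values vanish to a high order).\<close>

lemma dt_cramer:
  assumes "i < n"
  shows "dt n M * t i = (\<Sum>k<n. cof n M k i * (\<Sum>j<n. M k j * t j))"
proof -
  have "(\<Sum>k<n. cof n M k i * (\<Sum>j<n. M k j * t j)) =
      (\<Sum>j<n. (\<Sum>k<n. cof n M k i * M k j) * t j)"
    by (simp add: sum_distrib_left sum_distrib_right mult.assoc) (rule sum.swap)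
  also have "\<dots> = (\<Sum>j<n. if i = j then dt n M * t j else 0)"
    by (intro sum.cong refl) (simp add: cof_mult_column assms)
  also have "\<dots> = dt n M * t i" using assms by simp
  finally show ?thesis by simp
qed

lemma norm_dt_le:
  fixes M :: "nat \<Rightarrow> nat \<Rightarrow> complex"
  assumes "\<And>i j. i < n \<Longrightarrow> j < n \<Longrightarrow> norm (M i j) \<le> \<rho> i"
  shows "norm (dt n M) \<le> fact n * (\<Prod>i<n. \<rho> i)"
proof -
  have "norm (dt n M) \<le> (\<Sum>p | p permutes {0..<n}. (\<Prod>i = 0..<n. \<rho> i))"
    unfolding dt_expand
  proof (rule order.trans[OF norm_sum], rule sum_mono)
    fix p assume "p \<in> {p. p permutes {0..<n}}"
    then have "p i < n" if "i < n" for i using that by (auto dest: permutes_in_image)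
    then have "norm (\<Prod>i = 0..<n. M i (p i)) \<le> (\<Prod>i = 0..<n. \<rho> i)"
      unfolding prod_norm[symmetric] using assms by (intro prod_mono) auto
    moreover have "norm (signof p :: complex) = 1" by (auto simp: sign_def)
    ultimately show "norm (signof p * (\<Prod>i = 0..<n. M i (p i))) \<le> (\<Prod>i = 0..<n. \<rho> i)"
      by (simp add: norm_mult)
  qed
  also have "\<dots> = fact n * (\<Prod>i<n. \<rho> i)"
    by (simp add: card_permutations lessThan_atLeast0)
  finally show ?thesis .
qed

section \<open>Algebraic integers\<close>

text \<open>The characteristic polynomial of an integer matrix is monic with integer coefficients.\<close>

lemma integral_if_eigenvector:
  fixes x :: complex and v :: "'i \<Rightarrow> complex" and M :: "'i \<Rightarrow> 'i \<Rightarrow> int"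
  assumes "finite I" "k \<in> I" "v k \<noteq> 0"
    and eq: "\<And>i. i \<in> I \<Longrightarrow> x * v i = (\<Sum>j\<in>I. of_int (M i j) * v j)"
  shows "algebraic_int x"
proof -
  define n where "n = card I"
  obtain h where h: "bij_betw h {..<n} I"
    using ex_bij_betw_nat_finite[OF \<open>finite I\<close>] by (auto simp: n_def lessThan_atLeast0)
  define A :: "int mat" where "A = Matrix.mat n n (\<lambda>(i,j). M (h i) (h j))"
  define w where "w = Matrix.vec n (\<lambda>i. v (h i))"
  have A: "A \<in> carrier_mat n n" by (simp add: A_def)
  have hI: "h i \<in> I" if "i < n" for i using h that by (auto simp: bij_betw_def)
  obtain i where i: "i < n" "h i = k"
    using h \<open>k \<in> I\<close> by (auto simp: bij_betw_def)
  have "w \<noteq> 0\<^sub>v n" using i assms(3) by (auto simp: w_def vec_eq_iff)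
  moreover have "map_mat of_int A *\<^sub>v w = x \<cdot>\<^sub>v w"
  proof (rule eq_vecI)
    fix i assume "i < dim_vec (x \<cdot>\<^sub>v w)"
    then have i: "i < n" by (simp add: w_def)
    have "vec_index (map_mat of_int A *\<^sub>v w) i = (\<Sum>j<n. of_int (M (h i) (h j)) * v (h j))"
      using i by (simp add: A_def w_def scalar_prod_def lessThan_atLeast0)
    also have "\<dots> = (\<Sum>j\<in>I. of_int (M (h i) j) * v j)"
      by (rule sum.reindex_bij_betw[OF h])
    finally show "vec_index (map_mat of_int A *\<^sub>v w) i = vec_index (x \<cdot>\<^sub>v w) i"
      using i eq[OF hI[OF i]] by (simp add: w_def)
  qed (auto simp: A_def w_def)
  ultimately have "eigenvalue (map_mat of_int A) x"
    using A unfolding eigenvalue_def eigenvector_def by (intro exI[of _ w]) (auto simp: w_def)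
  then have "poly (char_poly (map_mat of_int A)) x = 0"
    using eigenvalue_root_char_poly[of "map_mat of_int A" n x] A by simp
  then have "poly (map_poly of_int (char_poly A)) x = 0"
    using of_int_hom.char_poly_hom[OF A] by metis
  moreover have "lead_coeff (char_poly A) = 1" using degree_monic_char_poly[OF A] by simp
  ultimately show ?thesis unfolding algebraic_int_altdef_ipoly by blast
qed

definition int_span :: "('i \<Rightarrow> complex) \<Rightarrow> 'i set \<Rightarrow> complex set" where
  "int_span v I = {\<Sum>i\<in>I. of_int (c i) * v i | c :: 'i \<Rightarrow> int. True}"

lemma int_span_0: "0 \<in> int_span v I"
  unfolding int_span_def by (auto intro!: exI[of _ "\<lambda>_. 0"])

lemma int_span_add: "x \<in> int_span v I \<Longrightarrow> y \<in> int_span v I \<Longrightarrow> x + y \<in> int_span v I"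
  unfolding int_span_def
proof clarsimp
  fix c c' :: "'a \<Rightarrow> int"
  show "\<exists>e. (\<Sum>i\<in>I. of_int (c i) * v i) + (\<Sum>i\<in>I. of_int (c' i) * v i) =
      (\<Sum>i\<in>I. of_int (e i) * v i)"
    by (rule exI[of _ "\<lambda>i. c i + c' i"]) (simp add: sum.distrib distrib_right)
qed

lemma int_span_scale: "x \<in> int_span v I \<Longrightarrow> of_int m * x \<in> int_span v I"
  unfolding int_span_def
proof clarsimp
  fix c :: "'a \<Rightarrow> int"
  show "\<exists>c'. of_int m * (\<Sum>i\<in>I. of_int (c i) * v i) = (\<Sum>i\<in>I. of_int (c' i) * v i)"
    by (rule exI[of _ "\<lambda>i. m * c i"]) (simp add: sum_distrib_left mult.assoc)
qed

lemma int_span_sum: "(\<And>j. j \<in> J \<Longrightarrow> f j \<in> int_span v I) \<Longrightarrow> sum f J \<in> int_span v I"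
  by (induction J rule: infinite_finite_induct) (auto intro: int_span_0 int_span_add)

lemma int_span_base:
  assumes "finite I" "i \<in> I" shows "v i \<in> int_span v I"
proof -
  have "v i = (\<Sum>j\<in>I. of_int (if j = i then 1 else 0) * v j)"
    using assms by (simp add: if_distrib[of of_int] if_distrib[of "\<lambda>x. x * _"] cong: if_cong)
  then show ?thesis unfolding int_span_def by (intro CollectI exI) auto
qed

lemma int_span_mult_closed:
  assumes "\<And>i. i \<in> I \<Longrightarrow> x * v i \<in> int_span v I" "y \<in> int_span v I"
  shows "x * y \<in> int_span v I"
proof -
  obtain c where y: "y = (\<Sum>i\<in>I. of_int (c i) * v i)" using assms(2) unfolding int_span_def by auto
  have "x * y = (\<Sum>i\<in>I. of_int (c i) * (x * v i))"
    unfolding y by (simp add: sum_distrib_left algebra_simps)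
  then show ?thesis using assms(1) by (auto intro!: int_span_sum int_span_scale)
qed

lemma integral_if_int_span_stable:
  assumes "finite I" "k \<in> I" "v k \<noteq> 0" "\<And>i. i \<in> I \<Longrightarrow> x * v i \<in> int_span v I"
  shows "algebraic_int x"
proof -
  have "\<forall>i\<in>I. \<exists>c :: 'a \<Rightarrow> int. x * v i = (\<Sum>j\<in>I. of_int (c j) * v j)"
    using assms(4) unfolding int_span_def by blast
  then obtain M :: "'a \<Rightarrow> 'a \<Rightarrow> int" where "\<forall>i\<in>I. x * v i = (\<Sum>j\<in>I. of_int (M i j) * v j)"
    by metis
  then show ?thesis using integral_if_eigenvector[of I k v x M] assms by blast
qed

lemma monic_int_relation:
  fixes x :: complex
  assumes "algebraic_int x"
  obtains m c where "m > 0" "x ^ m = (\<Sum>k<m. of_int (c k) * x ^ k)"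
proof -
  obtain p where p: "poly (map_poly of_int p) x = 0" "lead_coeff p = 1"
    using assms unfolding algebraic_int_altdef_ipoly by blast
  define m where "m = degree p"
  have "poly (map_poly of_int p) x = (\<Sum>k\<le>m. of_int (coeff p k) * x ^ k)"
    unfolding poly_altdef m_def by (simp add: coeff_map_poly degree_map_poly)
  also have "\<dots> = (\<Sum>k<m. of_int (coeff p k) * x ^ k) + x ^ m"
    using p(2) by (simp add: lessThan_Suc_atMost[symmetric] m_def)
  finally have rel: "x ^ m = (\<Sum>k<m. of_int (- coeff p k) * x ^ k)"
    using p(1) by (simp add: sum_negf eq_neg_iff_add_eq_0 add.commute)
  have "m > 0"
  proof (rule gr0I)
    assume "m = 0"
    then show False using rel by simp
  qed
  with rel show ?thesis by (intro that)
qed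

text \<open>The products \<open>x ^ i * y ^ j\<close> below the two degrees span a finitely generated group that is stable
  under multiplication by \<open>x\<close> and by \<open>y\<close>.\<close>

lemma algebraic_int_add_mult:
  fixes x y :: complex
  assumes "algebraic_int x" "algebraic_int y"
  shows "algebraic_int (x + y)" "algebraic_int (x * y)"
proof -
  obtain m c where m: "m > 0" "x ^ m = (\<Sum>k<m. of_int (c k) * x ^ k)"
    using monic_int_relation[OF assms(1)] .
  obtain n e where n: "n > 0" "y ^ n = (\<Sum>k<n. of_int (e k) * y ^ k)"
    using monic_int_relation[OF assms(2)] .
  define I where "I = {..<m} \<times> {..<n}"
  define v where "v = (\<lambda>(i::nat,j::nat). x ^ i * y ^ j)"
  have I: "finite I" "(0,0) \<in> I" "v (0,0) \<noteq> 0" using m n by (auto simp: I_def v_def)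
  have X: "x * v i \<in> int_span v I" if "i \<in> I" for i
  proof -
    obtain a b where ab: "i = (a,b)" "a < m" "b < n" using \<open>i \<in> I\<close> by (auto simp: I_def)
    show ?thesis
    proof (cases "Suc a < m")
      case True
      then have "x * v i = v (Suc a, b)" "(Suc a, b) \<in> I" using ab by (auto simp: v_def I_def)
      then show ?thesis using int_span_base[OF I(1)] by metis
    next
      case False
      then have "m = Suc a" using ab by simp
      then have "x * v i = x ^ m * y ^ b" using ab by (simp add: v_def)
      also have "\<dots> = (\<Sum>k<m. of_int (c k) * v (k, b))"
        unfolding m(2) by (simp add: sum_distrib_right v_def mult.assoc)
      also have "\<dots> \<in> int_span v I"
        using ab by (intro int_span_sum int_span_scale int_span_base) (auto simp: I_def)
      finally show ?thesis .
    qed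
  qed
  have Y: "y * v i \<in> int_span v I" if "i \<in> I" for i
  proof -
    obtain a b where ab: "i = (a,b)" "a < m" "b < n" using \<open>i \<in> I\<close> by (auto simp: I_def)
    show ?thesis
    proof (cases "Suc b < n")
      case True
      then have "y * v i = v (a, Suc b)" "(a, Suc b) \<in> I" using ab by (auto simp: v_def I_def)
      then show ?thesis using int_span_base[OF I(1)] by metis
    next
      case False
      then have "n = Suc b" using ab by simp
      then have "y * v i = x ^ a * y ^ n" using ab by (simp add: v_def)
      also have "\<dots> = (\<Sum>k<n. of_int (e k) * v (a, k))"
        unfolding n(2) by (simp add: sum_distrib_left v_def mult_ac)
      also have "\<dots> \<in> int_span v I"
        using ab by (intro int_span_sum int_span_scale int_span_base) (auto simp: I_def)
      finally show ?thesis .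
    qed
  qed
  show "algebraic_int (x + y)"
    by (rule integral_if_int_span_stable[where v = v, OF I]) (auto simp: distrib_right intro: int_span_add X Y)
  show "algebraic_int (x * y)"
  proof (rule integral_if_int_span_stable[where v = v, OF I])
    fix i assume "i \<in> I"
    from int_span_mult_closed[OF X Y[OF this]] show "x * y * v i \<in> int_span v I"
      by (simp add: mult.assoc)
  qed
qed

lemma algebraic_int_sum:
  fixes f :: "'a \<Rightarrow> complex"
  shows "(\<And>i. i \<in> I \<Longrightarrow> algebraic_int (f i)) \<Longrightarrow> algebraic_int (sum f I)"
  by (induction I rule: infinite_finite_induct) (simp_all add: algebraic_int_add_mult)

text \<open>Multiplying by the leading coefficient \<open>a\<close> of an integer relation of degree \<open>n\<close>, and the relation
  itself by \<open>a ^ (n - 1)\<close>, makes it monic.\<close>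

lemma algebraic_imp_multiple_integral:
  fixes x :: complex
  assumes "algebraic x"
  obtains m :: nat where "m > 0" "algebraic_int (of_nat m * x)"
proof -
  obtain p where p: "p \<noteq> 0" "poly (map_poly of_int p) x = 0" using assms by (rule algebraicE')
  define a where "a = lead_coeff p"
  define n where "n = degree p"
  have a: "a \<noteq> 0" using p by (simp add: a_def)
  have n: "n > 0"
  proof (rule ccontr)
    assume "\<not> n > 0"
    then obtain c where "p = [:c:]" unfolding n_def using degree_eq_zeroE by auto
    then show False using p by simp
  qed
  have rel: "of_int a * x ^ n = (\<Sum>k<n. of_int (- coeff p k) * x ^ k)"
  proof -
    have "poly (map_poly of_int p) x = (\<Sum>k\<le>n. of_int (coeff p k) * x ^ k)"
      unfolding poly_altdef n_def by (simp add: coeff_map_poly degree_map_poly)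
    also have "\<dots> = (\<Sum>k<n. of_int (coeff p k) * x ^ k) + of_int a * x ^ n"
      by (simp add: lessThan_Suc_atMost[symmetric] n_def a_def)
    finally show ?thesis using p(2) by (simp add: sum_negf eq_neg_iff_add_eq_0 add.commute)
  qed
  define y where "y = of_int a * x"
  have yn: "y ^ n = (\<Sum>k<n. of_int (- coeff p k * a ^ (n - 1 - k)) * y ^ k)"
  proof -
    have "y ^ n = of_int a ^ (n - 1) * (of_int a * x ^ n)"
      using n by (cases n) (simp_all add: y_def power_mult_distrib)
    also have "\<dots> = (\<Sum>k<n. of_int (- coeff p k) * (of_int a ^ (n - 1) * x ^ k))"
      unfolding rel by (simp add: sum_distrib_left mult_ac)
    also have "\<dots> = (\<Sum>k<n. of_int (- coeff p k * a ^ (n - 1 - k)) * y ^ k)"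
    proof (intro sum.cong refl)
      fix k assume "k \<in> {..<n}"
      then have "of_int a ^ (n - 1) = of_int a ^ (n - 1 - k) * (of_int a ^ k :: complex)"
        by (simp flip: power_add)
      then show "of_int (- coeff p k) * (of_int a ^ (n - 1) * x ^ k) =
          of_int (- coeff p k * a ^ (n - 1 - k)) * y ^ k"
        by (simp add: y_def power_mult_distrib)
    qed
    finally show ?thesis .
  qed
  have y: "algebraic_int y"
  proof (rule integral_if_int_span_stable[of "{..<n}" 0 "\<lambda>k. y ^ k"])
    fix i assume i: "i \<in> {..<n}"
    show "y * y ^ i \<in> int_span ((^) y) {..<n}"
    proof (cases "Suc i < n")
      case True
      then show ?thesis using int_span_base[of "{..<n}" "Suc i" "(^) y"] by simp
    next
      case False
      then have "n = Suc i" using i by simp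
      then have "y * y ^ i = y ^ n" by simp
      also have "y ^ n \<in> int_span ((^) y) {..<n}"
        unfolding yn by (intro int_span_sum int_span_scale int_span_base) auto
      finally show ?thesis .
    qed
  qed (use n in auto)
  have "algebraic_int (of_nat (nat \<bar>a\<bar>) * x)"
  proof (cases "a > 0")
    case True
    then show ?thesis using y by (simp add: y_def)
  next
    case False
    then have "of_nat (nat \<bar>a\<bar>) * x = - y" by (simp add: y_def)
    then show ?thesis using algebraic_int_minus[OF y] by simp
  qed
  then show ?thesis using that[of "nat \<bar>a\<bar>"] a by simp
qed

lemma algebraic_add_mult_nat:
  fixes x y :: complex
  assumes "algebraic x" "algebraic y"
  shows "algebraic (x + of_nat c * y)"
proof -
  obtain m :: nat where m: "m > 0" "algebraic_int (of_nat m * x)"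
    using algebraic_imp_multiple_integral[OF assms(1)] .
  obtain n :: nat where n: "n > 0" "algebraic_int (of_nat n * y)"
    using algebraic_imp_multiple_integral[OF assms(2)] .
  have nat: "algebraic_int (of_nat k :: complex)" for k by (rule int_imp_algebraic_int) auto
  have "algebraic_int (of_nat n * (of_nat m * x) + of_nat (m * c) * (of_nat n * y))"
    by (intro algebraic_int_add_mult m n nat)
  also have "of_nat n * (of_nat m * x) + of_nat (m * c) * (of_nat n * y) =
      of_nat (m * n) * (x + of_nat c * y)" by (simp add: algebra_simps)
  finally have "algebraic (of_nat (m * n) * (x + of_nat c * y))" by blast
  then obtain p where p: "p \<noteq> 0" "poly (map_poly of_int p) (of_nat (m * n) * (x + of_nat c * y)) = 0"
    by (rule algebraicE')
  define q where "q = map_poly of_int p \<circ>\<^sub>p [:0, of_nat (m * n) :: complex:]"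
  show ?thesis
  proof (rule algebraicI)
    show "coeff q i \<in> \<int>" for i
      by (simp add: q_def coeff_pcompose_linear coeff_map_poly)
    show "q \<noteq> 0" using p m n by (auto simp: q_def pcompose_eq_0_iff)
    show "poly q (x + of_nat c * y) = 0" using p(2) by (simp add: q_def poly_pcompose mult.commute)
  qed
qed

section \<open>Number fields and primitive elements\<close>

interpretation of_rat_poly: map_poly_comm_ring_hom "of_rat :: rat \<Rightarrow> complex" ..

abbreviation rpoly :: "rat poly \<Rightarrow> complex \<Rightarrow> complex" where
  "rpoly p x \<equiv> poly (map_poly of_rat p) x"

lemma rpoly_add: "rpoly (p + q) x = rpoly p x + rpoly q x"
  by (simp add: of_rat_poly.hom_add)

lemma rpoly_diff: "rpoly (p - q) x = rpoly p x - rpoly q x"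
  using rpoly_add[of "p - q" q x] by simp

lemma rpoly_mult: "rpoly (p * q) x = rpoly p x * rpoly q x"
  by (simp add: of_rat_poly.hom_mult)

lemma rpoly_const: "rpoly [:c:] x = of_rat c"
  by (cases "c = 0") (simp_all add: map_poly_pCons)

lemma rpoly_X: "rpoly [:0, 1:] x = x"
  by (simp add: map_poly_pCons)

lemma rpoly_pcompose: "rpoly (p \<circ>\<^sub>p q) x = rpoly p (rpoly q x)"
  by (simp add: of_rat_hom.map_poly_pcompose poly_pcompose)

lemma rpoly_1: "rpoly 1 x = 1"
  by (simp add: one_pCons map_poly_pCons)

lemma rpoly_altdef:
  assumes "degree p < n"
  shows "rpoly p x = (\<Sum>i<n. of_rat (coeff p i) * x ^ i)"
proof -
  have "rpoly p x = (\<Sum>i\<le>degree p. of_rat (coeff p i) * x ^ i)"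
    by (simp add: poly_altdef coeff_map_poly)
  also have "\<dots> = (\<Sum>i<n. of_rat (coeff p i) * x ^ i)"
    using assms by (intro sum.mono_neutral_left) (auto simp: coeff_eq_0)
  finally show ?thesis .
qed

text \<open>A rational polynomial of least degree that vanishes at \<open>a\<close>, made monic.\<close>

lemma minimal_polynomial_exists:
  assumes "algebraic (a :: complex)"
  obtains p :: "rat poly" where "lead_coeff p = 1" "irreducible p" "degree p > 0"
    "\<And>q. rpoly q a = 0 \<longleftrightarrow> p dvd q"
proof -
  define R where "R = (\<lambda>q :: rat poly. q \<noteq> 0 \<and> rpoly q a = 0)"
  obtain q0 where q0: "q0 \<noteq> 0" "poly (map_poly of_int q0) a = 0"
    using assms by (rule algebraicE')
  have "map_poly of_rat (map_poly of_int q0 :: rat poly) = (map_poly of_int q0 :: complex poly)"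
    by (intro poly_eqI) (simp add: coeff_map_poly)
  then have "R (map_poly of_int q0)" using q0 by (simp add: R_def)
  then obtain q where q: "R q" and min: "\<And>r. R r \<Longrightarrow> degree q \<le> degree r"
    using ex_has_least_nat[of R _ degree] by blast
  define p where "p = smult (inverse (lead_coeff q)) q"
  have p: "p \<noteq> 0" "lead_coeff p = 1" "rpoly p a = 0" "degree p = degree q"
    using q by (auto simp: p_def R_def of_rat_hom.map_poly_hom_smult)
  have dvd: "rpoly r a = 0 \<longleftrightarrow> p dvd r" for r
  proof
    assume "rpoly r a = 0"
    moreover have "r = p * (r div p) + r mod p" by simp
    ultimately have "rpoly (r mod p) a = 0" using p(3) rpoly_add rpoly_mult
      by (metis add_0 mult_zero_left)
    moreover have "degree (r mod p) < degree p" if "r mod p \<noteq> 0"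
      using degree_mod_less[OF p(1)] that by blast
    ultimately have "r mod p = 0" using min[of "r mod p"] p(4) unfolding R_def by linarith
    then show "p dvd r" by (simp add: mod_eq_0_iff_dvd)
  next
    assume "p dvd r"
    then show "rpoly r a = 0" using p(3) by (auto elim!: dvdE simp: rpoly_mult)
  qed
  have deg: "degree p > 0"
  proof (rule ccontr)
    assume "\<not> degree p > 0"
    then obtain c where "p = [:c:]" using degree_eq_zeroE by auto
    then show False using p by (simp add: rpoly_const)
  qed
  have "irreducible p"
  proof (rule irreducibleI)
    show "p \<noteq> 0" "\<not> p dvd 1" using p deg poly_dvd_1 by auto
    fix r s assume rs: "p = r * s"
    then have "rpoly r a = 0 \<or> rpoly s a = 0" using p(3) by (simp add: rpoly_mult)
    moreover have "r \<noteq> 0" "s \<noteq> 0" using rs p by auto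
    moreover have "degree p = degree r + degree s" using rs \<open>r \<noteq> 0\<close> \<open>s \<noteq> 0\<close> by (simp add: degree_mult_eq)
    ultimately have "degree s = 0 \<or> degree r = 0" using min[of r] min[of s] p(4)
      by (auto simp: R_def)
    then show "r dvd 1 \<or> s dvd 1" using \<open>r \<noteq> 0\<close> \<open>s \<noteq> 0\<close> by (auto simp: is_unit_iff_degree)
  qed
  then show ?thesis using that p(2) deg dvd by blast
qed

definition rat_adjoin :: "complex \<Rightarrow> complex set" where
  "rat_adjoin a = range (\<lambda>q. rpoly q a)"

lemma rat_adjoin_self: "a \<in> rat_adjoin a"
  unfolding rat_adjoin_def by (rule range_eqI[of _ _ "[:0, 1:]"]) (simp add: rpoly_X)

lemma rat_adjoin_of_rat: "of_rat r \<in> rat_adjoin a"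
  unfolding rat_adjoin_def by (rule range_eqI[of _ _ "[:r:]"]) (simp add: rpoly_const)

text \<open>Inverses come from a Bezout identity with the minimal polynomial.\<close>

lemma is_subfield_rat_adjoin:
  assumes "algebraic a"
  shows "is_subfield (rat_adjoin a)"
  unfolding is_subfield_def
proof (intro conjI ballI)
  show "0 \<in> rat_adjoin a" using rat_adjoin_of_rat[of 0 a] by simp
  show "1 \<in> rat_adjoin a" using rat_adjoin_of_rat[of 1 a] by simp
  fix x assume x: "x \<in> rat_adjoin a"
  then obtain p where p: "x = rpoly p a" unfolding rat_adjoin_def by auto
  {
    fix y assume "y \<in> rat_adjoin a"
    then obtain q where q: "y = rpoly q a" unfolding rat_adjoin_def by auto
    show "x - y \<in> rat_adjoin a" "x * y \<in> rat_adjoin a"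
      unfolding p q rpoly_mult[symmetric] rpoly_diff[symmetric] rat_adjoin_def by auto
  }
  obtain m where m: "irreducible m" "\<And>q. rpoly q a = 0 \<longleftrightarrow> m dvd q"
    using minimal_polynomial_exists[OF assms] by metis
  show "inverse x \<in> rat_adjoin a"
  proof (cases "x = 0")
    case True
    then show ?thesis using x by simp
  next
    case False
    then have "\<not> m dvd p" using m(2) p by auto
    moreover have "prime_elem m" using m(1) by (rule irreducible_imp_prime_elem_gcd)
    ultimately have "coprime m p" by (metis prime_elem_imp_coprime)
    then have "gcd m p = 1" by simp
    then obtain u v where "u * m + v * p = 1" using bezout_coefficients_fst_snd[of m p] by metis
    then have "rpoly (u * m + v * p) a = 1" by (simp add: rpoly_1)
    then have "rpoly v a * x = 1" using m(2)[of m] by (simp add: rpoly_add rpoly_mult p)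
    then have "inverse x = rpoly v a" by (metis inverse_unique mult.commute)
    then show ?thesis unfolding rat_adjoin_def by auto
  qed
qed

lemma subfield_closed:
  assumes "is_subfield F"
  shows "0 \<in> F" "1 \<in> F" "x \<in> F \<Longrightarrow> y \<in> F \<Longrightarrow> x - y \<in> F" "x \<in> F \<Longrightarrow> y \<in> F \<Longrightarrow> x * y \<in> F"
    "x \<in> F \<Longrightarrow> inverse x \<in> F" "x \<in> F \<Longrightarrow> - x \<in> F" "x \<in> F \<Longrightarrow> y \<in> F \<Longrightarrow> x + y \<in> F"
    "x \<in> F \<Longrightarrow> y \<in> F \<Longrightarrow> x / y \<in> F"
proof -
  show *: "0 \<in> F" "1 \<in> F" "\<And>x y. x \<in> F \<Longrightarrow> y \<in> F \<Longrightarrow> x - y \<in> F"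
    "\<And>x y. x \<in> F \<Longrightarrow> y \<in> F \<Longrightarrow> x * y \<in> F" "\<And>x. x \<in> F \<Longrightarrow> inverse x \<in> F"
    using assms unfolding is_subfield_def by auto
  show neg: "- x \<in> F" if "x \<in> F" for x using *(3)[OF *(1) that] by simp
  show "x + y \<in> F" if "x \<in> F" "y \<in> F" for x y using *(3)[OF that(1) neg[OF that(2)]] by simp
  show "x / y \<in> F" if "x \<in> F" "y \<in> F" for x y
    unfolding divide_inverse using that * by blast
qed

lemma subfield_sum:
  assumes "is_subfield F"
  shows "(\<And>i. i \<in> I \<Longrightarrow> f i \<in> F) \<Longrightarrow> sum f I \<in> F"
  by (induction I rule: infinite_finite_induct) (auto intro: subfield_closed[OF assms])

lemma subfield_power:
  assumes "is_subfield F" "x \<in> F"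
  shows "x ^ n \<in> F"
  by (induction n) (auto intro: subfield_closed[OF assms(1)] assms(2))

lemma subfield_of_nat:
  assumes "is_subfield F"
  shows "of_nat n \<in> F"
  by (induction n) (auto intro: subfield_closed[OF assms])

lemma subfield_of_rat:
  assumes "is_subfield F"
  shows "of_rat r \<in> F"
proof -
  have int: "of_int k \<in> F" for k
  proof (cases "k \<ge> 0")
    case True
    then show ?thesis using subfield_of_nat[OF assms, of "nat k"] by simp
  next
    case False
    then show ?thesis using subfield_closed(6)[OF assms subfield_of_nat[OF assms, of "nat (- k)"]]
      by simp
  qed
  obtain a b where "r = of_int a / of_int b" by (metis Rat_cases of_int_rat quotient_of_div surj_pair)
  then have "(of_rat r :: complex) = of_int a / of_int b" by (simp add: of_rat_divide)
  then show ?thesis using int subfield_closed(8)[OF assms] by metis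
qed

lemma rat_adjoin_subset:
  assumes "is_subfield F" "a \<in> F"
  shows "rat_adjoin a \<subseteq> F"
proof -
  have "rpoly q a \<in> F" for q
    unfolding rpoly_altdef[of q "Suc (degree q)", OF lessI]
    by (intro subfield_sum[OF assms(1)] subfield_closed(4)[OF assms(1)] subfield_power assms
      subfield_of_rat)
  then show ?thesis unfolding rat_adjoin_def by auto
qed

text \<open>Division with remainder by a monic polynomial stays inside the coefficient field.\<close>

lemma subfield_poly_division:
  fixes g :: "complex poly"
  assumes F: "is_subfield F" and g: "\<And>i. coeff g i \<in> F" "lead_coeff g = 1"
  shows "(\<And>i. coeff p i \<in> F) \<Longrightarrow>
    \<exists>s r. p = g * s + r \<and> (\<forall>i. coeff r i \<in> F) \<and> (r = 0 \<or> degree r < degree g)"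
proof (induction "degree p" arbitrary: p rule: less_induct)
  case less
  show ?case
  proof (cases "p = 0 \<or> degree p < degree g")
    case True
    then show ?thesis using less.prems by (intro exI[of _ 0] exI[of _ p]) auto
  next
    case False
    define t where "t = monom (lead_coeff p) (degree p - degree g)"
    define p' where "p' = p - g * t"
    have t: "t \<noteq> 0" using False by (simp add: t_def)
    have "degree t = degree p - degree g" using False by (simp add: t_def degree_monom_eq)
    moreover have "g \<noteq> 0" using g(2) by auto
    ultimately have deg: "degree (g * t) = degree p" using t False by (simp add: degree_mult_eq)
    have lc: "lead_coeff (g * t) = lead_coeff p"
      using g(2) \<open>degree t = degree p - degree g\<close> by (simp add: lead_coeff_mult t_def)
    have p'F: "coeff p' i \<in> F" for i
      unfolding p'_def coeff_diff coeff_mult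
      by (intro subfield_closed[OF F] subfield_sum[OF F] g less.prems)
        (auto simp: t_def intro: subfield_closed(1)[OF F] less.prems)
    have main: "\<exists>s r. p' = g * s + r \<and> (\<forall>i. coeff r i \<in> F) \<and> (r = 0 \<or> degree r < degree g)"
    proof (cases "p' = 0 \<or> degree p = 0")
      case True
      have "p' = 0"
      proof (rule ccontr)
        assume "p' \<noteq> 0"
        then have "degree p = 0" using True by auto
        then have "degree p' = 0" "coeff p' 0 = 0" unfolding p'_def
          using deg lc degree_diff_le[of p 0 "g * t"] by auto
        then show False using \<open>p' \<noteq> 0\<close> by (metis leading_coeff_0_iff)
      qed
      then show ?thesis using subfield_closed(1)[OF F] by (intro exI[of _ 0]) auto
    next
      case False
      have "degree p' \<le> degree p" unfolding p'_def using deg degree_diff_le[of p "degree p" "g * t"] by simp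
      moreover have "coeff p' (degree p) = 0" using lc deg by (simp add: p'_def)
      ultimately have "degree p' < degree p" using False
        by (metis le_neq_implies_less leading_coeff_0_iff)
      from less.hyps[OF this p'F] show ?thesis .
    qed
    then obtain s r where sr: "p' = g * s + r" "\<forall>i. coeff r i \<in> F" "r = 0 \<or> degree r < degree g" by blast
    have "p = g * (s + t) + r" using sr(1) unfolding p'_def by (simp add: algebra_simps)
    then show ?thesis using sr by blast
  qed
qed

lemma pcompose_subfield_closed:
  assumes F: "is_subfield F" and q: "\<And>i. coeff q i \<in> F"
  shows "(\<And>i. coeff p i \<in> F) \<Longrightarrow> coeff (p \<circ>\<^sub>p q) i \<in> F"
proof (induction p arbitrary: i)
  case 0
  then show ?case using subfield_closed(1)[OF F] by simp
next
  case (pCons a p)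
  have a: "a \<in> F" using pCons.prems[of 0] by simp
  have p: "coeff p i \<in> F" for i using pCons.prems[of "Suc i"] by simp
  have "coeff (q * (p \<circ>\<^sub>p q)) i \<in> F"
    unfolding coeff_mult by (intro subfield_sum[OF F] subfield_closed(4)[OF F] q pCons.IH p)
  moreover have "coeff [:a:] i \<in> F" using a subfield_closed(1)[OF F] by (cases i) auto
  ultimately show ?case by (simp add: pcompose_pCons subfield_closed(7)[OF F] del: coeff_pCons)
qed

text \<open>The classical argument: all but finitely many combinations \<open>\<alpha> + c * \<beta>\<close> separate the pairs of
  conjugates, so that \<open>\<beta>\<close> becomes the only common root of two polynomials over the field that the
  combination generates.\<close>

lemma primitive_element_two:
  fixes \<alpha> \<beta> :: complex
  assumes \<alpha>: "algebraic \<alpha>" and \<beta>: "algebraic \<beta>"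
  shows "\<exists>c::nat. \<alpha> \<in> rat_adjoin (\<alpha> + of_nat c * \<beta>) \<and> \<beta> \<in> rat_adjoin (\<alpha> + of_nat c * \<beta>)"
proof -
  obtain p where p: "lead_coeff p = 1" "irreducible p" "\<And>q. rpoly q \<alpha> = 0 \<longleftrightarrow> p dvd q"
    using minimal_polynomial_exists[OF \<alpha>] by metis
  obtain q where q: "lead_coeff q = 1" "irreducible q" "degree q > 0"
      "\<And>r. rpoly r \<beta> = 0 \<longleftrightarrow> q dvd r"
    using minimal_polynomial_exists[OF \<beta>] by metis
  define pc qc where "pc = (map_poly of_rat p :: complex poly)" and "qc = (map_poly of_rat q :: complex poly)"
  have nz: "pc \<noteq> 0" "qc \<noteq> 0" using p(1) q(1) by (auto simp: pc_def qc_def)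
  have root: "poly pc \<alpha> = 0" "poly qc \<beta> = 0" using p(3)[of p] q(4)[of q] by (auto simp: pc_def qc_def)
  \<comment> \<open>Outside this finite set of values of \<open>c\<close>, the number \<open>\<alpha> + c * \<beta>\<close> determines the pair \<open>(\<alpha>, \<beta>)\<close>
    among all pairs of conjugates.\<close>
  define bad where "bad = (\<lambda>(x, y). (x - \<alpha>) / (\<beta> - y)) ` ({x. poly pc x = 0} \<times> {y. poly qc y = 0})"
  have "finite bad" unfolding bad_def using nz by (intro finite_imageI finite_cartesian_product) (auto simp: poly_roots_finite)
  moreover have "infinite (range (of_nat :: nat \<Rightarrow> complex))"
    using infinite_UNIV_nat finite_imageD[of "of_nat :: nat \<Rightarrow> complex" UNIV] by (auto intro: inj_of_nat)
  ultimately obtain c :: nat where c: "of_nat c \<notin> bad" by (metis ex_new_if_finite finite_subset rangeE subsetI)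
  define \<gamma> where "\<gamma> = \<alpha> + of_nat c * \<beta>"
  define F where "F = rat_adjoin \<gamma>"
  have F: "is_subfield F" unfolding F_def \<gamma>_def
    by (intro is_subfield_rat_adjoin algebraic_add_mult_nat assms)
  have \<gamma>: "\<gamma> \<in> F" unfolding F_def by (rule rat_adjoin_self)
  define h where "h = pc \<circ>\<^sub>p [:\<gamma>, - of_nat c:]"
  have hF: "coeff h i \<in> F" for i unfolding h_def
  proof (rule pcompose_subfield_closed[OF F])
    show "coeff [:\<gamma>, - of_nat c:] i \<in> F" for i
      using \<gamma> F by (auto simp: coeff_pCons subfield_closed subfield_of_nat split: nat.splits)
    show "coeff pc i \<in> F" for i unfolding pc_def by (simp add: coeff_map_poly subfield_of_rat[OF F])
  qed
  have qF: "coeff qc i \<in> F" for i unfolding qc_def by (simp add: coeff_map_poly subfield_of_rat[OF F])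
  have h\<beta>: "poly h \<beta> = 0" using root by (simp add: h_def poly_pcompose \<gamma>_def)
  have common: "y = \<beta>" if "poly h y = 0" "poly qc y = 0" for y
  proof (rule ccontr)
    assume "y \<noteq> \<beta>"
    define x where "x = \<gamma> - of_nat c * y"
    have "poly pc x = 0" using that(1) by (simp add: h_def poly_pcompose x_def mult.commute)
    moreover have "of_nat c = (x - \<alpha>) / (\<beta> - y)" using \<open>y \<noteq> \<beta>\<close>
      by (simp add: x_def \<gamma>_def field_simps)
    ultimately have "of_nat c \<in> bad" unfolding bad_def using that(2) by (intro image_eqI[of _ _ "(x,y)"]) auto
    then show False using c by simp
  qed
  \<comment> \<open>The monic polynomial \<open>g\<close> of least degree over \<open>F\<close> with root \<open>\<beta>\<close> divides \<open>qc\<close> and \<open>h\<close>, so that \<open>\<beta>\<close>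
    is its only root. It is a simple one, since it is a simple root of \<open>qc\<close>.\<close>
  define R where "R = (\<lambda>g :: complex poly. (\<forall>i. coeff g i \<in> F) \<and> g \<noteq> 0 \<and> poly g \<beta> = 0)"
  have "R qc" using qF nz root by (auto simp: R_def)
  then obtain g0 where g0: "R g0" and min: "\<And>r. R r \<Longrightarrow> degree g0 \<le> degree r"
    using ex_has_least_nat[of R _ degree] by blast
  define g where "g = smult (inverse (lead_coeff g0)) g0"
  have g: "\<And>i. coeff g i \<in> F" "lead_coeff g = 1" "g \<noteq> 0" "poly g \<beta> = 0" "degree g = degree g0"
    using g0 by (auto simp: g_def R_def intro: subfield_closed[OF F])
  have dvd: "g dvd r" if "\<And>i. coeff r i \<in> F" "poly r \<beta> = 0" for r
  proof -
    from subfield_poly_division[where p = r, OF F g(1,2)] that(1)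
    obtain s t where st: "r = g * s + t" "\<forall>i. coeff t i \<in> F" "t = 0 \<or> degree t < degree g"
      by blast
    have "poly t \<beta> = 0" using that(2) st(1) g(4) by simp
    then have "t = 0" using st(2,3) min[of t] g(5) unfolding R_def
      by (metis not_le)
    then show ?thesis using st(1) by simp
  qed
  have gq: "g dvd qc" and gh: "g dvd h" using dvd qF root hF h\<beta> by blast+
  have "[:-\<beta>, 1:] dvd g" using g(4) by (simp add: poly_eq_0_iff_dvd)
  then obtain k where k: "g = [:-\<beta>, 1:] * k" by (rule dvdE)
  have "degree k = 0"
  proof (rule ccontr)
    assume "degree k \<noteq> 0"
    then obtain z where z: "poly k z = 0"
      using fundamental_theorem_of_algebra[of k] constant_degree[of k] by auto
    then have "poly g z = 0" using k by simp
    then have "poly qc z = 0" "poly h z = 0" using gq gh by (auto elim!: dvdE)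
    then have "z = \<beta>" by (intro common)
    then have "[:-\<beta>, 1:] dvd k" using z by (simp add: poly_eq_0_iff_dvd)
    then obtain k' where k': "k = [:-\<beta>, 1:] * k'" by (rule dvdE)
    obtain w' where w': "qc = g * w'" using gq by (rule dvdE)
    define w where "w = k' * w'"
    have w: "qc = [:-\<beta>, 1:] * ([:-\<beta>, 1:] * w)" unfolding w' k k' w_def by (simp only: mult.assoc)
    have "poly (pderiv qc) \<beta> = 0" unfolding w pderiv_mult by simp
    then have "rpoly (pderiv q) \<beta> = 0" unfolding qc_def by (simp add: of_rat_hom.map_poly_pderiv)
    then have "q dvd pderiv q" using q(4) by simp
    moreover have "pderiv q \<noteq> 0" using q(3) by (simp add: pderiv_eq_0_iff)
    ultimately have "degree q \<le> degree (pderiv q)" by (rule dvd_imp_degree_le)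
    then show False using q(3) by (simp add: degree_pderiv)
  qed
  then obtain e where "k = [:e:]" using degree_eq_zeroE by auto
  then have "g = [:-\<beta>, 1:]" using k g(2) by (cases "e = 0") auto
  then have "- (- \<beta>) \<in> F" using g(1)[of 0] subfield_closed(6)[OF F] by (metis coeff_pCons_0)
  then have \<beta>F: "\<beta> \<in> F" by simp
  have "\<alpha> = \<gamma> - of_nat c * \<beta>" by (simp add: \<gamma>_def)
  then have "\<alpha> \<in> F" using \<gamma> \<beta>F subfield_closed(3,4)[OF F] subfield_of_nat[OF F] by metis
  then show ?thesis using \<beta>F unfolding F_def \<gamma>_def by blast
qed

text \<open>The last clause makes the field generated by \<open>\<theta>\<close> the smallest one that contains \<open>B\<close>; it is needed
  to identify it with an intersection of fields.\<close>

lemma primitive_element_finite: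
  assumes "finite B" "\<And>b. b \<in> B \<Longrightarrow> algebraic b"
  shows "\<exists>\<theta>. algebraic \<theta> \<and> B \<subseteq> rat_adjoin \<theta> \<and> (\<forall>F. is_subfield F \<longrightarrow> B \<subseteq> F \<longrightarrow> \<theta> \<in> F)"
  using assms
proof (induction B)
  case empty
  show ?case by (intro exI[of _ 0]) (auto simp: subfield_closed)
next
  case (insert b B)
  then obtain \<theta> where \<theta>: "algebraic \<theta>" "B \<subseteq> rat_adjoin \<theta>"
      "\<And>F. is_subfield F \<Longrightarrow> B \<subseteq> F \<Longrightarrow> \<theta> \<in> F" by auto
  have b: "algebraic b" using insert.prems by simp
  obtain c :: nat where c: "\<theta> \<in> rat_adjoin (\<theta> + of_nat c * b)" "b \<in> rat_adjoin (\<theta> + of_nat c * b)"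
    using primitive_element_two[OF \<theta>(1) b] by auto
  define \<gamma> where "\<gamma> = \<theta> + of_nat c * b"
  have \<gamma>: "algebraic \<gamma>" unfolding \<gamma>_def by (intro algebraic_add_mult_nat \<theta> b)
  have "rat_adjoin \<theta> \<subseteq> rat_adjoin \<gamma>"
    using rat_adjoin_subset[OF is_subfield_rat_adjoin[OF \<gamma>]] c unfolding \<gamma>_def by auto
  moreover have "\<gamma> \<in> F" if "is_subfield F" "insert b B \<subseteq> F" for F
    unfolding \<gamma>_def using that \<theta>(3)[of F] by (auto intro!: subfield_closed subfield_of_nat)
  ultimately show ?case using \<gamma> \<theta>(2) c(2) unfolding \<gamma>_def[symmetric]
    by (intro exI[of _ \<gamma>]) auto
qed

lemma algebraic_of_multiple:
  fixes x :: complex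
  assumes "algebraic (of_nat m * x)" "m > 0"
  shows "algebraic x"
proof -
  obtain p where p: "p \<noteq> 0" "poly (map_poly of_int p) (of_nat m * x) = 0"
    using assms(1) by (rule algebraicE')
  define q where "q = map_poly of_int p \<circ>\<^sub>p [:0, of_nat m :: complex:]"
  show ?thesis
  proof (rule algebraicI)
    show "coeff q i \<in> \<int>" for i
      by (simp add: q_def coeff_pcompose_linear coeff_map_poly)
    show "q \<noteq> 0" using p assms(2) by (auto simp: q_def pcompose_eq_0_iff)
    show "poly q x = 0" using p(2) by (simp add: q_def poly_pcompose mult.commute)
  qed
qed

lemma algebraic_add_mult:
  fixes x y :: complex
  assumes "algebraic x" "algebraic y"
  shows "algebraic (x + y)" "algebraic (x * y)"
proof -
  obtain m :: nat where m: "m > 0" "algebraic_int (of_nat m * x)"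
    using algebraic_imp_multiple_integral[OF assms(1)] .
  obtain n :: nat where n: "n > 0" "algebraic_int (of_nat n * y)"
    using algebraic_imp_multiple_integral[OF assms(2)] .
  have "algebraic_int (of_nat m * x * (of_nat n * y))" by (intro algebraic_int_add_mult m n)
  then have "algebraic (of_nat (m * n) * (x * y))"
    using algebraic_int_imp_algebraic by (simp add: mult_ac)
  then show "algebraic (x * y)" by (rule algebraic_of_multiple) (use m n in simp)
  show "algebraic (x + y)" using algebraic_add_mult_nat[OF assms, of 1] by simp
qed

lemma is_subfield_algebraic: "is_subfield {x. algebraic x}"
proof -
  have "algebraic (x - y)" if "algebraic x" "algebraic y" for x y :: complex
    using algebraic_add_mult(1)[of x "- y"] that by simp
  then show ?thesis unfolding is_subfield_def
    by (auto intro: algebraic_add_mult rat_imp_algebraic)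
qed

lemma common_integral_multiple:
  assumes "finite S" "\<And>s. s \<in> S \<Longrightarrow> algebraic (s :: complex)"
  shows "\<exists>E::nat. E > 0 \<and> (\<forall>s\<in>S. algebraic_int (of_nat E * s))"
  using assms
proof (induction S)
  case empty
  show ?case by (intro exI[of _ 1]) auto
next
  case (insert s S)
  then obtain E :: nat where E: "E > 0" "\<forall>s\<in>S. algebraic_int (of_nat E * s)" by auto
  obtain m :: nat where m: "m > 0" "algebraic_int (of_nat m * s)"
    using algebraic_imp_multiple_integral insert.prems by blast
  have nat: "algebraic_int (of_nat k :: complex)" for k by (rule int_imp_algebraic_int) auto
  have "algebraic_int (of_nat (E * m) * t)" if "t \<in> insert s S" for t
  proof (cases "t = s")
    case True
    then show ?thesis using algebraic_int_add_mult(2)[OF nat[of E] m(2)] by (simp add: mult.assoc)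
  next
    case False
    then show ?thesis using algebraic_int_add_mult(2)[OF nat[of m], of "of_nat E * t"] E(2) that
      by (simp add: mult_ac)
  qed
  then show ?case using E(1) m(1) by (intro exI[of _ "E * m"]) auto
qed

lemma common_denominator:
  fixes r :: "nat \<Rightarrow> rat"
  shows "\<exists>m::nat. m > 0 \<and> (\<forall>i<n. of_nat m * r i \<in> \<int>)"
proof (induction n)
  case 0
  show ?case by (intro exI[of _ 1]) auto
next
  case (Suc n)
  then obtain m :: nat where m: "m > 0" "\<forall>i<n. of_nat m * r i \<in> \<int>" by auto
  obtain a b where ab: "quotient_of (r n) = (a, b)" by (cases "quotient_of (r n)")
  then have b: "b > 0" "r n = of_int a / of_int b"
    using quotient_of_denom_pos quotient_of_div by blast+
  have "of_nat (m * nat b) * r i \<in> \<int>" if "i < Suc n" for i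
  proof (cases "i = n")
    case True
    then have "of_nat (m * nat b) * r i = of_int (int m * a)" using b by simp
    then show ?thesis by (metis Ints_of_int)
  next
    case False
    then have "of_nat m * r i \<in> \<int>" using m(2) that by simp
    then have "of_nat (nat b) * (of_nat m * r i) \<in> \<int>" by (rule Ints_mult[OF Ints_of_nat])
    then show ?thesis by (simp add: mult_ac)
  qed
  then show ?case using m(1) b(1) by (intro exI[of _ "m * nat b"]) auto
qed

section \<open>Orders generated by one algebraic integer\<close>

text \<open>The setting for all size estimates: \<open>\<theta>\<close> is an algebraic integer of degree \<open>d\<close>, and numbers of its
  field are measured by their coordinates in the order \<open>\<int>[\<theta>]\<close>.\<close>

locale order_gen =
  fixes \<theta> :: complex and g :: "int poly"
  assumes monic: "lead_coeff g = 1"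
    and root: "poly (map_poly of_int g) \<theta> = 0"
    and indep: "\<And>q. degree q < degree g \<Longrightarrow> rpoly q \<theta> = 0 \<Longrightarrow> q = 0"
begin

definition d :: nat where "d = degree g"

definition elt :: "(nat \<Rightarrow> int) \<Rightarrow> complex" where
  "elt z = (\<Sum>i<d. of_int (z i) * \<theta> ^ i)"

text \<open>\<open>sized T x\<close> replaces bounds for the house and the denominator by one condition. It says that \<open>x\<close> lies
  in the order, and it bounds all conjugates at once by a multiple of \<open>T\<close>, without the mention of any
  conjugate.\<close>

definition sized :: "real \<Rightarrow> complex \<Rightarrow> bool" where
  "sized T x \<longleftrightarrow> (\<exists>z. x = elt z \<and> (\<forall>i<d. \<bar>real_of_int (z i)\<bar> \<le> T))"

lemma d_pos: "d > 0"
proof (rule ccontr)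
  assume "\<not> d > 0"
  then obtain c where "g = [:c:]" unfolding d_def using degree_eq_zeroE by auto
  then show False using monic root by simp
qed

lemma rat_relation_trivial:
  assumes "(\<Sum>i<d. of_rat (r i) * \<theta> ^ i) = 0" "i < d"
  shows "r i = 0"
proof -
  define q where "q = (\<Sum>i<d. monom (r i) i)"
  have c: "coeff q j = (if j < d then r j else 0)" for j
    unfolding q_def coeff_sum by (auto simp: if_distrib cong: if_cong)
  have "degree q \<le> d - 1" by (rule degree_le) (auto simp: c)
  then have deg: "degree q < d" using d_pos by simp
  have "rpoly q \<theta> = 0" unfolding rpoly_altdef[OF deg] using assms(1) by (simp add: c)
  then have "q = 0" using indep deg unfolding d_def by blast
  then show ?thesis using c[of i] assms(2) by simp
qed

lemma elt_inj:
  assumes "elt z = elt w" "i < d"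
  shows "z i = w i"
proof -
  have "(\<Sum>i<d. of_rat (of_int (z i - w i)) * \<theta> ^ i) = elt z - elt w"
    unfolding elt_def by (simp add: sum_subtractf[symmetric] left_diff_distrib of_rat_diff)
  then have "(of_int (z i - w i) :: rat) = 0"
    using rat_relation_trivial[of "\<lambda>i. of_int (z i - w i)" i] assms by simp
  then show ?thesis by simp
qed

lemma sized_mono: "sized S x \<Longrightarrow> S \<le> T \<Longrightarrow> sized T x"
  unfolding sized_def using order.trans by blast

lemma sized_nonneg: "sized T x \<Longrightarrow> T \<ge> 0"
  unfolding sized_def using d_pos by (meson abs_ge_zero order.trans)

lemma sized_add:
  assumes "sized S x" "sized T y" shows "sized (S + T) (x + y)"
proof -
  obtain z w where "x = elt z" "\<forall>i<d. \<bar>real_of_int (z i)\<bar> \<le> S"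
    "y = elt w" "\<forall>i<d. \<bar>real_of_int (w i)\<bar> \<le> T" using assms unfolding sized_def by blast
  then show ?thesis unfolding sized_def
    by (intro exI[of _ "\<lambda>i. z i + w i"])
      (fastforce simp: elt_def sum.distrib distrib_right)
qed

lemma sized_scale:
  assumes "sized T x" shows "sized (\<bar>real_of_int m\<bar> * T) (of_int m * x)"
proof -
  obtain z where "x = elt z" "\<forall>i<d. \<bar>real_of_int (z i)\<bar> \<le> T" using assms unfolding sized_def by blast
  then show ?thesis unfolding sized_def
    by (intro exI[of _ "\<lambda>i. m * z i"])
      (auto simp: elt_def sum_distrib_left mult.assoc abs_mult intro!: mult_left_mono)
qed

lemma sized_scale_nat:
  assumes "sized T x" shows "sized (real m * T) (of_nat m * x)"
  using sized_scale[OF assms, of "int m"] by simp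

lemma sized_minus: "sized T x \<Longrightarrow> sized T (- x)"
  using sized_scale[of T x "-1"] by simp

lemma sized_0: "T \<ge> 0 \<Longrightarrow> sized T 0"
  unfolding sized_def by (intro exI[of _ "\<lambda>_. 0"]) (auto simp: elt_def)

lemma sized_sum:
  assumes "\<And>i. i \<in> I \<Longrightarrow> sized (T i) (f i)"
  shows "sized (sum T I) (sum f I)"
  using assms by (induction I rule: infinite_finite_induct) (auto intro: sized_0 sized_add)

lemma sized_sum_const:
  assumes "\<And>i. i \<in> I \<Longrightarrow> sized T (f i)"
  shows "sized (real (card I) * T) (sum f I)"
  using sized_sum[of I "\<lambda>_. T" f] assms by simp

lemma sized_power_gen:
  assumes "i < d" shows "sized 1 (\<theta> ^ i)"
  unfolding sized_def
proof (intro exI[of _ "\<lambda>j. if j = i then 1 else 0"] conjI allI impI)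
  show "\<theta> ^ i = elt (\<lambda>j. if j = i then 1 else 0)"
    unfolding elt_def using assms by (simp add: if_distrib[of of_int] if_distrib[of "\<lambda>x. x * _"] cong: if_cong)
qed auto

lemma sized_1: "sized 1 1"
  using sized_power_gen[of 0] d_pos by simp

lemma sized_of_int: "sized \<bar>real_of_int m\<bar> (of_int m)"
  using sized_scale[OF sized_1, of m] by simp

lemma gen_power_d: "\<theta> ^ d = (\<Sum>i<d. of_int (- coeff g i) * \<theta> ^ i)"
proof -
  have "poly (map_poly of_int g) \<theta> = (\<Sum>k\<le>d. of_int (coeff g k) * \<theta> ^ k)"
    unfolding poly_altdef d_def by (simp add: coeff_map_poly degree_map_poly)
  also have "\<dots> = (\<Sum>k<d. of_int (coeff g k) * \<theta> ^ k) + \<theta> ^ d"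
    using monic by (simp add: lessThan_Suc_atMost[symmetric] d_def)
  finally show ?thesis
    using root by (simp add: sum_negf eq_neg_iff_add_eq_0 add.commute)
qed

lemma int_span_imp_sized:
  assumes "x \<in> int_span ((^) \<theta>) {..<d}" shows "\<exists>T. sized T x"
proof -
  obtain z where z: "x = elt z" using assms unfolding int_span_def elt_def by auto
  have "\<bar>real_of_int (z i)\<bar> \<le> (\<Sum>j<d. \<bar>real_of_int (z j)\<bar>)" if "i < d" for i
    using that by (intro member_le_sum) auto
  then show ?thesis unfolding sized_def using z by blast
qed

lemma gen_power_int_span: "\<theta> ^ k \<in> int_span ((^) \<theta>) {..<d}"
proof (induction k)
  case 0
  show ?case using int_span_base[of "{..<d}" 0 "(^) \<theta>"] d_pos by simp
next
  case (Suc k)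
  have "\<theta> * \<theta> ^ i \<in> int_span ((^) \<theta>) {..<d}" if "i \<in> {..<d}" for i
  proof (cases "Suc i < d")
    case True
    then show ?thesis using int_span_base[of "{..<d}" "Suc i" "(^) \<theta>"] by simp
  next
    case False
    then have "d = Suc i" using that by simp
    then have "\<theta> * \<theta> ^ i = \<theta> ^ d" by simp
    also have "\<dots> \<in> int_span ((^) \<theta>) {..<d}"
      unfolding gen_power_d by (intro int_span_sum int_span_scale int_span_base) auto
    finally show ?thesis .
  qed
  from int_span_mult_closed[OF this Suc.IH] show ?case by simp
qed

text \<open>Products and absolute values cost a constant factor that depends on \<open>\<theta>\<close> only: a product is a
  bilinear expression in the coordinates, whose coefficients are the coordinates of the powers of
  \<open>\<theta>\<close> below \<open>2 * d - 1\<close>.\<close>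

lemma kappa_exists:
  "\<exists>\<kappa>\<ge>1. (\<forall>S T x y. sized S x \<longrightarrow> sized T y \<longrightarrow> sized (\<kappa> * S * T) (x * y)) \<and>
     (\<forall>T x. sized T x \<longrightarrow> norm x \<le> \<kappa> * T)"
proof -
  have "\<forall>k. \<exists>T. sized T (\<theta> ^ k)" using int_span_imp_sized gen_power_int_span by blast
  then obtain Tk where Tk: "\<And>k. sized (Tk k) (\<theta> ^ k)" by metis
  have Tk0: "Tk k \<ge> 0" for k using Tk sized_nonneg by blast
  define k1 where "k1 = (\<Sum>i<d. \<Sum>j<d. Tk (i + j))"
  define k2 where "k2 = (\<Sum>i<d. norm \<theta> ^ i)"
  define \<kappa> where "\<kappa> = 1 + k1 + k2"
  have k0: "k1 \<ge> 0" "k2 \<ge> 0" unfolding k1_def k2_def using Tk0 by (auto intro!: sum_nonneg)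
  have mult: "sized (\<kappa> * S * T) (x * y)" if xy: "sized S x" "sized T y" for S T x y
  proof -
    obtain z w where z: "x = elt z" "\<And>i. i < d \<Longrightarrow> \<bar>real_of_int (z i)\<bar> \<le> S"
      and w: "y = elt w" "\<And>i. i < d \<Longrightarrow> \<bar>real_of_int (w i)\<bar> \<le> T" using xy unfolding sized_def by blast
    have ST: "S \<ge> 0" "T \<ge> 0" using xy sized_nonneg by auto
    have eq: "x * y = (\<Sum>i<d. \<Sum>j<d. of_int (z i * w j) * \<theta> ^ (i + j))"
      unfolding z(1) w(1) elt_def sum_product
      by (intro sum.cong refl) (simp add: power_add mult_ac)
    have "sized (\<Sum>i<d. \<Sum>j<d. S * T * Tk (i + j)) (x * y)"
      unfolding eq
    proof (intro sized_sum)
      fix i j assume ij: "i \<in> {..<d}" "j \<in> {..<d}"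
      have "\<bar>real_of_int (z i * w j)\<bar> \<le> S * T"
        using z(2) w(2) ij ST by (auto simp: abs_mult intro!: mult_mono)
      then show "sized (S * T * Tk (i + j)) (of_int (z i * w j) * \<theta> ^ (i + j))"
        by (intro sized_mono[OF sized_scale[OF Tk]] mult_right_mono Tk0)
    qed
    moreover have "(\<Sum>i<d. \<Sum>j<d. S * T * Tk (i + j)) = k1 * (S * T)"
      by (simp add: k1_def sum_distrib_left mult.commute)
    moreover have "k1 * (S * T) \<le> \<kappa> * (S * T)"
      using k0 ST by (intro mult_right_mono) (auto simp: \<kappa>_def)
    ultimately show ?thesis by (metis sized_mono mult.assoc)
  qed
  have nrm: "norm x \<le> \<kappa> * T" if x: "sized T x" for T x
  proof -
    obtain z where z: "x = elt z" "\<And>i. i < d \<Longrightarrow> \<bar>real_of_int (z i)\<bar> \<le> T"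
      using x unfolding sized_def by blast
    have "norm x \<le> (\<Sum>i<d. T * norm \<theta> ^ i)"
      unfolding z(1) elt_def using z(2)
      by (intro order.trans[OF norm_sum] sum_mono) (auto simp: norm_mult norm_power intro!: mult_right_mono)
    also have "\<dots> = k2 * T" by (simp add: k2_def sum_distrib_left mult.commute)
    also have "\<dots> \<le> \<kappa> * T" using k0 sized_nonneg[OF x] by (intro mult_right_mono) (auto simp: \<kappa>_def)
    finally show ?thesis .
  qed
  have "\<kappa> \<ge> 1" using k0 by (simp add: \<kappa>_def)
  then show ?thesis using mult nrm by blast
qed

definition \<kappa> :: real where
  "\<kappa> = (SOME \<kappa>. \<kappa> \<ge> 1 \<and> (\<forall>S T x y. sized S x \<longrightarrow> sized T y \<longrightarrow> sized (\<kappa> * S * T) (x * y)) \<and>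
     (\<forall>T x. sized T x \<longrightarrow> norm x \<le> \<kappa> * T))"

lemma kappa_ge_1: "\<kappa> \<ge> 1"
  and sized_mult: "sized S x \<Longrightarrow> sized T y \<Longrightarrow> sized (\<kappa> * S * T) (x * y)"
  and sized_norm: "sized T x \<Longrightarrow> norm x \<le> \<kappa> * T"
  using someI_ex[OF kappa_exists] unfolding \<kappa>_def[symmetric] by blast+

lemma sized_power: "sized T x \<Longrightarrow> T \<ge> 1 \<Longrightarrow> sized ((\<kappa> * T) ^ n) (x ^ n)"
proof (induction n)
  case 0
  show ?case using sized_1 by simp
next
  case (Suc n)
  have "sized (\<kappa> * T * (\<kappa> * T) ^ n) (x * x ^ n)" by (intro sized_mult Suc)
  then show ?case by simp
qed

lemma sized_prod:
  assumes "\<And>i. i \<in> I \<Longrightarrow> sized (T i) (f i)"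
  shows "sized (\<kappa> ^ card I * prod T I) (prod f I)"
  using assms
proof (induction I rule: infinite_finite_induct)
  case (insert i I)
  have "sized (\<kappa> * T i * (\<kappa> ^ card I * prod T I)) (f i * prod f I)"
    using insert by (intro sized_mult) auto
  then show ?case using insert by (simp add: mult_ac)
qed (auto intro: sized_1)

lemma sized_dt:
  assumes "\<And>i j. i < n \<Longrightarrow> j < n \<Longrightarrow> sized (\<rho> i) (M i j)"
  shows "sized (fact n * \<kappa> ^ n * (\<Prod>i<n. \<rho> i)) (dt n M)"
proof -
  have "sized (real (card {p. p permutes {0..<n}}) * (\<kappa> ^ n * (\<Prod>i<n. \<rho> i))) (dt n M)"
    unfolding dt_expand
  proof (rule sized_sum_const)
    fix p assume "p \<in> {p. p permutes {0..<n}}"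
    then have "p i < n" if "i < n" for i using that by (auto dest: permutes_in_image)
    then have "sized (\<kappa> ^ card {0..<n} * (\<Prod>i=0..<n. \<rho> i)) (\<Prod>i=0..<n. M i (p i))"
      using assms by (intro sized_prod) auto
    then have "sized (\<kappa> ^ n * (\<Prod>i<n. \<rho> i)) (\<Prod>i=0..<n. M i (p i))"
      by (simp add: lessThan_atLeast0)
    then show "sized (\<kappa> ^ n * (\<Prod>i<n. \<rho> i)) (signof p * (\<Prod>i=0..<n. M i (p i)))"
      using sized_minus by (auto simp: sign_def)
  qed
  then show ?thesis by (simp add: card_permutations mult.assoc)
qed

text \<open>Liouville's inequality. The vector of powers of \<open>\<theta>\<close> is an eigenvector, with eigenvalue
  \<open>x\<close>, of the integer matrix of multiplication by \<open>x\<close>; its determinant is a nonzero integer and by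
  Cramer's rule a multiple of \<open>x\<close> with a cofactor of degree \<open>d - 1\<close> in the size of \<open>x\<close>.\<close>

lemma liouville:
  "\<exists>c>0. \<forall>T x. T \<ge> 1 \<longrightarrow> sized T x \<longrightarrow> x \<noteq> 0 \<longrightarrow> norm x \<ge> c / T ^ (d - 1)"
proof -
  define G where "G = (\<Sum>k<d. norm \<theta> ^ k)"
  have G: "G \<ge> 1"
  proof -
    have "norm \<theta> ^ 0 \<le> G" unfolding G_def using d_pos by (intro member_le_sum) auto
    then show ?thesis by simp
  qed
  define c where "c = 1 / (fact d * \<kappa> ^ (d - 1) * G)"
  have c: "c > 0" unfolding c_def using kappa_ge_1 G by simp
  have "norm x \<ge> c / T ^ (d - 1)" if T: "T \<ge> 1" and x: "sized T x" "x \<noteq> 0" for T x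
  proof -
    have "\<forall>i\<in>{..<d}. \<exists>z. x * \<theta> ^ i = elt z \<and> (\<forall>j<d. \<bar>real_of_int (z j)\<bar> \<le> \<kappa> * T)"
      using sized_mult[OF x(1) sized_power_gen] unfolding sized_def by simp
    from bchoice[OF this] obtain M where
      "\<forall>i\<in>{..<d}. x * \<theta> ^ i = elt (M i) \<and> (\<forall>j<d. \<bar>real_of_int (M i j)\<bar> \<le> \<kappa> * T)" by blast
    then have M: "\<And>i. i < d \<Longrightarrow> x * \<theta> ^ i = elt (M i)"
      "\<And>i j. i < d \<Longrightarrow> j < d \<Longrightarrow> \<bar>real_of_int (M i j)\<bar> \<le> \<kappa> * T" by blast+
    have "dt d M \<noteq> 0"
    proof
      assume "dt d M = 0"
      then have "dt d (\<lambda>i j. M j i) = 0" using dt_0_transpose[of d M] by simp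
      then obtain v where v: "\<exists>i<d. v i \<noteq> 0" "\<And>k. k < d \<Longrightarrow> (\<Sum>j<d. M j k * v j) = 0"
        using dt_eq_0_imp_kernel[of d "\<lambda>i j. M j i"] by blast
      have "x * elt v = (\<Sum>j<d. of_int (v j) * (x * \<theta> ^ j))"
        unfolding elt_def by (simp add: sum_distrib_left mult_ac)
      also have "\<dots> = (\<Sum>j<d. of_int (v j) * (\<Sum>k<d. of_int (M j k) * \<theta> ^ k))"
        using M(1) by (simp add: elt_def)
      also have "\<dots> = (\<Sum>j<d. \<Sum>k<d. of_int (M j k * v j) * \<theta> ^ k)"
        by (simp add: sum_distrib_left mult_ac)
      also have "\<dots> = (\<Sum>k<d. \<Sum>j<d. of_int (M j k * v j) * \<theta> ^ k)" by (rule sum.swap)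
      also have "\<dots> = (\<Sum>k<d. of_int (\<Sum>j<d. M j k * v j) * \<theta> ^ k)"
        by (simp add: sum_distrib_right)
      also have "\<dots> = 0" by (intro sum.neutral) (auto simp: v(2) simp del: of_int_sum)
      finally have "elt v = elt (\<lambda>_. 0)" using x(2) by (simp add: elt_def)
      then show False using v(1) elt_inj by blast
    qed
    let ?M = "\<lambda>i j. complex_of_int (M i j)"
    have "dt d ?M = of_int (dt d M)"
      by (rule dt_hom) (unfold_locales, auto)
    then have "norm (dt d ?M) \<ge> 1" using \<open>dt d M \<noteq> 0\<close> by (simp add: norm_of_int)
    moreover have "dt d ?M * \<theta> ^ 0 = (\<Sum>k<d. cof d ?M k 0 * (x * \<theta> ^ k))"
      by (subst dt_cramer[where t = "\<lambda>j. \<theta> ^ j", OF d_pos]) (simp add: M(1) elt_def)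
    moreover have "norm (\<Sum>k<d. cof d ?M k 0 * (x * \<theta> ^ k)) \<le>
        (\<Sum>k<d. fact d * (\<kappa> * T) ^ (d - 1) * (norm x * norm \<theta> ^ k))"
    proof (intro order.trans[OF norm_sum] sum_mono)
      fix k assume k: "k \<in> {..<d}"
      have "norm (cof d ?M k 0) \<le> fact d * (\<Prod>i<d. if i = k then 1 else \<kappa> * T)"
        unfolding cof_def by (rule norm_dt_le) (use M(2) in auto)
      also have "(\<Prod>i<d. if i = k then 1 else \<kappa> * T) = (\<kappa> * T) ^ (d - 1)"
        using k by (simp add: prod.If_cases Diff_eq[symmetric])
      finally show "norm (cof d ?M k 0 * (x * \<theta> ^ k)) \<le>
          fact d * (\<kappa> * T) ^ (d - 1) * (norm x * norm \<theta> ^ k)"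
        by (simp add: norm_mult norm_power mult_right_mono)
    qed
    ultimately have "1 \<le> (\<Sum>k<d. fact d * (\<kappa> * T) ^ (d - 1) * (norm x * norm \<theta> ^ k))" by simp
    also have "\<dots> = (fact d * \<kappa> ^ (d - 1) * G) * T ^ (d - 1) * norm x"
      by (simp add: G_def sum_distrib_left sum_distrib_right power_mult_distrib mult_ac)
    finally have 1: "1 \<le> norm x * ((fact d * \<kappa> ^ (d - 1) * G) * T ^ (d - 1))" by (simp add: mult_ac)
    have "(fact d * \<kappa> ^ (d - 1) * G) * T ^ (d - 1) > 0"
      using kappa_ge_1 G T by (intro mult_pos_pos) auto
    then have "1 / ((fact d * \<kappa> ^ (d - 1) * G) * T ^ (d - 1)) \<le> norm x"
      using 1 by (simp only: pos_divide_le_eq)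
    then show ?thesis by (simp add: c_def)
  qed
  then show ?thesis using c by blast
qed

end

section \<open>The house and the coordinates of an algebraic number\<close>

context order_gen
begin

definition gq :: "rat poly" where "gq = map_poly of_int g"

lemma gq: "degree gq = d" "gq \<noteq> 0" "rpoly gq z = poly (map_poly of_int g) z" "lead_coeff gq = 1"
proof -
  show deg: "degree gq = d" by (simp add: gq_def d_def degree_map_poly)
  show "gq \<noteq> 0" using deg d_pos by auto
  have "map_poly of_rat gq = (map_poly of_int g :: complex poly)"
    unfolding gq_def by (intro poly_eqI) (simp add: coeff_map_poly)
  then show "rpoly gq z = poly (map_poly of_int g) z" by simp
  show "lead_coeff gq = 1" using monic deg by (simp add: gq_def coeff_map_poly d_def)
qed

lemma relation_dvd: "rpoly q \<theta> = 0 \<longleftrightarrow> gq dvd q"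
proof
  assume "rpoly q \<theta> = 0"
  moreover have "q = gq * (q div gq) + q mod gq" by simp
  moreover have "rpoly gq \<theta> = 0" using root gq(3) by simp
  ultimately have "rpoly (q mod gq) \<theta> = 0"
    by (metis add_0 mult_zero_left rpoly_add rpoly_mult)
  moreover have "degree (q mod gq) < degree g"
    using degree_mod_less'[of gq q] gq(1,2) d_pos unfolding d_def by (cases "q mod gq = 0") auto
  ultimately have "q mod gq = 0" using indep by blast
  then show "gq dvd q" by (simp add: mod_eq_0_iff_dvd)
next
  assume "gq dvd q"
  then show "rpoly q \<theta> = 0" using root gq(3) by (auto elim!: dvdE simp: rpoly_mult)
qed

definition conjs :: "complex set" where "conjs = {z. rpoly gq z = 0}"

text \<open>Rational relations of \<open>\<theta>\<close> hold for its conjugates; this stands in for field embeddings.\<close>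

lemma relation_conj: "rpoly q \<theta> = 0 \<Longrightarrow> z \<in> conjs \<Longrightarrow> rpoly q z = 0"
  unfolding relation_dvd conjs_def by (auto elim!: dvdE simp: rpoly_mult)

text \<open>The minimal polynomial has no multiple root, because it does not divide its derivative.\<close>

lemma card_conjs: "finite conjs" "card conjs = d"
proof -
  let ?G = "map_poly of_rat gq :: complex poly"
  have nz: "?G \<noteq> 0" using gq(2) by simp
  show "finite conjs" unfolding conjs_def using nz by (rule poly_roots_finite)
  have pd: "pderiv gq \<noteq> 0" using gq(1) d_pos by (simp add: pderiv_eq_0_iff)
  have no: "rpoly (pderiv gq) z \<noteq> 0" if "z \<in> conjs" for z
  proof
    assume z: "rpoly (pderiv gq) z = 0"
    have th: "rpoly (pderiv gq) \<theta> \<noteq> 0"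
    proof
      assume "rpoly (pderiv gq) \<theta> = 0"
      then have "gq dvd pderiv gq" by (simp add: relation_dvd)
      then have "degree gq \<le> degree (pderiv gq)" using pd by (rule dvd_imp_degree_le)
      then show False using gq(1) d_pos by (simp add: degree_pderiv)
    qed
    define h where "h = gcd gq (pderiv gq)"
    have "h dvd gq" "h dvd pderiv gq" by (auto simp: h_def)
    then obtain k where k: "gq = h * k" by (auto elim: dvdE)
    have "rpoly h \<theta> \<noteq> 0" using th \<open>h dvd pderiv gq\<close> by (auto elim!: dvdE simp: rpoly_mult)
    moreover have "rpoly h \<theta> * rpoly k \<theta> = 0"
      using relation_dvd[of gq] k by (metis dvd_refl rpoly_mult)
    ultimately have "gq dvd k" using relation_dvd by simp
    moreover have "h \<noteq> 0" "k \<noteq> 0" using k gq(2) by auto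
    ultimately have "degree gq \<le> degree k" by (intro dvd_imp_degree_le)
    then have "degree h = 0" using k \<open>h \<noteq> 0\<close> \<open>k \<noteq> 0\<close> by (simp add: degree_mult_eq)
    then obtain c where c: "h = [:c:]" using degree_eq_zeroE by auto
    define u v where "u = fst (bezout_coefficients gq (pderiv gq))"
      and "v = snd (bezout_coefficients gq (pderiv gq))"
    have "u * gq + v * pderiv gq = h"
      unfolding u_def v_def h_def by (rule bezout_coefficients_fst_snd)
    then have "rpoly h z = rpoly u z * rpoly gq z + rpoly v z * rpoly (pderiv gq) z"
      by (metis rpoly_add rpoly_mult)
    then have "rpoly h z = 0" using z that unfolding conjs_def by simp
    then show False using c \<open>h \<noteq> 0\<close> by (simp add: rpoly_const)
  qed
  have "rsquarefree ?G" unfolding rsquarefree_roots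
    using no unfolding conjs_def by (auto simp: of_rat_hom.map_poly_pderiv)
  then show "card conjs = d" using rsquarefree_card_degree[OF nz] gq(1) by (simp add: conjs_def)
qed

lemma galois_conjugates_eq:
  assumes "algebraic x"
  obtains p :: "rat poly" where "p \<noteq> 0" "galois_conjugates x = {b. rpoly p b = 0}" "rpoly p x = 0"
proof -
  obtain p where p: "lead_coeff p = 1" "irreducible p" "degree p > 0" "\<And>q. rpoly q x = 0 \<longleftrightarrow> p dvd q"
    using minimal_polynomial_exists[OF assms] by blast
  have "rpoly p b = 0" if q: "irreducible q" "rpoly q x = 0" "rpoly q b = 0" for q b
  proof -
    have "p dvd q" using p(4) q(2) by simp
    then obtain u where u: "q = p * u" by (rule dvdE)
    have "\<not> p dvd 1" using p(3) by (auto simp: poly_dvd_1)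
    then have "u dvd 1" using irreducibleD[OF q(1) u] by blast
    then have "u \<noteq> 0" "degree u = 0" by (auto simp: is_unit_iff_degree poly_dvd_1)
    moreover from this obtain c where "u = [:c:]" using degree_eq_zeroE by blast
    ultimately have "u = [:c:]" "c \<noteq> 0" by auto
    have "rpoly p b * rpoly u b = 0" using q(3) unfolding u rpoly_mult .
    moreover have "rpoly u b = of_rat c" unfolding \<open>u = [:c:]\<close> by (rule rpoly_const)
    ultimately show ?thesis using \<open>c \<noteq> 0\<close> by simp
  qed
  then have "galois_conjugates x = {b. rpoly p b = 0}"
    unfolding galois_conjugates_def using p(2) p(4)[of p] by auto
  then show ?thesis using that p by (metis degree_0 dvd_refl less_irrefl)
qed

text \<open>The number \<open>q(z)\<close> is a Galois conjugate of \<open>q(\<theta>)\<close>.\<close>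

lemma norm_conj_le_house:
  assumes "algebraic (rpoly q \<theta>)" "z \<in> conjs"
  shows "norm (rpoly q z) \<le> house (rpoly q \<theta>)"
proof -
  obtain p where p: "p \<noteq> 0" "galois_conjugates (rpoly q \<theta>) = {b. rpoly p b = 0}" "rpoly p (rpoly q \<theta>) = 0"
    using galois_conjugates_eq[OF assms(1)] .
  have "rpoly (p \<circ>\<^sub>p q) \<theta> = 0" using p(3) by (simp add: rpoly_pcompose)
  then have "rpoly p (rpoly q z) = 0" using relation_conj assms(2) by (metis rpoly_pcompose)
  moreover have "finite (galois_conjugates (rpoly q \<theta>))"
    unfolding p(2) using p(1) by (intro poly_roots_finite) simp
  ultimately show ?thesis unfolding house_def by (intro Max_ge) (auto simp: p(2))
qed

lemma theta_conj: "\<theta> \<in> conjs"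
  using root gq(3) by (simp add: conjs_def)

lemma norm_le_house:
  assumes "x \<in> rat_adjoin \<theta>" "algebraic x"
  shows "norm x \<le> house x"
  using assms norm_conj_le_house theta_conj unfolding rat_adjoin_def by blast

lemma algebraic_int_conj:
  assumes "algebraic_int (of_nat D * rpoly q \<theta>)" "z \<in> conjs"
  shows "algebraic_int (of_nat D * rpoly q z)"
proof -
  obtain F where F: "poly (map_poly of_int F) (of_nat D * rpoly q \<theta>) = 0" "lead_coeff F = 1"
    using assms(1) unfolding algebraic_int_altdef_ipoly by blast
  define Fq where "Fq = (map_poly of_int F :: rat poly)"
  have Fq: "rpoly Fq y = poly (map_poly of_int F) y" for y
  proof -
    have "map_poly of_rat Fq = (map_poly of_int F :: complex poly)"
      unfolding Fq_def by (intro poly_eqI) (simp add: coeff_map_poly)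
    then show ?thesis by simp
  qed
  have sc: "rpoly ([:of_nat D:] * q) y = of_nat D * rpoly q y" for y
    unfolding rpoly_mult by (simp add: rpoly_const)
  have "rpoly (Fq \<circ>\<^sub>p ([:of_nat D:] * q)) \<theta> = 0"
    unfolding rpoly_pcompose sc Fq using F(1) .
  then have "rpoly (Fq \<circ>\<^sub>p ([:of_nat D:] * q)) z = 0" using relation_conj assms(2) by blast
  then have "poly (map_poly of_int F) (of_nat D * rpoly q z) = 0"
    unfolding rpoly_pcompose sc Fq .
  then show ?thesis using F(2) unfolding algebraic_int_altdef_ipoly by blast
qed

definition lagrange :: "complex \<Rightarrow> complex poly" where
  "lagrange z = (\<Prod>w\<in>conjs - {z}. smult (inverse (z - w)) [:- w, 1:])"

lemma poly_lagrange:
  assumes "z \<in> conjs" "w \<in> conjs"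
  shows "poly (lagrange z) w = (if w = z then 1 else 0)"
proof (cases "w = z")
  case True
  have "poly (smult (inverse (z - x)) [:- x, 1:]) z = 1" if "x \<in> conjs - {z}" for x
  proof -
    have "poly (smult (inverse (z - x)) [:- x, 1:]) z = inverse (z - x) * (z - x)" by (simp add: algebra_simps)
    also have "\<dots> = 1" using that by (intro left_inverse) auto
    finally show ?thesis .
  qed
  then show ?thesis unfolding lagrange_def poly_prod True
    by (simp only: prod.neutral_const if_True simp_thms cong: prod.cong)
next
  case False
  then show ?thesis unfolding lagrange_def poly_prod using assms card_conjs(1)
    by (auto intro!: prod_zero bexI[of _ w])
qed

lemma degree_lagrange:
  assumes "z \<in> conjs" shows "degree (lagrange z) < d"
proof -
  have "degree (lagrange z) \<le> (\<Sum>w\<in>conjs - {z}. degree (smult (inverse (z - w)) [:- w, 1:]))"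
    unfolding lagrange_def by (rule degree_prod_sum_le[unfolded o_def]) (simp add: card_conjs)
  also have "\<dots> \<le> (\<Sum>w\<in>conjs - {z}. 1)" by (intro sum_mono) auto
  also have "\<dots> = d - 1" using assms card_conjs by simp
  finally show ?thesis using d_pos by simp
qed

lemma algebraic_conj: "z \<in> conjs \<Longrightarrow> algebraic z"
  unfolding conjs_def using gq(2)
  by (auto intro!: algebraicI'[of "map_poly of_rat gq"] simp: coeff_map_poly)

lemma algebraic_coeff_lagrange:
  assumes "z \<in> conjs"
  shows "algebraic (coeff (lagrange z) i)"
proof -
  note F = is_subfield_algebraic
  have "coeff (\<Prod>w\<in>A. smult (inverse (z - w)) [:- w, 1:]) i \<in> {x. algebraic x}"
    if "A \<subseteq> conjs" for A i
    using that
  proof (induction A arbitrary: i rule: infinite_finite_induct)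
    case (insert w A)
    have "coeff (smult (inverse (z - w)) [:- w, 1:]) j \<in> {x. algebraic x}" for j
    proof -
      have wz: "w \<in> {x. algebraic x}" "z \<in> {x. algebraic x}"
        using insert.prems assms algebraic_conj by auto
      have "coeff [:- w, 1:] j \<in> {x. algebraic x}"
        using subfield_closed(1,2)[OF F] subfield_closed(6)[OF F wz(1)]
        by (auto simp: coeff_pCons split: nat.split)
      then show ?thesis unfolding coeff_smult
        using subfield_closed(4)[OF F subfield_closed(5)[OF F subfield_closed(3)[OF F wz(2,1)]]] by blast
    qed
    then show ?case unfolding prod.insert[OF insert.hyps] coeff_mult using insert
      by (intro subfield_sum[OF F] subfield_closed(4)[OF F]) auto
  qed (auto simp: coeff_1)
  then show ?thesis unfolding lagrange_def by blast
qed

text \<open>An element of the field is \<open>q(\<theta>)\<close> with \<open>q\<close> of degree less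
  than \<open>d\<close>, and Lagrange interpolation at the conjugates of \<open>\<theta>\<close> recovers \<open>q\<close> from the
  conjugates \<open>q(z)\<close> of the element, with coefficients that depend only on \<open>\<theta>\<close>.\<close>

lemma house_imp_sized:
  "\<exists>(E::nat) (C::real). E \<ge> 1 \<and> C \<ge> 1 \<and> (\<forall>x\<in>rat_adjoin \<theta>. \<forall>D::nat. D \<ge> 1 \<longrightarrow>
     algebraic_int (of_nat D * x) \<longrightarrow> sized (C * real D * house x) (of_nat (E * D) * x))"
proof -
  obtain E :: nat where E: "E > 0"
      "\<And>z i. z \<in> conjs \<Longrightarrow> i < d \<Longrightarrow> algebraic_int (of_nat E * coeff (lagrange z) i)"
    using common_integral_multiple[of "(\<lambda>(z, i). coeff (lagrange z) i) ` (conjs \<times> {..<d})"]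
      card_conjs(1) algebraic_coeff_lagrange by force
  define C0 where "C0 = (\<Sum>z\<in>conjs. \<Sum>i<d. norm (coeff (lagrange z) i))"
  define C where "C = 1 + real E * C0"
  have C0: "C0 \<ge> 0" unfolding C0_def by (intro sum_nonneg) auto
  have "sized (C * real D * house x) (of_nat (E * D) * x)"
    if x: "x \<in> rat_adjoin \<theta>" and D: "D \<ge> 1" "algebraic_int (of_nat D * x)" for x and D :: nat
  proof -
    have alg: "algebraic x"
      using algebraic_of_multiple[OF algebraic_int_imp_algebraic[OF D(2)]] D(1) by simp
    have "0 \<le> norm x" by simp
    also have "\<dots> \<le> house x" by (rule norm_le_house[OF x alg])
    finally have h0: "house x \<ge> 0" .
    obtain q0 where q0: "x = rpoly q0 \<theta>" using x unfolding rat_adjoin_def by auto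
    define q where "q = q0 mod gq"
    have "q0 = gq * (q0 div gq) + q" by (simp add: q_def)
    then have "rpoly q0 \<theta> = rpoly gq \<theta> * rpoly (q0 div gq) \<theta> + rpoly q \<theta>"
      by (metis rpoly_add rpoly_mult)
    then have xq: "x = rpoly q \<theta>" using relation_dvd[of gq] q0 by simp
    have deg: "degree q < d"
      using degree_mod_less'[of gq q0] gq(1,2) d_pos unfolding q_def by (cases "q0 mod gq = 0") auto
    have interp: "map_poly of_rat q = (\<Sum>z\<in>conjs. smult (rpoly q z) (lagrange z))"
    proof (rule poly_eqI_degree[of conjs])
      fix w assume w: "w \<in> conjs"
      have "poly (\<Sum>z\<in>conjs. smult (rpoly q z) (lagrange z)) w =
          (\<Sum>z\<in>conjs. if z = w then rpoly q z else 0)"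
        unfolding poly_sum using w by (intro sum.cong) (auto simp: poly_lagrange)
      then show "rpoly q w = poly (\<Sum>z\<in>conjs. smult (rpoly q z) (lagrange z)) w"
        using w card_conjs(1) by simp
    next
      show "degree (map_poly of_rat q :: complex poly) < card conjs" using deg card_conjs by simp
      have "degree (\<Sum>z\<in>conjs. smult (rpoly q z) (lagrange z)) \<le> d - 1"
        using degree_lagrange d_pos
        by (intro degree_sum_le card_conjs(1)) (fastforce intro: order.trans[OF degree_smult_le])
      then show "degree (\<Sum>z\<in>conjs. smult (rpoly q z) (lagrange z)) < card conjs"
        using d_pos card_conjs by simp
    qed
    have cf: "of_rat (coeff q i) = (\<Sum>z\<in>conjs. rpoly q z * coeff (lagrange z) i)" for i
      using arg_cong[OF interp, of "\<lambda>p. coeff p i"] by (simp add: coeff_sum coeff_map_poly)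
    have int: "of_nat (E * D) * of_rat (coeff q i) \<in> (\<int> :: complex set)" if i: "i < d" for i
    proof (rule rational_algebraic_int_is_int)
      have "of_nat (E * D) * of_rat (coeff q i) =
          (\<Sum>z\<in>conjs. (of_nat D * rpoly q z) * (of_nat E * coeff (lagrange z) i))"
        unfolding cf by (simp add: sum_distrib_left mult_ac)
      also have "algebraic_int \<dots>"
      proof (rule algebraic_int_sum)
        fix w assume w: "w \<in> conjs"
        have "algebraic_int (of_nat D * rpoly q w)"
          using D(2) w unfolding xq by (rule algebraic_int_conj)
        then show "algebraic_int ((of_nat D * rpoly q w) * (of_nat E * coeff (lagrange w) i))"
          using E(2)[OF w i] by (rule algebraic_int_add_mult(2))
      qed
      finally show "algebraic_int (of_nat (E * D) * of_rat (coeff q i) :: complex)" .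
      show "of_nat (E * D) * of_rat (coeff q i) \<in> (\<rat> :: complex set)"
        by (intro Rats_mult Rats_of_nat Rats_of_rat)
    qed
    then have "\<forall>i\<in>{..<d}. \<exists>z::int. of_nat (E * D) * of_rat (coeff q i) = (of_int z :: complex)"
      by (auto elim: Ints_cases)
    from bchoice[OF this] obtain z :: "nat \<Rightarrow> int" where
      z: "\<forall>i\<in>{..<d}. of_nat (E * D) * of_rat (coeff q i) = (of_int (z i) :: complex)" by blast
    have "of_nat (E * D) * x = elt z"
      unfolding xq rpoly_altdef[OF deg] elt_def sum_distrib_left
      using z by (intro sum.cong) (auto simp: mult.assoc[symmetric])
    moreover have "\<bar>real_of_int (z i)\<bar> \<le> C * real D * house x" if i: "i < d" for i
    proof -
      have "\<bar>real_of_int (z i)\<bar> = norm (of_int (z i) :: complex)" by (simp add: norm_of_int)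
      also have "\<dots> = norm (of_nat (E * D) * (of_rat (coeff q i) :: complex))" using z i by simp
      also have "\<dots> = real E * real D * norm (\<Sum>z\<in>conjs. rpoly q z * coeff (lagrange z) i)"
        unfolding cf by (simp add: norm_mult)
      also have "norm (\<Sum>z\<in>conjs. rpoly q z * coeff (lagrange z) i) \<le>
          (\<Sum>z\<in>conjs. house x * (\<Sum>i<d. norm (coeff (lagrange z) i)))"
      proof (intro order.trans[OF norm_sum] sum_mono)
        fix w assume w: "w \<in> conjs"
        have "norm (coeff (lagrange w) i) \<le> (\<Sum>i<d. norm (coeff (lagrange w) i))"
          using i by (intro member_le_sum) auto
        then show "norm (rpoly q w * coeff (lagrange w) i) \<le>
            house x * (\<Sum>i<d. norm (coeff (lagrange w) i))"
          unfolding norm_mult using norm_conj_le_house[of q w] alg w h0 unfolding xq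
          by (intro mult_mono) auto
      qed
      also have "\<dots> = house x * C0" by (simp add: C0_def sum_distrib_left)
      also have "real E * real D * (house x * C0) = (real E * C0) * (real D * house x)" by simp
      also have "\<dots> \<le> C * (real D * house x)" unfolding C_def using h0 by (intro mult_right_mono) auto
      finally show ?thesis by (simp add: mult_left_mono mult.assoc)
    qed
    ultimately show ?thesis unfolding sized_def by blast
  qed
  moreover have "C \<ge> 1" using C0 by (simp add: C_def)
  moreover have "E \<ge> 1" using E(1) by simp
  ultimately show ?thesis by blast
qed

text \<open>The powers of \<open>\<theta>\<close> below \<open>d\<close> are a basis.\<close>

lemma field_degree_rat_adjoin: "field_degree (rat_adjoin \<theta>) = d"
proof -
  define B where "B = (\<lambda>i. \<theta> ^ i) ` {..<d}"
  have inj: "inj_on (\<lambda>i. \<theta> ^ i) {..<d}"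
  proof (rule inj_onI, rule ccontr)
    fix i j assume ij: "i \<in> {..<d}" "j \<in> {..<d}" "\<theta> ^ i = \<theta> ^ j" "i \<noteq> j"
    have "elt (\<lambda>k. if k = i then 1 else 0) = elt (\<lambda>k. if k = j then 1 else 0)"
      unfolding elt_def using ij
      by (simp add: if_distrib[of of_int] if_distrib[of "\<lambda>x. x * _"] cong: if_cong)
    from elt_inj[OF this, of i] ij show False by simp
  qed
  have indB: "\<not> rat_vs.dependent B"
  proof
    assume "rat_vs.dependent B"
    then obtain u where u: "\<exists>v\<in>B. u v \<noteq> 0" "(\<Sum>v\<in>B. of_rat (u v) * v) = 0"
      using rat_vs.dependent_finite[of B] unfolding B_def by auto
    have "(\<Sum>i<d. of_rat (u (\<theta> ^ i)) * \<theta> ^ i) = 0"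
      using u(2) unfolding B_def sum.reindex[OF inj] by simp
    then show False using rat_relation_trivial[of "\<lambda>i. u (\<theta> ^ i)"] u(1) unfolding B_def by auto
  qed
  have span: "rat_vs.span B = rat_adjoin \<theta>"
  proof
    have sub: "rat_vs.subspace (rat_adjoin \<theta>)"
    proof (rule rat_vs.subspaceI)
      show "0 \<in> rat_adjoin \<theta>" using rat_adjoin_of_rat[of 0] by simp
      fix x y assume "x \<in> rat_adjoin \<theta>" "y \<in> rat_adjoin \<theta>"
      then show "x + y \<in> rat_adjoin \<theta>" unfolding rat_adjoin_def
        by (auto simp: rpoly_add[symmetric])
    next
      fix c x assume "x \<in> rat_adjoin \<theta>"
      then obtain q where q: "x = rpoly q \<theta>" unfolding rat_adjoin_def by auto
      have "of_rat c * x = rpoly ([:c:] * q) \<theta>" unfolding rpoly_mult rpoly_const q ..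
      then show "of_rat c * x \<in> rat_adjoin \<theta>" unfolding rat_adjoin_def by blast
    qed
    have "\<theta> ^ i \<in> rat_adjoin \<theta>" for i
    proof -
      have "rpoly ([:0,1:] ^ i) \<theta> = \<theta> ^ i"
        by (induction i) (simp_all only: power_0 power_Suc rpoly_1 rpoly_mult rpoly_X)
      then show ?thesis unfolding rat_adjoin_def by (metis rangeI)
    qed
    then show "rat_vs.span B \<subseteq> rat_adjoin \<theta>"
      unfolding B_def by (intro rat_vs.span_minimal sub) auto
    show "rat_adjoin \<theta> \<subseteq> rat_vs.span B"
    proof
      fix x assume "x \<in> rat_adjoin \<theta>"
      then obtain q0 where q0: "x = rpoly q0 \<theta>" unfolding rat_adjoin_def by auto
      define q where "q = q0 mod gq"
      have "q0 = gq * (q0 div gq) + q" by (simp add: q_def)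
      then have "rpoly q0 \<theta> = rpoly gq \<theta> * rpoly (q0 div gq) \<theta> + rpoly q \<theta>"
        by (metis rpoly_add rpoly_mult)
      then have xq: "x = rpoly q \<theta>" using relation_dvd[of gq] q0 by simp
      have deg: "degree q < d"
        using degree_mod_less'[of gq q0] gq(1,2) d_pos unfolding q_def by (cases "q0 mod gq = 0") auto
      show "x \<in> rat_vs.span B" unfolding xq rpoly_altdef[OF deg]
        by (intro rat_vs.span_sum rat_vs.span_scale rat_vs.span_base) (auto simp: B_def)
    qed
  qed
  have "rat_vs.dim (rat_adjoin \<theta>) = card B"
    by (rule rat_vs.dim_eq_card[OF _ indB]) (simp add: span[symmetric] rat_vs.span_span)
  then show ?thesis unfolding field_degree_def B_def using card_image[OF inj] by simp
qed

end

section \<open>Number fields as fields of fractions of an order\<close>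

text \<open>A generator of a number field becomes an algebraic integer after multiplication by an integer.\<close>

lemma order_gen_exists:
  assumes "algebraic \<theta>0"
  shows "\<exists>\<theta> g. order_gen \<theta> g \<and> rat_adjoin \<theta> = rat_adjoin \<theta>0"
proof -
  obtain p where p: "lead_coeff p = 1" "degree p > 0" "\<And>q. rpoly q \<theta>0 = 0 \<longleftrightarrow> p dvd q"
    using minimal_polynomial_exists[OF assms] by metis
  define n where "n = degree p"
  obtain m :: nat where m: "m > 0" "\<forall>i<Suc n. of_nat m * coeff p i \<in> \<int>"
    using common_denominator[of "Suc n" "coeff p"] by blast
  have "\<forall>i\<in>{..<n}. \<exists>z::int. of_nat m ^ (n - i) * coeff p i = of_int z"
  proof
    fix i assume "i \<in> {..<n}"
    then have "of_nat m ^ (n - i) * coeff p i = of_nat m ^ (n - i - 1) * (of_nat m * coeff p i)"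
      using power_Suc2[of "of_nat m :: rat" "n - i - 1"] by (simp add: Suc_diff_Suc)
    also have "\<dots> \<in> \<int>"
    proof (rule Ints_mult)
      show "of_nat m * coeff p i \<in> \<int>" using m(2) \<open>i \<in> {..<n}\<close> by simp
    qed (intro Ints_power Ints_of_nat)
    finally show "\<exists>z::int. of_nat m ^ (n - i) * coeff p i = of_int z" by (auto elim: Ints_cases)
  qed
  from bchoice[OF this] obtain z :: "nat \<Rightarrow> int"
    where z: "\<forall>i\<in>{..<n}. of_nat m ^ (n - i) * coeff p i = of_int (z i)" by (elim exE) (rule that)
  \<comment> \<open>This is \<open>m ^ n * p (X / m)\<close>, with root \<open>m * \<theta>0\<close>.\<close>
  define g where "g = monom 1 n + (\<Sum>i<n. monom (z i) i)"
  define \<theta> where "\<theta> = of_nat m * \<theta>0"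
  have cg: "coeff g j = (if j < n then z j else if j = n then 1 else 0)" for j
    unfolding g_def coeff_add coeff_sum by simp
  have deg: "degree g = n"
    by (rule order.antisym, rule degree_le) (auto simp: cg intro: le_degree)
  have z': "of_int (z i) = of_nat m ^ (n - i) * (of_rat (coeff p i) :: complex)" if "i < n" for i
  proof -
    have "(of_int (z i) :: complex) = of_rat (of_int (z i))" by simp
    also have "of_int (z i) = of_nat m ^ (n - i) * coeff p i" using z that by simp
    finally show ?thesis by (simp add: of_rat_mult of_rat_power)
  qed
  have "poly (map_poly of_int g) \<theta> = (\<Sum>i\<le>n. of_int (coeff g i) * \<theta> ^ i)"
    unfolding poly_altdef using deg by (simp add: coeff_map_poly degree_map_poly)
  also have "\<dots> = (\<Sum>i\<le>n. of_nat m ^ n * (of_rat (coeff p i) * \<theta>0 ^ i))"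
  proof (intro sum.cong refl)
    fix i assume "i \<in> {..n}"
    then consider "i < n" | "i = n" by fastforce
    then show "of_int (coeff g i) * \<theta> ^ i = of_nat m ^ n * (of_rat (coeff p i) * \<theta>0 ^ i)"
    proof cases
      case 1
      then have "of_nat m ^ n = of_nat m ^ (n - i) * (of_nat m ^ i :: complex)" by (simp flip: power_add)
      then show ?thesis using 1 by (simp add: cg z' \<theta>_def power_mult_distrib)
    next
      case 2
      then show ?thesis using p(1) by (simp add: cg \<theta>_def power_mult_distrib n_def)
    qed
  qed
  also have "\<dots> = of_nat m ^ n * rpoly p \<theta>0"
    by (simp add: rpoly_altdef[of p "Suc n"] n_def sum_distrib_left lessThan_Suc_atMost)
  also have "rpoly p \<theta>0 = 0" using p(3) by simp
  finally have root: "poly (map_poly of_int g) \<theta> = 0" by simp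
  have "order_gen \<theta> g"
  proof
    show "lead_coeff g = 1" by (simp add: deg cg)
    show "poly (map_poly of_int g) \<theta> = 0" by (rule root)
    fix q assume q: "degree q < degree g" "rpoly q \<theta> = 0"
    define r where "r = q \<circ>\<^sub>p [:0, of_nat m:]"
    have "rpoly [:0, of_nat m:] \<theta>0 = \<theta>" using m(1) by (simp add: map_poly_pCons \<theta>_def mult.commute)
    then have "rpoly r \<theta>0 = 0" unfolding r_def rpoly_pcompose using q(2) by simp
    then have "p dvd r" using p(3) by simp
    moreover have "degree r < degree p" unfolding r_def using q(1) deg m(1) by (simp add: degree_pcompose n_def)
    ultimately have "r = 0" using dvd_imp_degree_le[of p r] by force
    then show "q = 0" unfolding r_def using m(1) by (auto simp: pcompose_eq_0_iff)
  qed
  moreover have "rat_adjoin \<theta> = rat_adjoin \<theta>0"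
  proof -
    have mm: "of_nat m = (of_rat (of_nat m) :: complex)" by simp
    have F0: "is_subfield (rat_adjoin \<theta>0)" by (rule is_subfield_rat_adjoin[OF assms])
    have alg: "algebraic \<theta>"
      using root cg[of n] by (intro algebraicI'[of "map_poly of_int g"]) (auto simp: coeff_map_poly)
    have F: "is_subfield (rat_adjoin \<theta>)" by (rule is_subfield_rat_adjoin[OF alg])
    have "\<theta> \<in> rat_adjoin \<theta>0" unfolding \<theta>_def mm
      by (intro subfield_closed(4)[OF F0] rat_adjoin_of_rat rat_adjoin_self)
    moreover have "\<theta>0 = \<theta> / of_nat m" using m(1) by (simp add: \<theta>_def)
    then have "\<theta>0 \<in> rat_adjoin \<theta>"
      using subfield_closed(8)[OF F rat_adjoin_self rat_adjoin_of_rat] mm by metis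
    ultimately show ?thesis using rat_adjoin_subset F F0 by blast
  qed
  ultimately show ?thesis by blast
qed

text \<open>This puts the field of the theorem into the setting of \<open>order_gen\<close>, by a primitive element for \<open>\<alpha>\<close>
  together with a finite spanning set of \<open>K\<close>.\<close>

lemma adjoin_eq_rat_adjoin:
  assumes K: "number_field K" "\<forall>x\<in>K. algebraic x" and \<alpha>: "algebraic \<alpha>"
  shows "\<exists>\<theta> g. order_gen \<theta> g \<and> adjoin K \<alpha> = rat_adjoin \<theta>"
proof -
  obtain B where B: "finite B" "rat_vs.span B = K" using K(1) unfolding number_field_def by auto
  have BK: "B \<subseteq> K" using B(2) rat_vs.span_superset by auto
  then obtain \<theta>0 where \<theta>0: "algebraic \<theta>0" "insert \<alpha> B \<subseteq> rat_adjoin \<theta>0"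
      "\<forall>F. is_subfield F \<longrightarrow> insert \<alpha> B \<subseteq> F \<longrightarrow> \<theta>0 \<in> F"
    using primitive_element_finite[of "insert \<alpha> B"] K(2) \<alpha> B(1) by blast
  have F0: "is_subfield (rat_adjoin \<theta>0)" by (rule is_subfield_rat_adjoin[OF \<theta>0(1)])
  have "K \<subseteq> rat_adjoin \<theta>0"
    unfolding B(2)[symmetric]
  proof (rule rat_vs.span_minimal)
    show "B \<subseteq> rat_adjoin \<theta>0" using \<theta>0(2) by simp
    show "rat_vs.subspace (rat_adjoin \<theta>0)"
      by (rule rat_vs.subspaceI) (auto intro: subfield_closed[OF F0] rat_adjoin_of_rat)
  qed
  then have "adjoin K \<alpha> \<subseteq> rat_adjoin \<theta>0"
    unfolding adjoin_def using \<theta>0(2) F0 by (intro hull_minimal) auto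
  moreover have "rat_adjoin \<theta>0 \<subseteq> adjoin K \<alpha>"
    unfolding adjoin_def hull_def
  proof (rule Inter_greatest)
    fix F assume "F \<in> {t. is_subfield t \<and> insert \<alpha> K \<subseteq> t}"
    then have "is_subfield F" "insert \<alpha> B \<subseteq> F" using BK by auto
    then show "rat_adjoin \<theta>0 \<subseteq> F" using \<theta>0(3) rat_adjoin_subset by blast
  qed
  ultimately have "adjoin K \<alpha> = rat_adjoin \<theta>0" by (rule equalityI)
  then show ?thesis using order_gen_exists[OF \<theta>0(1)] by (simp add: eq_commute)
qed

context order_gen
begin

section \<open>Siegel's lemma\<close>

text \<open>The pigeonhole principle: the vectors whose coordinates lie in \<open>{0..T}\<close> are more numerous than
  the possible values of the linear forms, so two of them have the same image, and their difference
  is a solution. All counts are \<open>d\<close>-th powers, because every number has \<open>d\<close> coordinates.\<close>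

lemma siegel_lemma:
  fixes a :: "nat \<Rightarrow> nat \<Rightarrow> complex" and T :: nat
  assumes a: "\<And>i j. i < M \<Longrightarrow> j < N \<Longrightarrow> sized S (a i j)"
    and S: "S \<ge> 0"
    and bound: "(2 * (real N * (\<kappa> * S * real T)) + 1) ^ M < (real T + 1) ^ N"
  shows "\<exists>x. (\<exists>j<N. x j \<noteq> 0) \<and> (\<forall>j<N. sized (real T) (x j)) \<and> (\<forall>i<M. (\<Sum>j<N. a i j * x j) = 0)"
proof -
  define R where "R = real N * (\<kappa> * S * real T)"
  have R: "R \<ge> 0" unfolding R_def using S kappa_ge_1 by simp
  define X where "X = PiE ({..<N} \<times> {..<d}) (\<lambda>_. {0..int T})"
  define Y where "Y = PiE ({..<M} \<times> {..<d}) (\<lambda>_. {- \<lfloor>R\<rfloor>..\<lfloor>R\<rfloor>})"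
  define x where "x = (\<lambda>(u :: nat \<times> nat \<Rightarrow> int) j. elt (\<lambda>i. u (j, i)))"
  have fin: "finite X" "finite Y" unfolding X_def Y_def by (auto intro!: finite_PiE)
  have xs: "sized (real T) (x u j)" if "u \<in> X" "j < N" for u j
    unfolding sized_def x_def
  proof (intro exI conjI allI impI)
    fix i assume "i < d"
    then have "u (j, i) \<in> {0..int T}" using that unfolding X_def by (auto simp: PiE_iff)
    then show "\<bar>real_of_int (u (j, i))\<bar> \<le> real T" by auto
  qed simp
  have "sized R (\<Sum>j<N. a i j * x u j)" if "u \<in> X" "i < M" for u i
  proof -
    have "sized (real (card {..<N}) * (\<kappa> * S * real T)) (\<Sum>j<N. a i j * x u j)"
      using that by (intro sized_sum_const sized_mult a xs) auto
    then show ?thesis by (simp add: R_def)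
  qed
  then have "\<forall>p\<in>X \<times> {..<M}. \<exists>z. (\<Sum>j<N. a (snd p) j * x (fst p) j) = elt z \<and> (\<forall>i<d. \<bar>real_of_int (z i)\<bar> \<le> R)"
    unfolding sized_def by auto
  from bchoice[OF this] obtain c0 where
    "\<forall>p\<in>X \<times> {..<M}. (\<Sum>j<N. a (snd p) j * x (fst p) j) = elt (c0 p) \<and> (\<forall>i<d. \<bar>real_of_int (c0 p i)\<bar> \<le> R)"
    by blast
  then have c0: "(\<Sum>j<N. a i j * x u j) = elt (c0 (u, i))" "k < d \<Longrightarrow> \<bar>real_of_int (c0 (u, i) k)\<bar> \<le> R"
    if "u \<in> X" "i < M" for u i k using that by fastforce+
  define F where "F = (\<lambda>u. \<lambda>(i, k)\<in>{..<M} \<times> {..<d}. c0 (u, i) k)"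
  have FY: "F ` X \<subseteq> Y"
  proof
    fix y assume "y \<in> F ` X"
    then obtain u where u: "u \<in> X" "y = F u" by auto
    have "c0 (u, i) k \<in> {- \<lfloor>R\<rfloor>..\<lfloor>R\<rfloor>}" if "i < M" "k < d" for i k
    proof -
      have "real_of_int (c0 (u, i) k) \<le> R" "real_of_int (- c0 (u, i) k) \<le> R"
        using c0(2)[OF u(1) that] by (auto simp: abs_le_iff)
      then show ?thesis unfolding le_floor_iff[symmetric] by auto
    qed
    then show "y \<in> Y" unfolding u(2) F_def Y_def by auto
  qed
  have "real (card Y) = (2 * real_of_int \<lfloor>R\<rfloor> + 1) ^ (M * d)"
    unfolding Y_def using R by (simp add: card_PiE of_nat_diff)
  also have "\<dots> \<le> (2 * R + 1) ^ (M * d)" using R by (intro power_mono) auto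
  also have "\<dots> = ((2 * R + 1) ^ M) ^ d" by (simp add: power_mult)
  also have "\<dots> < ((real T + 1) ^ N) ^ d" using bound R d_pos unfolding R_def by (intro power_strict_mono) auto
  also have "\<dots> = real (card X)" unfolding X_def by (simp add: card_PiE power_mult add.commute)
  finally have "card Y < card X" by simp
  then have "\<not> inj_on F X" using card_inj_on_le[OF _ FY fin(2)] by fastforce
  then obtain u w where uw: "u \<in> X" "w \<in> X" "u \<noteq> w" "F u = F w" unfolding inj_on_def by blast
  define y where "y = (\<lambda>j. x u j - x w j)"
  have y_eq: "y j = elt (\<lambda>i. u (j, i) - w (j, i))" for j
    unfolding y_def x_def elt_def by (simp add: sum_subtractf left_diff_distrib)
  obtain p where p: "p \<in> {..<N} \<times> {..<d}" "u p \<noteq> w p"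
    using uw(1-3) unfolding X_def by (metis PiE_ext)
  have "y (fst p) \<noteq> 0"
  proof
    assume "y (fst p) = 0"
    then have "elt (\<lambda>i. u (fst p, i) - w (fst p, i)) = elt (\<lambda>_. 0)" unfolding y_eq by (simp add: elt_def)
    from elt_inj[OF this, of "snd p"] p show False by auto
  qed
  moreover have "sized (real T) (y j)" if "j < N" for j
    unfolding sized_def y_eq
  proof (intro exI conjI allI impI)
    fix i assume "i < d"
    then have "u (j, i) \<in> {0..int T}" "w (j, i) \<in> {0..int T}"
      using that uw(1,2) unfolding X_def by (auto simp: PiE_iff)
    then show "\<bar>real_of_int (u (j, i) - w (j, i))\<bar> \<le> real T" by auto
  qed simp
  moreover have "(\<Sum>j<N. a i j * y j) = 0" if i: "i < M" for i
  proof -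
    have "c0 (u, i) k = c0 (w, i) k" if "k < d" for k
      using fun_cong[OF uw(4), of "(i, k)"] i that by (simp add: F_def)
    then have "elt (c0 (u, i)) = elt (c0 (w, i))" by (simp add: elt_def)
    then have "(\<Sum>j<N. a i j * x u j) = (\<Sum>j<N. a i j * x w j)" using c0(1) uw(1,2) i by simp
    then show ?thesis by (simp add: y_def right_diff_distrib sum_subtractf)
  qed
  moreover have "fst p < N" using p(1) by auto
  ultimately show ?thesis by blast
qed

end

section \<open>Transcendence over the rational functions with complex coefficients\<close>

text \<open>Gaussian elimination does not leave the field of the coefficients. The system \<open>E\<close> may be infinite;
  the induction is on the set of unknowns.\<close>

lemma homogeneous_system_descent:
  fixes c :: "'i \<Rightarrow> complex"
  assumes k: "is_subfield k" and "finite I"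
    and "\<And>e i. e \<in> E \<Longrightarrow> i \<in> I \<Longrightarrow> e i \<in> k"
    and "\<And>e. e \<in> E \<Longrightarrow> (\<Sum>i\<in>I. e i * c i) = 0" and "\<exists>i\<in>I. c i \<noteq> 0"
  shows "\<exists>b. (\<forall>i. b i \<in> k) \<and> (\<exists>i\<in>I. b i \<noteq> 0) \<and> (\<forall>e\<in>E. (\<Sum>i\<in>I. e i * b i) = 0)"
  using assms(2-)
proof (induction I arbitrary: E)
  case empty
  then show ?case by simp
next
  case (insert i I)
  note k0 = subfield_closed[OF k]
  show ?case
  proof (cases "\<forall>e\<in>E. e i = 0")
    case True
    have "(\<Sum>j\<in>insert i I. e j * (if j = i then 1 else 0)) = 0" if "e \<in> E" for e
      using True that insert.hyps by (intro sum.neutral) auto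
    then show ?thesis using k0(1,2) by (intro exI[of _ "\<lambda>j. if j = i then 1 else 0"]) auto
  next
    case False
    then obtain e0 where e0: "e0 \<in> E" "e0 i \<noteq> 0" by blast
    define red where "red = (\<lambda>e j. e j - e i * e0 j / e0 i)"
    have eqs: "e i * c i + (\<Sum>j\<in>I. e j * c j) = 0" if "e \<in> E" for e
      using insert.prems(2)[OF that] insert.hyps by simp
    have red_sum: "(\<Sum>j\<in>I. red e j * x j) = (\<Sum>j\<in>I. e j * x j) - e i / e0 i * (\<Sum>j\<in>I. e0 j * x j)" for e x
      by (simp add: red_def left_diff_distrib sum_subtractf sum_distrib_left mult.assoc)
    have "\<exists>b. (\<forall>i. b i \<in> k) \<and> (\<exists>i\<in>I. b i \<noteq> 0) \<and> (\<forall>e\<in>red ` E. (\<Sum>i\<in>I. e i * b i) = 0)"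
    proof (rule insert.IH)
      fix e j assume "e \<in> red ` E" "j \<in> I"
      then show "e j \<in> k" using insert.prems(1) e0(1) unfolding red_def by (auto intro!: k0)
    next
      fix e assume "e \<in> red ` E"
      then obtain e' where e': "e' \<in> E" "e = red e'" by auto
      have 1: "(\<Sum>j\<in>I. e' j * c j) = - (e' i * c i)" "(\<Sum>j\<in>I. e0 j * c j) = - (e0 i * c i)"
        using eqs[OF e'(1)] eqs[OF e0(1)] by (simp_all add: eq_neg_iff_add_eq_0 add.commute)
      show "(\<Sum>j\<in>I. e j * c j) = 0" unfolding e'(2) red_sum 1 using e0(2) by simp
    next
      show "\<exists>j\<in>I. c j \<noteq> 0"
      proof (rule ccontr)
        assume "\<not> (\<exists>j\<in>I. c j \<noteq> 0)"
        then have "c i = 0" using eqs[OF e0(1)] e0(2) by simp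
        then show False using insert.prems(3) \<open>\<not> (\<exists>j\<in>I. c j \<noteq> 0)\<close> by auto
      qed
    qed
    then obtain b where b: "\<And>j. b j \<in> k" "\<exists>j\<in>I. b j \<noteq> 0" "\<And>e. e \<in> E \<Longrightarrow> (\<Sum>j\<in>I. red e j * b j) = 0"
      by blast
    define b' where "b' = b(i := - (\<Sum>j\<in>I. e0 j * b j) / e0 i)"
    have b'I: "(\<Sum>j\<in>I. e j * b' j) = (\<Sum>j\<in>I. e j * b j)" for e
      using insert.hyps by (intro sum.cong) (auto simp: b'_def)
    have "b' j \<in> k" for j
      unfolding b'_def using b(1) insert.prems(1)[OF e0(1)]
      by (auto intro!: k0 subfield_sum[OF k])
    moreover have "\<exists>j\<in>insert i I. b' j \<noteq> 0" using b(2) insert.hyps by (auto simp: b'_def)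
    moreover have "(\<Sum>j\<in>insert i I. e j * b' j) = 0" if "e \<in> E" for e
      using b(3)[OF that, unfolded red_sum] insert.hyps by (simp add: b'I) (simp add: b'_def)
    ultimately show ?thesis by blast
  qed
qed

definition fop :: "complex poly \<Rightarrow> complex fls" where
  "fop p = fps_to_fls (fps_of_poly p)"

lemma fop_simps: "fop 0 = 0" "fop 1 = 1" "fop (p + q) = fop p + fop q" "fop (p * q) = fop p * fop q"
  "fop (p - q) = fop p - fop q" "fop (- p) = - fop p"
  by (simp_all add: fop_def fps_of_poly_add fps_of_poly_mult fps_of_poly_diff fps_of_poly_uminus
      fls_times_fps_to_fls)

lemma fop_eq_0_iff: "fop p = 0 \<longleftrightarrow> p = 0"
  by (simp add: fop_def)

lemma comm_ring_hom_fop: "comm_ring_hom fop"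
  by unfold_locales (simp_all add: fop_simps)

interpretation fop_hom: comm_ring_hom fop by (rule comm_ring_hom_fop)
interpretation fop_poly_hom: map_poly_comm_ring_hom fop ..

lemma fop_deriv: "fls_deriv (fop p) = fop (pderiv p)"
  by (simp add: fop_def fls_deriv_fps_to_fls fps_of_poly_pderiv)

interpretation fps_of_poly_hom: comm_ring_hom "fps_of_poly :: complex poly \<Rightarrow> complex fps"
  by unfold_locales (simp_all add: fps_of_poly_add fps_of_poly_mult)
interpretation fps_of_poly_poly_hom: map_poly_comm_ring_hom "fps_of_poly :: complex poly \<Rightarrow> complex fps" ..
interpretation fps_to_fls_hom: comm_ring_hom "fps_to_fls :: complex fps \<Rightarrow> complex fls"
  by unfold_locales (simp_all add: fls_times_fps_to_fls)

lemma poly_fop: "poly (map_poly fop Q) (fps_to_fls f) = fps_to_fls (poly (map_poly fps_of_poly Q) f)"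
  by (induction Q)
    (simp_all add: map_poly_pCons fop_simps fop_def fls_times_fps_to_fls fop_eq_0_iff)

text \<open>Transcendence over \<open>\<complex>(x)\<close> instead of over the algebraic functions with algebraic coefficients. The
  zero estimate needs it in this form, since it involves an arbitrary rational solution of the
  differential equation.\<close>

definition transcendental_fps :: "complex fps \<Rightarrow> bool" where
  "transcendental_fps f \<longleftrightarrow> (\<forall>Q :: complex poly poly. Q \<noteq> 0 \<longrightarrow> poly (map_poly fps_of_poly Q) f \<noteq> 0)"

lemma fps_nth_poly_fps_of_poly:
  assumes "degree Q \<le> e" "\<And>i. degree (coeff Q i) \<le> m"
  shows "fps_nth (poly (map_poly fps_of_poly Q) f) l =
    (\<Sum>(i,j)\<in>{..e} \<times> {..m}. (if j \<le> l then fps_nth (f ^ i) (l - j) else 0) * coeff (coeff Q i) j)"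
proof -
  have "poly (map_poly fps_of_poly Q) f = (\<Sum>i\<le>degree Q. fps_of_poly (coeff Q i) * f ^ i)"
    by (simp add: poly_altdef coeff_map_poly degree_map_poly)
  also have "\<dots> = (\<Sum>i\<le>e. fps_of_poly (coeff Q i) * f ^ i)"
    using assms(1) by (intro sum.mono_neutral_left) (auto simp: coeff_eq_0)
  finally have "fps_nth (poly (map_poly fps_of_poly Q) f) l =
      (\<Sum>i\<le>e. \<Sum>j=0..l. coeff (coeff Q i) j * fps_nth (f ^ i) (l - j))"
    by (simp add: fps_sum_nth fps_mult_nth)
  also have "\<dots> = (\<Sum>i\<le>e. \<Sum>j\<le>m. (if j \<le> l then fps_nth (f ^ i) (l - j) else 0) * coeff (coeff Q i) j)"
  proof (rule sum.cong[OF refl])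
    fix i
    have "(\<Sum>j=0..l. coeff (coeff Q i) j * fps_nth (f ^ i) (l - j)) =
        (\<Sum>j\<in>{0..l} \<union> {..m}. (if j \<le> l then fps_nth (f ^ i) (l - j) else 0) * coeff (coeff Q i) j)"
      by (rule sum.mono_neutral_cong_left) (auto simp: mult.commute)
    also have "\<dots> = (\<Sum>j\<le>m. (if j \<le> l then fps_nth (f ^ i) (l - j) else 0) * coeff (coeff Q i) j)"
    proof (rule sum.mono_neutral_right)
      have "coeff (coeff Q i) j = 0" if "j > m" for j
        using that assms(2)[of i] by (intro coeff_eq_0) simp
      then show "\<forall>j\<in>{0..l} \<union> {..m} - {..m}. (if j \<le> l then fps_nth (f ^ i) (l - j) else 0) * coeff (coeff Q i) j = 0"
        by auto
    qed auto
    finally show "(\<Sum>j=0..l. coeff (coeff Q i) j * fps_nth (f ^ i) (l - j)) =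
      (\<Sum>j\<le>m. (if j \<le> l then fps_nth (f ^ i) (l - j) else 0) * coeff (coeff Q i) j)" .
  qed
  also have "\<dots> = (\<Sum>(i,j)\<in>{..e} \<times> {..m}. (if j \<le> l then fps_nth (f ^ i) (l - j) else 0) * coeff (coeff Q i) j)"
    by (simp add: sum.cartesian_product)
  finally show ?thesis .
qed

lemma fps_nth_power_subfield:
  assumes k: "is_subfield k" and f: "\<And>n. fps_nth f n \<in> k"
  shows "fps_nth (f ^ i) n \<in> k"
proof (induction i arbitrary: n)
  case 0
  then show ?case using subfield_closed(1,2)[OF k] by simp
next
  case (Suc i)
  then show ?case using f by (auto simp: fps_mult_nth intro!: subfield_sum[OF k] subfield_closed[OF k])
qed

text \<open>The coefficients of an algebraic relation of \<open>f\<close> with bounded degrees solve an infinite homogeneous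
  linear system over the field of the coefficients of \<open>f\<close>. If it has a complex solution, then it has
  one in that field.\<close>

lemma transcendental_fps_descent:
  assumes k: "is_subfield k" "\<And>x. x \<in> k \<Longrightarrow> algebraic x"
    and f: "\<And>n. fps_nth f n \<in> k" and tr: "transcendental_series f"
  shows "transcendental_fps f"
  unfolding transcendental_fps_def
proof (intro allI impI notI)
  fix Q :: "complex poly poly"
  assume Q: "Q \<noteq> 0" "poly (map_poly fps_of_poly Q) f = 0"
  define e where "e = degree Q"
  define m where "m = (\<Sum>i\<le>e. degree (coeff Q i))"
  have deg: "degree (coeff Q i) \<le> m" for i
  proof (cases "i \<le> e")
    case True
    then show ?thesis unfolding m_def by (intro member_le_sum) auto
  qed (simp add: e_def coeff_eq_0)
  define I where "I = {..e} \<times> {..m}"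
  define E where "E = (\<lambda>l (i, j). if j \<le> l then fps_nth (f ^ i) (l - j) else 0)"
  define c where "c = (\<lambda>(i, j). coeff (coeff Q i) j)"
  have "\<exists>b. (\<forall>p. b p \<in> k) \<and> (\<exists>p\<in>I. b p \<noteq> 0) \<and> (\<forall>v\<in>range E. (\<Sum>p\<in>I. v p * b p) = 0)"
  proof (rule homogeneous_system_descent[OF k(1)])
    show "finite I" by (simp add: I_def)
    show "v p \<in> k" if "v \<in> range E" "p \<in> I" for v p
      using that fps_nth_power_subfield[OF k(1) f] subfield_closed(1)[OF k(1)]
      by (auto simp: E_def split: prod.splits)
    show "(\<Sum>p\<in>I. v p * c p) = 0" if v: "v \<in> range E" for v
    proof -
      obtain l where l: "v = E l" using v by auto
      have "(\<Sum>p\<in>I. E l p * c p) = fps_nth (poly (map_poly fps_of_poly Q) f) l"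
        by (subst fps_nth_poly_fps_of_poly[of Q e m])
          (auto simp: e_def deg I_def E_def c_def intro!: sum.cong)
      then show ?thesis using Q(2) l by simp
    qed
    have "lead_coeff Q \<noteq> 0" using Q(1) by simp
    then have "lead_coeff (lead_coeff Q) \<noteq> 0" by simp
    then have "c (e, degree (lead_coeff Q)) \<noteq> 0" by (simp add: c_def e_def)
    moreover have "(e, degree (lead_coeff Q)) \<in> I" using deg by (simp add: I_def)
    ultimately show "\<exists>p\<in>I. c p \<noteq> 0" by blast
  qed
  then obtain b where b: "\<And>p. b p \<in> k" "\<exists>p\<in>I. b p \<noteq> 0" "\<And>l. (\<Sum>p\<in>I. E l p * b p) = 0" by blast
  define q where "q = (\<lambda>i. \<Sum>j\<le>m. monom (b (i, j)) j)"
  define R where "R = (\<Sum>i\<le>e. monom (q i) i)"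
  have cq: "coeff (q i) j = (if j \<le> m then b (i, j) else 0)" for i j
    unfolding q_def coeff_sum by simp
  have cR: "coeff R i = (if i \<le> e then q i else 0)" for i
    unfolding R_def coeff_sum by simp
  have dR: "degree R \<le> e" by (rule degree_le) (simp add: cR)
  have dq: "degree (coeff R i) \<le> m" for i by (rule degree_le) (simp add: cR cq)
  have "fps_nth (poly (map_poly fps_of_poly R) f) l = 0" for l
  proof -
    have "fps_nth (poly (map_poly fps_of_poly R) f) l = (\<Sum>p\<in>I. E l p * b p)"
      by (subst fps_nth_poly_fps_of_poly[OF dR dq])
        (auto simp: I_def E_def cR cq intro!: sum.cong)
    then show ?thesis using b(3) by simp
  qed
  then have "poly (map_poly fps_of_poly R) f = 0" by (intro fps_ext) simp
  then have "poly (map_poly fop R) (fps_to_fls f) = 0" by (simp add: poly_fop)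
  moreover have "map_poly fop R \<noteq> 0"
  proof -
    obtain i j where ij: "(i, j) \<in> I" "b (i, j) \<noteq> 0" using b(2) by auto
    then have "coeff (coeff R i) j \<noteq> 0" by (simp add: cR cq I_def)
    then have "fop (coeff R i) \<noteq> 0" unfolding fop_eq_0_iff by auto
    then have "coeff (map_poly fop R) i \<noteq> 0" by (simp add: coeff_map_poly fop_simps)
    then show ?thesis by (metis coeff_0)
  qed
  moreover have "coeff (map_poly fop R) i \<in> alg_rat_functions" for i
  proof -
    have 1: "\<forall>j. algebraic (coeff (coeff R i) j)"
      using b(1) k(2) by (auto simp: cR cq)
    have 2: "\<forall>j. algebraic (coeff (1 :: complex poly) j)" by (auto simp: coeff_1)
    have "coeff (map_poly fop R) i = fps_to_fls (fps_of_poly (coeff R i)) / fps_to_fls (fps_of_poly 1)"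
      by (simp add: coeff_map_poly fop_def)
    then show ?thesis unfolding alg_rat_functions_def using 1 2 one_neq_zero by blast
  qed
  ultimately show False using tr unfolding transcendental_series_def by blast
qed

definition rat_functions :: "complex fls set" where
  "rat_functions = {fop p / fop q | p q. q \<noteq> 0}"

lemma Rat_fop: "fop p \<in> rat_functions"
proof -
  have "fop p = fop p / fop 1" by (simp add: fop_simps)
  then show ?thesis unfolding rat_functions_def using one_neq_zero by blast
qed

lemma Rat_closed:
  assumes "x \<in> rat_functions" "y \<in> rat_functions"
  shows "x + y \<in> rat_functions" "x * y \<in> rat_functions" "x - y \<in> rat_functions" "x / y \<in> rat_functions" "- x \<in> rat_functions" "fls_deriv x \<in> rat_functions"
proof -
  obtain p q where x: "x = fop p / fop q" "q \<noteq> 0" using assms(1) unfolding rat_functions_def by blast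
  obtain r s where y: "y = fop r / fop s" "s \<noteq> 0" using assms(2) unfolding rat_functions_def by blast
  have nz: "fop q \<noteq> 0" "fop s \<noteq> 0" using x y by (simp_all add: fop_eq_0_iff)
  have "x + y = fop (p * s + r * q) / fop (q * s)"
    using nz by (simp add: x(1) y(1) fop_simps add_frac_eq)
  then show "x + y \<in> rat_functions" unfolding rat_functions_def using x(2) y(2) by (metis (mono_tags, lifting) mem_Collect_eq mult_eq_0_iff)
  have "x - y = fop (p * s - r * q) / fop (q * s)"
    using nz by (simp add: x(1) y(1) fop_simps diff_frac_eq)
  then show "x - y \<in> rat_functions" unfolding rat_functions_def using x(2) y(2) by (metis (mono_tags, lifting) mem_Collect_eq mult_eq_0_iff)
  have "x * y = fop (p * r) / fop (q * s)" by (simp add: x(1) y(1) fop_simps)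
  then show "x * y \<in> rat_functions" unfolding rat_functions_def using x(2) y(2) by (metis (mono_tags, lifting) mem_Collect_eq mult_eq_0_iff)
  have "- x = fop (- p) / fop q" by (simp add: x(1) fop_simps)
  then show "- x \<in> rat_functions" unfolding rat_functions_def using x(2) by blast
  show "x / y \<in> rat_functions"
  proof (cases "r = 0")
    case True
    then have "x / y = fop 0" by (simp add: y fop_simps)
    then show ?thesis using Rat_fop by metis
  next
    case False
    have "x / y = fop (p * s) / fop (q * r)" by (simp add: x(1) y(1) fop_simps)
    then show ?thesis unfolding rat_functions_def using x(2) False by (metis (mono_tags, lifting) mem_Collect_eq mult_eq_0_iff)
  qed
  have "x * fop q = fop p" using nz by (simp add: x(1))
  then have "fls_deriv (x * fop q) = fop (pderiv p)" by (simp add: fop_deriv)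
  then have "fls_deriv x * fop q = fop (pderiv p) - x * fop (pderiv q)"
    by (simp add: fop_deriv algebra_simps)
  then have "fls_deriv x = (fop (pderiv p) - x * fop (pderiv q)) / fop q"
    using nz by (simp add: field_simps)
  also have "\<dots> = fop (pderiv p * q - p * pderiv q) / fop (q * q)"
    using nz by (simp add: x(1) fop_simps field_simps)
  finally show "fls_deriv x \<in> rat_functions" unfolding rat_functions_def using x(2) by (metis (mono_tags, lifting) mem_Collect_eq mult_eq_0_iff)
qed

lemma Rat_common_denominator:
  assumes "\<And>i. x i \<in> rat_functions"
  shows "\<exists>q. q \<noteq> 0 \<and> (\<forall>i<(n::nat). \<exists>p. fop q * x i = fop p)"
proof (induction n)
  case 0
  show ?case by (intro exI[of _ 1]) auto
next
  case (Suc n)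
  then obtain q where q: "q \<noteq> 0" "\<forall>i<n. \<exists>p. fop q * x i = fop p" by blast
  obtain r s where rs: "x n = fop r / fop s" "s \<noteq> 0" using assms[of n] unfolding rat_functions_def by blast
  have "\<exists>p. fop (q * s) * x i = fop p" if "i < Suc n" for i
  proof (cases "i = n")
    case True
    then have "fop (q * s) * x i = fop (q * r)" using rs by (simp add: fop_simps fop_eq_0_iff)
    then show ?thesis by blast
  next
    case False
    then have "i < n" using that by simp
    then obtain p where "fop q * x i = fop p" using q(2) by blast
    then have "fop (q * s) * x i = fop (p * s)" by (simp add: fop_simps mult_ac)
    then show ?thesis by blast
  qed
  then show ?case using q(1) rs(2) by (intro exI[of _ "q * s"]) auto
qed

lemma transcendental_fps_Rat:
  assumes tr: "transcendental_fps f" and P: "P \<noteq> 0" "\<And>i. coeff P i \<in> rat_functions"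
  shows "poly P (fps_to_fls f) \<noteq> 0"
proof
  assume eq: "poly P (fps_to_fls f) = 0"
  obtain q where q: "q \<noteq> 0" "\<forall>i<Suc (degree P). \<exists>p. fop q * coeff P i = fop p"
    using Rat_common_denominator[of "coeff P" "Suc (degree P)"] P(2) by blast
  have "\<forall>i. \<exists>p. fop q * coeff P i = fop p"
  proof
    fix i
    show "\<exists>p. fop q * coeff P i = fop p"
    proof (cases "i < Suc (degree P)")
      case False
      then have "fop q * coeff P i = fop 0" by (simp add: coeff_eq_0 fop_simps)
      then show ?thesis by blast
    qed (use q in blast)
  qed
  from choice[OF this] obtain p where p: "\<And>i. fop q * coeff P i = fop (p i)" by blast
  define Q where "Q = (\<Sum>i\<le>degree P. monom (p i) i)"
  have cQ: "coeff Q i = p i" for i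
  proof (cases "i \<le> degree P")
    case False
    then have "fop (p i) = 0" using p[of i] by (simp add: coeff_eq_0)
    then show ?thesis using False by (simp add: Q_def coeff_sum fop_eq_0_iff)
  qed (simp add: Q_def coeff_sum)
  have QP: "map_poly fop Q = smult (fop q) P"
    by (intro poly_eqI) (simp add: coeff_map_poly fop_simps cQ p)
  have "Q \<noteq> 0" using QP P(1) q(1) by (auto simp: fop_eq_0_iff)
  then have "poly (map_poly fps_of_poly Q) f \<noteq> 0" using tr unfolding transcendental_fps_def by blast
  then have "poly (map_poly fop Q) (fps_to_fls f) \<noteq> 0" by (simp add: poly_fop)
  then show False using eq by (simp add: QP)
qed

section \<open>The differential operator on polynomials in the unknown function\<close>

definition derivation :: "('a::idom \<Rightarrow> 'a) \<Rightarrow> bool" where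
  "derivation \<delta> \<longleftrightarrow> (\<forall>a b. \<delta> (a + b) = \<delta> a + \<delta> b) \<and> (\<forall>a b. \<delta> (a * b) = a * \<delta> b + \<delta> a * b)"

lemma derivation_simps:
  assumes "derivation \<delta>"
  shows "\<delta> (a + b) = \<delta> a + \<delta> b" "\<delta> (a * b) = a * \<delta> b + \<delta> a * b" "\<delta> 0 = 0"
proof -
  show add: "\<delta> (a + b) = \<delta> a + \<delta> b" for a b using assms by (simp add: derivation_def)
  show "\<delta> (a * b) = a * \<delta> b + \<delta> a * b" using assms by (simp add: derivation_def)
  have "\<delta> 0 + \<delta> 0 = \<delta> 0 + 0" using add[of 0 0] by (simp only: add_0_right)
  then show "\<delta> 0 = 0" by (simp only: add_left_cancel)
qed

text \<open>If \<open>\<delta> y = B * y + C\<close>, then the derivative of \<open>P(y)\<close> is the value at \<open>y\<close> of this polynomial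
  (\<open>poly_dop\<close>). The operator acts on polynomials in an indeterminate, for any derivation of the
  coefficients; it is used for \<open>A * d/dx\<close> on polynomials, power series and Laurent series.\<close>

definition dop :: "('a::idom \<Rightarrow> 'a) \<Rightarrow> 'a \<Rightarrow> 'a \<Rightarrow> 'a poly \<Rightarrow> 'a poly" where
  "dop \<delta> B C P = map_poly \<delta> P + [:C, B:] * pderiv P"

lemma coeff_dop:
  fixes P :: "'a::idom poly"
  assumes "derivation \<delta>"
  shows "coeff (dop \<delta> B C P) i = \<delta> (coeff P i) + of_nat i * B * coeff P i + of_nat (Suc i) * C * coeff P (Suc i)"
  unfolding dop_def
  by (cases i) (simp_all add: coeff_map_poly derivation_simps[OF assms] coeff_pderiv algebra_simps)

lemma degree_dop_le:
  fixes P :: "'a::idom poly"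
  assumes "derivation \<delta>"
  shows "degree (dop \<delta> B C P) \<le> degree P"
  by (rule degree_le) (simp add: coeff_dop[OF assms] coeff_eq_0 derivation_simps[OF assms])

lemma degree_dop_pow_le:
  fixes P :: "'a::idom poly"
  assumes "derivation \<delta>"
  shows "degree ((dop \<delta> B C ^^ k) P) \<le> degree P"
  by (induction k) (auto intro: order.trans[OF degree_dop_le[OF assms]])

lemma dop_add:
  fixes P Q :: "'a::idom poly"
  assumes "derivation \<delta>"
  shows "dop \<delta> B C (P + Q) = dop \<delta> B C P + dop \<delta> B C Q"
  by (intro poly_eqI) (simp add: coeff_dop[OF assms] derivation_simps[OF assms] algebra_simps)

lemma dop_smult:
  fixes P :: "'a::idom poly"
  assumes "derivation \<delta>"
  shows "dop \<delta> B C (smult a P) = smult a (dop \<delta> B C P) + smult (\<delta> a) P"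
  by (intro poly_eqI) (simp add: coeff_dop[OF assms] derivation_simps[OF assms] algebra_simps)

lemma dop_pCons:
  fixes P :: "'a::idom poly"
  assumes "derivation \<delta>"
  shows "dop \<delta> B C (pCons a P) = [:\<delta> a:] + pCons 0 (dop \<delta> B C P) + [:C, B:] * P"
proof -
  have "map_poly \<delta> (pCons a P) = pCons (\<delta> a) (map_poly \<delta> P)"
    by (intro poly_eqI) (simp add: coeff_map_poly derivation_simps[OF assms] coeff_pCons split: nat.split)
  then show ?thesis by (simp add: dop_def pderiv_pCons algebra_simps)
qed

lemma dop_pow_add:
  fixes P Q :: "'a::idom poly"
  assumes "derivation \<delta>"
  shows "(dop \<delta> B C ^^ k) (P + Q) = (dop \<delta> B C ^^ k) P + (dop \<delta> B C ^^ k) Q"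
  by (induction k) (simp_all add: dop_add[OF assms])

lemma dop_pow_smult_Suc:
  fixes P :: "'a::idom poly"
  assumes "derivation \<delta>"
  shows "(dop \<delta> B C ^^ Suc k) (smult a P) =
    (dop \<delta> B C ^^ k) (smult a (dop \<delta> B C P)) + (dop \<delta> B C ^^ k) (smult (\<delta> a) P)"
  by (simp only: funpow_Suc_right o_apply dop_smult[OF assms] dop_pow_add[OF assms])

lemma poly_dop:
  fixes P :: "'a::idom poly"
  assumes "derivation \<delta>" and "\<delta> y = B * y + C"
  shows "poly (dop \<delta> B C P) y = \<delta> (poly P y)"
  by (induction P)
    (simp_all add: dop_def[of _ _ _ 0] dop_pCons[OF assms(1)] derivation_simps[OF assms(1)] assms(2) algebra_simps)

lemma poly_dop_pow:
  fixes P :: "'a::idom poly"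
  assumes "derivation \<delta>" and "\<delta> y = B * y + C"
  shows "poly ((dop \<delta> B C ^^ k) P) y = (\<delta> ^^ k) (poly P y)"
  by (induction k) (simp_all add: poly_dop[where \<delta> = \<delta>, OF assms])

lemma map_poly_dop:
  fixes P :: "'a::idom poly" and h :: "'a \<Rightarrow> 'b::idom"
  assumes "comm_ring_hom h" "derivation \<delta>" "derivation \<delta>'" "\<And>a. h (\<delta> a) = \<delta>' (h a)"
  shows "map_poly h (dop \<delta> B C P) = dop \<delta>' (h B) (h C) (map_poly h P)"
proof -
  interpret comm_ring_hom h by fact
  have hn: "h (of_nat n) = of_nat n" for n by (induction n) (simp_all add: hom_add)
  show ?thesis
    by (intro poly_eqI)
      (simp add: hn coeff_map_poly coeff_dop[OF assms(2)] coeff_dop[OF assms(3)] assms(4) hom_add hom_mult)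
qed

lemma map_poly_dop_pow:
  fixes P :: "'a::idom poly" and h :: "'a \<Rightarrow> 'b::idom"
  assumes "comm_ring_hom h" "derivation \<delta>" "derivation \<delta>'" "\<And>a. h (\<delta> a) = \<delta>' (h a)"
  shows "map_poly h ((dop \<delta> B C ^^ k) P) = (dop \<delta>' (h B) (h C) ^^ k) (map_poly h P)"
  by (induction k) (simp_all add: map_poly_dop[OF assms])

text \<open>The substitution \<open>y = Y + w\<close> transforms the differential equation into one for \<open>Y\<close> with the same \<open>B\<close>.
  If \<open>w\<close> is a solution, then the new equation is homogeneous.\<close>

lemma dop_shift:
  fixes P :: "'a::idom poly"
  assumes "derivation \<delta>"
  shows "dop \<delta> B C P \<circ>\<^sub>p [:w, 1:] = dop \<delta> B (C + B * w - \<delta> w) (P \<circ>\<^sub>p [:w, 1:])"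
proof (induction P)
  case 0
  show ?case by (simp add: dop_def)
next
  case (pCons a P)
  let ?C = "C + B * w - \<delta> w" and ?R = "P \<circ>\<^sub>p [:w, 1:]"
  have R: "pCons a P \<circ>\<^sub>p [:w, 1:] = [:a:] + (smult w ?R + pCons 0 ?R)"
    by (simp add: pcompose_pCons)
  have "dop \<delta> B ?C (pCons a P \<circ>\<^sub>p [:w, 1:]) =
      [:\<delta> a:] + (smult w (dop \<delta> B ?C ?R) + smult (\<delta> w) ?R + (pCons 0 (dop \<delta> B ?C ?R) + [:?C, B:] * ?R))"
    unfolding R dop_add[OF assms] dop_smult[OF assms] dop_pCons[OF assms]
    by (simp add: derivation_simps[OF assms] dop_def[of _ _ _ 0])
  also have "\<dots> = dop \<delta> B C (pCons a P) \<circ>\<^sub>p [:w, 1:]"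
    unfolding dop_pCons[OF assms] pcompose_add pcompose_mult
    by (simp add: pcompose_pCons pCons.IH algebra_simps smult_add_left smult_diff_left)
  finally show ?case ..
qed

lemma dop_shift_pow:
  fixes P :: "'a::idom poly"
  assumes "derivation \<delta>"
  shows "(dop \<delta> B C ^^ k) P \<circ>\<^sub>p [:w, 1:] = (dop \<delta> B (C + B * w - \<delta> w) ^^ k) (P \<circ>\<^sub>p [:w, 1:])"
  by (induction k) (simp_all add: dop_shift[OF assms])

text \<open>The combination of \<open>P\<close> and its derivative in which the term of degree \<open>degree P\<close> cancels.\<close>

definition lead_elim :: "('a::idom \<Rightarrow> 'a) \<Rightarrow> 'a \<Rightarrow> 'a \<Rightarrow> 'a poly \<Rightarrow> 'a poly" where
  "lead_elim \<delta> B C P = smult (lead_coeff P) (dop \<delta> B C P)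
     - smult (\<delta> (lead_coeff P) + of_nat (degree P) * B * lead_coeff P) P"

lemma coeff_elim:
  fixes P :: "'a::idom poly"
  assumes "derivation \<delta>"
  shows "coeff (lead_elim \<delta> B C P) i =
    lead_coeff P * (\<delta> (coeff P i) + of_nat i * B * coeff P i + of_nat (Suc i) * C * coeff P (Suc i))
    - (\<delta> (lead_coeff P) + of_nat (degree P) * B * lead_coeff P) * coeff P i"
  by (simp add: lead_elim_def coeff_dop[OF assms])

text \<open>The rows of coefficients of the derivatives of \<open>P\<close> become triangular when the leading term is
  eliminated repeatedly. \<open>S P\<close> is the set of exponents that are still present; as long as every
  elimination removes exactly the leading exponent from it, a linear functional that vanishes on the
  first \<open>card (S P)\<close> derivatives vanishes on all monomials with exponents in \<open>S P\<close>. The predicate \<open>G\<close>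
  is an invariant of the elimination.\<close>

lemma functional_vanishes:
  fixes P :: "'a::idom poly" and v :: "nat \<Rightarrow> 'a" and S :: "'a poly \<Rightarrow> nat set"
  assumes der: "derivation \<delta>"
    and step: "\<And>P. G P \<Longrightarrow> S P \<noteq> {} \<Longrightarrow>
      P \<noteq> 0 \<and> degree P \<in> S P \<and> G (lead_elim \<delta> B C P) \<and> S (lead_elim \<delta> B C P) = S P - {degree P}"
    and sub: "\<And>P. G P \<Longrightarrow> {i. coeff P i \<noteq> 0} \<subseteq> S P"
  shows "G P \<Longrightarrow> S P \<subseteq> {..N} \<Longrightarrow>
    (\<And>k. k < card (S P) \<Longrightarrow> (\<Sum>i\<le>N. coeff ((dop \<delta> B C ^^ k) P) i * v i) = 0) \<Longrightarrow> i \<in> S P \<Longrightarrow> v i = 0"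
proof (induction "card (S P)" arbitrary: P i)
  case 0
  then show ?case using finite_subset[OF 0(3)] by auto
next
  case (Suc n)
  let ?D = "dop \<delta> B C" and ?E = "lead_elim \<delta> B C P"
  define ell where "ell = (\<lambda>Q. \<Sum>i\<le>N. coeff Q i * v i)"
  have ell: "ell (Q + R) = ell Q + ell R" "ell (smult a Q) = a * ell Q" for Q R a
    by (simp_all add: ell_def sum.distrib sum_distrib_left algebra_simps)
  have fin: "finite (S P)" using Suc.prems(2) finite_subset by auto
  have ne: "S P \<noteq> {}" using Suc.prems(4) by auto
  note st = step[OF Suc.prems(1) ne]
  have ell0: "ell ((?D ^^ k) P) = 0" if "k < Suc n" for k
    using Suc.prems(3)[of k] that Suc.hyps(2) by (simp add: ell_def)
  have comb: "ell ((?D ^^ k) (smult a ((?D ^^ j) P))) = 0" if "j + k < Suc n" for j k a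
    using that
  proof (induction k arbitrary: a j)
    case 0
    then show ?case by (simp add: ell ell0)
  next
    case (Suc k)
    have "?D ((?D ^^ j) P) = (?D ^^ Suc j) P" by simp
    then show ?case unfolding dop_pow_smult_Suc[OF der] ell
      using Suc.IH[of "Suc j" a] Suc.IH[of j "\<delta> a"] Suc.prems by simp
  qed
  have vS: "v j = 0" if "j \<in> S P" "j \<noteq> degree P" for j
  proof (rule Suc.hyps(1))
    show "n = card (S ?E)" using st Suc.hyps(2) fin by simp
    show "G ?E" "S ?E \<subseteq> {..N}" "j \<in> S ?E" using st Suc.prems(2) that by auto
    fix k assume "k < card (S ?E)"
    then have k: "k < n" using st Suc.hyps(2) fin by simp
    define a where "a = - (\<delta> (lead_coeff P) + of_nat (degree P) * B * lead_coeff P)"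
    have E: "?E = smult (lead_coeff P) ((?D ^^ 1) P) + smult a ((?D ^^ 0) P)"
      by (simp add: lead_elim_def a_def smult_diff_left smult_add_left)
    have "ell ((?D ^^ k) ?E) = 0" unfolding E dop_pow_add[OF der] ell
      using comb[of 1 k "lead_coeff P"] comb[of 0 k a] k by simp
    then show "(\<Sum>i\<le>N. coeff ((?D ^^ k) ?E) i * v i) = 0" by (simp add: ell_def)
  qed
  show ?case
  proof (cases "i = degree P")
    case False
    then show ?thesis using vS Suc.prems(4) by blast
  next
    case True
    have "ell P = (\<Sum>j\<le>N. if j = i then coeff P i * v i else 0)"
      unfolding ell_def
    proof (rule sum.cong[OF refl])
      fix j
      show "coeff P j * v j = (if j = i then coeff P i * v i else 0)"
        using vS[of j] sub[OF Suc.prems(1)] True by (cases "coeff P j = 0") auto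
    qed
    also have "\<dots> = coeff P i * v i" using Suc.prems(2,4) by auto
    finally have "lead_coeff P * v i = 0" using ell0[of 0] True by simp
    then show ?thesis using st by simp
  qed
qed

lemma Rat_uminus: "x \<in> rat_functions \<Longrightarrow> - x \<in> rat_functions" and Rat_deriv: "x \<in> rat_functions \<Longrightarrow> fls_deriv x \<in> rat_functions"
  using Rat_closed(5,6)[of x x] by blast+

lemma Rat_of_nat: "of_nat n \<in> rat_functions"
proof -
  have "fop (of_nat n) = of_nat n" by (induction n) (simp_all add: fop_simps)
  then show ?thesis using Rat_fop[of "of_nat n"] by simp
qed

abbreviation fder :: "complex poly \<Rightarrow> complex fls \<Rightarrow> complex fls" where
  "fder A \<equiv> (\<lambda>u. fop A * fls_deriv u)"

lemma derivation_fder: "derivation (fder A)"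
  unfolding derivation_def by (auto simp: algebra_simps)

lemma Rat_elim:
  assumes "\<And>i. coeff P i \<in> rat_functions" "C \<in> rat_functions" "B \<in> rat_functions"
  shows "coeff (lead_elim (fder A) B C P) i \<in> rat_functions"
  unfolding coeff_elim[OF derivation_fder]
  by (intro Rat_closed(1-4) Rat_deriv assms Rat_fop Rat_of_nat)

text \<open>If the equation has no rational solution, elimination lowers the degree by exactly one: the
  vanishing of the next coefficient would make minus the quotient of the two leading coefficients,
  divided by the degree, a rational solution.\<close>

lemma elim_degree_drop:
  assumes nosol: "\<And>w. w \<in> rat_functions \<Longrightarrow> fder A w \<noteq> B * w + C"
    and P: "\<And>i. coeff P i \<in> rat_functions" "P \<noteq> 0" and B: "B \<in> rat_functions" and C: "C \<in> rat_functions"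
  shows "(if lead_elim (fder A) B C P = 0 then {} else {..degree (lead_elim (fder A) B C P)}) = {..degree P} - {degree P}"
proof -
  let ?E = "lead_elim (fder A) B C P" and ?e = "degree P"
  have top: "coeff ?E i = 0" if "i \<ge> ?e" for i
  proof (cases "i = ?e")
    case True
    show ?thesis unfolding True coeff_elim[OF derivation_fder] by (simp add: coeff_eq_0 algebra_simps)
  next
    case False
    then show ?thesis using that by (simp add: coeff_elim[OF derivation_fder] coeff_eq_0)
  qed
  show ?thesis
  proof (cases ?e)
    case 0
    have "?E = 0" using top 0 by (intro poly_eqI) simp
    then show ?thesis using 0 by auto
  next
    case (Suc e)
    have nz: "coeff ?E e \<noteq> 0"
    proof
      assume E0: "coeff ?E e = 0"
      define l where "l = lead_coeff P"
      define p where "p = coeff P e"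
      have l: "l \<noteq> 0" using P(2) by (simp add: l_def)
      have cE: "l * fder A p - p * fder A l - B * l * p + of_nat (Suc e) * C * l * l = 0"
        using E0 unfolding coeff_elim[OF derivation_fder] l_def[symmetric] p_def[symmetric]
        by (simp add: Suc l_def[symmetric, unfolded Suc] algebra_simps)
      define w where "w = - p / (of_nat (Suc e) * l)"
      have l1: "(of_nat (Suc e) :: complex fls) \<noteq> 0" by (simp del: of_nat_Suc)
      have wl: "w * (of_nat (Suc e) * l) = - p" using l l1 by (simp add: w_def del: of_nat_Suc)
      have "w \<in> rat_functions"
      proof -
        show ?thesis unfolding w_def l_def p_def using P(1) by (intro Rat_closed(2,4) Rat_uminus Rat_of_nat)
      qed
      moreover have "fder A w = B * w + C"
      proof -
        have dw: "of_nat (Suc e) * (fls_deriv w * l + w * fls_deriv l) = - fls_deriv p"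
          using arg_cong[OF wl, of fls_deriv] by (simp del: of_nat_Suc add: algebra_simps)
        have pw: "p = - (of_nat (Suc e) * (w * l))" using wl by (simp add: mult_ac del: of_nat_Suc)
        have dp: "fls_deriv p = - (of_nat (Suc e) * (fls_deriv w * l + w * fls_deriv l))" using dw by simp
        have "- (of_nat (Suc e) * l * l) * (fder A w - B * w - C) = 0"
          using cE unfolding dp pw by (simp add: algebra_simps del: of_nat_Suc)
        then have "fder A w - B * w = C" using l l1 by (simp del: of_nat_Suc)
        then show ?thesis by (simp only: diff_eq_eq add.commute)
      qed
      ultimately show False using nosol by blast
    qed
    then have "degree ?E = e"
      using top Suc by (intro order.antisym degree_le le_degree) auto
    moreover have "?E \<noteq> 0" using nz by auto
    ultimately show ?thesis using Suc by auto
  qed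
qed

text \<open>If the equation is homogeneous with a transcendental solution \<open>H\<close>, elimination removes the
  leading term and keeps all the others: a further vanishing coefficient would make a quotient
  \<open>p / (l * H ^ k)\<close> constant.\<close>

lemma elim_support:
  assumes A: "A \<noteq> 0" and H: "fder A H = B * H"
    and tr: "\<And>P. P \<noteq> 0 \<Longrightarrow> (\<And>i. coeff P i \<in> rat_functions) \<Longrightarrow> poly P H \<noteq> 0"
    and P: "\<And>i. coeff P i \<in> rat_functions" "P \<noteq> 0"
  shows "{i. coeff (lead_elim (fder A) B 0 P) i \<noteq> 0} = {i. coeff P i \<noteq> 0} - {degree P}"
proof -
  let ?E = "lead_elim (fder A) B 0 P" and ?e = "degree P"
  define l where "l = lead_coeff P"
  have l: "l \<noteq> 0" using P(2) by (simp add: l_def)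
  have lR: "l \<in> rat_functions" unfolding l_def by (rule P)
  have H0: "H \<noteq> 0" using tr[of "[:0,1:]"] Rat_fop[of 0] Rat_fop[of 1]
    by (auto simp: coeff_pCons fop_simps split: nat.splits)
  have cE: "coeff ?E i = l * (fder A (coeff P i) + of_nat i * B * coeff P i)
      - (fder A l + of_nat ?e * B * l) * coeff P i" for i
    by (simp add: coeff_elim[OF derivation_fder] l_def)
  have nz: "coeff ?E i \<noteq> 0" if i: "coeff P i \<noteq> 0" "i \<noteq> ?e" for i
  proof
    assume E0: "coeff ?E i = 0"
    have "i < ?e" using i le_degree[of P i] by simp
    define k where "k = ?e - i"
    have k: "?e = i + k" "k > 0" using \<open>i < ?e\<close> by (simp_all add: k_def)
    define p where "p = coeff P i"
    have eq: "l * fder A p = (fder A l + of_nat k * B * l) * p"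
      using E0 unfolding cE p_def[symmetric] k(1) by (simp add: algebra_simps)
    define u where "u = p / (l * H ^ k)"
    have ul: "u * (l * H ^ k) = p" using l H0 by (simp add: u_def)
    have dH: "fder A (H ^ k) = of_nat k * B * H ^ k"
    proof -
      have "fder A (H ^ k) = of_nat k * H ^ (k - 1) * fder A H" by (simp add: fls_deriv_power mult_ac)
      also have "\<dots> = of_nat k * B * (H ^ (k - 1) * H)" unfolding H by (simp add: mult_ac)
      also have "H ^ (k - 1) * H = H ^ k" using k(2) by (metis power_minus_mult)
      finally show ?thesis .
    qed
    have "fder A p = fder A u * (l * H ^ k) + u * (fder A l * H ^ k + l * fder A (H ^ k))"
      unfolding ul[symmetric] by (simp add: algebra_simps)
    then have "l * fder A p = l * fder A u * (l * H ^ k) + (fder A l + of_nat k * B * l) * (u * (l * H ^ k))"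
      unfolding dH by (simp only: algebra_simps)
    then have "l * fder A u * (l * H ^ k) = 0" unfolding ul eq by simp
    then have "fls_deriv u = 0" using l H0 A by (simp add: fop_eq_0_iff)
    then obtain c where c: "u = fls_const c" using fls_deriv_eq_0_iff by blast
    define R where "R = monom (u * l) k - [:p:]"
    have "fop [:c:] = fls_const c" by (simp add: fop_def fps_of_poly_const)
    then have "u \<in> rat_functions" using c Rat_fop by metis
    then have RR: "coeff R j \<in> rat_functions" for j
      using P(1)[of i] lR Rat_fop[of 0] unfolding R_def p_def
      by (auto simp: coeff_pCons fop_simps split: nat.split intro!: Rat_closed(2,3) Rat_uminus)
    have "poly R H = 0" using ul by (simp add: R_def poly_monom mult_ac)
    moreover have "coeff R 0 = - p" using k(2) by (simp add: R_def)
    then have "R \<noteq> 0" using i(1) by (auto simp: p_def)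
    ultimately show False using tr RR by blast
  qed
  moreover have "coeff ?E i = 0" if "coeff P i = 0" for i
    using that by (simp add: cE)
  moreover have "coeff ?E ?e = 0" unfolding cE l_def by (simp add: algebra_simps)
  ultimately show ?thesis by auto
qed

text \<open>The hypothesis \<open>cases\<close> can always be achieved: if the equation has a rational solution, the
  expansion of \<open>P\<close> around it makes \<open>C\<close> vanish. In the homogeneous case \<open>S\<close> is the set of exponents of
  \<open>P\<close>, and otherwise it contains all exponents up to the degree.\<close>

lemma derivatives_independent:
  assumes A: "A \<noteq> 0" and F: "fder A F = B * F + C"
    and tr: "\<And>P. P \<noteq> 0 \<Longrightarrow> (\<And>i. coeff P i \<in> rat_functions) \<Longrightarrow> poly P F \<noteq> 0"
    and B: "B \<in> rat_functions" and C: "C \<in> rat_functions"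
    and cases: "C = 0 \<or> (\<forall>w\<in>rat_functions. fder A w \<noteq> B * w + C)"
    and P: "\<And>i. coeff P i \<in> rat_functions" "P \<noteq> 0" "degree P \<le> N"
  obtains S where "S \<subseteq> {..N}" "S \<noteq> {}"
    "\<And>k i. coeff ((dop (fder A) B C ^^ k) P) i \<noteq> 0 \<Longrightarrow> i \<in> S"
    "\<And>v i. (\<And>k. k < card S \<Longrightarrow> (\<Sum>i\<le>N. coeff ((dop (fder A) B C ^^ k) P) i * v i) = 0) \<Longrightarrow> i \<in> S \<Longrightarrow> v i = 0"
proof (cases "C = 0")
  case True
  define S where "S = (\<lambda>P :: complex fls poly. {i. coeff P i \<noteq> 0})"
  have SN: "S P \<subseteq> {..N}"
  proof
    fix i assume "i \<in> S P"
    then have "i \<le> degree P" unfolding S_def by (intro le_degree) simp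
    then show "i \<in> {..N}" using P(3) by simp
  qed
  have supp: "coeff P i \<noteq> 0" if "coeff ((dop (fder A) B C ^^ k) P) i \<noteq> 0" for k i
    using that
  proof (induction k)
    case (Suc k)
    then show ?case using True
      by (cases "coeff ((dop (fder A) B C ^^ k) P) i = 0") (auto simp: coeff_dop[OF derivation_fder])
  qed simp
  have "v i = 0" if "\<And>k. k < card (S P) \<Longrightarrow> (\<Sum>i\<le>N. coeff ((dop (fder A) B C ^^ k) P) i * v i) = 0"
      "i \<in> S P" for v i
  proof (rule functional_vanishes[OF derivation_fder,
      where G = "\<lambda>P. \<forall>i. coeff P i \<in> rat_functions" and S = S and P = P and N = N])
    fix P' :: "complex fls poly" assume P': "\<forall>i. coeff P' i \<in> rat_functions" "S P' \<noteq> {}"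
    then have "P' \<noteq> 0" by (auto simp: S_def)
    then show "P' \<noteq> 0 \<and> degree P' \<in> S P' \<and> (\<forall>i. coeff (lead_elim (fder A) B C P') i \<in> rat_functions) \<and>
        S (lead_elim (fder A) B C P') = S P' - {degree P'}"
      using Rat_elim[of P' C B A] P' B C elim_support[OF A, of F B P'] tr F True by (auto simp: S_def)
  next
    show "S P \<subseteq> {..N}" by (rule SN)
  qed (use that P in \<open>auto simp: S_def\<close>)
  moreover have "S P \<noteq> {}" using P(2) unfolding S_def by (auto simp: poly_eq_iff)
  ultimately show ?thesis using that[of "S P"] supp SN unfolding S_def by blast
next
  case False
  then have nosol: "\<And>w. w \<in> rat_functions \<Longrightarrow> fder A w \<noteq> B * w + C" using cases by blast
  define S where "S = (\<lambda>P :: complex fls poly. if P = 0 then {} else {..degree P})"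
  have supp: "i \<in> S P" if "coeff ((dop (fder A) B C ^^ k) P) i \<noteq> 0" for k i
  proof -
    have "i \<le> degree P" using le_degree[OF that] degree_dop_pow_le[OF derivation_fder[of A], of k B C P] by simp
    then show ?thesis using P(2) by (simp add: S_def)
  qed
  have "v i = 0" if "\<And>k. k < card (S P) \<Longrightarrow> (\<Sum>i\<le>N. coeff ((dop (fder A) B C ^^ k) P) i * v i) = 0"
      "i \<in> S P" for v i
  proof (rule functional_vanishes[OF derivation_fder,
      where G = "\<lambda>P. \<forall>i. coeff P i \<in> rat_functions" and S = S and P = P and N = N])
    fix P' :: "complex fls poly" assume P': "\<forall>i. coeff P' i \<in> rat_functions" "S P' \<noteq> {}"
    then have "P' \<noteq> 0" by (auto simp: S_def)
    then show "P' \<noteq> 0 \<and> degree P' \<in> S P' \<and> (\<forall>i. coeff (lead_elim (fder A) B C P') i \<in> rat_functions) \<and>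
        S (lead_elim (fder A) B C P') = S P' - {degree P'}"
      using Rat_elim[of P' C B A] P' B C elim_degree_drop[OF nosol, of P'] unfolding S_def by auto
  qed (use that P le_degree in \<open>auto simp: S_def\<close>)
  moreover have "S P \<subseteq> {..N}" "S P \<noteq> {}" using P(2,3) unfolding S_def by auto
  ultimately show ?thesis using that[of "S P"] supp by blast
qed

section \<open>The zero estimate\<close>

text \<open>Bookkeeping for rational functions with poles at the zeros of \<open>v\<close> only. It is stable under sums,
  products and derivatives, and it bounds the order at \<open>0\<close> from both sides (\<open>pole_bound_subdegree\<close>).\<close>

definition pole_bound :: "complex poly \<Rightarrow> nat \<Rightarrow> nat \<Rightarrow> complex fls \<Rightarrow> bool" where
  "pole_bound v m t x \<longleftrightarrow> (\<exists>p. x * fop v ^ m = fop p \<and> degree p \<le> t)"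

lemma fop_power: "fop (p ^ n) = fop p ^ n"
  by (induction n) (simp_all add: fop_simps)

lemma pole_bound_fop: "degree p \<le> t \<Longrightarrow> pole_bound v 0 t (fop p)"
  unfolding pole_bound_def by auto

lemma pole_bound_mono:
  assumes "pole_bound v m t x" "m \<le> m'" "t + (m' - m) * degree v \<le> t'"
  shows "pole_bound v m' t' x"
proof -
  obtain p where p: "x * fop v ^ m = fop p" "degree p \<le> t" using assms(1) unfolding pole_bound_def by blast
  have "x * fop v ^ m' = (x * fop v ^ m) * fop v ^ (m' - m)"
    using assms(2) by (simp add: mult.assoc flip: power_add)
  then have "x * fop v ^ m' = fop (p * v ^ (m' - m))" by (simp add: p(1) fop_simps fop_power)
  moreover have "degree (p * v ^ (m' - m)) \<le> t'"
    using degree_mult_le[of p "v ^ (m' - m)"] degree_power_le[of v "m' - m"] p(2) assms(3)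
    by (simp add: mult.commute)
  ultimately show ?thesis unfolding pole_bound_def by blast
qed

lemma pole_bound_0: "pole_bound v m t 0"
  unfolding pole_bound_def by (intro exI[of _ 0]) (simp add: fop_simps)

lemma pole_bound_add: "pole_bound v m t x \<Longrightarrow> pole_bound v m t y \<Longrightarrow> pole_bound v m t (x + y)"
  unfolding pole_bound_def by (metis degree_add_le distrib_right fop_simps(3))

lemma pole_bound_mult: "pole_bound v m t x \<Longrightarrow> pole_bound v m' t' y \<Longrightarrow> pole_bound v (m + m') (t + t') (x * y)"
proof -
  assume "pole_bound v m t x" "pole_bound v m' t' y"
  then obtain p q where p: "x * fop v ^ m = fop p" "degree p \<le> t"
    and q: "y * fop v ^ m' = fop q" "degree q \<le> t'" unfolding pole_bound_def by blast
  have "x * y * fop v ^ (m + m') = (x * fop v ^ m) * (y * fop v ^ m')" by (simp add: power_add mult_ac)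
  also have "\<dots> = fop (p * q)" by (simp add: p q fop_simps)
  finally show ?thesis unfolding pole_bound_def using p(2) q(2) degree_mult_le[of p q] by force
qed

lemma pole_bound_sum: "(\<And>i. i \<in> I \<Longrightarrow> pole_bound v m t (g i)) \<Longrightarrow> pole_bound v m t (sum g I)"
  by (induction I rule: infinite_finite_induct) (auto intro: pole_bound_0 pole_bound_add)

lemma pole_bound_of_int: "pole_bound v 0 0 (of_int k)"
proof -
  have "fop (of_int k) = of_int k"
  proof -
    have "fop (of_nat n) = of_nat n" for n by (induction n) (simp_all add: fop_simps)
    then show ?thesis by (cases k) (simp_all add: fop_simps del: of_nat_Suc)
  qed
  moreover have "degree (of_int k :: complex poly) = 0" by (metis degree_of_int)
  ultimately show ?thesis using pole_bound_fop[of "of_int k" 0 v] by simp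
qed

lemma pole_bound_prod:
  "(\<And>i. i \<in> I \<Longrightarrow> pole_bound v m t (g i)) \<Longrightarrow> pole_bound v (card I * m) (card I * t) (prod g I)"
proof (induction I rule: infinite_finite_induct)
  case (insert i I)
  have "pole_bound v (m + card I * m) (t + card I * t) (g i * prod g I)"
    using insert by (intro pole_bound_mult) auto
  then show ?case using insert by simp
qed (use pole_bound_of_int[of v 1] in simp_all)

lemma pole_bound_dt:
  assumes "\<And>i j. i < n \<Longrightarrow> j < n \<Longrightarrow> pole_bound v m t (M i j)"
  shows "pole_bound v (n * m) (n * t) (dt n M)"
  unfolding dt_expand
proof (rule pole_bound_sum)
  fix p assume "p \<in> {p. p permutes {0..<n}}"
  then have "p i < n" if "i < n" for i using that by (auto dest: permutes_in_image)
  then have "pole_bound v (card {0..<n} * m) (card {0..<n} * t) (\<Prod>i=0..<n. M i (p i))"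
    using assms by (intro pole_bound_prod) auto
  then have "pole_bound v (0 + n * m) (0 + n * t) (signof p * (\<Prod>i=0..<n. M i (p i)))"
    by (intro pole_bound_mult pole_bound_of_int) simp
  then show "pole_bound v (n * m) (n * t) (signof p * (\<Prod>i=0..<n. M i (p i)))" by simp
qed

lemma pole_bound_cof:
  assumes "\<And>i j. i < n \<Longrightarrow> j < n \<Longrightarrow> pole_bound v m t (M i j)" and "m * degree v \<le> t"
  shows "pole_bound v (n * m) (n * t) (cof n M k i)"
  unfolding cof_def
proof (rule pole_bound_dt)
  fix a b assume "a < n" "b < n"
  moreover have "pole_bound v m t (of_int z)" for z by (rule pole_bound_mono[OF pole_bound_of_int]) (use assms(2) in auto)
  from this[of 0] this[of 1] have "pole_bound v m t 0" "pole_bound v m t 1" by simp_all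
  ultimately show "pole_bound v m t ((M(k := \<lambda>c. if c = i then 1 else 0)) a b)" using assms(1) by simp
qed

lemma pole_bound_fder:
  assumes "pole_bound v m t x"
  shows "pole_bound v (Suc m) (t + degree A + degree v) (fder A x)"
proof -
  obtain p where p: "x * fop v ^ m = fop p" "degree p \<le> t" using assms unfolding pole_bound_def by blast
  have "fls_deriv x * fop v ^ m + x * (of_nat m * fop v ^ (m - 1) * fop (pderiv v)) = fop (pderiv p)"
    using arg_cong[OF p(1), of fls_deriv] by (simp add: fop_deriv fls_deriv_power algebra_simps)
  then have "(fls_deriv x * fop v ^ m + x * (of_nat m * fop v ^ (m - 1) * fop (pderiv v))) * fop v =
      fop (pderiv p) * fop v" by simp
  then have "fls_deriv x * fop v ^ Suc m + (x * fop v ^ m) * of_nat m * fop (pderiv v) = fop (pderiv p) * fop v"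
    by (cases m) (simp_all add: algebra_simps)
  moreover have nat: "fop (of_nat m) = of_nat m" by (induction m) (simp_all add: fop_simps)
  ultimately have "fls_deriv x * fop v ^ Suc m = fop (pderiv p * v - p * of_nat m * pderiv v)"
    unfolding p(1) by (simp add: fop_simps nat eq_diff_eq)
  then have "fder A x * fop v ^ Suc m = fop (A * (pderiv p * v - p * of_nat m * pderiv v))"
    by (simp add: fop_simps mult_ac)
  moreover have "degree (A * (pderiv p * v - p * of_nat m * pderiv v)) \<le> t + degree A + degree v"
  proof -
    have 1: "degree (pderiv p * v) \<le> t + degree v"
      using degree_mult_le[of "pderiv p" v] p(2) by (simp add: degree_pderiv)
    have "degree (p * of_nat m) \<le> t"
      using degree_mult_le[of p "of_nat m"] p(2) by simp
    then have 2: "degree (p * of_nat m * pderiv v) \<le> t + degree v"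
      using degree_mult_le[of "p * of_nat m" "pderiv v"] by (simp add: degree_pderiv)
    show ?thesis using degree_mult_le[of A] degree_diff_le[OF 1 2] by (metis add.assoc add.commute add_left_mono order.trans)
  qed
  ultimately show ?thesis unfolding pole_bound_def by blast
qed

lemma pole_bound_dop:
  assumes P: "\<And>i. pole_bound v m t (coeff P i)"
    and s: "degree A + degree v \<le> s" "degree B + degree v \<le> s" "degree C + degree v \<le> s"
  shows "pole_bound v (Suc m) (t + s) (coeff (dop (fder A) (fop B) (fop C) P) i)"
proof -
  have 1: "pole_bound v (Suc m) (t + s) (fder A (coeff P i))"
    by (rule pole_bound_mono[OF pole_bound_fder[OF P]]) (use s in auto)
  have b: "pole_bound v (0 + (0 + m)) (0 + (degree q + t)) (of_int z * (fop q * coeff P j))" for z q j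
    by (intro pole_bound_mult pole_bound_of_int pole_bound_fop P order.refl)
  have 2: "pole_bound v (Suc m) (t + s) (of_int z * (fop q * coeff P j))" if "degree q + degree v \<le> s" for z q j
    by (rule pole_bound_mono[OF b]) (use that in auto)
  have "pole_bound v (Suc m) (t + s) (fder A (coeff P i) + of_int (int i) * (fop B * coeff P i)
      + of_int (int (Suc i)) * (fop C * coeff P (Suc i)))"
    by (intro pole_bound_add 1 2 s)
  then show ?thesis by (simp add: coeff_dop[OF derivation_fder] mult.assoc)
qed

lemma pole_bound_dop_pow:
  assumes P: "\<And>i. pole_bound v m t (coeff P i)"
    and s: "degree A + degree v \<le> s" "degree B + degree v \<le> s" "degree C + degree v \<le> s"
  shows "pole_bound v (m + k) (t + k * s) (coeff ((dop (fder A) (fop B) (fop C) ^^ k) P) i)"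
proof (induction k arbitrary: i)
  case (Suc k)
  show ?case using pole_bound_dop[OF Suc s] by (simp add: algebra_simps)
qed (use P in simp)

lemma map_poly_fop_pCons: "map_poly fop (pCons a Q) = pCons (fop a) (map_poly fop Q)"
  by (intro poly_eqI) (simp add: coeff_map_poly coeff_pCons fop_simps split: nat.split)

lemma pole_bound_shift:
  assumes w: "w * fop v = fop u" and s: "degree u + degree v \<le> s"
  shows "(\<And>i. degree (coeff Q i) \<le> n) \<Longrightarrow>
    pole_bound v (degree Q) (n + degree Q * s) (coeff (map_poly fop Q \<circ>\<^sub>p [:w, 1:]) i)"
proof (induction Q arbitrary: i)
  case 0
  then show ?case by (simp add: pole_bound_0)
next
  case (pCons a Q)
  have a: "degree a \<le> n" using pCons.prems[of 0] by simp
  have Q: "degree (coeff Q i) \<le> n" for i using pCons.prems[of "Suc i"] by simp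
  show ?case
  proof (cases "Q = 0")
    case True
    have "pole_bound v 0 n (coeff [:fop a:] i)" using a pole_bound_fop[of a n v] pole_bound_0 by (cases i) auto
    then show ?thesis using True by (simp add: map_poly_fop_pCons)
  next
    case False
    let ?R = "map_poly fop Q \<circ>\<^sub>p [:w, 1:]" and ?q = "degree Q"
    have IH: "pole_bound v ?q (n + ?q * s) (coeff ?R i)" for i using pCons.IH[OF Q] .
    have up: "pole_bound v (Suc ?q) (n + Suc ?q * s) x" if "pole_bound v ?q (n + ?q * s) x" for x
      by (rule pole_bound_mono[OF that]) (use s in auto)
    have pw: "pole_bound v 1 (degree u) w" unfolding pole_bound_def using w by auto
    have "pole_bound v (1 + ?q) (degree u + (n + ?q * s)) (w * coeff ?R i)" by (rule pole_bound_mult[OF pw IH])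
    then have wR: "pole_bound v (Suc ?q) (n + Suc ?q * s) (w * coeff ?R i)"
      by (rule pole_bound_mono) (use s in auto)
    have fa: "pole_bound v (Suc ?q) (n + Suc ?q * s) (fop a)"
    proof (rule pole_bound_mono[OF pole_bound_fop[OF a]])
      have "Suc ?q * degree v \<le> Suc ?q * s" by (rule mult_le_mono2) (use s in auto)
      then show "n + (Suc ?q - 0) * degree v \<le> n + Suc ?q * s" by simp
    qed simp
    have "coeff (map_poly fop (pCons a Q) \<circ>\<^sub>p [:w, 1:]) i =
        coeff [:fop a:] i + (w * coeff ?R i + (case i of 0 \<Rightarrow> 0 | Suc j \<Rightarrow> coeff ?R j))"
      by (simp add: map_poly_fop_pCons pcompose_pCons coeff_pCons split: nat.split)
    moreover have "pole_bound v (Suc ?q) (n + Suc ?q * s) (coeff [:fop a:] i)" using fa pole_bound_0 by (cases i) auto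
    moreover have "pole_bound v (Suc ?q) (n + Suc ?q * s) (case i of 0 \<Rightarrow> 0 | Suc j \<Rightarrow> coeff ?R j)"
      using up[OF IH] pole_bound_0 by (cases i) auto
    ultimately show ?thesis using wR False by (auto intro!: pole_bound_add simp del: mult_Suc)
  qed
qed

lemma subdegree_fop:
  assumes "p \<noteq> 0" shows "0 \<le> fls_subdegree (fop p)" "fls_subdegree (fop p) \<le> int (degree p)"
proof -
  show "0 \<le> fls_subdegree (fop p)" unfolding fop_def by (rule fls_subdegree_fls_to_fps_gt0)
  have "subdegree (fps_of_poly p) \<le> degree p" using assms by (intro subdegree_leI) simp
  then show "fls_subdegree (fop p) \<le> int (degree p)"
    by (simp add: fop_def fls_subdegree_fls_to_fps)
qed

lemma pole_bound_subdegree: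
  assumes "pole_bound v m t x" "x \<noteq> 0" "v \<noteq> 0"
  shows "fls_subdegree x \<le> int t" "- int (m * degree v) \<le> fls_subdegree x"
proof -
  obtain p where p: "x * fop v ^ m = fop p" "degree p \<le> t" using assms(1) unfolding pole_bound_def by blast
  have nz: "fop v \<noteq> 0" using assms(3) by (simp add: fop_eq_0_iff)
  then have "fop p \<noteq> 0" using p(1) assms(2) by (metis mult_eq_0_iff power_not_zero)
  then have p0: "p \<noteq> 0" by (simp add: fop_eq_0_iff)
  have "fls_subdegree x + int m * fls_subdegree (fop v) = fls_subdegree (fop p)"
    using assms(2) nz unfolding p(1)[symmetric] by (simp add: fls_subdegree_pow)
  moreover have "0 \<le> int m * fls_subdegree (fop v)" using subdegree_fop[OF assms(3)] by simp
  moreover have "int m * fls_subdegree (fop v) \<le> int m * int (degree v)"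
    using subdegree_fop[OF assms(3)] by (intro mult_left_mono) auto
  ultimately show "fls_subdegree x \<le> int t" "- int (m * degree v) \<le> fls_subdegree x"
    using subdegree_fop[OF p0] p(2) by auto
qed

text \<open>The order at \<open>0\<close> is at least \<open>K\<close>; in this form the condition includes the zero series.\<close>

definition order_ge :: "int \<Rightarrow> complex fls \<Rightarrow> bool" where
  "order_ge K x \<longleftrightarrow> (\<forall>i<K. fls_nth x i = 0)"

lemma order_ge_mono: "order_ge K x \<Longrightarrow> L \<le> K \<Longrightarrow> order_ge L x"
  unfolding order_ge_def by auto

lemma order_ge_subdegree: "x \<noteq> 0 \<Longrightarrow> order_ge K x \<longleftrightarrow> K \<le> fls_subdegree x"
  unfolding order_ge_def by (meson fls_eq0_below_subdegree fls_subdegree_geI less_le_trans)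

lemma order_ge_sum: "(\<And>i. i \<in> I \<Longrightarrow> order_ge K (g i)) \<Longrightarrow> order_ge K (sum g I)"
  unfolding order_ge_def by (induction I rule: infinite_finite_induct) auto

lemma order_ge_mult:
  assumes "order_ge K x" "order_ge L y" shows "order_ge (K + L) (x * y)"
proof (cases "x = 0 \<or> y = 0")
  case True
  then show ?thesis by (auto simp: order_ge_def)
next
  case False
  then have "K \<le> fls_subdegree x" "L \<le> fls_subdegree y" using assms order_ge_subdegree by blast+
  then show ?thesis using False by (subst order_ge_subdegree) auto
qed

lemma order_ge_fop: "order_ge 0 (fop p)"
  by (cases "p = 0") (simp_all add: order_ge_def fop_simps fop_def)

lemma order_ge_fder: "order_ge K x \<Longrightarrow> order_ge (K - 1) (fder A x)"
proof -
  assume "order_ge K x"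
  then have "order_ge (K - 1) (fls_deriv x)" unfolding order_ge_def by simp
  from order_ge_mult[OF order_ge_fop this] show ?thesis by simp
qed

lemma order_ge_fder_pow: "order_ge K x \<Longrightarrow> order_ge (K - int k) ((fder A ^^ k) x)"
proof (induction k)
  case (Suc k)
  from order_ge_fder[OF Suc.IH[OF Suc.prems], of A] show ?case by (simp add: algebra_simps)
qed simp

lemma coeff_pcompose_sum:
  fixes p q :: "'a::idom poly"
  assumes "degree p < n"
  shows "coeff (p \<circ>\<^sub>p q) j = (\<Sum>i<n. coeff p i * coeff (q ^ i) j)"
proof -
  have "p \<circ>\<^sub>p q = (\<Sum>i\<le>degree p. smult (coeff p i) (q ^ i))"
    unfolding pcompose_altdef poly_altdef by (simp add: coeff_map_poly degree_map_poly)
  also have "\<dots> = (\<Sum>i<n. smult (coeff p i) (q ^ i))"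
    using assms by (intro sum.mono_neutral_left) (auto simp: coeff_eq_0)
  finally show ?thesis by (simp add: coeff_sum)
qed

definition pder :: "complex poly \<Rightarrow> complex poly \<Rightarrow> complex poly" where
  "pder A p = A * pderiv p"

lemma derivation_pder: "derivation (pder A)"
  unfolding derivation_def pder_def by (auto simp: pderiv_add pderiv_mult algebra_simps)

lemma fop_pder: "fop (pder A p) = fder A (fop p)"
  by (simp add: pder_def fop_simps fop_deriv)

lemma map_poly_fop_dop_pow:
  "map_poly fop ((dop (pder A) B C ^^ k) Q) = (dop (fder A) (fop B) (fop C) ^^ k) (map_poly fop Q)"
  using map_poly_dop_pow[where h = fop and \<delta> = "pder A" and \<delta>' = "fder A" and B = B and C = C and k = k and P = Q]
    comm_ring_hom_fop derivation_pder derivation_fder fop_pder by blast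

lemma ode_fls:
  assumes "fps_of_poly A * fps_deriv f = fps_of_poly B * f + fps_of_poly C"
  shows "fder A (fps_to_fls f) = fop B * fps_to_fls f + fop C"
  using arg_cong[OF assms, of fps_to_fls]
  by (simp add: fop_def fls_times_fps_to_fls fls_deriv_fps_to_fls)

text \<open>The derivatives of \<open>Q\<close> are expanded in powers of \<open>y - w\<close> for a rational solution \<open>w\<close> of the equation, or
  in powers of \<open>y\<close> if there is none (then \<open>w = 0\<close>). Let \<open>r\<close> be the number of exponents that occur. By
  \<open>derivatives_independent\<close> the first \<open>r\<close> derivatives are independent, and their determinant has degree
  about \<open>r * n\<close>. By Cramer's rule it inherits the order of vanishing of \<open>Q(f)\<close>, up to a constant. For
  \<open>r \<le> N\<close> this is impossible when \<open>Q(f)\<close> vanishes to an order greater than \<open>N * n + c0\<close>. So \<open>r = N + 1\<close>,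
  and the change of basis is triangular.\<close>

lemma zero_estimate:
  fixes A B C :: "complex poly" and f :: "complex fps" and N :: nat
  assumes A: "A \<noteq> 0" and ode: "fps_of_poly A * fps_deriv f = fps_of_poly B * f + fps_of_poly C"
    and tr: "transcendental_fps f"
  shows "\<exists>c0::nat. \<forall>Q n K. Q \<noteq> 0 \<longrightarrow> degree Q \<le> N \<longrightarrow> (\<forall>i. degree (coeff Q i) \<le> n) \<longrightarrow>
    (\<forall>i<K. fps_nth (poly (map_poly fps_of_poly Q) f) i = 0) \<longrightarrow> N * n + c0 < K \<longrightarrow>
    dt (Suc N) (\<lambda>k i. coeff ((dop (pder A) B C ^^ k) Q) i) \<noteq> 0"
proof -
  define F where "F = fps_to_fls f"
  have FF: "fder A F = fop B * F + fop C" unfolding F_def by (rule ode_fls[OF ode])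
  obtain w Cp where w: "w \<in> rat_functions" "fop Cp = fop C + fop B * w - fder A w" "degree Cp \<le> degree C"
    "Cp = 0 \<or> (\<forall>x\<in>rat_functions. fder A x \<noteq> fop B * x + fop Cp)"
  proof (cases "\<exists>w\<in>rat_functions. fder A w = fop B * w + fop C")
    case True
    then obtain w where "w \<in> rat_functions" "fder A w = fop B * w + fop C" by blast
    then show ?thesis using that[of w 0] by (simp add: fop_simps)
  next
    case False
    have "0 \<in> rat_functions" using Rat_fop[of 0] by (simp add: fop_simps)
    then show ?thesis using that[of 0 C] False by auto
  qed
  obtain u v where uv: "w = fop u / fop v" "v \<noteq> 0" using w(1) unfolding rat_functions_def by blast
  have wv: "w * fop v = fop u" using uv by (simp add: fop_eq_0_iff)
  define H where "H = F - w"
  have HH: "fder A H = fop B * H + fop Cp"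
    using FF w(2) by (simp add: H_def algebra_simps)
  have trH: "poly P H \<noteq> 0" if P: "P \<noteq> 0" "\<And>i. coeff P i \<in> rat_functions" for P
  proof -
    define R where "R = P \<circ>\<^sub>p [:- w, 1:]"
    have lin: "coeff [:- w, 1:] i \<in> rat_functions" for i
      using Rat_uminus[OF w(1)] Rat_fop[of 0] Rat_fop[of 1]
      by (auto simp: coeff_pCons fop_simps split: nat.split)
    have sumR: "(\<And>i. i \<in> I \<Longrightarrow> g i \<in> rat_functions) \<Longrightarrow> sum g I \<in> rat_functions" for g and I :: "nat set"
      using Rat_fop[of 0] by (induction I rule: infinite_finite_induct) (auto simp: fop_simps Rat_closed(1))
    have pow: "coeff ([:- w, 1:] ^ n) i \<in> rat_functions" for n i
    proof (induction n arbitrary: i)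
      case 0
      then show ?case using Rat_fop[of 0] Rat_fop[of 1] by (auto simp: fop_simps)
    next
      case (Suc n)
      then show ?case unfolding power_Suc coeff_mult by (intro sumR Rat_closed(2) lin) auto
    qed
    have "coeff R i \<in> rat_functions" for i
      unfolding R_def coeff_pcompose_sum[OF lessI] by (intro sumR Rat_closed(2) P pow)
    moreover have "R \<noteq> 0" unfolding R_def using P(1) by (simp add: pcompose_eq_0_iff)
    ultimately have "poly R F \<noteq> 0" unfolding F_def by (intro transcendental_fps_Rat[OF tr])
    then show ?thesis by (simp add: R_def poly_pcompose H_def)
  qed
  have H0: "H \<noteq> 0" using trH[of "[:0,1:]"] Rat_fop[of 0] Rat_fop[of 1]
    by (auto simp: coeff_pCons fop_simps split: nat.splits)
  define s where "s = degree A + degree B + degree C + degree u + degree v"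
  define m0 where "m0 = 2 * N"
  define c0 where "c0 = N + Suc N * m0 * degree v + Suc N * (m0 * s) + N * nat \<bar>fls_subdegree H\<bar>"
  have main: "dt (Suc N) (\<lambda>k i. coeff ((dop (pder A) B C ^^ k) Q) i) \<noteq> 0"
    if Q: "Q \<noteq> 0" "degree Q \<le> N" "\<And>i. degree (coeff Q i) \<le> n"
      and K: "\<forall>i<K. fps_nth (poly (map_poly fps_of_poly Q) f) i = 0" "N * n + c0 < K" for Q n K
  proof -
    define P where "P = map_poly fop Q \<circ>\<^sub>p [:w, 1:]"
    let ?D = "dop (fder A) (fop B) (fop Cp)"
    have degP: "degree P \<le> N"
    proof -
      have "degree (map_poly fop Q) \<le> degree Q" by (rule degree_map_poly_le)
      moreover have "degree [:w, 1:] = 1" by simp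
      ultimately show ?thesis unfolding P_def degree_pcompose using Q(2) by simp
    qed
    have Q0: "map_poly fop Q \<noteq> 0"
    proof
      assume "map_poly fop Q = 0"
      then have "fop (coeff Q i) = 0" for i by (metis coeff_0 coeff_map_poly fop_simps(1))
      then show False using Q(1) by (auto simp: fop_eq_0_iff poly_eq_iff)
    qed
    have P0: "P \<noteq> 0" unfolding P_def using Q0 by (simp add: pcompose_eq_0_iff)
    have pvP: "pole_bound v (degree Q) (n + degree Q * s) (coeff P i)" for i
      unfolding P_def by (rule pole_bound_shift[OF wv]) (use Q(3) in \<open>auto simp: s_def\<close>)
    have pvP': "pole_bound v N (n + N * s) (coeff P i)" for i
    proof (rule pole_bound_mono[OF pvP Q(2)])
      have "(N - degree Q) * degree v \<le> (N - degree Q) * s" by (rule mult_le_mono2) (simp add: s_def)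
      then have "degree Q * s + (N - degree Q) * degree v \<le> (degree Q + (N - degree Q)) * s"
        by (simp only: add_mult_distrib add_left_mono)
      then show "n + degree Q * s + (N - degree Q) * degree v \<le> n + N * s" using Q(2) by simp
    qed
    have RatP: "coeff P i \<in> rat_functions" for i
    proof -
      obtain p where "coeff P i * fop v ^ N = fop p" using pvP'[of i] unfolding pole_bound_def by blast
      then have "coeff P i = fop p / fop (v ^ N)" using uv(2) by (simp add: fop_power fop_eq_0_iff field_simps)
      moreover have "v ^ N \<noteq> 0" using uv(2) by simp
      ultimately show ?thesis unfolding rat_functions_def by blast
    qed
    have cases: "fop Cp = 0 \<or> (\<forall>x\<in>rat_functions. fder A x \<noteq> fop B * x + fop Cp)"
      using w(4) by (auto simp: fop_simps)
    obtain S where S: "S \<subseteq> {..N}" "S \<noteq> {}"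
      "\<And>k i. coeff ((?D ^^ k) P) i \<noteq> 0 \<Longrightarrow> i \<in> S"
      "\<And>v i. (\<And>k. k < card S \<Longrightarrow> (\<Sum>i\<le>N. coeff ((?D ^^ k) P) i * v i) = 0) \<Longrightarrow> i \<in> S \<Longrightarrow> v i = 0"
      using derivatives_independent[OF A HH trH Rat_fop Rat_fop cases RatP P0 degP] by blast
    define r where "r = card S"
    have finS: "finite S" using S(1) finite_subset by auto
    have r: "0 < r" "r \<le> Suc N"
      using S(1,2) finS card_mono[OF _ S(1)] by (auto simp: r_def card_gt_0_iff)
    obtain e where e: "bij_betw e {..<r} S"
      using ex_bij_betw_nat_finite[OF finS] by (auto simp: r_def lessThan_atLeast0)
    have eS: "e j \<in> S" if "j < r" for j using e that by (auto simp: bij_betw_def)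
    define M where "M = (\<lambda>k j. coeff ((?D ^^ k) P) (e j))"
    have det: "dt r M \<noteq> 0"
    proof
      assume "dt r M = 0"
      then obtain x where x: "\<exists>i<r. x i \<noteq> 0" "\<forall>k<r. (\<Sum>j<r. M k j * x j) = 0"
        using dt_eq_0_imp_kernel by blast
      define y where "y = (\<lambda>i. if i \<in> S then x (the_inv_into {..<r} e i) else 0)"
      have ye: "y (e j) = x j" if "j < r" for j
        using that eS e by (simp add: y_def bij_betw_def the_inv_into_f_f)
      have "(\<Sum>i\<le>N. coeff ((?D ^^ k) P) i * y i) = 0" if "k < card S" for k
      proof -
        have "(\<Sum>i\<le>N. coeff ((?D ^^ k) P) i * y i) = (\<Sum>i\<in>S. coeff ((?D ^^ k) P) i * y i)"
          using S(1) by (intro sum.mono_neutral_right) (auto simp: y_def)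
        also have "\<dots> = (\<Sum>j<r. coeff ((?D ^^ k) P) (e j) * y (e j))"
          by (rule sum.reindex_bij_betw[OF e, symmetric])
        also have "\<dots> = (\<Sum>j<r. M k j * x j)" by (intro sum.cong) (auto simp: M_def ye)
        finally show ?thesis using x(2) that by (simp add: r_def)
      qed
      then have "y i = 0" if "i \<in> S" for i using S(4) that by blast
      then show False using x(1) ye eS by metis
    qed
    have pvM: "pole_bound v m0 (n + m0 * s) (M k j)" if "k \<le> N" for k j
    proof -
      have "pole_bound v (N + k) (n + N * s + k * s) (M k j)"
        unfolding M_def by (rule pole_bound_dop_pow[OF pvP']) (use w(3) in \<open>auto simp: s_def\<close>)
      then show ?thesis
      proof (rule pole_bound_mono)
        have "(N - k) * degree v \<le> (N - k) * s" by (rule mult_le_mono2) (simp add: s_def)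
        then have "k * s + (N - k) * degree v \<le> (k + (N - k)) * s" by (simp only: add_mult_distrib add_left_mono)
        then show "n + N * s + k * s + (m0 - (N + k)) * degree v \<le> n + m0 * s"
          using that by (simp add: m0_def algebra_simps)
      qed (use that in \<open>simp add: m0_def\<close>)
    qed
    have vm: "m0 * degree v \<le> n + m0 * s"
    proof -
      have "m0 * degree v \<le> m0 * s" by (rule mult_le_mono2) (simp add: s_def)
      then show ?thesis by (rule trans_le_add2)
    qed
    have ord: "order_ge (int K) (poly P H)"
    proof -
      have "poly P H = poly (map_poly fop Q) F" by (simp add: P_def poly_pcompose H_def)
      then have "poly P H = fps_to_fls (poly (map_poly fps_of_poly Q) f)" by (simp add: F_def poly_fop)
      then show ?thesis using K(1) unfolding order_ge_def by simp
    qed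
    have rows: "(\<Sum>j<r. M k j * H ^ e j) = (fder A ^^ k) (poly P H)" for k
    proof -
      have "(fder A ^^ k) (poly P H) = poly ((?D ^^ k) P) H"
        by (rule poly_dop_pow[OF derivation_fder HH, symmetric])
      also have "\<dots> = (\<Sum>i\<le>degree ((?D ^^ k) P). coeff ((?D ^^ k) P) i * H ^ i)" by (rule poly_altdef)
      also have "\<dots> = (\<Sum>i\<in>S. coeff ((?D ^^ k) P) i * H ^ i)"
      proof (rule sum.mono_neutral_cong)
        show "coeff ((?D ^^ k) P) i * H ^ i = 0" if "i \<in> {..degree ((?D ^^ k) P)} - S" for i using S(3)[of k i] that by auto
        show "coeff ((?D ^^ k) P) i * H ^ i = 0" if "i \<in> S - {..degree ((?D ^^ k) P)}" for i
          using that by (simp add: coeff_eq_0)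
      qed (use finS in auto)
      also have "\<dots> = (\<Sum>j<r. M k j * H ^ e j)"
        unfolding M_def by (rule sum.reindex_bij_betw[OF e, symmetric])
      finally show ?thesis ..
    qed
    have cramer: "dt r M * H ^ e 0 = (\<Sum>k<r. cof r M k 0 * (fder A ^^ k) (poly P H))"
      using dt_cramer[of 0 r M "\<lambda>j. H ^ e j"] r(1) by (simp add: rows)
    have pvdt: "pole_bound v (r * m0) (r * (n + m0 * s)) (dt r M)"
      by (rule pole_bound_dt) (use r pvM in auto)
    have "order_ge (int K - int N - int (r * m0 * degree v)) (dt r M * H ^ e 0)"
      unfolding cramer
    proof (rule order_ge_sum)
      fix k assume k: "k \<in> {..<r}"
      have pvc: "pole_bound v (r * m0) (r * (n + m0 * s)) (cof r M k 0)"
        by (rule pole_bound_cof[OF _ vm]) (use r pvM in auto)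
      have 1: "order_ge (- int (r * m0 * degree v)) (cof r M k 0)"
        using pole_bound_subdegree(2)[OF pvc _ uv(2)] order_ge_subdegree by (cases "cof r M k 0 = 0") (auto simp: order_ge_def)
      have 2: "order_ge (int K - int N) ((fder A ^^ k) (poly P H))"
        by (rule order_ge_mono[OF order_ge_fder_pow[OF ord]]) (use k r in auto)
      show "order_ge (int K - int N - int (r * m0 * degree v)) (cof r M k 0 * (fder A ^^ k) (poly P H))"
        by (rule order_ge_mono[OF order_ge_mult[OF 1 2]]) simp
    qed
    moreover have nz: "dt r M * H ^ e 0 \<noteq> 0" using det H0 by simp
    ultimately have "int K - int N - int (r * m0 * degree v) \<le> fls_subdegree (dt r M * H ^ e 0)"
      using order_ge_subdegree by blast
    also have "\<dots> = fls_subdegree (dt r M) + int (e 0) * fls_subdegree H"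
      using det H0 by (simp add: fls_subdegree_pow)
    also have "\<dots> \<le> int (r * (n + m0 * s)) + int N * \<bar>fls_subdegree H\<bar>"
    proof (rule add_mono)
      show "fls_subdegree (dt r M) \<le> int (r * (n + m0 * s))" by (rule pole_bound_subdegree(1)[OF pvdt det uv(2)])
      have "e 0 \<le> N" using eS[OF r(1)] S(1) by auto
      have "int (e 0) * fls_subdegree H \<le> int (e 0) * \<bar>fls_subdegree H\<bar>" by (intro mult_left_mono) auto
      also have "\<dots> \<le> int N * \<bar>fls_subdegree H\<bar>" using \<open>e 0 \<le> N\<close> by (intro mult_right_mono) auto
      finally show "int (e 0) * fls_subdegree H \<le> int N * \<bar>fls_subdegree H\<bar>" .
    qed
    finally have "int K \<le> int (N + r * m0 * degree v + r * (n + m0 * s) + N * nat \<bar>fls_subdegree H\<bar>)"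
      by simp
    then have Kle: "K \<le> N + r * m0 * degree v + r * (n + m0 * s) + N * nat \<bar>fls_subdegree H\<bar>" by linarith
    \<comment> \<open>For \<open>r \<le> N\<close> the last inequality would bound \<open>K\<close> by \<open>N * n + c0\<close>.\<close>
    have "r = Suc N"
    proof (rule ccontr)
      assume "r \<noteq> Suc N"
      then have "r \<le> N" using r by simp
      then have "r * n \<le> N * n" "r * m0 * degree v \<le> Suc N * m0 * degree v" "r * (m0 * s) \<le> Suc N * (m0 * s)"
        using r(2) by (simp_all only: mult_le_mono1 mult_le_mono order.refl)
      then have "K \<le> N * n + c0" using Kle unfolding c0_def by (simp only: distrib_left)
      then show False using K(2) by simp
    qed
    have degD: "degree ((dop (fder A) (fop B) (fop C) ^^ k) (map_poly fop Q)) < Suc N" for k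
      using degree_dop_pow_le[OF derivation_fder[of A], of k "fop B" "fop C" "map_poly fop Q"]
        degree_map_poly_le[of fop Q] Q(2) by simp
    have "dt (Suc N) M = dt (Suc N) (\<lambda>k j. \<Sum>i<Suc N. fop (coeff ((dop (pder A) B C ^^ k) Q) i) * coeff ([:w, 1:] ^ i) (e j))"
    proof (rule dt_cong)
      fix k j
      have "(?D ^^ k) P = (dop (fder A) (fop B) (fop C) ^^ k) (map_poly fop Q) \<circ>\<^sub>p [:w, 1:]"
        unfolding P_def w(2) by (rule dop_shift_pow[OF derivation_fder, symmetric])
      then have "M k j = (\<Sum>i<Suc N. coeff ((dop (fder A) (fop B) (fop C) ^^ k) (map_poly fop Q)) i * coeff ([:w, 1:] ^ i) (e j))"
        unfolding M_def by (simp only: coeff_pcompose_sum[OF degD])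
      then show "M k j = (\<Sum>i<Suc N. fop (coeff ((dop (pder A) B C ^^ k) Q) i) * coeff ([:w, 1:] ^ i) (e j))"
        unfolding map_poly_fop_dop_pow[symmetric] by (simp add: coeff_map_poly fop_simps)
    qed
    then have "dt (Suc N) M = dt (Suc N) (\<lambda>k i. fop (coeff ((dop (pder A) B C ^^ k) Q) i)) *
        dt (Suc N) (\<lambda>i j. coeff ([:w, 1:] ^ i) (e j))" by (simp only: dt_mult)
    then have "dt (Suc N) (\<lambda>k i. fop (coeff ((dop (pder A) B C ^^ k) Q) i)) \<noteq> 0"
      using det \<open>r = Suc N\<close> by auto
    then have "fop (dt (Suc N) (\<lambda>k i. coeff ((dop (pder A) B C ^^ k) Q) i)) \<noteq> 0"
      by (simp only: dt_hom[OF comm_ring_hom_fop] not_False_eq_True)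
    then show ?thesis by (rule contrapos_nn) (simp only: fop_simps)
  qed
  then show ?thesis by blast
qed

section \<open>Specialisation of the derivatives at a point\<close>

interpretation cpoly_vs: vector_space "smult :: complex \<Rightarrow> complex poly \<Rightarrow> complex poly"
  by unfold_locales (simp_all add: smult_add_right smult_add_left)

text \<open>Specialisation at \<open>x = \<alpha>\<close> of a polynomial in the unknown function whose coefficients are polynomials
  in \<open>x\<close>.\<close>

definition eval_coeffs :: "complex \<Rightarrow> complex poly poly \<Rightarrow> complex poly" where
  "eval_coeffs \<alpha> P = map_poly (\<lambda>p. poly p \<alpha>) P"

lemma coeff_eval_coeffs: "coeff (eval_coeffs \<alpha> P) i = poly (coeff P i) \<alpha>"
  by (simp add: eval_coeffs_def coeff_map_poly)

lemma eval_coeffs_add: "eval_coeffs \<alpha> (P + Q) = eval_coeffs \<alpha> P + eval_coeffs \<alpha> Q"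
  by (intro poly_eqI) (simp add: coeff_eval_coeffs)

lemma eval_coeffs_smult: "eval_coeffs \<alpha> (smult a P) = smult (poly a \<alpha>) (eval_coeffs \<alpha> P)"
  by (intro poly_eqI) (simp add: coeff_eval_coeffs)

lemma degree_eval_coeffs_le: "degree (eval_coeffs \<alpha> P) \<le> degree P"
  by (rule degree_le) (simp add: coeff_eval_coeffs coeff_eq_0)

lemma dop_pow_sum:
  fixes P :: "'i \<Rightarrow> 'a::idom poly"
  assumes "derivation \<delta>"
  shows "(dop \<delta> B C ^^ k) (sum P I) = (\<Sum>i\<in>I. (dop \<delta> B C ^^ k) (P i))"
proof (induction I rule: infinite_finite_induct)
  case (insert i I)
  then show ?case by (simp add: dop_pow_add[OF assms])
next
  case empty
  have "(dop \<delta> B C ^^ k) 0 = 0" by (induction k) (simp_all add: dop_def)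
  then show ?case by simp
next
  case (infinite I)
  have "(dop \<delta> B C ^^ k) 0 = 0" by (induction k) (simp_all add: dop_def)
  then show ?case using infinite by simp
qed

text \<open>A factor that vanishes at \<open>\<alpha>\<close> to order \<open>m\<close> has to be hit by each of the \<open>m\<close> differentiations: all
  other terms of the product rule vanish at \<open>\<alpha>\<close>.\<close>

lemma eval_coeffs_dop_pow_vanishing_factor:
  "eval_coeffs \<alpha> ((dop (pder A) B C ^^ m) (smult ([:- \<alpha>, 1:] ^ m * b) P)) =
    smult (poly A \<alpha> ^ m * fact m * poly b \<alpha>) (eval_coeffs \<alpha> P)"
proof (induction m arbitrary: b P)
  case 0
  then show ?case by (simp add: eval_coeffs_smult)
next
  case (Suc m)
  let ?X = "[:- \<alpha>, 1:] :: complex poly"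
  have "pderiv (?X ^ Suc m) = of_nat (Suc m) * ?X ^ m"
    unfolding pderiv_power_Suc by (simp add: pderiv_pCons of_nat_poly del: of_nat_Suc)
  then have "pder A (?X ^ Suc m * b) = ?X ^ m * (A * (of_nat (Suc m) * b + ?X * pderiv b))"
    unfolding pder_def pderiv_mult by (simp only: power_Suc distrib_left mult_ac add_ac)
  moreover have "?X ^ Suc m * b = ?X ^ m * (?X * b)" by (simp only: power_Suc2 mult.assoc)
  moreover have "poly (?X * b) \<alpha> = 0" by simp
  moreover have "poly (A * (of_nat (Suc m) * b + ?X * pderiv b)) \<alpha> = of_nat (Suc m) * poly A \<alpha> * poly b \<alpha>"
    by (simp del: of_nat_Suc mult_pCons_left mult_pCons_right)
  ultimately show ?case
    unfolding dop_pow_smult_Suc[OF derivation_pder] eval_coeffs_add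
    by (simp only: Suc.IH mult_zero_right smult_0_left add_0_left) (simp add: mult_ac)
qed

lemma eval_coeffs_dop_pow_span:
  "eval_coeffs \<alpha> ((dop (pder A) B C ^^ m) (smult a ((dop (pder A) B C ^^ k) Q))) \<in>
    cpoly_vs.span {eval_coeffs \<alpha> ((dop (pder A) B C ^^ j) Q) | j. j \<le> m + k}"
proof (induction m arbitrary: a k)
  case 0
  show ?case unfolding funpow_0 eval_coeffs_smult by (rule cpoly_vs.span_scale, rule cpoly_vs.span_base) auto
next
  case (Suc m)
  let ?D = "dop (pder A) B C"
  have "?D ((?D ^^ k) Q) = (?D ^^ Suc k) Q" by simp
  moreover have "eval_coeffs \<alpha> ((?D ^^ m) (smult (pder A a) ((?D ^^ k) Q))) \<in>
      cpoly_vs.span {eval_coeffs \<alpha> ((?D ^^ j) Q) | j. j \<le> Suc m + k}"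
    by (rule subsetD[OF cpoly_vs.span_mono Suc.IH]) auto
  moreover have "eval_coeffs \<alpha> ((?D ^^ m) (smult a ((?D ^^ Suc k) Q))) \<in>
      cpoly_vs.span {eval_coeffs \<alpha> ((?D ^^ j) Q) | j. j \<le> Suc m + k}"
    using Suc.IH[of a "Suc k"] by simp
  ultimately show ?case unfolding dop_pow_smult_Suc[OF derivation_pder] eval_coeffs_add
    by (simp add: cpoly_vs.span_add)
qed

lemma degree_coeff_dop_pow:
  assumes "\<And>i. degree (coeff Q i) \<le> n"
  shows "degree (coeff ((dop (pder A) B C ^^ k) Q) i) \<le> n + k * (degree A + degree B + degree C)"
proof (induction k arbitrary: i)
  case (Suc k)
  let ?s = "degree A + degree B + degree C" and ?Q = "(dop (pder A) B C ^^ k) Q"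
  have 1: "degree (pder A (coeff ?Q i)) \<le> n + k * ?s + ?s"
  proof -
    have "degree (pder A (coeff ?Q i)) \<le> degree A + degree (coeff ?Q i)"
      using degree_mult_le[of A "pderiv (coeff ?Q i)"] unfolding pder_def by (simp add: degree_pderiv)
    then show ?thesis using Suc[of i] by linarith
  qed
  have 2: "degree (of_nat i * B * coeff ?Q i) \<le> n + k * ?s + ?s"
    using degree_mult_le[of "of_nat i * B" "coeff ?Q i"] degree_mult_le[of "of_nat i" B] Suc[of i] by simp
  have 3: "degree (of_nat (Suc i) * C * coeff ?Q (Suc i)) \<le> n + k * ?s + ?s"
    using degree_mult_le[of "of_nat (Suc i) * C" "coeff ?Q (Suc i)"] degree_mult_le[of "of_nat (Suc i)" C] Suc[of "Suc i"]
    by (simp del: of_nat_Suc)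
  have "degree (coeff ((dop (pder A) B C ^^ Suc k) Q) i) \<le> n + k * ?s + ?s"
    unfolding funpow.simps o_apply coeff_dop[OF derivation_pder] by (intro degree_add_le 1 2 3)
  then show ?case by (simp add: algebra_simps)
qed (use assms in simp)

lemma order_at_two_points:
  fixes p :: "complex poly"
  assumes "p \<noteq> 0" "\<alpha> \<noteq> 0" "\<And>i. i < K \<Longrightarrow> coeff p i = 0"
  shows "order \<alpha> p + K \<le> degree p"
proof -
  have "monom 1 K dvd p" using assms(3) by (simp add: monom_1_dvd_iff')
  then obtain q where q: "p = monom 1 K * q" by (rule dvdE)
  have nz: "q \<noteq> 0" using q assms(1) by auto
  have "order \<alpha> p = order \<alpha> (monom 1 K :: complex poly) + order \<alpha> q"
    unfolding q by (rule order_mult) (use assms(1) q in simp)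
  also have "order \<alpha> (monom 1 K :: complex poly) = 0"
    using assms(2) by (intro order_0I) (simp add: poly_monom)
  finally have "order \<alpha> p \<le> degree q" using order_degree[OF nz, of \<alpha>] by simp
  moreover have "degree p = K + degree q" unfolding q using nz by (simp add: degree_mult_eq degree_monom_eq monom_eq_0_iff)
  ultimately show ?thesis by simp
qed

text \<open>The determinant \<open>\<Delta>\<close> of the first \<open>N + 1\<close> derivatives has degree at most about \<open>(N + 1) * n\<close>, and it
  vanishes at \<open>0\<close> to order \<open>K - N\<close> at least, since Cramer's rule expresses it by the derivatives of
  \<open>Q(f)\<close>. So its order at \<open>\<alpha>\<close> is at most some \<open>\<tau>\<close> which is small when \<open>K\<close> is close to \<open>(N + 1) * n\<close>. The
  products \<open>\<Delta> * Y ^ i\<close> are combinations of the \<open>N + 1\<close> derivatives. Differentiating these identities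
  \<open>\<tau>\<close> times and putting \<open>x = \<alpha>\<close> isolates a nonzero multiple of \<open>Y ^ i\<close>, and the other side only
  involves derivatives up to order \<open>\<tau> + N\<close>.\<close>

lemma derivatives_span_at_point:
  fixes A B C :: "complex poly" and f :: "complex fps" and N :: nat
  assumes ode: "fps_of_poly A * fps_deriv f = fps_of_poly B * f + fps_of_poly C"
    and \<alpha>: "\<alpha> \<noteq> 0" "poly A \<alpha> \<noteq> 0"
    and Q: "degree Q \<le> N" "\<And>i. degree (coeff Q i) \<le> n"
    and K: "\<forall>i<K. fps_nth (poly (map_poly fps_of_poly Q) f) i = 0"
    and det: "dt (Suc N) (\<lambda>k i. coeff ((dop (pder A) B C ^^ k) Q) i) \<noteq> 0"
    and P: "degree P \<le> N"
  shows "P \<in> cpoly_vs.span {eval_coeffs \<alpha> ((dop (pder A) B C ^^ k) Q) | k.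
    k + K \<le> Suc N * n + (Suc N * (N * (degree A + degree B + degree C)) + 2 * N)}"
proof -
  let ?D = "dop (pder A) B C" and ?s = "degree A + degree B + degree C"
  define M where "M = (\<lambda>k i. coeff ((?D ^^ k) Q) i)"
  define \<Delta> where "\<Delta> = dt (Suc N) M"
  have nz: "\<Delta> \<noteq> 0" using det by (simp add: \<Delta>_def M_def)
  have degM: "degree (M k i) \<le> n + N * ?s" if "k \<le> N" for k i
  proof -
    have "degree (M k i) \<le> n + k * ?s" unfolding M_def by (rule degree_coeff_dop_pow[OF Q(2)])
    also have "\<dots> \<le> n + N * ?s" using that by (intro add_left_mono mult_le_mono1)
    finally show ?thesis .
  qed
  have "degree \<Delta> \<le> (n + N * ?s) * Suc N"
    unfolding \<Delta>_def dt_def by (rule degree_det_le) (auto intro!: degM)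
  then have deg: "degree \<Delta> \<le> Suc N * n + Suc N * (N * ?s)" by (simp add: algebra_simps)
  define F where "F = fps_to_fls f"
  have FF: "fder A F = fop B * F + fop C" unfolding F_def by (rule ode_fls[OF ode])
  have degD: "degree ((?D ^^ k) Q) \<le> N" for k
    using degree_dop_pow_le[OF derivation_pder[of A], of k B C Q] Q(1) by simp
  have low: "coeff \<Delta> i = 0" if "i < K - N" for i
  proof -
    have ord: "order_ge (int K) (poly (map_poly fop Q) F)"
      using K unfolding order_ge_def F_def poly_fop by simp
    have rows: "(\<Sum>j<Suc N. fop (M k j) * F ^ j) = (fder A ^^ k) (poly (map_poly fop Q) F)" for k
    proof -
      have "(fder A ^^ k) (poly (map_poly fop Q) F) = poly (map_poly fop ((?D ^^ k) Q)) F"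
        unfolding map_poly_fop_dop_pow by (rule poly_dop_pow[OF derivation_fder FF, symmetric])
      also have "\<dots> = (\<Sum>j\<le>degree (map_poly fop ((?D ^^ k) Q)). fop (M k j) * F ^ j)"
        unfolding poly_altdef by (simp add: coeff_map_poly fop_simps M_def)
      also have "\<dots> = (\<Sum>j<Suc N. fop (M k j) * F ^ j)"
      proof (rule sum.mono_neutral_left)
        show "{..degree (map_poly fop ((?D ^^ k) Q))} \<subseteq> {..<Suc N}"
          using degree_map_poly_le[of fop "(?D ^^ k) Q"] degD[of k] by auto
        show "\<forall>j\<in>{..<Suc N} - {..degree (map_poly fop ((?D ^^ k) Q))}. fop (M k j) * F ^ j = 0"
        proof
          fix j assume "j \<in> {..<Suc N} - {..degree (map_poly fop ((?D ^^ k) Q))}"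
          then have "coeff (map_poly fop ((?D ^^ k) Q)) j = 0" by (intro coeff_eq_0) auto
          then show "fop (M k j) * F ^ j = 0" by (simp add: coeff_map_poly fop_simps M_def)
        qed
      qed simp
      finally show ?thesis ..
    qed
    have "fop \<Delta> * F ^ 0 = (\<Sum>k<Suc N. cof (Suc N) (\<lambda>k j. fop (M k j)) k 0 * (fder A ^^ k) (poly (map_poly fop Q) F))"
      unfolding \<Delta>_def dt_hom[OF comm_ring_hom_fop, symmetric]
      using dt_cramer[of 0 "Suc N" "\<lambda>k j. fop (M k j)" "\<lambda>j. F ^ j"] by (simp only: rows zero_less_Suc)
    also have "order_ge (int K - int N) \<dots>"
    proof (rule order_ge_sum)
      fix k assume k: "k \<in> {..<Suc N}"
      have 1: "order_ge 0 (cof (Suc N) (\<lambda>k j. fop (M k j)) k 0)"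
        unfolding cof_hom[OF comm_ring_hom_fop] by (rule order_ge_fop)
      have 2: "order_ge (int K - int N) ((fder A ^^ k) (poly (map_poly fop Q) F))"
        by (rule order_ge_mono[OF order_ge_fder_pow[OF ord]]) (use k in auto)
      from order_ge_mult[OF 1 2] show "order_ge (int K - int N)
          (cof (Suc N) (\<lambda>k j. fop (M k j)) k 0 * (fder A ^^ k) (poly (map_poly fop Q) F))" by simp
    qed
    finally have o: "order_ge (int K - int N) (fop \<Delta>)" by simp
    have "int i < int K - int N" using that by linarith
    then have "fls_nth (fop \<Delta>) (int i) = 0" using o unfolding order_ge_def by blast
    then show ?thesis by (simp add: fop_def)
  qed
  define \<tau> where "\<tau> = order \<alpha> \<Delta>"
  have \<tau>: "\<tau> + (K - N) \<le> Suc N * n + Suc N * (N * ?s)"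
    unfolding \<tau>_def using order_at_two_points[where K = "K - N", OF nz \<alpha>(1) low] deg by linarith
  obtain b where b: "\<Delta> = [:- \<alpha>, 1:] ^ \<tau> * b" "\<not> [:- \<alpha>, 1:] dvd b"
    using order_decomp[OF nz] unfolding \<tau>_def by blast
  have b\<alpha>: "poly b \<alpha> \<noteq> 0" using b(2) by (simp add: poly_eq_0_iff_dvd)
  define V where "V = cpoly_vs.span {eval_coeffs \<alpha> ((?D ^^ j) Q) | j. j \<le> \<tau> + N}"
  have mono: "monom 1 i \<in> V" if i: "i \<le> N" for i
  proof -
    have "smult \<Delta> (monom 1 i) = (\<Sum>k<Suc N. smult (cof (Suc N) M k i) ((?D ^^ k) Q))"
    proof (rule poly_eqI)
      fix j
      show "coeff (smult \<Delta> (monom 1 i)) j = coeff (\<Sum>k<Suc N. smult (cof (Suc N) M k i) ((?D ^^ k) Q)) j"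
      proof (cases "j \<le> N")
        case True
        have "coeff (\<Sum>k<Suc N. smult (cof (Suc N) M k i) ((?D ^^ k) Q)) j = (\<Sum>k<Suc N. cof (Suc N) M k i * M k j)"
          unfolding coeff_sum coeff_smult M_def ..
        also have "\<dots> = (if i = j then \<Delta> else 0)"
          unfolding \<Delta>_def by (rule cof_mult_column) (use i True in auto)
        finally show ?thesis by simp
      next
        case False
        then have "coeff ((?D ^^ k) Q) j = 0" for k using degD[of k] by (intro coeff_eq_0) simp
        then show ?thesis using False i by (simp add: coeff_sum)
      qed
    qed
    then have "eval_coeffs \<alpha> ((?D ^^ \<tau>) (smult ([:- \<alpha>, 1:] ^ \<tau> * b) (monom 1 i))) =
        eval_coeffs \<alpha> (\<Sum>k<Suc N. (?D ^^ \<tau>) (smult (cof (Suc N) M k i) ((?D ^^ k) Q)))"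
      unfolding b(1)[symmetric] by (simp only: dop_pow_sum[OF derivation_pder])
    also have "\<dots> = (\<Sum>k<Suc N. eval_coeffs \<alpha> ((?D ^^ \<tau>) (smult (cof (Suc N) M k i) ((?D ^^ k) Q))))"
    proof -
      have "eval_coeffs \<alpha> (sum R I) = (\<Sum>k\<in>I. eval_coeffs \<alpha> (R k))" for R and I :: "nat set"
      proof (induction I rule: infinite_finite_induct)
        case (insert x F)
        then show ?case by (simp add: eval_coeffs_add)
      qed (simp_all add: eval_coeffs_def)
      then show ?thesis .
    qed
    also have "\<dots> \<in> V"
      unfolding V_def
    proof (rule cpoly_vs.span_sum)
      fix k assume "k \<in> {..<Suc N}"
      then show "eval_coeffs \<alpha> ((?D ^^ \<tau>) (smult (cof (Suc N) M k i) ((?D ^^ k) Q))) \<in>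
          cpoly_vs.span {eval_coeffs \<alpha> ((?D ^^ j) Q) | j. j \<le> \<tau> + N}"
        by (intro subsetD[OF cpoly_vs.span_mono eval_coeffs_dop_pow_span]) auto
    qed
    finally have "smult (poly A \<alpha> ^ \<tau> * fact \<tau> * poly b \<alpha>) (eval_coeffs \<alpha> (monom 1 i)) \<in> V"
      unfolding eval_coeffs_dop_pow_vanishing_factor .
    then have "smult (inverse (poly A \<alpha> ^ \<tau> * fact \<tau> * poly b \<alpha>))
        (smult (poly A \<alpha> ^ \<tau> * fact \<tau> * poly b \<alpha>) (eval_coeffs \<alpha> (monom 1 i))) \<in> V"
      unfolding V_def by (rule cpoly_vs.span_scale)
    moreover have "poly A \<alpha> ^ \<tau> * fact \<tau> * poly b \<alpha> \<noteq> 0" using \<alpha>(2) b\<alpha> by simp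
    ultimately have "eval_coeffs \<alpha> (monom 1 i) \<in> V" by (simp only: smult_smult left_inverse smult_1_left not_False_eq_True)
    moreover have "eval_coeffs \<alpha> (monom 1 i) = monom 1 i" by (intro poly_eqI) (simp add: coeff_eval_coeffs)
    ultimately show ?thesis by simp
  qed
  have "P = (\<Sum>i\<le>degree P. smult (coeff P i) (monom 1 i))"
    by (simp add: smult_monom poly_as_sum_of_monoms)
  also have "\<dots> \<in> V" unfolding V_def
    by (intro cpoly_vs.span_sum cpoly_vs.span_scale mono[unfolded V_def]) (use P in auto)
  finally have "P \<in> V" .
  moreover have "j + K \<le> Suc N * n + (Suc N * (N * ?s) + 2 * N)" if "j \<le> \<tau> + N" for j
    using that \<tau> by linarith
  then have "V \<subseteq> cpoly_vs.span {eval_coeffs \<alpha> ((?D ^^ k) Q) | k. k + K \<le> Suc N * n + (Suc N * (N * ?s) + 2 * N)}"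
    unfolding V_def by (intro cpoly_vs.span_mono) auto
  ultimately show ?thesis by blast
qed

section \<open>Growth in terms of factorials\<close>

text \<open>Growth at most \<open>n! ^ e\<close> up to exponential factors. Any such factor is absorbed by an arbitrarily
  small increase of \<open>e\<close> (\<open>fgrowth_absorb\<close>), so that only the exponents have to be tracked.\<close>

definition fgrowth :: "real \<Rightarrow> (nat \<Rightarrow> real) \<Rightarrow> bool" where
  "fgrowth e u \<longleftrightarrow> (\<exists>C\<ge>1. \<forall>n. 0 \<le> u n \<and> u n \<le> C ^ Suc n * fact n powr e)"

lemma fact_powr_ge_1: "e \<ge> 0 \<Longrightarrow> 1 \<le> fact n powr (e :: real)"
  by (rule ge_one_powr_ge_zero) simp_all

lemma fgrowthI:
  assumes "C \<ge> 1" "\<And>n. 0 \<le> u n" "\<And>n. u n \<le> C ^ Suc n * fact n powr e"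
  shows "fgrowth e u"
  unfolding fgrowth_def using assms by blast

lemma fgrowth_le: "fgrowth e v \<Longrightarrow> (\<And>n. 0 \<le> u n) \<Longrightarrow> (\<And>n. u n \<le> v n) \<Longrightarrow> fgrowth e u"
  unfolding fgrowth_def by (meson order.trans)

lemma fgrowth_mono:
  assumes "fgrowth e u" "e \<le> e'" shows "fgrowth e' u"
proof -
  obtain C where C: "C \<ge> 1" "\<And>n. 0 \<le> u n" "\<And>n. u n \<le> C ^ Suc n * fact n powr e"
    using assms(1) unfolding fgrowth_def by blast
  have "fact n powr e \<le> fact n powr e'" for n :: nat using assms(2) by (intro powr_mono) auto
  then have "u n \<le> C ^ Suc n * fact n powr e'" for n
    using C(3)[of n] C(1) by (meson mult_left_mono order.trans zero_le_power zero_le_one)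
  then show ?thesis using C by (intro fgrowthI)
qed

lemma fgrowth_const: "c \<ge> 0 \<Longrightarrow> fgrowth 0 (\<lambda>_. c)"
proof (rule fgrowthI[of "c + 1"])
  fix n assume "c \<ge> 0"
  then have "c + 1 \<le> (c + 1) ^ Suc n" using self_le_power[of "c + 1" "Suc n"] by simp
  then show "c \<le> (c + 1) ^ Suc n * fact n powr 0" by simp
qed auto

lemma fgrowth_mult:
  assumes "fgrowth e u" "fgrowth e' v" shows "fgrowth (e + e') (\<lambda>n. u n * v n)"
proof -
  obtain C where C: "C \<ge> 1" "\<And>n. 0 \<le> u n" "\<And>n. u n \<le> C ^ Suc n * fact n powr e"
    using assms(1) unfolding fgrowth_def by blast
  obtain D where D: "D \<ge> 1" "\<And>n. 0 \<le> v n" "\<And>n. v n \<le> D ^ Suc n * fact n powr e'"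
    using assms(2) unfolding fgrowth_def by blast
  show ?thesis
  proof (rule fgrowthI[of "C * D"])
    show "1 \<le> C * D" using mult_mono[of 1 C 1 D] C(1) D(1) by simp
    fix n
    show "0 \<le> u n * v n" using C D by simp
    have "u n * v n \<le> (C ^ Suc n * fact n powr e) * (D ^ Suc n * fact n powr e')"
      using C D by (intro mult_mono) auto
    then show "u n * v n \<le> (C * D) ^ Suc n * fact n powr (e + e')"
      by (simp add: powr_add power_mult_distrib mult_ac)
  qed
qed

lemma fgrowth_power: "fgrowth e u \<Longrightarrow> fgrowth (real k * e) (\<lambda>n. u n ^ k)"
proof (induction k)
  case 0
  then show ?case using fgrowth_const[of 1] by simp
next
  case (Suc k)
  from fgrowth_mult[OF Suc.prems Suc.IH[OF Suc.prems]] show ?case by (simp add: algebra_simps)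
qed

lemma fgrowth_add:
  assumes "fgrowth e u" "fgrowth e v" shows "fgrowth e (\<lambda>n. u n + v n)"
proof -
  obtain C where C: "C \<ge> 1" "\<And>n. 0 \<le> u n" "\<And>n. u n \<le> C ^ Suc n * fact n powr e"
    using assms(1) unfolding fgrowth_def by blast
  obtain D where D: "D \<ge> 1" "\<And>n. 0 \<le> v n" "\<And>n. v n \<le> D ^ Suc n * fact n powr e"
    using assms(2) unfolding fgrowth_def by blast
  show ?thesis
  proof (rule fgrowthI[of "C + D"])
    show "1 \<le> C + D" using C(1) D(1) by simp
    fix n
    show "0 \<le> u n + v n" using C D by simp
    have "C ^ n \<le> (C + D) ^ n" "D ^ n \<le> (C + D) ^ n" using C(1) D(1) by (auto intro!: power_mono)
    then have "C * C ^ n + D * D ^ n \<le> C * (C + D) ^ n + D * (C + D) ^ n"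
      using C(1) D(1) by (intro add_mono mult_left_mono) auto
    then have "C ^ Suc n + D ^ Suc n \<le> (C + D) ^ Suc n" by (simp add: algebra_simps)
    then have "(C ^ Suc n + D ^ Suc n) * fact n powr e \<le> (C + D) ^ Suc n * fact n powr e"
      by (intro mult_right_mono) auto
    then show "u n + v n \<le> (C + D) ^ Suc n * fact n powr e"
      using C(3)[of n] D(3)[of n] by (simp add: algebra_simps)
  qed
qed

lemma fgrowth_exp: "B \<ge> 0 \<Longrightarrow> fgrowth 0 (\<lambda>n. B ^ n)"
proof (rule fgrowthI[of "B + 1"])
  fix n assume B: "B \<ge> 0"
  have "B ^ n \<le> (B + 1) ^ n" using B by (intro power_mono) auto
  also have "\<dots> \<le> (B + 1) ^ Suc n" using B by (intro power_increasing) auto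
  finally show "B ^ n \<le> (B + 1) ^ Suc n * fact n powr 0" by simp
qed auto

lemma fgrowth_n: "fgrowth 0 (\<lambda>n. real n)"
  by (rule fgrowth_le[OF fgrowth_exp[of 2]]) (auto intro: less_imp_le of_nat_less_two_power)

lemma fgrowth_fact_powr: "fgrowth e (\<lambda>n. fact n powr e)"
  by (rule fgrowthI[of 1]) auto

text \<open>One term of the exponential series at \<open>n\<close>.\<close>

lemma power_self_le: "real n ^ n \<le> exp 1 ^ n * fact n"
proof -
  have "(\<lambda>k. real n ^ k / fact k) sums exp (real n)"
    using exp_converges[of "real n"] by (simp add: field_simps scaleR_conv_of_real)
  then have "real n ^ n / fact n \<le> exp (real n)"
    using sum_le_suminf[of "\<lambda>k. real n ^ k / fact k" "{n}"] sums_summable sums_unique by fastforce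
  also have "exp (real n) = exp 1 ^ n" by (simp flip: exp_of_nat_mult)
  finally show ?thesis by (simp add: field_simps)
qed

lemma fact_mult_le: "fact (m * n) \<le> ((real m * exp 1) ^ m) ^ n * fact n ^ m"
proof -
  have "fact (m * n) \<le> real (m * n) ^ (m * n)"
    using fact_le_power[of "m * n"] by (metis of_nat_power)
  also have "\<dots> = (real m ^ m) ^ n * (real n ^ n) ^ m"
    by (simp add: power_mult_distrib mult.commute flip: power_mult)
  also have "\<dots> \<le> (real m ^ m) ^ n * (exp 1 ^ n * fact n) ^ m"
    by (intro mult_left_mono power_mono power_self_le) auto
  also have "\<dots> = ((real m * exp 1) ^ m) ^ n * fact n ^ m"
    by (simp add: power_mult_distrib mult.commute flip: power_mult)
  finally show ?thesis .
qed

lemma fgrowth_fact_mult: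
  assumes "e \<ge> 0" shows "fgrowth (real m * e) (\<lambda>n. fact (m * n) powr e)"
proof -
  define B where "B = (real m * exp 1) ^ m"
  have B: "B \<ge> 0" by (simp add: B_def)
  have "fact (m * n) powr e \<le> (B powr e) ^ n * fact n powr (real m * e)" for n
  proof -
    have "fact (m * n) powr e \<le> (B ^ n * fact n ^ m) powr e"
      using fact_mult_le[of m n] assms unfolding B_def by (intro powr_mono2) auto
    also have "\<dots> = (B ^ n) powr e * (fact n ^ m) powr e"
      using B by (simp add: powr_mult)
    also have "(fact n ^ m) powr e = fact n powr (real m * e)"
      by (simp add: powr_powr flip: powr_realpow)
    also have "(B ^ n) powr e = (B powr e) ^ n"
      using B by (cases "B = 0") (simp_all add: powr_powr mult.commute power_0_left flip: powr_realpow)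
    finally show ?thesis .
  qed
  moreover have "fgrowth (0 + real m * e) (\<lambda>n. (B powr e) ^ n * fact n powr (real m * e))"
    by (intro fgrowth_mult fgrowth_exp fgrowth_fact_powr) auto
  ultimately show ?thesis by (intro fgrowth_le[where u = "\<lambda>n. fact (m * n) powr e"]) auto
qed

text \<open>Again one term of the exponential series, now at \<open>C powr (1 / \<epsilon>)\<close>, raised to the power \<open>\<epsilon>\<close>.\<close>

lemma power_le_fact_powr:
  fixes C \<epsilon> :: real
  assumes "C \<ge> 1" "\<epsilon> > 0"
  shows "\<exists>c\<ge>1. \<forall>n. C ^ n \<le> c * fact n powr \<epsilon>"
proof -
  define B where "B = C powr (1 / \<epsilon>)"
  have B: "B > 0" using assms by (simp add: B_def)
  have "C ^ n \<le> exp (B * \<epsilon>) * fact n powr \<epsilon>" for n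
  proof -
    have "(\<lambda>k. B ^ k / fact k) sums exp B"
      using exp_converges[of B] by (simp add: field_simps scaleR_conv_of_real)
    then have "B ^ n / fact n \<le> exp B"
      using sum_le_suminf[of "\<lambda>k. B ^ k / fact k" "{n}"] sums_summable sums_unique B by fastforce
    then have "B ^ n \<le> exp B * fact n" by (simp add: field_simps)
    then have "(B ^ n) powr \<epsilon> \<le> (exp B * fact n) powr \<epsilon>"
      using B assms by (intro powr_mono2) auto
    also have "\<dots> = exp (B * \<epsilon>) * fact n powr \<epsilon>" by (simp add: powr_mult exp_powr_real)
    also have "(B ^ n) powr \<epsilon> = (B powr \<epsilon>) ^ n"
      using B by (simp add: powr_powr mult.commute flip: powr_realpow)
    also have "B powr \<epsilon> = C" using assms by (simp add: B_def powr_powr)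
    finally show ?thesis .
  qed
  moreover have "exp (B * \<epsilon>) \<ge> 1" using B assms by simp
  ultimately show ?thesis by blast
qed

lemma fgrowth_absorb:
  assumes "fgrowth e u" "\<epsilon> > 0"
  shows "\<exists>c\<ge>1. \<forall>n. u n \<le> c * fact n powr (e + \<epsilon>)"
proof -
  obtain C where C: "C \<ge> 1" "\<And>n. 0 \<le> u n" "\<And>n. u n \<le> C ^ Suc n * fact n powr e"
    using assms(1) unfolding fgrowth_def by blast
  obtain c where c: "c \<ge> 1" "\<And>n. C ^ n \<le> c * fact n powr \<epsilon>"
    using power_le_fact_powr[OF C(1) assms(2)] by blast
  have "u n \<le> (C * c) * fact n powr (e + \<epsilon>)" for n
  proof -
    have "C ^ Suc n * fact n powr e \<le> C * (c * fact n powr \<epsilon>) * fact n powr e"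
      using c(2)[of n] C(1) by (auto intro!: mult_right_mono mult_left_mono)
    then show ?thesis using C(3)[of n] by (simp add: powr_add mult_ac)
  qed
  moreover have "C * c \<ge> 1" using mult_mono[of 1 C 1 c] C(1) c(1) by simp
  ultimately show ?thesis by blast
qed

context order_gen
begin

section \<open>Powers of the E-function\<close>

text \<open>The bounds for house and denominator in the definition of an E-function, in terms of coordinates.\<close>

lemma E_function_sized:
  assumes E: "E_function f" and f: "\<And>n. fps_nth f n \<in> rat_adjoin \<theta>" and \<epsilon>: "\<epsilon> > 0"
  shows "\<exists>c\<ge>1. \<forall>n. \<exists>D::nat. D \<ge> 1 \<and> real D \<le> c * fact n powr \<epsilon> \<and>
    (\<forall>k\<le>n. sized (c * fact n powr \<epsilon>) (of_nat D * (fact k * fps_nth f k)))"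
proof -
  define a where "a = (\<lambda>n. fact n * fps_nth f n)"
  have alg: "algebraic (a n)" for n using E unfolding E_function_def a_def by (simp add: Let_def)
  have "\<forall>\<epsilon>>0. \<exists>c>0. \<forall>n. house (a n) \<le> c * fact n powr \<epsilon> \<and>
      real (den (a ` {..n})) \<le> c * fact n powr \<epsilon>"
    using E unfolding E_function_def a_def Let_def by blast
  from this[rule_format, of "\<epsilon> / 2"] \<epsilon> obtain c0 where c0: "c0 > 0" "\<And>n. house (a n) \<le> c0 * fact n powr (\<epsilon> / 2)"
      "\<And>n. real (den (a ` {..n})) \<le> c0 * fact n powr (\<epsilon> / 2)"
    by auto
  obtain E0 :: nat and C where EC: "E0 \<ge> 1" "C \<ge> 1"
      "\<And>x D. x \<in> rat_adjoin \<theta> \<Longrightarrow> (D::nat) \<ge> 1 \<Longrightarrow> algebraic_int (of_nat D * x) \<Longrightarrow>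
        sized (C * real D * house x) (of_nat (E0 * D) * x)"
    using house_imp_sized by blast
  have aL: "a n \<in> rat_adjoin \<theta>" for n
  proof -
    have "rpoly [:fact n:] \<theta> = fact n" unfolding rpoly_const by (metis of_nat_fact of_rat_of_nat_eq)
    then obtain q where "fps_nth f n = rpoly q \<theta>" "(fact n :: complex) = rpoly [:fact n:] \<theta>"
      using f[of n] unfolding rat_adjoin_def by auto
    then have "a n = rpoly ([:fact n:] * q) \<theta>" by (simp only: a_def rpoly_mult)
    then show ?thesis unfolding rat_adjoin_def by blast
  qed
  define c where "c = 1 + real E0 * c0 + C * c0 * c0"
  have c1: "c \<ge> 1" using c0(1) EC by (simp add: c_def)
  have "\<exists>D::nat. D \<ge> 1 \<and> real D \<le> c * fact n powr \<epsilon> \<and>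
      (\<forall>k\<le>n. sized (c * fact n powr \<epsilon>) (of_nat D * (fact k * fps_nth f k)))" for n
  proof -
    define d0 where "d0 = den (a ` {..n})"
    have "\<exists>D. D \<ge> 1 \<and> (\<forall>x\<in>a ` {..n}. algebraic_int (of_nat D * x))"
      using common_integral_multiple[of "a ` {..n}"] alg by (auto simp: Suc_le_eq)
    then have "d0 \<ge> 1 \<and> (\<forall>x\<in>a ` {..n}. algebraic_int (of_nat d0 * x))"
      unfolding d0_def den_def by (rule LeastI_ex)
    then have d0: "d0 \<ge> 1" "\<And>k. k \<le> n \<Longrightarrow> algebraic_int (of_nat d0 * a k)" by auto
    have h: "fact n powr (\<epsilon> / 2) * fact n powr (\<epsilon> / 2) = fact n powr \<epsilon>"
      by (simp flip: powr_add)
    have h1: "(1::real) \<le> fact n powr (\<epsilon> / 2)" using \<epsilon> by (intro fact_powr_ge_1) simp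
    have "real (E0 * d0) \<le> c * fact n powr \<epsilon>"
    proof -
      have "real (E0 * d0) \<le> real E0 * (c0 * fact n powr (\<epsilon> / 2))"
        using c0(3)[of n] by (simp add: d0_def mult_left_mono)
      also have "\<dots> \<le> real E0 * (c0 * (fact n powr (\<epsilon> / 2) * fact n powr (\<epsilon> / 2)))"
        using h1 c0(1) by (intro mult_left_mono) auto
      also have "\<dots> \<le> c * fact n powr \<epsilon>" unfolding h mult.assoc[symmetric] c_def
        using c0(1) EC by (intro mult_right_mono) auto
      finally show ?thesis .
    qed
    moreover have "sized (c * fact n powr \<epsilon>) (of_nat (E0 * d0) * a k)" if k: "k \<le> n" for k
    proof (rule sized_mono[OF EC(3)[OF aL d0(1) d0(2)[OF k]]])
      have "(fact k :: real) powr (\<epsilon> / 2) \<le> fact n powr (\<epsilon> / 2)"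
        using \<epsilon> k by (intro powr_mono2 fact_mono) auto
      then have hk: "house (a k) \<le> c0 * fact n powr (\<epsilon> / 2)"
        using c0(1) c0(2)[of k] by (meson mult_left_mono less_imp_le order.trans)
      have "0 \<le> norm (a k)" by simp
      also have "\<dots> \<le> house (a k)" by (rule norm_le_house[OF aL alg])
      finally have h0: "0 \<le> house (a k)" .
      have "C * real d0 * house (a k) \<le> C * (c0 * fact n powr (\<epsilon> / 2)) * (c0 * fact n powr (\<epsilon> / 2))"
        using hk h0 c0(1,3) EC(2) by (intro mult_mono) (auto simp: d0_def)
      also have "\<dots> = (C * c0 * c0) * fact n powr \<epsilon>" unfolding h[symmetric] by simp
      also have "\<dots> \<le> c * fact n powr \<epsilon>" unfolding c_def using c0(1) EC by (intro mult_right_mono) auto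
      finally show "C * real d0 * house (a k) \<le> c * fact n powr \<epsilon>" .
    qed
    moreover have "E0 * d0 \<ge> 1" using EC(1) d0(1) by simp
    ultimately show ?thesis unfolding a_def by blast
  qed
  then show ?thesis using c1 by blast
qed

text \<open>The Taylor coefficients of a product are sums of products with binomial weights, whose sum \<open>2 ^ k\<close>
  is harmless.\<close>

lemma fps_power_sized_step:
  assumes T: "T \<ge> 1" and D: "\<And>k. k \<le> n \<Longrightarrow> sized T (of_nat D * (fact k * fps_nth f k))"
  shows "k \<le> n \<Longrightarrow> sized ((\<kappa> * T * 2 ^ n) ^ i) (of_nat (D ^ i) * (fact k * fps_nth (f ^ i) k))"
proof (induction i arbitrary: k)
  case 0
  have "fact k * fps_nth (f ^ 0) k = of_nat (if k = 0 then 1 else 0)" by simp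
  then show ?case using sized_1 sized_0[of 1] by simp
next
  case (Suc i)
  let ?S = "(\<kappa> * T * 2 ^ n) ^ i"
  have eq: "of_nat (D ^ Suc i) * (fact k * fps_nth (f ^ Suc i) k) =
     (\<Sum>j=0..k. of_nat (k choose j) *
       ((of_nat D * (fact j * fps_nth f j)) * (of_nat (D ^ i) * (fact (k - j) * fps_nth (f ^ i) (k - j)))))"
  proof -
    have "of_nat (D ^ Suc i) * (fact k * fps_nth (f ^ Suc i) k) =
        (\<Sum>j=0..k. fact k * (of_nat D * fps_nth f j * (of_nat (D ^ i) * fps_nth (f ^ i) (k - j))))"
      by (simp add: fps_mult_nth sum_distrib_left mult_ac)
    also have "\<dots> = (\<Sum>j=0..k. of_nat (k choose j) *
       ((of_nat D * (fact j * fps_nth f j)) * (of_nat (D ^ i) * (fact (k - j) * fps_nth (f ^ i) (k - j)))))"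
    proof (rule sum.cong[OF refl])
      fix j assume "j \<in> {0..k}"
      then have "fact j * fact (k - j) * (k choose j) = fact k" by (intro binomial_fact_lemma) simp
      from arg_cong[OF this, of "of_nat :: nat \<Rightarrow> complex"]
      have "fact k = of_nat (k choose j) * (fact j * fact (k - j) :: complex)" by (simp add: mult_ac)
      then show "fact k * (of_nat D * fps_nth f j * (of_nat (D ^ i) * fps_nth (f ^ i) (k - j))) =
        of_nat (k choose j) * ((of_nat D * (fact j * fps_nth f j)) *
          (of_nat (D ^ i) * (fact (k - j) * fps_nth (f ^ i) (k - j))))" by (simp add: mult_ac)
    qed
    finally show ?thesis .
  qed
  have "sized (\<Sum>j=0..k. real (k choose j) * (\<kappa> * T * ?S)) (of_nat (D ^ Suc i) * (fact k * fps_nth (f ^ Suc i) k))"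
    unfolding eq using Suc.prems by (intro sized_sum sized_scale_nat sized_mult D Suc.IH) auto
  moreover have "(\<Sum>j=0..k. real (k choose j) * (\<kappa> * T * ?S)) \<le> (\<kappa> * T * 2 ^ n) ^ Suc i"
  proof -
    have "(\<Sum>j=0..k. real (k choose j)) = real (2 ^ k)"
      using choose_row_sum[of k] by (simp flip: of_nat_sum add: atMost_atLeast0)
    then have "(\<Sum>j=0..k. real (k choose j) * (\<kappa> * T * ?S)) = 2 ^ k * (\<kappa> * T * ?S)"
      by (simp flip: sum_distrib_right)
    also have "\<dots> \<le> 2 ^ n * (\<kappa> * T * ?S)"
      using Suc.prems kappa_ge_1 T by (intro mult_right_mono power_increasing) auto
    finally show ?thesis by (simp add: mult_ac)
  qed
  ultimately show ?case by (rule sized_mono)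
qed

lemma E_function_powers_sized:
  assumes E: "E_function f" and f: "\<And>n. fps_nth f n \<in> rat_adjoin \<theta>" and \<epsilon>: "\<epsilon> > 0"
  shows "\<exists>c\<ge>1. \<forall>n. \<exists>D::nat. D \<ge> 1 \<and> real D \<le> c * fact n powr \<epsilon> \<and>
    (\<forall>i\<le>N. \<forall>k\<le>n. sized (c * fact n powr \<epsilon>) (of_nat D * (fact k * fps_nth (f ^ i) k)))"
proof -
  define \<epsilon>1 where "\<epsilon>1 = (\<epsilon> / 4) / (real N + 1)"
  have \<epsilon>1: "\<epsilon>1 > 0" using \<epsilon> by (simp add: \<epsilon>1_def)
  obtain c1 where c1: "c1 \<ge> 1" "\<forall>n. \<exists>D::nat. D \<ge> 1 \<and> real D \<le> c1 * fact n powr \<epsilon>1 \<and>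
    (\<forall>k\<le>n. sized (c1 * fact n powr \<epsilon>1) (of_nat D * (fact k * fps_nth f k)))"
    using E_function_sized[OF E f \<epsilon>1] by blast
  define T where "T = (\<lambda>n. c1 * fact n powr \<epsilon>1)"
  define U where "U = (\<lambda>n. (T n * (\<kappa> * T n * 2 ^ n)) ^ N)"
  have T1: "T n \<ge> 1" for n
    unfolding T_def using mult_mono[of 1 c1 1 "fact n powr \<epsilon>1"] c1(1) fact_powr_ge_1[of \<epsilon>1 n] \<epsilon>1 by simp
  have gT: "fgrowth (0 + \<epsilon>1) T"
    unfolding T_def by (intro fgrowth_mult fgrowth_const fgrowth_fact_powr) (use c1 in auto)
  have "fgrowth (real N * ((0 + \<epsilon>1) + ((0 + (0 + \<epsilon>1)) + 0))) U"
    unfolding U_def by (intro fgrowth_power fgrowth_mult gT fgrowth_const fgrowth_exp) (use kappa_ge_1 in auto)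
  then have "fgrowth (\<epsilon> / 2) U"
  proof (rule fgrowth_mono)
    show "real N * ((0 + \<epsilon>1) + ((0 + (0 + \<epsilon>1)) + 0)) \<le> \<epsilon> / 2"
    proof -
      have "real N + 1 \<noteq> 0" by linarith
      then have "(real N + 1) * \<epsilon>1 = \<epsilon> / 4"
        unfolding \<epsilon>1_def by (metis nonzero_mult_div_cancel_left times_divide_eq_right)
      then have "real N * \<epsilon>1 \<le> \<epsilon> / 4" using \<epsilon>1 by (simp add: algebra_simps)
      then show ?thesis by (simp add: algebra_simps)
    qed
  qed
  from fgrowth_absorb[OF this, of "\<epsilon> / 2"] \<epsilon>
  obtain c where c: "c \<ge> 1" "\<And>n. U n \<le> c * fact n powr \<epsilon>" by auto
  have "\<exists>D::nat. D \<ge> 1 \<and> real D \<le> c * fact n powr \<epsilon> \<and>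
    (\<forall>i\<le>N. \<forall>k\<le>n. sized (c * fact n powr \<epsilon>) (of_nat D * (fact k * fps_nth (f ^ i) k)))" for n
  proof -
    obtain D :: nat where D: "D \<ge> 1" "real D \<le> T n"
      "\<And>k. k \<le> n \<Longrightarrow> sized (T n) (of_nat D * (fact k * fps_nth f k))"
      using c1(2) unfolding T_def by blast
    let ?W = "\<kappa> * T n * 2 ^ n"
    have W: "1 \<le> ?W"
      using mult_mono[of 1 "\<kappa> * T n" 1 "2 ^ n"] mult_mono[of 1 \<kappa> 1 "T n"] kappa_ge_1 T1[of n] by simp
    have "real (D ^ N) \<le> (T n * ?W) ^ N"
    proof -
      have "real D * 1 \<le> T n * ?W" using D(2) W T1[of n] by (intro mult_mono) auto
      then show ?thesis by (simp add: power_mono)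
    qed
    then have 1: "real (D ^ N) \<le> c * fact n powr \<epsilon>" using c(2)[of n] unfolding U_def by linarith
    have 2: "sized (c * fact n powr \<epsilon>) (of_nat (D ^ N) * (fact k * fps_nth (f ^ i) k))"
      if i: "i \<le> N" and k: "k \<le> n" for i k
    proof -
      have "sized (real (D ^ (N - i)) * ?W ^ i) (of_nat (D ^ (N - i)) * (of_nat (D ^ i) * (fact k * fps_nth (f ^ i) k)))"
        by (intro sized_scale_nat fps_power_sized_step[OF T1 D(3) k])
      moreover have "of_nat (D ^ (N - i)) * (of_nat (D ^ i) * (fact k * fps_nth (f ^ i) k)) =
          of_nat (D ^ N) * (fact k * fps_nth (f ^ i) k)"
        using i by (simp add: mult.assoc[symmetric] flip: power_add)
      moreover have "real (D ^ (N - i)) * ?W ^ i \<le> U n"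
      proof -
        have "real (D ^ (N - i)) * ?W ^ i \<le> T n ^ N * ?W ^ N"
        proof (rule mult_mono)
          have "real (D ^ (N - i)) \<le> T n ^ (N - i)" using D(2) by (simp add: power_mono)
          also have "\<dots> \<le> T n ^ N" using T1[of n] by (intro power_increasing) auto
          finally show "real (D ^ (N - i)) \<le> T n ^ N" .
          show "?W ^ i \<le> ?W ^ N" using W i by (intro power_increasing) auto
        qed (use W T1[of n] in auto)
        then show ?thesis by (simp add: U_def power_mult_distrib)
      qed
      ultimately show ?thesis using c(2)[of n] by (metis order.trans sized_mono)
    qed
    show ?thesis using 1 2 D(1) by (intro exI[of _ "D ^ N"]) auto
  qed
  then show ?thesis using c(1) by blast
qed

end

section \<open>Siegel's auxiliary forms\<close>

text \<open>The weight \<open>n! / j!\<close> at \<open>x ^ j\<close> turns the conditions on the unknowns \<open>g i j\<close> into equations with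
  binomial coefficients and the moderate numbers \<open>m! * fps_nth (f ^ i) m\<close> (\<open>fps_nth_siegel_poly\<close>). Hence
  the \<open>g i j\<close> can be chosen of size \<open>n!\<close> to an arbitrarily small power, while the coefficients of the
  polynomial itself have size about \<open>n!\<close>.\<close>

definition siegel_poly :: "nat \<Rightarrow> nat \<Rightarrow> (nat \<Rightarrow> nat \<Rightarrow> complex) \<Rightarrow> complex poly poly" where
  "siegel_poly N n g = (\<Sum>i\<le>N. monom (\<Sum>j<n. monom (of_nat (fact n div fact j) * g i j) j) i)"

lemma coeff_siegel_poly:
  "coeff (coeff (siegel_poly N n g) i) j = (if i \<le> N \<and> j < n then of_nat (fact n div fact j) * g i j else 0)"
proof -
  have "coeff (siegel_poly N n g) i = (if i \<le> N then (\<Sum>j<n. monom (of_nat (fact n div fact j) * g i j) j) else 0)"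
    unfolding siegel_poly_def coeff_sum by simp
  then show ?thesis by (simp add: coeff_sum)
qed

lemma degree_siegel_poly: "degree (siegel_poly N n g) \<le> N"
  by (rule degree_le) (auto intro!: poly_eqI simp: coeff_siegel_poly)

lemma degree_coeff_siegel_poly: "degree (coeff (siegel_poly N n g) i) \<le> n"
  by (rule degree_le) (auto simp: coeff_siegel_poly)

lemma fps_nth_siegel_poly:
  "fact m * fps_nth (poly (map_poly fps_of_poly (siegel_poly N n g)) f) m =
    fact n * (\<Sum>i\<le>N. \<Sum>j<n. (if j \<le> m then of_nat (m choose j) * (fact (m - j) * fps_nth (f ^ i) (m - j)) else 0) * g i j)"
proof -
  have "fact m * fps_nth (poly (map_poly fps_of_poly (siegel_poly N n g)) f) m =
      (\<Sum>i\<le>N. \<Sum>j\<le>n. fact m * ((if j \<le> m then fps_nth (f ^ i) (m - j) else 0) * coeff (coeff (siegel_poly N n g) i) j))"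
    unfolding fps_nth_poly_fps_of_poly[OF degree_siegel_poly degree_coeff_siegel_poly]
    by (simp add: sum.cartesian_product sum_distrib_left split_def)
  also have "\<dots> = (\<Sum>i\<le>N. \<Sum>j<n. fact n * ((if j \<le> m then of_nat (m choose j) * (fact (m - j) * fps_nth (f ^ i) (m - j)) else 0) * g i j))"
  proof (rule sum.cong[OF refl])
    fix i assume i: "i \<in> {..N}"
    show "(\<Sum>j\<le>n. fact m * ((if j \<le> m then fps_nth (f ^ i) (m - j) else 0) * coeff (coeff (siegel_poly N n g) i) j)) =
      (\<Sum>j<n. fact n * ((if j \<le> m then of_nat (m choose j) * (fact (m - j) * fps_nth (f ^ i) (m - j)) else 0) * g i j))"
    proof (rule sum.mono_neutral_cong_right)
      fix j assume j: "j \<in> {..<n}"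
      have dv: "(of_nat (fact n div fact j) :: complex) = fact n / fact j"
      proof -
        have "(fact j :: nat) dvd fact n" using j by (intro fact_dvd) simp
        then obtain k :: nat where k: "fact n = fact j * k" by (rule dvdE)
        have "(fact n :: complex) = fact j * of_nat k"
          using arg_cong[OF k, of "of_nat :: nat \<Rightarrow> complex"] by simp
        moreover have "fact n div fact j = k" using k by simp
        ultimately show ?thesis by simp
      qed
      show "fact m * ((if j \<le> m then fps_nth (f ^ i) (m - j) else 0) * coeff (coeff (siegel_poly N n g) i) j) =
        fact n * ((if j \<le> m then of_nat (m choose j) * (fact (m - j) * fps_nth (f ^ i) (m - j)) else 0) * g i j)"
        using i j by (simp add: coeff_siegel_poly dv binomial_fact)
    qed (auto simp: coeff_siegel_poly)
  qed
  finally show ?thesis by (simp add: sum_distrib_left)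
qed

context order_gen
begin

text \<open>There are \<open>(N + 1) * n\<close> unknowns and \<open>n div q\<close> equations less. The ratio of the two numbers is bounded,
  so Siegel's lemma gives a solution whose size is a bounded power of the size of the coefficients.\<close>

lemma siegel_form:
  assumes E: "E_function f" and f: "\<And>n. fps_nth f n \<in> rat_adjoin \<theta>" and \<epsilon>: "\<epsilon> > 0" and q: "q \<ge> 1"
  shows "\<exists>c\<ge>1. \<forall>n\<ge>q. \<exists>g. (\<exists>i\<le>N. \<exists>j<n. g i j \<noteq> 0) \<and> (\<forall>i j. sized (c * fact n powr \<epsilon>) (g i j)) \<and>
    (\<forall>m < Suc N * n - n div q. fps_nth (poly (map_poly fps_of_poly (siegel_poly N n g)) f) m = 0)"
proof -
  \<comment> \<open>There are at most \<open>w\<close> times as many equations as surplus unknowns, hence the solution has size \<open>X n ^ w\<close>.\<close>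
  define w where "w = 2 * q * Suc N"
  have w: "w \<ge> 1" using q by (simp add: w_def)
  define \<epsilon>1 where "\<epsilon>1 = (\<epsilon> / 2) / (real w * real (Suc N))"
  have \<epsilon>1: "\<epsilon>1 > 0" using \<epsilon> w by (simp add: \<epsilon>1_def)
  from E_function_powers_sized[OF E f \<epsilon>1, of N]
  obtain c1 where c1: "c1 \<ge> 1" "\<forall>n. \<exists>D::nat. D \<ge> 1 \<and> real D \<le> c1 * fact n powr \<epsilon>1 \<and>
    (\<forall>i\<le>N. \<forall>k\<le>n. sized (c1 * fact n powr \<epsilon>1) (of_nat D * (fact k * fps_nth (f ^ i) k)))"
    by (elim exE conjE) (rule that)
  define S where "S = (\<lambda>n. 2 ^ (Suc N * n) * (c1 * fact (Suc N * n) powr \<epsilon>1))"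
  define X where "X = (\<lambda>n. 2 * real (Suc N * n) * \<kappa> * S n + 1)"
  have S0: "S n \<ge> 1" for n
  proof -
    have "1 * 1 \<le> c1 * fact (Suc N * n) powr \<epsilon>1"
      using c1(1) \<epsilon>1 by (intro mult_mono fact_powr_ge_1) auto
    moreover have "(1::real) \<le> 2 ^ (Suc N * n)" by (rule one_le_power) simp
    ultimately have "1 * 1 \<le> 2 ^ (Suc N * n) * (c1 * fact (Suc N * n) powr \<epsilon>1)"
      by (intro mult_mono) auto
    then show ?thesis unfolding S_def by simp
  qed
  have X1: "X n \<ge> 1" for n unfolding X_def using S0[of n] kappa_ge_1 by simp
  have gS: "fgrowth (real (Suc N) * \<epsilon>1) S"
  proof -
    have "fgrowth (0 + (0 + real (Suc N) * \<epsilon>1)) (\<lambda>n. (2 ^ Suc N) ^ n * (c1 * fact (Suc N * n) powr \<epsilon>1))"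
      by (intro fgrowth_mult fgrowth_exp fgrowth_const fgrowth_fact_mult) (use c1 \<epsilon>1 in auto)
    then show ?thesis unfolding S_def power_mult by (simp only: add_0_left)
  qed
  have gX: "fgrowth (real (Suc N) * \<epsilon>1) X"
  proof -
    have "fgrowth (0 + 0 + (real (Suc N) * \<epsilon>1)) (\<lambda>n. (2 * real (Suc N) * \<kappa>) * real n * S n)"
      by (intro fgrowth_mult fgrowth_const fgrowth_n gS) (use kappa_ge_1 in auto)
    moreover have "fgrowth (real (Suc N) * \<epsilon>1) (\<lambda>n. 1)"
      by (rule fgrowth_mono[OF fgrowth_const]) (use \<epsilon>1 in auto)
    ultimately have "fgrowth (real (Suc N) * \<epsilon>1) (\<lambda>n. (2 * real (Suc N) * \<kappa>) * real n * S n + 1)"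
      by (intro fgrowth_add) (simp_all del: of_nat_Suc)
    then show ?thesis
    proof (rule fgrowth_le)
      fix n
      show "0 \<le> X n" using X1[of n] by simp
      show "X n \<le> (2 * real (Suc N) * \<kappa>) * real n * S n + 1" by (simp add: X_def algebra_simps)
    qed
  qed
  have "fgrowth (0 + real w * (real (Suc N) * \<epsilon>1)) (\<lambda>n. 2 * X n ^ w)"
    by (intro fgrowth_mult fgrowth_const fgrowth_power gX) simp
  moreover have "0 + real w * (real (Suc N) * \<epsilon>1) = \<epsilon> / 2"
    using w unfolding \<epsilon>1_def by (simp del: of_nat_Suc add: mult.assoc[symmetric])
  ultimately have "fgrowth (\<epsilon> / 2) (\<lambda>n. 2 * X n ^ w)" by (simp only:)
  from fgrowth_absorb[OF this, of "\<epsilon> / 2"] \<epsilon>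
  obtain c where c: "c \<ge> 1" "\<And>n. 2 * X n ^ w \<le> c * fact n powr \<epsilon>" by auto
  have "\<exists>g. (\<exists>i\<le>N. \<exists>j<n. g i j \<noteq> 0) \<and> (\<forall>i j. sized (c * fact n powr \<epsilon>) (g i j)) \<and>
    (\<forall>m < Suc N * n - n div q. fps_nth (poly (map_poly fps_of_poly (siegel_poly N n g)) f) m = 0)"
    if n: "n \<ge> q" for n
  proof -
    have n0: "n > 0" using n q by simp
    define V where "V = Suc N * n"
    define \<mu>' where "\<mu>' = n div q"
    have \<mu>': "\<mu>' \<ge> 1" "\<mu>' \<le> n" unfolding \<mu>'_def using n q by (auto simp: div_greater_zero_iff Suc_le_eq)
    have nq: "n \<le> 2 * q * \<mu>'"
    proof -
      have "n < q * (\<mu>' + 1)" unfolding \<mu>'_def using q dividend_less_times_div[of q n] by simp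
      also have "\<dots> \<le> q * (2 * \<mu>')" using \<mu>'(1) by (intro mult_le_mono2) simp
      finally show ?thesis by (simp add: mult_ac)
    qed
    define M where "M = V - \<mu>'"
    have "\<mu>' \<le> V" using \<mu>'(2) by (simp add: V_def)
    then have MV: "V = M + \<mu>'" by (simp add: M_def)
    obtain D :: nat where D: "D \<ge> 1"
      "\<And>i k. i \<le> N \<Longrightarrow> k \<le> V \<Longrightarrow> sized (c1 * fact V powr \<epsilon>1) (of_nat D * (fact k * fps_nth (f ^ i) k))"
      using c1(2)[rule_format, of V] by blast
    define a where "a = (\<lambda>m p. if p mod n \<le> m then of_nat (m choose (p mod n)) *
      (of_nat D * (fact (m - p mod n) * fps_nth (f ^ (p div n)) (m - p mod n))) else 0)"
    define T where "T = nat \<lceil>X n ^ w\<rceil>"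
    have T: "X n ^ w \<le> real T" "real T \<le> X n ^ w + 1"
      using X1[of n] unfolding T_def by (auto simp: real_nat_ceiling_ge)
    have as: "sized (S n) (a m p)" if m: "m < M" and p: "p < V" for m p
    proof (cases "p mod n \<le> m")
      case True
      have "p div n \<le> N" using p n0 unfolding V_def by (metis less_Suc_eq_le less_mult_imp_div_less)
      moreover have "m - p mod n \<le> V" using m MV by simp
      ultimately have "sized (real (m choose (p mod n)) * (c1 * fact V powr \<epsilon>1)) (a m p)"
        unfolding a_def using True by (auto intro!: sized_scale_nat D(2))
      moreover have "real (m choose (p mod n)) * (c1 * fact V powr \<epsilon>1) \<le> S n"
      proof -
        have "m choose (p mod n) \<le> 2 ^ m" by (rule binomial_le_pow2)
        also have "(2::nat) ^ m \<le> 2 ^ V" using m MV by (intro power_increasing) auto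
        finally have "real (m choose (p mod n)) \<le> real (2 ^ V)" by (rule of_nat_mono)
        then show ?thesis unfolding S_def V_def[symmetric] using c1(1) by (intro mult_right_mono) auto
      qed
      ultimately show ?thesis by (rule sized_mono)
    next
      case False
      then show ?thesis using S0[of n] by (simp add: a_def sized_0)
    qed
    have bound: "(2 * (real V * (\<kappa> * S n * real T)) + 1) ^ M < (real T + 1) ^ V"
    proof -
      have "2 * (real V * (\<kappa> * S n * real T)) + 1 \<le> X n * (real T + 1)"
      proof -
        have "X n * (real T + 1) = 2 * (real V * (\<kappa> * S n * real T)) + 1 + (2 * real V * \<kappa> * S n + real T)"
          by (simp add: X_def V_def algebra_simps)
        moreover have "0 \<le> 2 * real V * \<kappa> * S n + real T" using S0[of n] kappa_ge_1 by simp
        ultimately show ?thesis by simp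
      qed
      then have "(2 * (real V * (\<kappa> * S n * real T)) + 1) ^ M \<le> (X n * (real T + 1)) ^ M"
        using S0[of n] kappa_ge_1 by (intro power_mono) auto
      also have "\<dots> = X n ^ M * (real T + 1) ^ M" by (rule power_mult_distrib)
      also have "X n ^ M \<le> (X n ^ w) ^ \<mu>'"
      proof -
        have "M \<le> Suc N * n" by (simp add: M_def V_def)
        also have "\<dots> \<le> Suc N * (2 * q * \<mu>')" using nq by (rule mult_le_mono2)
        also have "\<dots> = w * \<mu>'" by (simp add: w_def mult_ac)
        finally show ?thesis using X1[of n] by (simp add: power_increasing flip: power_mult)
      qed
      also have "(X n ^ w) ^ \<mu>' < (real T + 1) ^ \<mu>'"
        using T(1) X1[of n] \<mu>'(1) by (intro power_strict_mono) auto
      also have "(real T + 1) ^ \<mu>' * (real T + 1) ^ M = (real T + 1) ^ V" by (simp add: MV power_add)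
      finally show ?thesis by (simp add: mult_strict_right_mono)
    qed
    have "0 \<le> S n" using S0[of n] by simp
    from siegel_lemma[of M V "S n" a T, OF as this bound]
    obtain x where x: "\<exists>p<V. x p \<noteq> 0" "\<And>p. p < V \<Longrightarrow> sized (real T) (x p)"
      "\<And>m. m < M \<Longrightarrow> (\<Sum>p<V. a m p * x p) = 0" by blast
    define g where "g = (\<lambda>i j. if i * n + j < V then x (i * n + j) else 0)"
    have xg: "x p = g (p div n) (p mod n)" if "p < V" for p using that by (simp add: g_def)
    have reidx: "(\<Sum>p<V. h (p div n) (p mod n)) = (\<Sum>i\<le>N. \<Sum>j<n. h i j)" for h :: "nat \<Rightarrow> nat \<Rightarrow> complex"
    proof -
      have "(\<Sum>p<V. h (p div n) (p mod n)) = (\<Sum>(i,j)\<in>{..N} \<times> {..<n}. h i j)"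
      proof (rule sum.reindex_bij_witness[where j = "\<lambda>p. (p div n, p mod n)" and i = "\<lambda>(i,j). i * n + j"])
        fix p assume "p \<in> {..<V}"
        then show "(p div n, p mod n) \<in> {..N} \<times> {..<n}"
          using n0 unfolding V_def by (auto simp: less_mult_imp_div_less simp flip: less_Suc_eq_le)
      next
        fix b assume "b \<in> {..N} \<times> {..<n}"
        then obtain i j where b: "b = (i, j)" "i \<le> N" "j < n" by auto
        have "i * n + j < i * n + n" using b(3) by simp
        also have "\<dots> \<le> V" unfolding V_def using mult_le_mono1[of "Suc i" "Suc N" n] b(2) by (simp add: add.commute)
        finally show "(case b of (i, j) \<Rightarrow> i * n + j) \<in> {..<V}" using b by simp
        show "((case b of (i, j) \<Rightarrow> i * n + j) div n, (case b of (i, j) \<Rightarrow> i * n + j) mod n) = b"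
          using b by simp
      qed auto
      then show ?thesis by (simp add: sum.cartesian_product)
    qed
    have "\<exists>i\<le>N. \<exists>j<n. g i j \<noteq> 0"
    proof -
      obtain p where p: "p < V" "x p \<noteq> 0" using x(1) by blast
      have "p div n \<le> N" using p n0 unfolding V_def by (metis less_Suc_eq_le less_mult_imp_div_less)
      moreover have "p mod n < n" using n0 by simp
      ultimately show ?thesis using p xg by metis
    qed
    moreover have "sized (c * fact n powr \<epsilon>) (g i j)" for i j
    proof -
      have "real T \<le> 2 * X n ^ w" using T(2) one_le_power[OF X1[of n], of w] by linarith
      then have "real T \<le> c * fact n powr \<epsilon>" using c(2)[of n] by linarith
      then show ?thesis unfolding g_def using x(2) c(1) by (auto intro: sized_mono sized_0)
    qed
    moreover have "fps_nth (poly (map_poly fps_of_poly (siegel_poly N n g)) f) m = 0" if m: "m < M" for m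
    proof -
      let ?h = "\<lambda>i j. (if j \<le> m then of_nat (m choose j) * (fact (m - j) * fps_nth (f ^ i) (m - j)) else 0) * g i j"
      have "of_nat D * (\<Sum>i\<le>N. \<Sum>j<n. ?h i j) = of_nat D * (\<Sum>p<V. ?h (p div n) (p mod n))"
        by (rule arg_cong[where f = "\<lambda>x. of_nat D * x"], rule reidx[of ?h, symmetric])
      also have "\<dots> = (\<Sum>p<V. a m p * x p)"
        unfolding sum_distrib_left
      proof (rule sum.cong[OF refl])
        fix p assume "p \<in> {..<V}"
        then show "of_nat D * ?h (p div n) (p mod n) = a m p * x p" by (simp add: xg a_def)
      qed
      finally have "(\<Sum>i\<le>N. \<Sum>j<n. ?h i j) = 0" using x(3)[OF m] D(1) by simp
      then have "fact m * fps_nth (poly (map_poly fps_of_poly (siegel_poly N n g)) f) m = 0"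
        unfolding fps_nth_siegel_poly by simp
      then show ?thesis by simp
    qed
    ultimately show ?thesis unfolding M_def V_def \<mu>'_def by blast
  qed
  then show ?thesis using c(1) by blast
qed

lemma sized_poly_mult:
  assumes A: "\<And>l. sized S (coeff A l)" "degree A \<le> s" and p: "\<And>l. sized T (coeff p l)"
  shows "sized (real (Suc s) * (\<kappa> * S * T)) (coeff (A * p) j)"
proof -
  have eq: "coeff (A * p) j = (\<Sum>l\<in>{..j} \<inter> {..s}. coeff A l * coeff p (j - l))"
    unfolding coeff_mult using A(2) by (intro sum.mono_neutral_right) (auto simp: coeff_eq_0)
  have sum: "sized (real (card ({..j} \<inter> {..s})) * (\<kappa> * S * T)) (\<Sum>l\<in>{..j} \<inter> {..s}. coeff A l * coeff p (j - l))"
    by (intro sized_sum_const sized_mult A p)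
  have "card ({..j} \<inter> {..s}) \<le> card {..s}" by (intro card_mono) auto
  moreover have "0 \<le> \<kappa> * S * T" using kappa_ge_1 sized_nonneg[OF A(1)] sized_nonneg[OF p] by simp
  ultimately have "real (card ({..j} \<inter> {..s})) * (\<kappa> * S * T) \<le> real (Suc s) * (\<kappa> * S * T)"
    by (intro mult_right_mono) simp_all
  with sum show ?thesis unfolding eq by (rule sized_mono)
qed

lemma sized_dop:
  assumes ABC: "\<And>l. sized S (coeff A l)" "\<And>l. sized S (coeff B l)" "\<And>l. sized S (coeff C l)"
      "degree A \<le> s" "degree B \<le> s" "degree C \<le> s"
    and P: "\<And>i j. sized T (coeff (coeff P i) j)" "degree P \<le> N" "\<And>i. degree (coeff P i) \<le> t"
  shows "sized (real (Suc s) * \<kappa> * S * (real t + 2 * real N) * T) (coeff (coeff (dop (pder A) B C P) i) j)"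
proof -
  have T: "T \<ge> 0" using sized_nonneg[OF P(1)] .
  have 1: "sized (real (Suc s) * (\<kappa> * S * (real t * T))) (coeff (A * pderiv (coeff P i)) j)"
  proof (rule sized_poly_mult[OF ABC(1,4)])
    fix l
    show "sized (real t * T) (coeff (pderiv (coeff P i)) l)"
    proof (cases "Suc l \<le> t")
      case True
      have "sized (real (Suc l) * T) (of_nat (Suc l) * coeff (coeff P i) (Suc l))" by (rule sized_scale_nat[OF P(1)])
      then show ?thesis unfolding coeff_pderiv
        by (rule sized_mono) (use True T in \<open>intro mult_right_mono; simp\<close>)
    next
      case False
      then have "coeff (coeff P i) (Suc l) = 0" using P(3)[of i] by (intro coeff_eq_0) simp
      then show ?thesis unfolding coeff_pderiv using T by (simp add: sized_0)
    qed
  qed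
  have 2: "sized (real (Suc s) * (\<kappa> * S * (real N * T))) (coeff (q * (of_nat i * coeff P i)) j)"
    if q: "\<And>l. sized S (coeff q l)" "degree q \<le> s" for q i
  proof (rule sized_poly_mult[OF q])
    fix l
    have c: "coeff (of_nat i * coeff P i) l = of_nat i * coeff (coeff P i) l"
      by (simp add: of_nat_poly)
    show "sized (real N * T) (coeff (of_nat i * coeff P i) l)"
    proof (cases "i \<le> N")
      case True
      then show ?thesis unfolding c
        by (intro sized_mono[OF sized_scale_nat[OF P(1)]] mult_right_mono T) simp
    next
      case False
      then have "coeff P i = 0" using P(2) by (intro coeff_eq_0) simp
      then show ?thesis using T by (simp add: sized_0)
    qed
  qed
  have eq: "coeff (dop (pder A) B C P) i = A * pderiv (coeff P i) + B * (of_nat i * coeff P i)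
      + C * (of_nat (Suc i) * coeff P (Suc i))"
    unfolding coeff_dop[OF derivation_pder] pder_def by (simp add: mult_ac)
  have "sized (real (Suc s) * (\<kappa> * S * (real t * T)) + real (Suc s) * (\<kappa> * S * (real N * T))
      + real (Suc s) * (\<kappa> * S * (real N * T))) (coeff (coeff (dop (pder A) B C P) i) j)"
    unfolding eq coeff_add by (intro sized_add 1 2 ABC)
  then show ?thesis by (rule sized_mono) (simp add: algebra_simps)
qed

lemma sized_dop_pow:
  assumes ABC: "\<And>l. sized S (coeff A l)" "\<And>l. sized S (coeff B l)" "\<And>l. sized S (coeff C l)"
      "degree A + degree B + degree C \<le> s" and S: "S \<ge> 1"
    and P: "\<And>i j. sized T (coeff (coeff P i) j)" "degree P \<le> N" "\<And>i. degree (coeff P i) \<le> t"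
    and tk: "t + k * s \<le> t'"
  shows "sized ((real (Suc s) * \<kappa> * S * (real t' + 2 * real N)) ^ k * T) (coeff (coeff ((dop (pder A) B C ^^ k) P) i) j)"
  using tk
proof (induction k arbitrary: i j)
  case (Suc k)
  have degs: "degree (coeff ((dop (pder A) B C ^^ k) P) i) \<le> t'" for i
  proof -
    have "degree (coeff ((dop (pder A) B C ^^ k) P) i) \<le> t + k * (degree A + degree B + degree C)"
      by (rule degree_coeff_dop_pow[OF P(3)])
    also have "\<dots> \<le> t + k * s" using ABC(4) by simp
    also have "\<dots> \<le> t'" using Suc.prems by simp
    finally show ?thesis .
  qed
  have "degree ((dop (pder A) B C ^^ k) P) \<le> N"
    using degree_dop_pow_le[OF derivation_pder[of A], of k B C P] P(2) by simp
  from sized_dop[OF ABC(1-3) _ _ _ Suc.IH this degs, of s] ABC(4) Suc.prems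
  show ?case by (simp add: mult_ac)
qed (use P(1) in simp)

text \<open>The factor \<open>b ^ s\<close> clears the denominator of all powers of \<open>\<alpha>\<close> that occur.\<close>

lemma sized_poly_eval:
  assumes a: "sized a (of_nat b * \<alpha>)" "a \<ge> 1" and b: "b \<ge> 1"
    and p: "\<And>j. sized T (coeff p j)" "degree p \<le> s"
  shows "sized (real (Suc s) * (\<kappa> * T * ((\<kappa> * a * real b) ^ s))) (of_nat b ^ s * poly p \<alpha>)"
proof -
  have pe: "poly p \<alpha> = (\<Sum>j\<le>s. coeff p j * \<alpha> ^ j)"
    unfolding poly_altdef using p(2) by (intro sum.mono_neutral_left) (auto simp: coeff_eq_0)
  have eq: "of_nat b ^ s * poly p \<alpha> = (\<Sum>j\<le>s. coeff p j * (of_nat (b ^ (s - j)) * (of_nat b * \<alpha>) ^ j))"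
    unfolding pe sum_distrib_left
  proof (rule sum.cong[OF refl])
    fix j assume "j \<in> {..s}"
    then have "(of_nat b :: complex) ^ s = of_nat b ^ (s - j) * of_nat b ^ j" by (simp flip: power_add)
    then show "of_nat b ^ s * (coeff p j * \<alpha> ^ j) = coeff p j * (of_nat (b ^ (s - j)) * (of_nat b * \<alpha>) ^ j)"
      by (simp add: power_mult_distrib)
  qed
  have "sized (real (card {..s}) * (\<kappa> * T * ((\<kappa> * a * real b) ^ s))) (of_nat b ^ s * poly p \<alpha>)"
    unfolding eq
  proof (intro sized_sum_const sized_mult p(1))
    fix j assume j: "j \<in> {..s}"
    have "sized (real (b ^ (s - j)) * (\<kappa> * a) ^ j) (of_nat (b ^ (s - j)) * (of_nat b * \<alpha>) ^ j)"
      by (intro sized_scale_nat sized_power a)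
    then show "sized ((\<kappa> * a * real b) ^ s) (of_nat (b ^ (s - j)) * (of_nat b * \<alpha>) ^ j)"
    proof (rule sized_mono)
      have "1 \<le> \<kappa> * a" using mult_mono[of 1 \<kappa> 1 a] kappa_ge_1 a(2) by simp
      then have "(\<kappa> * a) ^ j \<le> (\<kappa> * a) ^ s" using j by (intro power_increasing) auto
      moreover have "real b ^ (s - j) \<le> real b ^ s" using b by (intro power_increasing) auto
      ultimately have "real b ^ (s - j) * (\<kappa> * a) ^ j \<le> real b ^ s * (\<kappa> * a) ^ s"
        using \<open>1 \<le> \<kappa> * a\<close> by (intro mult_mono) auto
      then show "real (b ^ (s - j)) * (\<kappa> * a) ^ j \<le> (\<kappa> * a * real b) ^ s"
        by (simp add: power_mult_distrib mult_ac)
    qed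
  qed
  then show ?thesis by simp
qed

end

section \<open>Weighted coefficient bounds\<close>

text \<open>Cauchy's inequality on the disc of radius \<open>\<rho>\<close>, taken as a condition on the Taylor coefficients.\<close>

definition coeff_bound :: "real \<Rightarrow> real \<Rightarrow> complex fps \<Rightarrow> bool" where
  "coeff_bound \<rho> W F \<longleftrightarrow> (\<forall>m. norm (fps_nth F m) * \<rho> ^ m \<le> W)"

lemma coeff_bound_deriv:
  assumes F: "coeff_bound ((1 + 1 / real k) * \<rho>) W F" and k: "k \<ge> 1" and \<rho>: "\<rho> \<ge> 1"
  shows "coeff_bound \<rho> (real k * W) (fps_deriv F)"
  unfolding coeff_bound_def
proof
  fix m
  let ?x = "norm (fps_nth F (Suc m)) * \<rho> ^ Suc m"
  have W: "(1 + 1 / real k) ^ Suc m * ?x \<le> W"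
    using F unfolding coeff_bound_def by (metis mult.left_commute power_mult_distrib)
  have x0: "0 \<le> ?x" using \<rho> by simp
  have "1 + real (Suc m) * (1 / real k) \<le> (1 + 1 / real k) ^ Suc m"
    by (rule Bernoulli_inequality) (rule order.trans[of _ 0], simp_all)
  then have "real k * (1 + real (Suc m) * (1 / real k)) \<le> real k * (1 + 1 / real k) ^ Suc m"
    by (rule mult_left_mono) simp
  moreover have "real k * (1 + real (Suc m) * (1 / real k)) = real k + real (Suc m)"
    using k by (simp add: distrib_left del: of_nat_Suc)
  ultimately have "real (Suc m) \<le> real k * (1 + 1 / real k) ^ Suc m" by linarith
  then have "real (Suc m) * ?x \<le> (real k * (1 + 1 / real k) ^ Suc m) * ?x" using x0 by (rule mult_right_mono)
  also have "\<dots> \<le> real k * W" using W by (simp add: mult.assoc mult_left_mono)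
  finally have 1: "real (Suc m) * ?x \<le> real k * W" .
  have "norm (fps_nth (fps_deriv F) m) * \<rho> ^ m = real (Suc m) * norm (fps_nth F (Suc m)) * \<rho> ^ m"
    by (simp add: norm_mult del: of_nat_Suc)
  also have "\<dots> \<le> real (Suc m) * norm (fps_nth F (Suc m)) * \<rho> ^ Suc m"
    using \<rho> by (intro mult_left_mono power_increasing) auto
  finally show "norm (fps_nth (fps_deriv F) m) * \<rho> ^ m \<le> real k * W" using 1 by (simp add: mult.assoc)
qed

lemma coeff_bound_poly_mult:
  assumes F: "coeff_bound \<rho> W F" and \<rho>: "\<rho> \<ge> 0"
  shows "coeff_bound \<rho> ((\<Sum>l\<le>degree A. norm (coeff A l) * \<rho> ^ l) * W) (fps_of_poly A * F)"
  unfolding coeff_bound_def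
proof
  fix m
  have W: "W \<ge> 0" using F \<rho> unfolding coeff_bound_def by (meson mult_nonneg_nonneg norm_ge_zero order.trans zero_le_power)
  have "norm (fps_nth (fps_of_poly A * F) m) * \<rho> ^ m \<le> (\<Sum>l=0..m. norm (coeff A l * fps_nth F (m - l))) * \<rho> ^ m"
    unfolding fps_mult_nth fps_of_poly_nth by (rule mult_right_mono[OF norm_sum]) (use \<rho> in simp)
  also have "\<dots> = (\<Sum>l=0..m. (norm (coeff A l) * \<rho> ^ l) * (norm (fps_nth F (m - l)) * \<rho> ^ (m - l)))"
    unfolding sum_distrib_right
  proof (rule sum.cong[OF refl])
    fix l assume "l \<in> {0..m}"
    then have "\<rho> ^ m = \<rho> ^ l * \<rho> ^ (m - l)" by (simp flip: power_add)
    then show "norm (coeff A l * fps_nth F (m - l)) * \<rho> ^ m = (norm (coeff A l) * \<rho> ^ l) * (norm (fps_nth F (m - l)) * \<rho> ^ (m - l))"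
      by (simp add: norm_mult)
  qed
  also have "\<dots> \<le> (\<Sum>l=0..m. (norm (coeff A l) * \<rho> ^ l) * W)"
    using F \<rho> unfolding coeff_bound_def by (intro sum_mono mult_left_mono) auto
  also have "\<dots> \<le> (\<Sum>l\<le>degree A. (norm (coeff A l) * \<rho> ^ l) * W)"
  proof -
    have "(\<Sum>l=0..m. (norm (coeff A l) * \<rho> ^ l) * W) = (\<Sum>l\<in>{0..m} \<inter> {..degree A}. (norm (coeff A l) * \<rho> ^ l) * W)"
      by (rule sum.mono_neutral_right) (auto simp: coeff_eq_0)
    also have "\<dots> \<le> (\<Sum>l\<le>degree A. (norm (coeff A l) * \<rho> ^ l) * W)"
      using W \<rho> by (intro sum_mono2) auto
    finally show ?thesis .
  qed
  finally show "norm (fps_nth (fps_of_poly A * F) m) * \<rho> ^ m \<le> (\<Sum>l\<le>degree A. norm (coeff A l) * \<rho> ^ l) * W"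
    by (simp add: sum_distrib_right)
qed

lemma coeff_bound_mono_radius: "coeff_bound \<rho>' W F \<Longrightarrow> 0 \<le> \<rho> \<Longrightarrow> \<rho> \<le> \<rho>' \<Longrightarrow> coeff_bound \<rho> W F"
  unfolding coeff_bound_def by (meson mult_left_mono norm_ge_zero order.trans power_mono)

lemma coeff_bound_mono: "coeff_bound \<rho> W F \<Longrightarrow> W \<le> W' \<Longrightarrow> coeff_bound \<rho> W' F"
  unfolding coeff_bound_def by (meson order.trans)

text \<open>Each of \<open>k\<close> differentiations shrinks the radius by the factor \<open>1 + 1 / k\<close> only, which costs
  a factor \<open>k\<close>; all of them together stay within the factor \<open>3 > e\<close>.\<close>

lemma coeff_bound_fder_pow:
  assumes F: "coeff_bound (3 * \<rho>) W F" and \<rho>: "\<rho> \<ge> 1"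
  shows "coeff_bound \<rho> ((real k * (\<Sum>l\<le>degree A. norm (coeff A l) * (3 * \<rho>) ^ l)) ^ k * W)
    (((\<lambda>u. fps_of_poly A * fps_deriv u) ^^ k) F)"
proof (cases "k = 0")
  case True
  then show ?thesis using coeff_bound_mono_radius[OF F] \<rho> by simp
next
  case False
  define \<eta> where "\<eta> = 1 + 1 / real k"
  define a where "a = (\<Sum>l\<le>degree A. norm (coeff A l) * (3 * \<rho>) ^ l)"
  have \<eta>: "\<eta> \<ge> 1" by (simp add: \<eta>_def)
  have a0: "a \<ge> 0" unfolding a_def using \<rho> by (intro sum_nonneg) auto
  have \<eta>k: "\<eta> ^ k \<le> 3"
  proof -
    have "\<eta> ^ k \<le> exp (1 / real k) ^ k"
      unfolding \<eta>_def by (intro power_mono) (auto intro: exp_ge_add_one_self)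
    also have "\<dots> = exp 1" using False by (simp flip: exp_of_nat_mult)
    finally show ?thesis using exp_le by linarith
  qed
  have W: "W \<ge> 0" using F \<rho> unfolding coeff_bound_def by (meson mult_nonneg_nonneg norm_ge_zero order.trans zero_le_power zero_le_mult_iff zero_le_numeral zero_le_one)
  have "coeff_bound (\<eta> ^ (k - j) * \<rho>) ((real k * a) ^ j * W) (((\<lambda>u. fps_of_poly A * fps_deriv u) ^^ j) F)" if "j \<le> k" for j
    using that
  proof (induction j)
    case 0
    have "\<eta> ^ k * \<rho> \<le> 3 * \<rho>" using \<eta>k \<rho> by (intro mult_right_mono) auto
    then show ?case using coeff_bound_mono_radius[OF F, of "\<eta> ^ k * \<rho>"] \<eta> \<rho> by simp
  next
    case (Suc j)
    let ?r = "\<eta> ^ (k - Suc j) * \<rho>" and ?F = "((\<lambda>u. fps_of_poly A * fps_deriv u) ^^ j) F"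
    have r1: "?r \<ge> 1" using \<eta> \<rho> one_le_power[OF \<eta>, of "k - Suc j"] mult_mono[of 1 "\<eta> ^ (k - Suc j)" 1 \<rho>] by simp
    have r3: "?r \<le> 3 * \<rho>"
    proof -
      have "\<eta> ^ (k - Suc j) \<le> \<eta> ^ k" using \<eta> by (intro power_increasing) auto
      then show ?thesis using \<eta>k \<rho> by (intro mult_right_mono) auto
    qed
    have "k - j = Suc (k - Suc j)" using Suc.prems by simp
    then have "coeff_bound ((1 + 1 / real k) * ?r) ((real k * a) ^ j * W) ?F"
      using Suc by (simp add: \<eta>_def[symmetric] mult.assoc)
    then have d: "coeff_bound ?r (real k * ((real k * a) ^ j * W)) (fps_deriv ?F)"
      by (rule coeff_bound_deriv) (use False r1 in auto)
    have "coeff_bound ?r ((\<Sum>l\<le>degree A. norm (coeff A l) * ?r ^ l) * (real k * ((real k * a) ^ j * W)))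
        (fps_of_poly A * fps_deriv ?F)"
      by (rule coeff_bound_poly_mult[OF d]) (use r1 in simp)
    moreover have "(\<Sum>l\<le>degree A. norm (coeff A l) * ?r ^ l) \<le> a"
      unfolding a_def using r1 r3 by (intro sum_mono mult_left_mono power_mono) auto
    then have "(\<Sum>l\<le>degree A. norm (coeff A l) * ?r ^ l) * (real k * ((real k * a) ^ j * W)) \<le> a * (real k * ((real k * a) ^ j * W))"
      using a0 W by (intro mult_right_mono) auto
    ultimately have "coeff_bound ?r (a * (real k * ((real k * a) ^ j * W))) (fps_of_poly A * fps_deriv ?F)"
      by (rule coeff_bound_mono)
    then show ?case by (simp add: mult_ac)
  qed
  from this[of k] show ?thesis by (simp add: a_def)
qed

lemma norm_eval_fps_le:
  assumes F: "coeff_bound \<rho> W F" and z: "2 * norm z \<le> \<rho>" and \<rho>: "\<rho> > 0"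
  shows "norm (eval_fps F z) \<le> 2 * W"
proof -
  have "norm (fps_nth F m * z ^ m) \<le> W * (1 / 2) ^ m" for m
  proof -
    have "norm (fps_nth F m * z ^ m) \<le> norm (fps_nth F m) * (\<rho> / 2) ^ m"
      unfolding norm_mult norm_power using z by (intro mult_left_mono power_mono) auto
    also have "\<dots> = (norm (fps_nth F m) * \<rho> ^ m) * (1 / 2) ^ m" by (simp add: power_divide)
    also have "\<dots> \<le> W * (1 / 2) ^ m" using F unfolding coeff_bound_def by (intro mult_right_mono) auto
    finally show ?thesis .
  qed
  moreover have "(\<lambda>m. W * (1 / 2) ^ m) sums (W * (1 / (1 - 1 / 2)))"
    by (intro sums_mult geometric_sums) simp
  ultimately show ?thesis unfolding eval_fps_def
    using norm_suminf_le[of "\<lambda>m. fps_nth F m * z ^ m" "\<lambda>m. W * (1 / 2) ^ m"]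
    by (simp add: sums_iff)
qed

section \<open>Further estimates for factorials\<close>

lemma fgrowth_power_div:
  assumes q: "q \<ge> 1"
  shows "fgrowth (1 / real q) (\<lambda>n. real n ^ (n div q))"
proof (rule fgrowthI[of "exp 1"])
  fix n
  define x where "x = real n ^ (n div q)"
  have x0: "x > 0" unfolding x_def by (cases "n = 0") auto
  have "x ^ q \<le> real n ^ n"
  proof (cases "n = 0")
    case False
    have "x ^ q = real n ^ ((n div q) * q)" by (simp add: x_def power_mult)
    also have "\<dots> \<le> real n ^ n" using False by (intro power_increasing) auto
    finally show ?thesis .
  qed (simp add: x_def)
  also have "\<dots> \<le> exp 1 ^ n * fact n" by (rule power_self_le)
  finally have "(x ^ q) powr (1 / real q) \<le> (exp 1 ^ n * fact n) powr (1 / real q)"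
    using x0 by (intro powr_mono2) auto
  also have "(x ^ q) powr (1 / real q) = x"
    using x0 q by (simp add: powr_powr flip: powr_realpow)
  also have "(exp 1 ^ n * fact n) powr (1 / real q) = (exp 1 ^ n) powr (1 / real q) * fact n powr (1 / real q)"
    by (simp add: powr_mult)
  also have "\<dots> \<le> exp 1 ^ Suc n * fact n powr (1 / real q)"
  proof (rule mult_right_mono)
    have e1: "(1::real) \<le> exp 1 ^ n" by (rule one_le_power) simp
    have "(exp 1 ^ n) powr (1 / real q) \<le> (exp 1 ^ n :: real) powr 1"
      using e1 q by (intro powr_mono) auto
    also have "\<dots> = exp 1 ^ n" using e1 by simp
    also have "\<dots> \<le> exp 1 ^ Suc n" by (intro power_increasing) auto
    finally show "(exp 1 ^ n) powr (1 / real q) \<le> exp (1::real) ^ Suc n" .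
  qed simp
  finally show "real n ^ (n div q) \<le> exp 1 ^ Suc n * fact n powr (1 / real q)" by (simp add: x_def)
qed auto

text \<open>Together with the next lemma this compares \<open>K!\<close> with \<open>n! ^ (N + 1)\<close> when \<open>K\<close> is slightly smaller than
  \<open>(N + 1) * n\<close>.\<close>

lemma fact_add_le: "fact (k + r) \<le> fact k * real (k + r) ^ r"
proof (induction r)
  case (Suc r)
  have "fact (k + Suc r) = real (k + Suc r) * fact (k + r)" by simp
  also have "\<dots> \<le> real (k + Suc r) * (fact k * real (k + r) ^ r)" by (intro mult_left_mono Suc.IH) simp
  also have "\<dots> \<le> real (k + Suc r) * (fact k * real (k + Suc r) ^ r)"
    by (intro mult_left_mono power_mono) auto
  finally show ?case by (simp add: mult_ac)
qed simp

lemma fact_power_le: "fact n ^ m \<le> (fact (m * n) :: real)"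
proof (induction m)
  case (Suc m)
  have "fact n * fact (m * n) dvd (fact (n + m * n) :: nat)" by (rule fact_fact_dvd_fact)
  then have "fact n * fact (m * n) \<le> (fact (n + m * n) :: nat)" by (rule dvd_imp_le) simp
  then have "real (fact n * fact (m * n)) \<le> real (fact (n + m * n))" by (rule of_nat_mono)
  then have 1: "fact n * fact (m * n) \<le> (fact (Suc m * n) :: real)" by simp
  have 2: "fact n * fact n ^ m \<le> fact n * (fact (m * n) :: real)" by (intro mult_left_mono Suc.IH) simp
  show ?case unfolding power_Suc by (rule order.trans[OF 2 1])
qed simp

section \<open>Evaluation of the auxiliary forms\<close>

lemma conv_radius_if_coeff_bound:
  assumes "\<And>\<rho>. \<rho> > 0 \<Longrightarrow> \<exists>W. coeff_bound \<rho> W F"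
  shows "fps_conv_radius F = \<infinity>"
proof -
  have "conv_radius (fps_nth F) \<ge> \<infinity>"
  proof (rule conv_radius_geI_ex)
    fix r :: real assume r: "0 < r"
    then obtain W where W: "coeff_bound (2 * r) W F" using assms[of "2 * r"] by auto
    have "summable (\<lambda>m. W * (1 / 2 :: real) ^ m)" by (intro summable_mult summable_geometric) simp
    then have "summable (\<lambda>m. fps_nth F m * of_real r ^ m)"
    proof (rule summable_comparison_test')
      fix m
      have "norm (fps_nth F m * of_real r ^ m) = (norm (fps_nth F m) * (2 * r) ^ m) * (1 / 2) ^ m"
        using r by (simp add: norm_mult norm_power power_mult_distrib power_divide)
      also have "\<dots> \<le> W * (1 / 2) ^ m" using W unfolding coeff_bound_def by (intro mult_right_mono) auto
      finally show "norm (fps_nth F m * of_real r ^ m) \<le> W * (1 / 2) ^ m" .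
    qed
    then show "\<exists>z. norm z = r \<and> summable (\<lambda>n. fps_nth F n * z ^ n)"
      using r by (intro exI[of _ "of_real r"]) auto
  qed
  then show ?thesis by (simp add: fps_conv_radius_def)
qed

lemma eval_fps_poly:
  assumes f: "fps_conv_radius f = \<infinity>"
  shows "fps_conv_radius (poly (map_poly fps_of_poly Q) f) = \<infinity> \<and>
    eval_fps (poly (map_poly fps_of_poly Q) f) \<alpha> = poly (eval_coeffs \<alpha> Q) (eval_fps f \<alpha>)"
proof (induction Q)
  case 0
  then show ?case by (simp add: eval_coeffs_def)
next
  case (pCons a Q)
  let ?F = "poly (map_poly fps_of_poly Q) f"
  have eq: "poly (map_poly fps_of_poly (pCons a Q)) f = fps_of_poly a + f * ?F"
  proof -
    have "map_poly fps_of_poly (pCons a Q) = pCons (fps_of_poly a) (map_poly fps_of_poly Q)"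
      by (intro poly_eqI) (simp add: coeff_map_poly coeff_pCons split: nat.split)
    then show ?thesis by simp
  qed
  have m: "fps_conv_radius (f * ?F) = \<infinity>"
    using fps_conv_radius_mult[of f ?F] f pCons.IH by simp
  have r: "fps_conv_radius (fps_of_poly a + f * ?F) = \<infinity>"
    using fps_conv_radius_add[of "fps_of_poly a" "f * ?F"] m by simp
  have "eval_fps (fps_of_poly a + f * ?F) \<alpha> = poly a \<alpha> + eval_fps f \<alpha> * eval_fps ?F \<alpha>"
    using f pCons.IH m by (subst eval_fps_add) (auto simp: eval_fps_mult)
  moreover have "eval_coeffs \<alpha> (pCons a Q) = pCons (poly a \<alpha>) (eval_coeffs \<alpha> Q)"
    by (intro poly_eqI) (simp add: coeff_eval_coeffs coeff_pCons split: nat.split)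
  ultimately show ?case using r pCons.IH by (simp add: eq)
qed

lemma fps_fder_pow_poly:
  assumes "fps_of_poly A * fps_deriv f = fps_of_poly B * f + fps_of_poly C"
  shows "((\<lambda>u. fps_of_poly A * fps_deriv u) ^^ k) (poly (map_poly fps_of_poly Q) f) =
    poly (map_poly fps_of_poly ((dop (pder A) B C ^^ k) Q)) f"
proof -
  let ?\<delta> = "\<lambda>u :: complex fps. fps_of_poly A * fps_deriv u"
  have der: "derivation ?\<delta>" unfolding derivation_def by (auto simp: algebra_simps)
  have hom: "comm_ring_hom (fps_of_poly :: complex poly \<Rightarrow> complex fps)"
    by unfold_locales (simp_all add: fps_of_poly_add fps_of_poly_mult)
  have c: "fps_of_poly (pder A a) = ?\<delta> (fps_of_poly a)" for a
    by (simp add: pder_def fps_of_poly_mult fps_of_poly_pderiv)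
  have "map_poly fps_of_poly ((dop (pder A) B C ^^ k) Q) =
      (dop ?\<delta> (fps_of_poly B) (fps_of_poly C) ^^ k) (map_poly fps_of_poly Q)"
    using map_poly_dop_pow[where h = fps_of_poly and \<delta> = "pder A" and \<delta>' = ?\<delta> and B = B and C = C and k = k and P = Q]
      hom derivation_pder der c by blast
  then show ?thesis using poly_dop_pow[where \<delta> = ?\<delta> and y = f and k = k and P = "map_poly fps_of_poly Q", OF der assms]
    by simp
qed

context order_gen
begin

lemma E_function_entire:
  assumes E: "E_function f" and fL: "\<And>n. fps_nth f n \<in> rat_adjoin \<theta>"
  shows "fps_conv_radius f = \<infinity>"
proof (rule conv_radius_if_coeff_bound)
  fix r :: real assume r: "r > 0"
  define \<epsilon> :: real where "\<epsilon> = 1 / 2"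
  have \<epsilon>: "\<epsilon> > 0" by (simp add: \<epsilon>_def)
  obtain c6 where c6: "c6 \<ge> 1" "\<And>m. (r + 1) ^ m \<le> c6 * fact m powr \<epsilon>"
    using power_le_fact_powr[of "r + 1" \<epsilon>] r \<epsilon> by auto
  from E_function_sized[OF E fL \<epsilon>] obtain cc where cc: "cc \<ge> 1"
    "\<forall>n. \<exists>D::nat. D \<ge> 1 \<and> real D \<le> cc * fact n powr \<epsilon> \<and>
      (\<forall>k\<le>n. sized (cc * fact n powr \<epsilon>) (of_nat D * (fact k * fps_nth f k)))"
    by (elim exE conjE) (rule that)
  have "norm (fps_nth f m) * r ^ m \<le> \<kappa> * cc * c6" for m
  proof -
    from cc(2)[rule_format, of m] obtain D :: nat where D: "D \<ge> 1"
      "\<forall>j\<le>m. sized (cc * fact m powr \<epsilon>) (of_nat D * (fact j * fps_nth f j))" by blast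
    have "1 * norm (fact m * fps_nth f m) \<le> real D * norm (fact m * fps_nth f m)"
      using D(1) by (intro mult_right_mono) auto
    also have "\<dots> = norm (of_nat D * (fact m * fps_nth f m))" by (simp add: norm_mult)
    also have "\<dots> \<le> \<kappa> * (cc * fact m powr \<epsilon>)" using D(2) by (intro sized_norm) auto
    finally have 1: "fact m * norm (fps_nth f m) \<le> \<kappa> * cc * fact m powr \<epsilon>"
      by (simp add: norm_mult mult.assoc)
    have "r ^ m \<le> (r + 1) ^ m" using r by (intro power_mono) auto
    then have 2: "r ^ m \<le> c6 * fact m powr \<epsilon>" using c6(2)[of m] by linarith
    have "fact m * norm (fps_nth f m) * r ^ m \<le> (\<kappa> * cc * fact m powr \<epsilon>) * (c6 * fact m powr \<epsilon>)"
      by (rule mult_mono[OF 1 2]) (use r kappa_ge_1 cc(1) in auto)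
    also have "\<dots> = \<kappa> * cc * c6 * (fact m powr \<epsilon> * fact m powr \<epsilon>)" by (simp only: mult_ac)
    also have "fact m powr \<epsilon> * fact m powr \<epsilon> = (fact m :: real)"
      unfolding powr_add[symmetric] by (simp add: \<epsilon>_def)
    finally have "fact m * (norm (fps_nth f m) * r ^ m) \<le> fact m * (\<kappa> * cc * c6)" by (simp add: mult_ac)
    then show ?thesis by (simp add: mult_le_cancel_left_pos)
  qed
  then show "\<exists>W. coeff_bound r W f" unfolding coeff_bound_def by blast
qed

text \<open>The values at \<open>\<alpha>\<close> of the derivatives of order at most \<open>n div q + e1\<close> of the auxiliary form, freed from
  denominators. There are few enough differentiations for their cost, about \<open>n ^ (n div q)\<close>, to be an
  arbitrarily small power of \<open>n!\<close>. The sizes come from the coefficients of the form, about \<open>n!\<close>. The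
  values come from the order of vanishing: the Taylor coefficients start at about \<open>(N + 1) * n\<close>, and
  there the division by \<open>m!\<close> gains \<open>n! ^ (N + 1)\<close> over a numerator of size about \<open>n!\<close>.\<close>

lemma small_forms:
  assumes E: "E_function f" and fL: "\<And>n. fps_nth f n \<in> rat_adjoin \<theta>"
    and A: "A \<noteq> 0" and ode: "fps_of_poly A * fps_deriv f = fps_of_poly B * f + fps_of_poly C"
    and tr: "transcendental_fps f"
    and ABC: "\<And>l. sized S (coeff A l)" "\<And>l. sized S (coeff B l)" "\<And>l. sized S (coeff C l)" and S: "S \<ge> 1"
    and \<alpha>: "\<alpha> \<noteq> 0" "poly A \<alpha> \<noteq> 0" and a: "sized a (of_nat b * \<alpha>)" "a \<ge> 1" and b: "b \<ge> 1"
    and \<eta>: "\<eta> > 0"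
  shows "\<exists>c\<ge>1. \<exists>n0. \<forall>n\<ge>n0. \<exists>V. (\<forall>P. degree P \<le> N \<longrightarrow> P \<in> cpoly_vs.span V) \<and>
    (\<forall>r\<in>V. degree r \<le> N \<and> (\<forall>i. sized (c * fact n powr (1 + \<eta>)) (coeff r i)) \<and>
      norm (poly r (eval_fps f \<alpha>)) \<le> c * fact n powr (\<eta> - real N))"
proof -
  \<comment> \<open>The three sources of loss, namely \<open>n ^ (n div q)\<close>, powers \<open>n! ^ \<epsilon>\<close> and exponential factors, get
    a share of \<open>\<eta>\<close> each. The summand 2 makes \<open>n div q\<close> at most \<open>n / 2\<close>, as the zero estimate requires.\<close>
  define q where "q = nat \<lceil>4 / \<eta>\<rceil> + 2"
  have q: "q \<ge> 2" by (simp add: q_def)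
  have q\<eta>: "1 / real q \<le> \<eta> / 4"
  proof -
    have "4 / \<eta> \<le> real q" unfolding q_def by linarith
    then show ?thesis using \<eta> q by (simp add: field_simps)
  qed
  define \<epsilon> where "\<epsilon> = min (1 / 4) (\<eta> / 4 / real (2 * N + 3))"
  have \<epsilon>: "\<epsilon> > 0" "2 * \<epsilon> \<le> 1" using \<eta> by (auto simp: \<epsilon>_def)
  have \<epsilon>\<eta>: "real (2 * N + 3) * \<epsilon> \<le> \<eta> / 4"
  proof -
    have "real (2 * N + 3) * \<epsilon> \<le> real (2 * N + 3) * (\<eta> / 4 / real (2 * N + 3))"
      by (intro mult_left_mono) (auto simp: \<epsilon>_def)
    also have "\<dots> = \<eta> / 4"
    proof -
      have "real (2 * N + 3) \<noteq> 0" by linarith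
      then show ?thesis by (metis nonzero_mult_div_cancel_left times_divide_eq_right)
    qed
    finally show ?thesis .
  qed
  have \<epsilon>\<eta>1: "\<epsilon> \<le> \<eta> / 4"
  proof -
    have "1 * \<epsilon> \<le> real (2 * N + 3) * \<epsilon>" using \<epsilon> by (intro mult_right_mono) auto
    then show ?thesis using \<epsilon>\<eta> by linarith
  qed
  have q1: "q \<ge> 1" using q by simp
  from siegel_form[OF E fL \<epsilon>(1) q1, of N] obtain c1 where c1: "c1 \<ge> 1"
    "\<forall>n\<ge>q. \<exists>g. (\<exists>i\<le>N. \<exists>j<n. g i j \<noteq> 0) \<and> (\<forall>i j. sized (c1 * fact n powr \<epsilon>) (g i j)) \<and>
    (\<forall>m < Suc N * n - n div q. fps_nth (poly (map_poly fps_of_poly (siegel_poly N n g)) f) m = 0)"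
    by (elim exE conjE) (rule that)
  from E_function_powers_sized[OF E fL \<epsilon>(1), of N] obtain c2 where c2: "c2 \<ge> 1"
    "\<forall>n. \<exists>D::nat. D \<ge> 1 \<and> real D \<le> c2 * fact n powr \<epsilon> \<and>
    (\<forall>i\<le>N. \<forall>k\<le>n. sized (c2 * fact n powr \<epsilon>) (of_nat D * (fact k * fps_nth (f ^ i) k)))"
    by (elim exE conjE) (rule that)
  from zero_estimate[OF A ode tr, of N] obtain c0 :: nat where c0:
    "\<forall>Q n K. Q \<noteq> 0 \<longrightarrow> degree Q \<le> N \<longrightarrow> (\<forall>i. degree (coeff Q i) \<le> n) \<longrightarrow>
    (\<forall>i<K. fps_nth (poly (map_poly fps_of_poly Q) f) i = 0) \<longrightarrow> N * n + c0 < K \<longrightarrow>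
    dt (Suc N) (\<lambda>k i. coeff ((dop (pder A) B C ^^ k) Q) i) \<noteq> 0"
    by (elim exE) (rule that)
  have fk: "norm (fact k * fps_nth (f ^ i) k) \<le> \<kappa> * (c2 * fact k powr \<epsilon>)" if i: "i \<le> N" for i k
  proof -
    from c2(2)[rule_format, of k] obtain D :: nat where D: "D \<ge> 1"
      "\<forall>i\<le>N. \<forall>j\<le>k. sized (c2 * fact k powr \<epsilon>) (of_nat D * (fact j * fps_nth (f ^ i) j))" by blast
    have "1 * norm (fact k * fps_nth (f ^ i) k) \<le> real D * norm (fact k * fps_nth (f ^ i) k)"
      using D(1) by (intro mult_right_mono) auto
    also have "\<dots> = norm (of_nat D * (fact k * fps_nth (f ^ i) k))" by (simp add: norm_mult)
    also have "\<dots> \<le> \<kappa> * (c2 * fact k powr \<epsilon>)" using D(2) i by (intro sized_norm) auto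
    finally show ?thesis by simp
  qed
  define s where "s = degree A + degree B + degree C"
  define e1 where "e1 = Suc N * (N * s) + 2 * N"
  \<comment> \<open>The radius is at least twice the modulus of \<open>\<alpha>\<close> for a geometric series, and \<open>R\<close> leaves room for the
    loss of radius by differentiation.\<close>
  define \<rho> where "\<rho> = 2 + 2 * norm \<alpha>"
  define R where "R = 3 * \<rho>"
  have \<rho>: "\<rho> \<ge> 1" "2 * norm \<alpha> \<le> \<rho>" "R \<ge> 1" by (auto simp: \<rho>_def R_def)
  define a' where "a' = (\<Sum>l\<le>degree A. norm (coeff A l) * R ^ l)"
  have a': "a' \<ge> 0" unfolding a'_def using \<rho> by (intro sum_nonneg) auto
  obtain c5 where c5: "c5 \<ge> 1" "\<And>m. (2 * R) ^ m \<le> c5 * fact m powr \<epsilon>"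
    using power_le_fact_powr[of "2 * R" \<epsilon>] \<rho> \<epsilon> by auto
  have cr: "fps_conv_radius f = \<infinity>" by (rule E_function_entire[OF E fL])
  define c4 where "c4 = real (Suc s) * \<kappa> * S * real (1 + s + e1 * s + 2 * N) + real (1 + e1) * (a' + 1)"
  have c4: "c4 \<ge> 1"
  proof -
    have "0 \<le> real (Suc s) * \<kappa> * S * real (1 + s + e1 * s + 2 * N)" using kappa_ge_1 S by simp
    moreover have "1 * 1 \<le> real (1 + e1) * (a' + 1)" using a' by (intro mult_mono) auto
    ultimately show ?thesis by (simp add: c4_def)
  qed
  \<comment> \<open>A bound for the cost of up to \<open>n div q + e1\<close> differentiations, both for sizes and for values.\<close>
  define Y where "Y = (\<lambda>n. c4 ^ n * c4 ^ e1 * (real n ^ (n div q) * real n ^ e1))"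
  have gY: "fgrowth (1 / real q) Y"
  proof -
    have "fgrowth (0 + 0 + (1 / real q + real e1 * 0)) Y"
      unfolding Y_def
      by (intro fgrowth_mult fgrowth_exp fgrowth_const fgrowth_power fgrowth_n fgrowth_power_div q1) (use c4 in auto)
    then show ?thesis by simp
  qed
  have Ybound: "x ^ k \<le> Y n" if x: "0 \<le> x" "x \<le> c4 * real n" and k: "k \<le> n div q + e1" and n: "n \<ge> 1" for x k n
  proof -
    have cn: "1 * 1 \<le> c4 * real n" using c4 n by (intro mult_mono) auto
    have "x ^ k \<le> (c4 * real n) ^ k" using x by (intro power_mono) auto
    also have "\<dots> \<le> (c4 * real n) ^ (n div q + e1)" using k cn by (intro power_increasing) auto
    also have "\<dots> = c4 ^ (n div q) * (c4 ^ e1 * (real n ^ (n div q) * real n ^ e1))"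
      by (simp add: power_add power_mult_distrib mult_ac)
    also have "\<dots> \<le> c4 ^ n * (c4 ^ e1 * (real n ^ (n div q) * real n ^ e1))"
      using c4 by (intro mult_right_mono power_increasing) auto
    finally show ?thesis by (simp add: Y_def mult_ac)
  qed
  define t where "t = (\<lambda>n. n + (n + e1) * s)"
  define T0 where "T0 = (\<lambda>n. fact n * (c1 * fact n powr \<epsilon>))"
  have gexp: "fgrowth 0 (\<lambda>n. x ^ t n)" if "x \<ge> 0" for x :: real
  proof -
    have "fgrowth (0 + 0) (\<lambda>n. x ^ (e1 * s) * (x ^ (1 + s)) ^ n)"
      by (intro fgrowth_mult fgrowth_const fgrowth_exp) (use that in auto)
    moreover have "x ^ (e1 * s) * (x ^ (1 + s)) ^ n = x ^ t n" for n
      by (simp add: t_def algebra_simps flip: power_add power_mult)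
    ultimately show ?thesis by simp
  qed
  have gfact: "fgrowth 1 (\<lambda>n. fact n)" by (rule fgrowthI[of 1]) auto
  have gT0: "fgrowth (1 + \<epsilon>) T0"
    using fgrowth_mult[OF gfact fgrowth_mult[OF fgrowth_const[of c1] fgrowth_fact_powr[of \<epsilon>]]] c1(1)
    unfolding T0_def by simp
  define u1 where "u1 = (\<lambda>n. real (Suc (t n)) * (\<kappa> * (Y n * T0 n) * ((\<kappa> * a * real b) ^ t n)))"
  have "fgrowth (1 + \<eta> / 2) u1"
  proof -
    have "fgrowth 0 (\<lambda>n. (1 + real (e1 * s)) + real (1 + s) * real n)"
    proof (rule fgrowth_add)
      show "fgrowth 0 (\<lambda>_. 1 + real (e1 * s))" by (rule fgrowth_const) (simp only: of_nat_0_le_iff add_nonneg_nonneg zero_le_one)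
      have "fgrowth (0 + 0) (\<lambda>n. real (1 + s) * real n)" by (intro fgrowth_mult fgrowth_const fgrowth_n) (simp only: of_nat_0_le_iff)
      then show "fgrowth 0 (\<lambda>n. real (1 + s) * real n)" by (simp only: add_0_left)
    qed
    then have "fgrowth 0 (\<lambda>n. real (Suc (t n)))"
      by (rule fgrowth_le) (simp_all add: t_def algebra_simps)
    then have "fgrowth (0 + (0 + (1 / real q + (1 + \<epsilon>)) + 0)) u1"
      unfolding u1_def
      by (intro fgrowth_mult gY gT0 gexp fgrowth_const) (use kappa_ge_1 a in auto)
    then show ?thesis by (rule fgrowth_mono) (use q\<eta> \<epsilon>\<eta>1 in simp)
  qed
  moreover have "1 + \<eta> / 2 + \<eta> / 2 = 1 + \<eta>" by simp
  ultimately have "\<exists>c\<ge>1. \<forall>n. u1 n \<le> c * fact n powr (1 + \<eta>)"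
    using fgrowth_absorb[of "1 + \<eta> / 2" u1 "\<eta> / 2"] \<eta> by (simp add: add.commute)
  then obtain c7 where c7: "c7 \<ge> 1" "\<And>n. u1 n \<le> c7 * fact n powr (1 + \<eta>)" by blast
  define G where "G = \<kappa> * c2 * (\<kappa> * c1) * c5 * real (Suc N)"
  have G0: "G \<ge> 0" unfolding G_def using kappa_ge_1 c1 c2 c5 by simp
  \<comment> \<open>A bound for the Taylor coefficients of the auxiliary form, weighted by the powers of \<open>R\<close>.\<close>
  define W where "W = (\<lambda>n. G * (fact n * fact n powr \<epsilon> * real n *
    (fact (Suc N * n) powr (2 * \<epsilon>) * (real (Suc N) ^ n * real n ^ (n div q)) * fact n powr (- real (Suc N)))))"
  have gW: "fgrowth (0 + (1 + \<epsilon> + 0 + (real (Suc N) * (2 * \<epsilon>) + (0 + 1 / real q) + - real (Suc N)))) W"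
    unfolding W_def
    by (intro fgrowth_mult fgrowth_const gfact fgrowth_fact_powr fgrowth_n fgrowth_fact_mult fgrowth_exp fgrowth_power_div q1)
      (use G0 \<epsilon> in auto)
  define u2 where "u2 = (\<lambda>n. real b ^ t n * (2 * (Y n * W n)))"
  have "fgrowth (\<eta> * 3 / 4 - real N) u2"
  proof -
    have "fgrowth (0 + (0 + (1 / real q + (0 + (1 + \<epsilon> + 0 + (real (Suc N) * (2 * \<epsilon>) + (0 + 1 / real q) + - real (Suc N))))))) u2"
      unfolding u2_def by (intro fgrowth_mult gexp fgrowth_const gY gW) auto
    then show ?thesis
    proof (rule fgrowth_mono)
      have "\<epsilon> + real (Suc N) * (2 * \<epsilon>) = real (2 * N + 3) * \<epsilon>" by (simp add: algebra_simps)
      then show "0 + (0 + (1 / real q + (0 + (1 + \<epsilon> + 0 + (real (Suc N) * (2 * \<epsilon>) + (0 + 1 / real q) + - real (Suc N)))))) \<le> \<eta> * 3 / 4 - real N"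
        using q\<eta> \<epsilon>\<eta> by simp
    qed
  qed
  moreover have "\<eta> * 3 / 4 - real N + \<eta> / 4 = \<eta> - real N" by simp
  ultimately have "\<exists>c\<ge>1. \<forall>n. u2 n \<le> c * fact n powr (\<eta> - real N)"
    using fgrowth_absorb[of "\<eta> * 3 / 4 - real N" u2 "\<eta> / 4"] \<eta> by simp
  then obtain c8 where c8: "c8 \<ge> 1" "\<And>n. u2 n \<le> c8 * fact n powr (\<eta> - real N)" by blast
  define c where "c = max c7 c8"
  define n0 where "n0 = max q (2 * c0 + 2)"
  have "\<exists>V. (\<forall>P. degree P \<le> N \<longrightarrow> P \<in> cpoly_vs.span V) \<and>
    (\<forall>r\<in>V. degree r \<le> N \<and> (\<forall>i. sized (c * fact n powr (1 + \<eta>)) (coeff r i)) \<and>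
      norm (poly r (eval_fps f \<alpha>)) \<le> c * fact n powr (\<eta> - real N))" if n: "n \<ge> n0" for n
  proof -
    have nq: "n \<ge> q" and n1: "n \<ge> 1" and nc: "n \<ge> 2 * c0 + 2" using n q by (auto simp: n0_def)
    from c1(2)[rule_format, OF nq] obtain g where "(\<exists>i\<le>N. \<exists>j<n. g i j \<noteq> 0) \<and>
      (\<forall>i j. sized (c1 * fact n powr \<epsilon>) (g i j)) \<and>
      (\<forall>m < Suc N * n - n div q. fps_nth (poly (map_poly fps_of_poly (siegel_poly N n g)) f) m = 0)"
      by (elim exE) (rule that)
    note g = this[THEN conjunct1] this[THEN conjunct2, THEN conjunct1] this[THEN conjunct2, THEN conjunct2]
    define Q where "Q = siegel_poly N n g"
    define K where "K = Suc N * n - n div q"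
    let ?D = "dop (pder A) B C"
    let ?F = "poly (map_poly fps_of_poly Q) f"
    have ndq: "n div q \<le> n div 2" using q by (intro div_le_mono2) auto
    then have ndq': "n div q \<le> n" by (meson div_le_dividend order.trans)
    have "n div q \<le> Suc N * n" using ndq' by (simp add: trans_le_add1)
    then have KV: "K + n div q = Suc N * n" unfolding K_def by (rule le_add_diff_inverse2)
    have Q0: "Q \<noteq> 0"
    proof -
      obtain i j where ij: "i \<le> N" "j < n" "g i j \<noteq> 0" using g(1) by blast
      have "(fact n div fact j :: nat) \<noteq> 0" using ij(2) by (simp add: div_eq_0_iff fact_mono not_less)
      then have "coeff (coeff Q i) j \<noteq> 0" unfolding Q_def coeff_siegel_poly using ij by simp
      then show ?thesis by auto
    qed
    have degQ: "degree Q \<le> N" "\<And>i. degree (coeff Q i) \<le> n"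
      unfolding Q_def by (rule degree_siegel_poly, rule degree_coeff_siegel_poly)
    have vanish: "\<forall>i<K. fps_nth ?F i = 0" using g(3) by (simp add: Q_def K_def)
    have "N * n + c0 < K"
    proof -
      have "Suc N * n = N * n + n" by simp
      then show ?thesis using KV ndq nc by linarith
    qed
    then have det: "dt (Suc N) (\<lambda>k i. coeff ((?D ^^ k) Q) i) \<noteq> 0"
      using c0 Q0 degQ vanish by blast
    define V where "V = (\<lambda>k. smult (of_nat b ^ t n) (eval_coeffs \<alpha> ((?D ^^ k) Q))) ` {..n div q + e1}"
    have spanV: "P \<in> cpoly_vs.span V" if P: "degree P \<le> N" for P
    proof -
      have "P \<in> cpoly_vs.span {eval_coeffs \<alpha> ((?D ^^ k) Q) | k. k + K \<le> Suc N * n + (Suc N * (N * (degree A + degree B + degree C)) + 2 * N)}"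
        by (rule derivatives_span_at_point[OF ode \<alpha> degQ vanish det P])
      moreover have "cpoly_vs.span {eval_coeffs \<alpha> ((?D ^^ k) Q) | k. k + K \<le> Suc N * n + (Suc N * (N * (degree A + degree B + degree C)) + 2 * N)}
          \<subseteq> cpoly_vs.span V"
      proof (rule cpoly_vs.span_minimal[OF _ cpoly_vs.subspace_span], rule subsetI)
        fix x assume "x \<in> {eval_coeffs \<alpha> ((?D ^^ k) Q) | k. k + K \<le> Suc N * n + (Suc N * (N * (degree A + degree B + degree C)) + 2 * N)}"
        then obtain k where k: "x = eval_coeffs \<alpha> ((?D ^^ k) Q)" "k + K \<le> Suc N * n + e1" unfolding e1_def s_def by blast
        have "k \<le> n div q + e1" using k(2) KV by linarith
        then have "smult (of_nat b ^ t n) x \<in> cpoly_vs.span V"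
          unfolding k(1) V_def by (intro cpoly_vs.span_base) blast
        then have "smult (inverse (of_nat b ^ t n)) (smult (of_nat b ^ t n) x) \<in> cpoly_vs.span V"
          by (rule cpoly_vs.span_scale)
        moreover have "(of_nat b ^ t n :: complex) \<noteq> 0" using b by simp
        ultimately show "x \<in> cpoly_vs.span V" by (simp only: smult_smult left_inverse smult_1_left not_False_eq_True)
      qed
      ultimately show ?thesis by blast
    qed
    have sQ: "sized (T0 n) (coeff (coeff Q i) j)" for i j
    proof (cases "i \<le> N \<and> j < n")
      case True
      have "sized (real (fact n div fact j) * (c1 * fact n powr \<epsilon>)) (of_nat (fact n div fact j) * g i j)"
        using g(2) by (intro sized_scale_nat) blast
      moreover have "real (fact n div fact j) \<le> fact n"
        using div_le_dividend[of "fact n" "fact j"] by (metis of_nat_fact of_nat_mono)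
      then have "real (fact n div fact j) * (c1 * fact n powr \<epsilon>) \<le> T0 n"
        unfolding T0_def using c1(1) by (intro mult_right_mono) auto
      ultimately show ?thesis using True unfolding Q_def coeff_siegel_poly by (auto intro: sized_mono)
    next
      case False
      have "T0 n \<ge> 0" unfolding T0_def using c1(1) by simp
      moreover have "coeff (coeff Q i) j = 0" unfolding Q_def coeff_siegel_poly by (rule if_not_P[OF False])
      ultimately show ?thesis using sized_0 by simp
    qed
    have tk: "n + k * s \<le> t n" if "k \<le> n div q + e1" for k
    proof -
      have "k \<le> n + e1" using that ndq' by linarith
      then have "k * s \<le> (n + e1) * s" by (rule mult_le_mono1)
      then show ?thesis by (simp add: t_def)
    qed
    have c4n: "real (Suc s) * \<kappa> * S * (real (t n) + 2 * real N) \<le> c4 * real n"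
    proof -
      have "t n + 2 * N \<le> (1 + s + e1 * s + 2 * N) * n"
      proof -
        have "e1 * s * 1 \<le> e1 * s * n" "2 * N * 1 \<le> 2 * N * n" using n1 by (intro mult_le_mono2; simp)+
        moreover have "(1 + s + e1 * s + 2 * N) * n = n + n * s + e1 * s * n + 2 * N * n"
          by (simp add: algebra_simps)
        moreover have "t n = n + n * s + e1 * s" by (simp only: t_def distrib_right add.assoc)
        ultimately show ?thesis by linarith
      qed
      then have "real (t n + 2 * N) \<le> real ((1 + s + e1 * s + 2 * N) * n)" by (rule of_nat_mono)
      moreover have "real (t n) + 2 * real N = real (t n + 2 * N)" by simp
      ultimately have "real (t n) + 2 * real N \<le> real (1 + s + e1 * s + 2 * N) * real n"
        by (metis of_nat_mult)
      then have "(real (Suc s) * \<kappa> * S) * (real (t n) + 2 * real N) \<le> (real (Suc s) * \<kappa> * S) * (real (1 + s + e1 * s + 2 * N) * real n)"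
        using kappa_ge_1 S by (intro mult_left_mono) auto
      also have "\<dots> \<le> c4 * real n" unfolding c4_def using a' by (simp add: distrib_right mult.assoc del: of_nat_Suc of_nat_add)
      finally show ?thesis .
    qed
    have T00: "T0 n \<ge> 0" unfolding T0_def using c1(1) by simp
    have sizes: "sized (c * fact n powr (1 + \<eta>)) (of_nat b ^ t n * poly (coeff ((?D ^^ k) Q) i) \<alpha>)"
      if k: "k \<le> n div q + e1" for k i
    proof -
      have "sized ((real (Suc s) * \<kappa> * S * (real (t n) + 2 * real N)) ^ k * T0 n) (coeff (coeff ((?D ^^ k) Q) i) j)" for j
        by (rule sized_dop_pow[OF ABC _ S sQ degQ tk[OF k]]) (simp add: s_def)
      moreover have "(real (Suc s) * \<kappa> * S * (real (t n) + 2 * real N)) ^ k * T0 n \<le> Y n * T0 n"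
        using kappa_ge_1 S by (intro mult_right_mono T00 Ybound c4n k n1) auto
      ultimately have "sized (Y n * T0 n) (coeff (coeff ((?D ^^ k) Q) i) j)" for j by (blast intro: sized_mono)
      moreover have "degree (coeff ((?D ^^ k) Q) i) \<le> t n"
        using degree_coeff_dop_pow[OF degQ(2), where A = A and B = B and C = C and k = k and i = i] tk[OF k] by (simp add: s_def)
      ultimately have "sized (u1 n) (of_nat b ^ t n * poly (coeff ((?D ^^ k) Q) i) \<alpha>)"
        unfolding u1_def by (intro sized_poly_eval a b)
      then show ?thesis
      proof (rule sized_mono)
        have "c7 * fact n powr (1 + \<eta>) \<le> c * fact n powr (1 + \<eta>)" by (intro mult_right_mono) (auto simp: c_def)
        then show "u1 n \<le> c * fact n powr (1 + \<eta>)" using c7(2)[of n] by linarith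
      qed
    qed
    have W0: "W n \<ge> 0" unfolding W_def using G0 by simp
    have bdF: "coeff_bound R (W n) ?F"
      unfolding coeff_bound_def
    proof
      fix m
      show "norm (fps_nth ?F m) * R ^ m \<le> W n"
      proof (cases "m < K")
        case True
        then show ?thesis using vanish W0 by simp
      next
        case False
        have "norm (fact m * fps_nth ?F m) \<le> fact n * (\<Sum>i\<le>N. \<Sum>j<n. 2 ^ m * (\<kappa> * (c2 * fact m powr \<epsilon>)) * (\<kappa> * (c1 * fact n powr \<epsilon>)))"
          unfolding Q_def fps_nth_siegel_poly norm_mult norm_fact
        proof (intro mult_left_mono order.trans[OF norm_sum] sum_mono)
          fix i j assume i: "i \<in> {..N}" and j: "j \<in> {..<n}"
          have "norm (g i j) \<le> \<kappa> * (c1 * fact n powr \<epsilon>)" using g(2) by (intro sized_norm) blast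
          moreover have "norm (if j \<le> m then of_nat (m choose j) * (fact (m - j) * fps_nth (f ^ i) (m - j)) else 0)
              \<le> 2 ^ m * (\<kappa> * (c2 * fact m powr \<epsilon>))"
          proof (cases "j \<le> m")
            case True
            have "m choose j \<le> 2 ^ m" by (rule binomial_le_pow2)
            then have "real (m choose j) \<le> real (2 ^ m)" by (rule of_nat_mono)
            moreover have "norm (fact (m - j) * fps_nth (f ^ i) (m - j)) \<le> \<kappa> * (c2 * fact m powr \<epsilon>)"
            proof -
              have "(fact (m - j) :: real) powr \<epsilon> \<le> fact m powr \<epsilon>" using \<epsilon> by (intro powr_mono2 fact_mono) auto
              then have "\<kappa> * (c2 * fact (m - j) powr \<epsilon>) \<le> \<kappa> * (c2 * fact m powr \<epsilon>)"
                using kappa_ge_1 c2(1) by (intro mult_left_mono) auto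
              then show ?thesis using fk[of i "m - j"] i by auto
            qed
            ultimately have "real (m choose j) * norm (fact (m - j) * fps_nth (f ^ i) (m - j)) \<le> 2 ^ m * (\<kappa> * (c2 * fact m powr \<epsilon>))"
              by (intro mult_mono) auto
            then show ?thesis using True by (simp add: norm_mult)
          next
            case False
            then show ?thesis using kappa_ge_1 c2(1) by simp
          qed
          ultimately show "norm ((if j \<le> m then of_nat (m choose j) * (fact (m - j) * fps_nth (f ^ i) (m - j)) else 0) * g i j)
              \<le> 2 ^ m * (\<kappa> * (c2 * fact m powr \<epsilon>)) * (\<kappa> * (c1 * fact n powr \<epsilon>))"
            unfolding norm_mult using kappa_ge_1 c2(1) by (intro mult_mono) auto
        qed simp
        then have "fact m * norm (fps_nth ?F m) \<le> (\<kappa> * c2 * (\<kappa> * c1) * real (Suc N)) * (fact n * fact n powr \<epsilon> * real n) * (2 ^ m * fact m powr \<epsilon>)"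
          by (simp add: norm_mult mult_ac del: of_nat_Suc)
        then have "fact m * norm (fps_nth ?F m) * R ^ m \<le>
            ((\<kappa> * c2 * (\<kappa> * c1) * real (Suc N)) * (fact n * fact n powr \<epsilon> * real n) * (2 ^ m * fact m powr \<epsilon>)) * R ^ m"
          by (rule mult_right_mono) (use \<rho> in simp)
        also have "\<dots> = ((\<kappa> * c2 * (\<kappa> * c1) * real (Suc N)) * (fact n * fact n powr \<epsilon> * real n) * fact m powr \<epsilon>) * (2 * R) ^ m"
          by (simp add: power_mult_distrib mult_ac)
        also have "\<dots> \<le> ((\<kappa> * c2 * (\<kappa> * c1) * real (Suc N)) * (fact n * fact n powr \<epsilon> * real n) * fact m powr \<epsilon>) * (c5 * fact m powr \<epsilon>)"
          using kappa_ge_1 c1 c2 by (intro mult_left_mono c5(2)) auto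
        also have "\<dots> = (G * (fact n * fact n powr \<epsilon> * real n)) * (fact m powr (2 * \<epsilon>))"
          by (simp add: G_def mult_ac powr_add[symmetric] del: of_nat_Suc)
        also have "fact m powr (2 * \<epsilon>) = fact m * fact m powr (2 * \<epsilon> - 1)" by (simp add: powr_diff)
        also have "\<dots> \<le> fact m * (fact (Suc N * n) powr (2 * \<epsilon>) * (real (Suc N) ^ n * real n ^ (n div q)) * fact n powr (- real (Suc N)))"
        proof (rule mult_left_mono)
          let ?V = "Suc N * n"
          have "(fact K :: real) \<le> fact m" using False by (intro fact_mono) simp
          then have "(fact m :: real) powr (2 * \<epsilon> - 1) \<le> fact K powr (2 * \<epsilon> - 1)"
            using \<epsilon>(2) by (intro powr_mono2') auto
          also have "\<dots> = fact K powr (2 * \<epsilon>) * (1 / fact K)" by (simp add: powr_diff)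
          also have "\<dots> \<le> fact ?V powr (2 * \<epsilon>) * ((real (Suc N) ^ n * real n ^ (n div q)) * fact n powr (- real (Suc N)))"
          proof (rule mult_mono)
            show "(fact K :: real) powr (2 * \<epsilon>) \<le> fact ?V powr (2 * \<epsilon>)"
              using \<epsilon> KV by (intro powr_mono2 fact_mono) auto
            have "fact n ^ Suc N \<le> (fact ?V :: real)" by (rule fact_power_le)
            also have "\<dots> \<le> fact K * real ?V ^ (n div q)" using fact_add_le[of K "n div q"] unfolding KV .
            also have "real ?V ^ (n div q) = real (Suc N) ^ (n div q) * real n ^ (n div q)"
              by (simp only: of_nat_mult power_mult_distrib)
            also have "\<dots> \<le> real (Suc N) ^ n * real n ^ (n div q)"
              using ndq' by (intro mult_right_mono power_increasing) auto
            finally have "fact n ^ Suc N \<le> fact K * (real (Suc N) ^ n * real n ^ (n div q))" by simp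
            then have "1 / fact K \<le> (real (Suc N) ^ n * real n ^ (n div q)) / fact n ^ Suc N"
              by (simp add: field_simps del: of_nat_Suc power_Suc)
            also have "\<dots> = (real (Suc N) ^ n * real n ^ (n div q)) * fact n powr (- real (Suc N))"
              by (simp add: powr_minus powr_realpow divide_inverse del: of_nat_Suc power_Suc)
            finally show "1 / fact K \<le> (real (Suc N) ^ n * real n ^ (n div q)) * fact n powr (- real (Suc N))" .
          qed auto
          finally show "fact m powr (2 * \<epsilon> - 1) \<le> fact ?V powr (2 * \<epsilon>) * (real (Suc N) ^ n * real n ^ (n div q)) * fact n powr (- real (Suc N))"
            by (simp only: mult.assoc)
        qed simp
        finally have "fact m * norm (fps_nth ?F m) * R ^ m \<le> (G * (fact n * fact n powr \<epsilon> * real n)) *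
            (fact m * (fact (Suc N * n) powr (2 * \<epsilon>) * (real (Suc N) ^ n * real n ^ (n div q)) * fact n powr (- real (Suc N))))"
          using G0 by (simp add: mult_left_mono del: of_nat_Suc)
        also have "\<dots> = fact m * W n" by (simp only: W_def mult_ac)
        finally have "fact m * (norm (fps_nth ?F m) * R ^ m) \<le> fact m * W n" by (simp only: mult.assoc)
        then show ?thesis by (simp add: mult_le_cancel_left_pos)
      qed
    qed
    have vals: "norm (of_nat b ^ t n * poly (eval_coeffs \<alpha> ((?D ^^ k) Q)) (eval_fps f \<alpha>)) \<le> c * fact n powr (\<eta> - real N)"
      if k: "k \<le> n div q + e1" for k
    proof -
      have "coeff_bound \<rho> ((real k * a') ^ k * W n) (poly (map_poly fps_of_poly ((?D ^^ k) Q)) f)"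
        using coeff_bound_fder_pow[OF bdF[unfolded R_def] \<rho>(1), where k = k and A = A]
        unfolding fps_fder_pow_poly[OF ode] a'_def R_def .
      then have "norm (eval_fps (poly (map_poly fps_of_poly ((?D ^^ k) Q)) f) \<alpha>) \<le> 2 * ((real k * a') ^ k * W n)"
        by (rule norm_eval_fps_le) (use \<rho> in auto)
      then have "norm (poly (eval_coeffs \<alpha> ((?D ^^ k) Q)) (eval_fps f \<alpha>)) \<le> 2 * ((real k * a') ^ k * W n)"
        using eval_fps_poly[OF cr, of "(?D ^^ k) Q" \<alpha>] by simp
      also have "\<dots> \<le> 2 * (Y n * W n)"
      proof -
        have "k \<le> (1 + e1) * n"
        proof -
          have "e1 * 1 \<le> e1 * n" using n1 by (intro mult_le_mono2)
          moreover have "(1 + e1) * n = n + e1 * n" by (simp only: distrib_right mult_1)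
          ultimately show ?thesis using k ndq' by linarith
        qed
        then have "real k \<le> real ((1 + e1) * n)" by (rule of_nat_mono)
        then have "real k \<le> real (1 + e1) * real n" by (simp only: of_nat_mult)
        then have "real k * a' \<le> (real (1 + e1) * real n) * (a' + 1)"
          by (rule mult_mono) (use a' in auto)
        also have "\<dots> \<le> c4 * real n" unfolding c4_def using kappa_ge_1 S by (simp add: algebra_simps)
        finally have "(real k * a') ^ k \<le> Y n" using a' by (intro Ybound k n1) auto
        then show ?thesis using W0 by (intro mult_left_mono mult_right_mono) auto
      qed
      finally have "real b ^ t n * norm (poly (eval_coeffs \<alpha> ((?D ^^ k) Q)) (eval_fps f \<alpha>)) \<le> u2 n"
        unfolding u2_def by (intro mult_left_mono) auto
      moreover have "c8 * fact n powr (\<eta> - real N) \<le> c * fact n powr (\<eta> - real N)"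
        by (intro mult_right_mono) (auto simp: c_def)
      moreover have "norm (of_nat b ^ t n * poly (eval_coeffs \<alpha> ((?D ^^ k) Q)) (eval_fps f \<alpha>)) =
          real b ^ t n * norm (poly (eval_coeffs \<alpha> ((?D ^^ k) Q)) (eval_fps f \<alpha>))"
        by (simp add: norm_mult norm_power)
      ultimately show ?thesis using c8(2)[of n] by linarith
    qed
    have "degree r \<le> N \<and> (\<forall>i. sized (c * fact n powr (1 + \<eta>)) (coeff r i)) \<and>
      norm (poly r (eval_fps f \<alpha>)) \<le> c * fact n powr (\<eta> - real N)" if r: "r \<in> V" for r
    proof -
      obtain k where k: "k \<le> n div q + e1" "r = smult (of_nat b ^ t n) (eval_coeffs \<alpha> ((?D ^^ k) Q))"
        using r unfolding V_def by auto
      have "degree r \<le> N"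
        unfolding k(2) using degree_smult_le[of "of_nat b ^ t n :: complex" "eval_coeffs \<alpha> ((?D ^^ k) Q)"]
          degree_eval_coeffs_le[of \<alpha> "(?D ^^ k) Q"] degree_dop_pow_le[OF derivation_pder[of A], of k B C Q] degQ(1) by linarith
      moreover have "sized (c * fact n powr (1 + \<eta>)) (coeff r i)" for i
        unfolding k(2) coeff_smult coeff_eval_coeffs by (rule sizes[OF k(1)])
      moreover have "norm (poly r (eval_fps f \<alpha>)) \<le> c * fact n powr (\<eta> - real N)"
        unfolding k(2) poly_smult by (rule vals[OF k(1)])
      ultimately show ?thesis by blast
    qed
    then show ?thesis using spanV by blast
  qed
  moreover have "c \<ge> 1" using c7(1) by (simp add: c_def)
  ultimately show ?thesis by blast
qed

end

section \<open>Completing the multiples of a polynomial to a basis\<close>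

lemma independent_multiples:
  fixes P :: "complex poly"
  assumes "P \<noteq> 0"
  shows "inj_on (\<lambda>i. monom 1 i * P) {..m::nat}" "\<not> cpoly_vs.dependent ((\<lambda>i. monom 1 i * P) ` {..m})"
proof -
  show inj: "inj_on (\<lambda>i. monom 1 i * P) {..m}"
    using assms by (auto intro!: inj_onI simp: monom_eq_iff')
  show "\<not> cpoly_vs.dependent ((\<lambda>i. monom 1 i * P) ` {..m})"
  proof
    assume "cpoly_vs.dependent ((\<lambda>i. monom 1 i * P) ` {..m})"
    then obtain u where u: "\<exists>v\<in>(\<lambda>i. monom 1 i * P) ` {..m}. u v \<noteq> 0"
      "(\<Sum>v\<in>(\<lambda>i. monom 1 i * P) ` {..m}. smult (u v) v) = 0"
      by (subst (asm) cpoly_vs.dependent_finite) auto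
    define R where "R = (\<Sum>i\<le>m. monom (u (monom 1 i * P)) i)"
    have "R * P = (\<Sum>i\<le>m. smult (u (monom 1 i * P)) (monom 1 i * P))"
      unfolding R_def sum_distrib_right by (intro sum.cong refl) (simp add: smult_monom flip: mult_smult_left)
    also have "\<dots> = 0" using u(2) unfolding sum.reindex[OF inj] by simp
    finally have "R = 0" using assms by simp
    then have coeffR: "coeff R i = 0" for i by simp
    have "u (monom 1 i * P) = 0" if "i \<le> m" for i using coeffR[of i] that unfolding R_def coeff_sum by simp
    then show False using u(1) by auto
  qed
qed

lemma span_monomials: "cpoly_vs.span ((\<lambda>i. monom 1 i * 1) ` {..N}) = {p. degree p \<le> N}"
proof (intro equalityI subsetI)
  fix p :: "complex poly" assume "p \<in> {p. degree p \<le> N}"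
  then have p: "degree p \<le> N" by simp
  have "p = (\<Sum>i\<le>degree p. smult (coeff p i) (monom 1 i * 1))" by (simp add: smult_monom poly_as_sum_of_monoms)
  also have "\<dots> \<in> cpoly_vs.span ((\<lambda>i. monom 1 i * 1) ` {..N})"
    using p by (intro cpoly_vs.span_sum cpoly_vs.span_scale cpoly_vs.span_base) auto
  finally show "p \<in> cpoly_vs.span ((\<lambda>i. monom 1 i * 1) ` {..N})" .
next
  fix p :: "complex poly" assume p: "p \<in> cpoly_vs.span ((\<lambda>i. monom 1 i * 1) ` {..N})"
  have "cpoly_vs.subspace {p. degree p \<le> N}"
    by (rule cpoly_vs.subspaceI) (auto intro: degree_add_le order.trans[OF degree_smult_le])
  moreover have "(\<lambda>i. monom 1 i * 1) ` {..N} \<subseteq> {p :: complex poly. degree p \<le> N}"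
    by (auto intro: order.trans[OF degree_monom_le])
  ultimately show "p \<in> {p. degree p \<le> N}" using cpoly_vs.span_minimal p by blast
qed

text \<open>The multiples \<open>X ^ i * P\<close> are linearly independent, so a spanning set contains vectors that complete
  them to a basis; the matrix of coefficients of a basis is invertible.\<close>

lemma complete_to_basis:
  fixes P :: "complex poly"
  assumes P: "P \<noteq> 0" "degree P \<le> \<delta>" "\<delta> \<le> N"
    and V: "\<And>p. degree p \<le> N \<Longrightarrow> p \<in> cpoly_vs.span V" "\<And>r. r \<in> V \<Longrightarrow> degree r \<le> N"
  obtains r where "\<And>k. k \<le> N - \<delta> \<Longrightarrow> r k = monom 1 k * P" "\<And>k. N - \<delta> < k \<Longrightarrow> k \<le> N \<Longrightarrow> r k \<in> V"
    "dt (Suc N) (\<lambda>k j. coeff (r k) j) \<noteq> 0"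
proof -
  define I where "I = (\<lambda>i. monom 1 i * P) ` {..N - \<delta>}"
  define W where "W = {p :: complex poly. degree p \<le> N}"
  have degI: "p \<in> W" if p: "p \<in> I" for p
  proof -
    obtain i where i: "i \<le> N - \<delta>" "p = monom 1 i * P" using p unfolding I_def by auto
    have "degree p \<le> degree (monom 1 i :: complex poly) + degree P" unfolding i(2) by (rule degree_mult_le)
    then show ?thesis using i(1) P(2,3) degree_monom_le[of "1 :: complex" i] unfolding W_def by simp
  qed
  have "\<not> cpoly_vs.dependent I" unfolding I_def by (rule independent_multiples[OF P(1)])
  then obtain B where B: "I \<subseteq> B" "B \<subseteq> I \<union> V" "\<not> cpoly_vs.dependent B" "I \<union> V \<subseteq> cpoly_vs.span B"
    using cpoly_vs.maximal_independent_subset_extend[of I "I \<union> V"] by blast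
  have BW: "B \<subseteq> W" using B(2) degI V(2) unfolding W_def by auto
  let ?Mo = "(\<lambda>i. monom 1 i * 1) ` {..N} :: complex poly set"
  have spanMo: "cpoly_vs.span ?Mo = W" unfolding W_def by (rule span_monomials)
  have finB: "finite B"
    using cpoly_vs.independent_span_bound[of ?Mo B] B(3) BW spanMo by auto
  have "cpoly_vs.span V \<subseteq> cpoly_vs.span B" using B(4) by (intro cpoly_vs.span_minimal cpoly_vs.subspace_span) auto
  then have WB: "W \<subseteq> cpoly_vs.span B" using V(1) unfolding W_def by auto
  have "cpoly_vs.span B \<subseteq> cpoly_vs.span W" by (rule cpoly_vs.span_mono[OF BW])
  moreover have "cpoly_vs.span W \<subseteq> cpoly_vs.span B" by (rule cpoly_vs.span_minimal[OF WB cpoly_vs.subspace_span])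
  ultimately have "cpoly_vs.span B = cpoly_vs.span W" by blast
  then have d1: "cpoly_vs.dim W = card B" using B(3) by (rule cpoly_vs.dim_eq_card)
  have "cpoly_vs.span ?Mo = cpoly_vs.span W" unfolding spanMo[symmetric] cpoly_vs.span_span ..
  then have "cpoly_vs.dim W = card ?Mo" by (rule cpoly_vs.dim_eq_card[OF _ independent_multiples(2)]) simp
  also have "\<dots> = Suc N" using card_image[OF independent_multiples(1)[of 1 N]] by simp
  finally have cardB: "card B = Suc N" using d1 by simp
  have cardI: "card I = Suc (N - \<delta>)" unfolding I_def using card_image[OF independent_multiples(1)[OF P(1)]] by simp
  have "card (B - I) = \<delta>" using card_Diff_subset[OF _ B(1)] finite_subset[OF B(1) finB] cardB cardI P(3) by simp
  then obtain h where h: "bij_betw h {..<\<delta>} (B - I)"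
    using ex_bij_betw_nat_finite[of "B - I"] finB by (auto simp: lessThan_atLeast0)
  define r where "r = (\<lambda>k. if k \<le> N - \<delta> then monom 1 k * P else h (k - Suc (N - \<delta>)))"
  have r1: "r k = monom 1 k * P" if "k \<le> N - \<delta>" for k using that by (simp add: r_def)
  have r2: "r k \<in> V" if "N - \<delta> < k" "k \<le> N" for k
  proof -
    have "k - Suc (N - \<delta>) < \<delta>" using that P(3) by linarith
    then have "h (k - Suc (N - \<delta>)) \<in> B - I" using h by (auto simp: bij_betw_def)
    then show ?thesis using that B(2) by (auto simp: r_def)
  qed
  have onto: "\<exists>k\<le>N. p = r k" if p: "p \<in> B" for p
  proof (cases "p \<in> I")
    case True
    then obtain i where i: "i \<le> N - \<delta>" "p = monom 1 i * P" unfolding I_def by auto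
    then show ?thesis using r1 by (intro exI[of _ i]) auto
  next
    case False
    then have "p \<in> h ` {..<\<delta>}" using p h by (auto simp: bij_betw_def)
    then obtain j where j: "j < \<delta>" "p = h j" by auto
    then show ?thesis using P(3) by (intro exI[of _ "Suc (N - \<delta>) + j"]) (auto simp: r_def)
  qed
  have "dt (Suc N) (\<lambda>k j. coeff (r k) j) \<noteq> 0"
  proof
    assume "dt (Suc N) (\<lambda>k j. coeff (r k) j) = 0"
    from dt_eq_0_imp_kernel[OF this] obtain v where v: "\<exists>i<Suc N. v i \<noteq> 0"
      "\<And>k. k < Suc N \<Longrightarrow> (\<Sum>j<Suc N. coeff (r k) j * v j) = 0" by blast
    have sub: "cpoly_vs.subspace {p. (\<Sum>j<Suc N. coeff p j * v j) = 0}"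
    proof (rule cpoly_vs.subspaceI)
      fix x y :: "complex poly" assume "x \<in> {p. (\<Sum>j<Suc N. coeff p j * v j) = 0}" "y \<in> {p. (\<Sum>j<Suc N. coeff p j * v j) = 0}"
      then show "x + y \<in> {p. (\<Sum>j<Suc N. coeff p j * v j) = 0}"
        by (simp add: distrib_right sum.distrib del: sum.lessThan_Suc)
    next
      fix c and x :: "complex poly" assume "x \<in> {p. (\<Sum>j<Suc N. coeff p j * v j) = 0}"
      then have "c * (\<Sum>j<Suc N. coeff x j * v j) = 0" by simp
      then show "smult c x \<in> {p. (\<Sum>j<Suc N. coeff p j * v j) = 0}"
        by (simp add: sum_distrib_left mult.assoc del: sum.lessThan_Suc)
    qed simp
    have "B \<subseteq> {p. (\<Sum>j<Suc N. coeff p j * v j) = 0}"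
    proof
      fix p assume "p \<in> B"
      then obtain k where "k \<le> N" "p = r k" using onto by blast
      then show "p \<in> {p. (\<Sum>j<Suc N. coeff p j * v j) = 0}" using v(2)[of k] by (simp del: sum.lessThan_Suc)
    qed
    then have sp: "cpoly_vs.span B \<subseteq> {p. (\<Sum>j<Suc N. coeff p j * v j) = 0}" using sub by (rule cpoly_vs.span_minimal)
    obtain i where i: "i < Suc N" "v i \<noteq> 0" using v(1) by blast
    have "monom 1 i \<in> W" unfolding W_def using i(1) degree_monom_le[of "1::complex" i] by auto
    then have "(\<Sum>j<Suc N. coeff (monom 1 i) j * v j) = 0" using sp WB by blast
    moreover have "(\<Sum>j<Suc N. coeff (monom 1 i) j * v j) = (\<Sum>j<Suc N. if i = j then v j else 0)"
      by (intro sum.cong refl) simp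
    moreover have "\<dots> = v i" using i(1) by (subst sum.delta') auto
    ultimately show False using i(2) by simp
  qed
  then show ?thesis using that r1 r2 by blast
qed

context order_gen
begin

section \<open>The determinant of integer multiples and small forms\<close>

text \<open>The determinant has \<open>N - \<delta> + 1\<close> rows \<open>X ^ i * P\<close> of size \<open>H\<close> and \<open>\<delta>\<close> rows from \<open>V\<close> of size \<open>U1\<close>. It is a
  nonzero number of the order, so Liouville's inequality bounds it from below. By Cramer's rule it
  is also a combination of the values of the rows at \<open>y\<close>, with cofactors in which one row is missing;
  this bounds it from above. The inequality says that the two bounds are compatible.\<close>

lemma determinant_inequality:
  assumes \<delta>: "1 \<le> \<delta>" "\<delta> \<le> N"
  shows "\<exists>C>0. \<forall>(P :: int poly) V H U1 U2. P \<noteq> 0 \<longrightarrow> degree P \<le> \<delta> \<longrightarrow>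
    (\<forall>i. \<bar>real_of_int (coeff P i)\<bar> \<le> H) \<longrightarrow> 1 \<le> H \<longrightarrow> 1 \<le> U1 \<longrightarrow>
    (\<forall>p. degree p \<le> N \<longrightarrow> p \<in> cpoly_vs.span V) \<longrightarrow>
    (\<forall>r\<in>V. degree r \<le> N \<and> (\<forall>i. sized U1 (coeff r i)) \<and> norm (poly r y) \<le> U2) \<longrightarrow>
    1 \<le> C * (H ^ (N - \<delta> + 1) * U1 ^ \<delta>) ^ (d - 1) *
      (norm (poly (map_poly of_int P) y) * (H ^ (N - \<delta>) * U1 ^ \<delta>) + U2 * (H ^ (N - \<delta> + 1) * U1 ^ (\<delta> - 1)))"
proof -
  obtain cL where cL: "cL > 0" "\<And>T x. T \<ge> 1 \<Longrightarrow> sized T x \<Longrightarrow> x \<noteq> 0 \<Longrightarrow> norm x \<ge> cL / T ^ (d - 1)"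
    using liouville by blast
  define L where "L = fact (Suc N) * \<kappa> ^ Suc N"
  define Ym where "Ym = (1 + norm y) ^ N"
  define C where "C = real (Suc N) * L * Ym * L ^ (d - 1) / cL"
  have L: "L \<ge> 1"
  proof -
    have "1 * 1 \<le> fact (Suc N) * \<kappa> ^ Suc N"
      using kappa_ge_1 fact_ge_1[of "Suc N", where ?'a = real] by (intro mult_mono one_le_power) auto
    then show ?thesis by (simp add: L_def)
  qed
  have Ym: "Ym \<ge> 1" unfolding Ym_def by (intro one_le_power) simp
  have C: "C > 0" unfolding C_def using L Ym cL(1) by simp
  have "1 \<le> C * (H ^ (N - \<delta> + 1) * U1 ^ \<delta>) ^ (d - 1) *
      (norm (poly (map_poly of_int P) y) * (H ^ (N - \<delta>) * U1 ^ \<delta>) + U2 * (H ^ (N - \<delta> + 1) * U1 ^ (\<delta> - 1)))"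
    if P: "P \<noteq> 0" "degree P \<le> \<delta>" "\<forall>i. \<bar>real_of_int (coeff P i)\<bar> \<le> H" and H: "1 \<le> H" and U1: "1 \<le> U1"
      and V: "\<forall>p. degree p \<le> N \<longrightarrow> p \<in> cpoly_vs.span V"
        "\<forall>r\<in>V. degree r \<le> N \<and> (\<forall>i. sized U1 (coeff r i)) \<and> norm (poly r y) \<le> U2"
    for P :: "int poly" and V H U1 U2
  proof -
    let ?P = "map_poly of_int P :: complex poly"
    let ?m = "N - \<delta> + 1"
    have P0: "?P \<noteq> 0" "degree ?P \<le> \<delta>" using P by (auto simp: degree_map_poly)
    obtain r where r: "\<And>k. k \<le> N - \<delta> \<Longrightarrow> r k = monom 1 k * ?P" "\<And>k. N - \<delta> < k \<Longrightarrow> k \<le> N \<Longrightarrow> r k \<in> V"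
      "dt (Suc N) (\<lambda>k j. coeff (r k) j) \<noteq> 0"
      using complete_to_basis[OF P0 \<delta>(2), of V] V by metis
    define M where "M = (\<lambda>k j. coeff (r k) j)"
    define \<rho> where "\<rho> = (\<lambda>k. if k < ?m then H else U1)"
    have sz: "sized (\<rho> k) (M k j)" if k: "k < Suc N" for k j
    proof (cases "k < ?m")
      case True
      have "coeff (r k) j = of_int (if j < k then 0 else coeff P (j - k))"
        using r(1)[of k] True by (simp add: coeff_monom_mult coeff_map_poly)
      then have "sized \<bar>real_of_int (if j < k then 0 else coeff P (j - k))\<bar> (M k j)"
        unfolding M_def by (simp only: sized_of_int)
      then show ?thesis using True P(3) H unfolding \<rho>_def by (auto elim!: sized_mono)
    next
      case False
      then show ?thesis using r(2)[of k] V(2) k unfolding M_def \<rho>_def by auto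
    qed
    have prod_\<rho>: "(\<Prod>k<Suc N. \<rho> k) = H ^ ?m * U1 ^ \<delta>"
    proof -
      have "(\<Prod>k<Suc N. \<rho> k) = (\<Prod>k\<in>{..<Suc N} \<inter> {k. k < ?m}. H) * (\<Prod>k\<in>{..<Suc N} \<inter> - {k. k < ?m}. U1)"
        unfolding \<rho>_def by (rule prod.If_cases) simp
      moreover have "{..<Suc N} \<inter> {k. k < ?m} = {..<?m}" "{..<Suc N} \<inter> - {k. k < ?m} = {?m..<Suc N}" by auto
      ultimately show ?thesis using \<delta> by simp
    qed
    define \<Delta> where "\<Delta> = dt (Suc N) M"
    define T where "T = L * (H ^ ?m * U1 ^ \<delta>)"
    have HU: "1 \<le> H ^ ?m * U1 ^ \<delta>"
      using mult_mono[of 1 "H ^ ?m" 1 "U1 ^ \<delta>"] one_le_power[OF H, of ?m] one_le_power[OF U1, of \<delta>] by simp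
    have T1: "T \<ge> 1" unfolding T_def using mult_mono[of 1 L 1 "H ^ ?m * U1 ^ \<delta>"] L HU by simp
    have "sized T \<Delta>" unfolding T_def L_def \<Delta>_def prod_\<rho>[symmetric] by (rule sized_dt) (rule sz)
    then have low: "cL / T ^ (d - 1) \<le> norm \<Delta>" using cL(2)[OF T1] r(3) by (simp add: \<Delta>_def M_def)
    have rdeg: "degree (r k) \<le> N" if "k < Suc N" for k
    proof (cases "k < ?m")
      case True
      then have k: "k \<le> N - \<delta>" by simp
      have "degree (monom 1 k * ?P) \<le> k + \<delta>"
        using degree_mult_le[of "monom 1 k" ?P] degree_monom_le[of "1::complex" k] P0(2) by linarith
      then show ?thesis using r(1)[OF k] k \<delta> by simp
    next
      case False
      then show ?thesis using r(2)[of k] V(2) that by auto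
    qed
    have "\<Delta> * y ^ 0 = (\<Sum>k<Suc N. cof (Suc N) M k 0 * (\<Sum>j<Suc N. M k j * y ^ j))"
      unfolding \<Delta>_def by (rule dt_cramer) simp
    also have "\<dots> = (\<Sum>k<Suc N. cof (Suc N) M k 0 * poly (r k) y)"
    proof (rule sum.cong[OF refl])
      fix k assume "k \<in> {..<Suc N}"
      then have "degree (r k) \<le> N" using rdeg by simp
      then have "poly (r k) y = (\<Sum>j<Suc N. M k j * y ^ j)"
        unfolding poly_altdef M_def by (intro sum.mono_neutral_left) (auto simp: coeff_eq_0)
      then show "cof (Suc N) M k 0 * (\<Sum>j<Suc N. M k j * y ^ j) = cof (Suc N) M k 0 * poly (r k) y" by simp
    qed
    finally have \<Delta>eq: "\<Delta> = (\<Sum>k<Suc N. cof (Suc N) M k 0 * poly (r k) y)" by simp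
    define p where "p = norm (poly ?P y)"
    define X where "X = p * (H ^ (N - \<delta>) * U1 ^ \<delta>) + U2 * (H ^ ?m * U1 ^ (\<delta> - 1))"
    have U20: "U2 \<ge> 0"
    proof -
      have "r N \<in> V" using r(2)[of N] \<delta> by simp
      then show ?thesis using V(2) norm_ge_zero order.trans by blast
    qed
    have cofb: "norm (cof (Suc N) M k 0) \<le> L * (\<Prod>i\<in>{..<Suc N} - {k}. \<rho> i)" if k: "k < Suc N" for k
    proof -
      have "norm (cof (Suc N) M k 0) \<le> fact (Suc N) * (\<Prod>i<Suc N. if i = k then 1 else \<kappa> * \<rho> i)"
        unfolding cof_def by (rule norm_dt_le) (use sz sized_norm in auto)
      also have "(\<Prod>i<Suc N. if i = k then 1 else \<kappa> * \<rho> i) = (\<Prod>i\<in>{..<Suc N} - {k}. \<kappa> * \<rho> i)"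
        by (rule prod.mono_neutral_cong_right) auto
      also have "\<dots> = \<kappa> ^ N * (\<Prod>i\<in>{..<Suc N} - {k}. \<rho> i)"
        using k by (simp add: prod.distrib del: lessThan_Suc)
      also have "fact (Suc N) * (\<kappa> ^ N * (\<Prod>i\<in>{..<Suc N} - {k}. \<rho> i)) \<le> L * (\<Prod>i\<in>{..<Suc N} - {k}. \<rho> i)"
      proof -
        have "\<kappa> ^ N \<le> \<kappa> ^ Suc N" using kappa_ge_1 by (intro power_increasing) auto
        moreover have "0 \<le> (\<Prod>i\<in>{..<Suc N} - {k}. \<rho> i)" using H U1 by (intro prod_nonneg) (auto simp: \<rho>_def)
        ultimately show ?thesis unfolding L_def mult.assoc by (intro mult_left_mono mult_right_mono) auto
      qed
      finally show ?thesis .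
    qed
    have prodk: "(\<Prod>i\<in>{..<Suc N} - {k}. \<rho> i) * \<rho> k = H ^ ?m * U1 ^ \<delta>" if "k < Suc N" for k
      using prod.remove[of "{..<Suc N}" k \<rho>] that prod_\<rho> by (simp add: mult.commute del: lessThan_Suc prod.lessThan_Suc)
    have summand: "norm (cof (Suc N) M k 0 * poly (r k) y) \<le> L * Ym * X" if k: "k < Suc N" for k
    proof (cases "k < ?m")
      case True
      have "(\<Prod>i\<in>{..<Suc N} - {k}. \<rho> i) * H = (H ^ (N - \<delta>) * U1 ^ \<delta>) * H"
        using prodk[OF k] True by (simp add: \<rho>_def mult_ac del: lessThan_Suc)
      then have e: "(\<Prod>i\<in>{..<Suc N} - {k}. \<rho> i) = H ^ (N - \<delta>) * U1 ^ \<delta>" using H by simp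
      have "norm (poly (r k) y) \<le> Ym * p"
      proof -
        have "norm (y ^ k) \<le> (1 + norm y) ^ k" unfolding norm_power by (intro power_mono) auto
        also have "\<dots> \<le> Ym" unfolding Ym_def using k by (intro power_increasing) auto
        finally have "norm (y ^ k) * p \<le> Ym * p" by (rule mult_right_mono) (simp add: p_def)
        then show ?thesis using r(1)[of k] True by (simp add: poly_monom norm_mult p_def)
      qed
      then have "norm (cof (Suc N) M k 0 * poly (r k) y) \<le> (L * (H ^ (N - \<delta>) * U1 ^ \<delta>)) * (Ym * p)"
        unfolding norm_mult using cofb[OF k] unfolding e using L H U1 by (intro mult_mono) auto
      also have "\<dots> = L * Ym * (p * (H ^ (N - \<delta>) * U1 ^ \<delta>))" by (simp add: mult_ac)
      also have "\<dots> \<le> L * Ym * X" unfolding X_def using L Ym U20 H U1 by (intro mult_left_mono) auto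
      finally show ?thesis .
    next
      case False
      have "(\<Prod>i\<in>{..<Suc N} - {k}. \<rho> i) * U1 = (H ^ ?m * U1 ^ (\<delta> - 1)) * U1"
        using prodk[OF k] False \<delta>(1) power_minus_mult[of \<delta> U1] by (simp add: \<rho>_def mult.assoc del: lessThan_Suc)
      then have e: "(\<Prod>i\<in>{..<Suc N} - {k}. \<rho> i) = H ^ ?m * U1 ^ (\<delta> - 1)" using U1 by simp
      have "norm (poly (r k) y) \<le> U2" using r(2)[of k] V(2) k False by auto
      then have "norm (cof (Suc N) M k 0 * poly (r k) y) \<le> (L * (H ^ ?m * U1 ^ (\<delta> - 1))) * U2"
        unfolding norm_mult using cofb[OF k] unfolding e using L H U1 by (intro mult_mono) auto
      also have "\<dots> = L * 1 * (U2 * (H ^ ?m * U1 ^ (\<delta> - 1)))" by (simp add: mult_ac)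
      also have "\<dots> \<le> L * Ym * X" unfolding X_def using L Ym U20 H U1
        by (intro mult_mono) (auto simp: p_def)
      finally show ?thesis .
    qed
    have "norm \<Delta> \<le> (\<Sum>k<Suc N. L * Ym * X)"
      unfolding \<Delta>eq using summand by (intro order.trans[OF norm_sum] sum_mono) auto
    then have "norm \<Delta> \<le> real (Suc N) * (L * Ym * X)" by simp
    then have "cL / T ^ (d - 1) \<le> real (Suc N) * (L * Ym * X)" using low by linarith
    then have "cL \<le> real (Suc N) * (L * Ym * X) * T ^ (d - 1)"
      using T1 by (simp add: pos_divide_le_eq del: of_nat_Suc)
    then have "1 \<le> real (Suc N) * (L * Ym * X) * T ^ (d - 1) / cL" using cL(1) by (simp add: pos_le_divide_eq del: of_nat_Suc)
    also have "\<dots> = C * (H ^ ?m * U1 ^ \<delta>) ^ (d - 1) * X"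
      unfolding C_def T_def power_mult_distrib[of L] by (simp add: mult_ac del: of_nat_Suc)
    finally show ?thesis unfolding X_def p_def .
  qed
  then show ?thesis using C by blast
qed

text \<open>Finitely many numbers of the field have a common denominator with respect to the order.\<close>

lemma common_size:
  assumes "finite X" "X \<subseteq> rat_adjoin \<theta>" "\<And>x. x \<in> X \<Longrightarrow> algebraic x"
  shows "\<exists>(D::nat) T. D \<ge> 1 \<and> T \<ge> 1 \<and> (\<forall>x\<in>X. sized T (of_nat D * x))"
proof -
  obtain E :: nat and C where EC: "E \<ge> 1" "C \<ge> 1"
      "\<And>x D. x \<in> rat_adjoin \<theta> \<Longrightarrow> (D::nat) \<ge> 1 \<Longrightarrow> algebraic_int (of_nat D * x) \<Longrightarrow>
        sized (C * real D * house x) (of_nat (E * D) * x)"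
    using house_imp_sized by blast
  obtain D :: nat where D: "D > 0" "\<forall>x\<in>X. algebraic_int (of_nat D * x)"
    using common_integral_multiple[OF assms(1,3)] by blast
  define T where "T = 1 + (\<Sum>x\<in>X. \<bar>C * real D * house x\<bar>)"
  have "sized T (of_nat (E * D) * x)" if x: "x \<in> X" for x
  proof (rule sized_mono[OF EC(3)])
    have "\<bar>C * real D * house x\<bar> \<le> (\<Sum>x\<in>X. \<bar>C * real D * house x\<bar>)" by (rule member_le_sum[OF x]) (use assms(1) in auto)
    then show "C * real D * house x \<le> T" unfolding T_def by linarith
  qed (use x D assms(2) in auto)
  moreover have "T \<ge> 1" unfolding T_def by (simp add: sum_nonneg)
  moreover have "E * D \<ge> 1" using EC(1) D(1) by simp
  ultimately show ?thesis by blast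
qed

end

section \<open>The choice of the parameters\<close>

text \<open>For \<open>d \<ge> 2\<close> the integer part in the definition of \<open>N1\<close> is at least 1, which compensates the
  subtraction of 1.\<close>

lemma opt_N_ge:
  assumes "d \<ge> 1" "\<delta> \<ge> 1"
  shows "\<delta> * d \<le> opt_N d \<delta>"
proof (cases "d = 1")
  case False
  then have d2: "real d \<ge> 2" using assms(1) by simp
  have "1 * 1 \<le> real d * (real d - 1)" using d2 by (intro mult_mono) auto
  then have "1 \<le> sqrt (real d ^ 2 - real d)" by (simp add: power2_eq_square algebra_simps)
  then have "1 * 1 \<le> real \<delta> * sqrt (real d ^ 2 - real d)" using assms(2) by (intro mult_mono) auto
  then have "1 \<le> \<lfloor>real \<delta> * sqrt (real d ^ 2 - real d)\<rfloor>" by linarith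
  then have "\<delta> * d \<le> N1 d \<delta>" unfolding N1_def by linarith
  then show ?thesis using False by (auto simp: opt_N_def N2_def)
qed (simp add: opt_N_def)

text \<open>For \<open>\<eta> = 0\<close> the left-hand side is exactly \<open>\<psi> d \<delta> N\<close>, and it depends continuously on \<open>\<eta>\<close>.\<close>

lemma perturbed_exponent:
  fixes \<epsilon> :: real
  assumes N: "\<delta> * d \<le> N" "d \<ge> 1" and \<epsilon>: "\<epsilon> > 0"
  shows "\<exists>\<eta>>0. real (N + 1) - real (\<delta> * d) - real (\<delta> * d) * \<eta> > 0 \<and>
    real (Suc (N - \<delta>) * d - 1) + real (Suc (N - \<delta>) * d) * (real (\<delta> * d) * (1 + \<eta>)) * (1 + \<eta>)
      / (real (N + 1) - real (\<delta> * d) - real (\<delta> * d) * \<eta>) < \<psi> d \<delta> N + \<epsilon>"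
proof -
  define w where "w = (\<lambda>\<eta>. real (N + 1) - real (\<delta> * d) - real (\<delta> * d) * \<eta>)"
  define e where "e = (\<lambda>\<eta>. real (Suc (N - \<delta>) * d - 1) +
    real (Suc (N - \<delta>) * d) * (real (\<delta> * d) * (1 + \<eta>)) * (1 + \<eta>) / w \<eta>)"
  have w0: "w 0 > 0"
  proof -
    have "real (\<delta> * d) \<le> real N" using N(1) by (simp only: of_nat_le_iff)
    then show ?thesis by (simp add: w_def)
  qed
  have wlim: "(w \<longlongrightarrow> w 0) (at_right 0)" unfolding w_def by (intro tendsto_intros)
  have elim: "(e \<longlongrightarrow> e 0) (at_right 0)" unfolding e_def using w0 by (intro tendsto_intros wlim) auto
  have "\<delta> \<le> N" using N by (metis le_trans mult.right_neutral mult_le_mono2)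
  then have m: "real (Suc (N - \<delta>)) = real N - real \<delta> + 1" by simp
  have "real (Suc (N - \<delta>) * d - 1) = real (Suc (N - \<delta>) * d) - 1" using N(2) by (subst of_nat_diff) auto
  then have "e 0 = \<psi> d \<delta> N"
    unfolding e_def \<psi>_def w_def of_nat_mult m by (simp add: power2_eq_square algebra_simps)
  then have "e 0 < \<psi> d \<delta> N + \<epsilon>" using \<epsilon> by simp
  then have "eventually (\<lambda>\<eta>. \<eta> > 0 \<and> w \<eta> > 0 \<and> e \<eta> < \<psi> d \<delta> N + \<epsilon>) (at_right 0)"
    using order_tendstoD(1)[OF wlim w0] order_tendstoD(2)[OF elim]
    by (intro eventually_conj eventually_at_right_less)
  then have "\<exists>\<eta>. \<eta> > 0 \<and> w \<eta> > 0 \<and> e \<eta> < \<psi> d \<delta> N + \<epsilon>" by (rule eventually_happens'[rotated]) simp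
  then show ?thesis unfolding e_def w_def by blast
qed

text \<open>Take the least \<open>n\<close> for which the second term is at most one half. Then the first term is at least one
  half, and it remains to bound \<open>n!\<close> from above: the condition fails for \<open>n - 1\<close>, and \<open>n! = n * (n - 1)!\<close>
  is at most about \<open>(n - 1)! powr (1 + \<eta>)\<close>.\<close>

lemma optimal_index:
  fixes K a b e w \<eta> :: real
  assumes K: "K > 0" and w: "w > 0" and b: "b \<ge> 0" and e: "e \<ge> 0" and \<eta>: "\<eta> > 0"
  shows "\<exists>c>0. \<forall>H p. 1 \<le> H \<longrightarrow> 0 \<le> p \<longrightarrow>
    (\<forall>n\<ge>n0. 1 \<le> K * (p * (H powr a * fact n powr b) + H powr e * fact n powr (- w))) \<longrightarrow>
    c * H powr (- (a + e * b * (1 + \<eta>) / w)) \<le> p"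
proof -
  obtain c1 where c1: "c1 \<ge> 1" "\<And>n. 2 ^ n \<le> c1 * (fact n :: real) powr \<eta>"
    using power_le_fact_powr[of 2 \<eta>] \<eta> by auto
  define s where "s = e * (1 + \<eta>) / w"
  define c2 where "c2 = fact n0 + c1 * (2 * K) powr ((1 + \<eta>) / w)"
  have s: "s \<ge> 0" unfolding s_def using e \<eta> w by simp
  have c2: "c2 \<ge> 1" unfolding c2_def using c1(1) fact_ge_1[of n0, where ?'a = real] by (simp add: add_increasing2)
  define c where "c = c2 powr (- b) / (2 * K)"
  have c: "c > 0" unfolding c_def using c2 K by simp
  have main: "c * H powr (- (a + e * b * (1 + \<eta>) / w)) \<le> p"
    if H: "1 \<le> H" and p: "0 \<le> p"
      and ineq: "\<forall>n\<ge>n0. 1 \<le> K * (p * (H powr a * fact n powr b) + H powr e * fact n powr (- w))" for H p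
  proof -
    \<comment> \<open>The second term of the inequality is at most one half.\<close>
    define good where "good = (\<lambda>n. n \<ge> n0 \<and> 2 * K * H powr e \<le> fact n powr w)"
    have "\<exists>n. good n"
    proof -
      obtain n :: nat where n: "(2 * K * H powr e) powr (1 / w) \<le> real n" using real_arch_simple by blast
      have "real n \<le> real (max n n0)" by simp
      also have "\<dots> \<le> fact (max n n0)" using fact_ge_self[of "max n n0"] by (metis of_nat_fact of_nat_le_iff)
      finally have "((2 * K * H powr e) powr (1 / w)) powr w \<le> fact (max n n0) powr w"
        using n w by (intro powr_mono2) auto
      then show ?thesis unfolding good_def using w K H by (intro exI[of _ "max n n0"]) (simp add: powr_powr)
    qed
    then obtain n where n: "good n" "\<And>m. m < n \<Longrightarrow> \<not> good m" using exists_least_iff[of good] by blast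
    have u: "fact n \<le> c2 * H powr s"
    proof (cases "n = n0")
      case True
      have "fact n0 * 1 \<le> c2 * H powr s"
        using c1(1) H s ge_one_powr_ge_zero[of H s] by (intro mult_mono) (auto simp: c2_def)
      then show ?thesis using True by simp
    next
      case False
      then have "n > n0" using n(1) unfolding good_def by simp
      then obtain m where m: "n = Suc m" "m \<ge> n0" by (cases n) auto
      have "\<not> good m" using n(2)[of m] m(1) by simp
      then have "fact m powr w < 2 * K * H powr e" using m(2) unfolding good_def by simp
      then have "(fact m powr w) powr ((1 + \<eta>) / w) \<le> (2 * K * H powr e) powr ((1 + \<eta>) / w)"
        using w \<eta> by (intro powr_mono2) auto
      then have fm: "fact m powr (1 + \<eta>) \<le> (2 * K) powr ((1 + \<eta>) / w) * H powr s"
        using w K H by (simp add: powr_powr powr_mult s_def)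
      have "fact n = (real (Suc m)) * fact m" unfolding m(1) by simp
      also have "\<dots> \<le> 2 ^ m * fact m"
      proof (rule mult_right_mono)
        have "Suc m \<le> 2 ^ m" by (simp only: Suc_le_eq less_exp)
        then have "real (Suc m) \<le> real (2 ^ m)" by (simp only: of_nat_le_iff)
        then show "real (Suc m) \<le> 2 ^ m" by simp
      qed simp
      also have "\<dots> \<le> (c1 * fact m powr \<eta>) * fact m" by (intro mult_right_mono c1(2)) simp
      also have "\<dots> = c1 * fact m powr (1 + \<eta>)" by (simp add: powr_add)
      also have "\<dots> \<le> c1 * ((2 * K) powr ((1 + \<eta>) / w) * H powr s)" using fm c1(1) by simp
      also have "\<dots> \<le> c2 * H powr s" unfolding c2_def by (simp add: distrib_right)
      finally show ?thesis .
    qed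
    have small: "K * (H powr e * fact n powr (- w)) \<le> 1 / 2"
      using n(1) unfolding good_def by (simp add: powr_minus field_simps)
    have "1 \<le> K * (p * (H powr a * fact n powr b) + H powr e * fact n powr (- w))"
      using ineq n(1) unfolding good_def by blast
    then have half: "1 / 2 \<le> K * (p * (H powr a * fact n powr b))" using small unfolding distrib_left by linarith
    have "fact n powr b \<le> (c2 * H powr s) powr b" using u b by (intro powr_mono2) auto
    also have "\<dots> = c2 powr b * H powr (s * b)" using c2 H by (simp add: powr_mult powr_powr)
    finally have fb: "fact n powr b \<le> c2 powr b * H powr (s * b)" .
    have "K * (p * (H powr a * fact n powr b)) \<le> K * (p * (H powr a * (c2 powr b * H powr (s * b))))"
      using fb K p by (intro mult_left_mono) auto
    then have "1 / 2 \<le> K * (p * (H powr a * (c2 powr b * H powr (s * b))))"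
      using half by linarith
    also have "\<dots> = K * c2 powr b * H powr (a + s * b) * p" by (simp add: powr_add mult_ac)
    finally have "1 / 2 \<le> K * c2 powr b * H powr (a + s * b) * p" .
    moreover have "0 < K * c2 powr b * H powr (a + s * b)" using K c2 H by simp
    ultimately have "1 / 2 / (K * c2 powr b * H powr (a + s * b)) \<le> p"
      by (simp only: pos_divide_le_eq mult.commute)
    then have "c2 powr (- b) / (2 * K) * H powr (- (a + s * b)) \<le> p"
      unfolding powr_minus by (simp only: divide_inverse inverse_mult_distrib mult_1_left mult_ac)
    moreover have "s * b = e * b * (1 + \<eta>) / w" by (simp add: s_def mult_ac)
    ultimately show ?thesis by (simp add: c_def)
  qed
  then show ?thesis using c by blast
qed

lemma power_products:
  fixes x y :: real
  shows "(x ^ m * y ^ l) ^ k * (x ^ i * y ^ j) = x ^ (m * k + i) * y ^ (l * k + j)"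
  unfolding power_mult_distrib power_add power_mult by (simp only: mult_ac)

context order_gen
begin

section \<open>The lower bound over a field with an explicit generator\<close>

text \<open>With \<open>m = N - \<delta> + 1\<close> and \<open>u = n!\<close>, the determinant inequality for the small forms of index \<open>n\<close> reads,
  up to powers of \<open>u\<close> with small exponents,
  \<open>1 \<le> const * (p * H ^ (m * d - 1) * u ^ (\<delta> * d) + H ^ (m * d) * u ^ (\<delta> * d - N - 1))\<close>
  for \<open>p = norm P(f \<alpha>)\<close>. The exponent of \<open>u\<close> in the second term is negative because of \<open>N \<ge> \<delta> * d\<close>.\<close>

lemma lower_bound:
  assumes E: "E_function f" and fL: "\<And>n. fps_nth f n \<in> rat_adjoin \<theta>"
    and A: "A \<noteq> 0" and ode: "fps_of_poly A * fps_deriv f = fps_of_poly B * f + fps_of_poly C"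
    and tr: "transcendental_fps f"
    and ABC: "\<And>l. sized S (coeff A l)" "\<And>l. sized S (coeff B l)" "\<And>l. sized S (coeff C l)" and S: "S \<ge> 1"
    and \<alpha>: "\<alpha> \<noteq> 0" "poly A \<alpha> \<noteq> 0" and a: "sized a (of_nat b * \<alpha>)" "a \<ge> 1" and b: "b \<ge> 1"
    and \<epsilon>: "\<epsilon> > 0" and \<delta>: "\<delta> \<ge> 1"
  shows "\<exists>c>0. \<forall>H (P :: int poly). 1 \<le> H \<longrightarrow> P \<noteq> 0 \<longrightarrow> degree P \<le> \<delta> \<longrightarrow>
    (\<forall>i. \<bar>real_of_int (coeff P i)\<bar> \<le> H) \<longrightarrow>
    c * H powr (- (\<mu> d \<delta> + \<epsilon>)) \<le> norm (poly (map_poly of_int P) (eval_fps f \<alpha>))"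
proof -
  define N where "N = opt_N d \<delta>"
  have d1: "d \<ge> 1" using d_pos by simp
  have Nd: "\<delta> * d \<le> N" unfolding N_def by (rule opt_N_ge[OF d1 \<delta>])
  have "\<delta> * 1 \<le> \<delta> * d" by (rule mult_le_mono2[OF d1])
  then have N\<delta>: "\<delta> \<le> N" using Nd by linarith
  define m where "m = Suc (N - \<delta>)"
  obtain \<eta> where \<eta>: "\<eta> > 0" "real (N + 1) - real (\<delta> * d) - real (\<delta> * d) * \<eta> > 0"
    "real (m * d - 1) + real (m * d) * (real (\<delta> * d) * (1 + \<eta>)) * (1 + \<eta>)
      / (real (N + 1) - real (\<delta> * d) - real (\<delta> * d) * \<eta>) < \<psi> d \<delta> N + \<epsilon>"
    using perturbed_exponent[OF Nd d1 \<epsilon>] unfolding m_def by blast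
  define w where "w = real (N + 1) - real (\<delta> * d) - real (\<delta> * d) * \<eta>"
  define h where "h = real (\<delta> * d) * (1 + \<eta>)"
  obtain c0 n0 where c0: "c0 \<ge> 1" "\<forall>n\<ge>n0. \<exists>V. (\<forall>P. degree P \<le> N \<longrightarrow> P \<in> cpoly_vs.span V) \<and>
    (\<forall>r\<in>V. degree r \<le> N \<and> (\<forall>i. sized (c0 * fact n powr (1 + \<eta>)) (coeff r i)) \<and>
      norm (poly r (eval_fps f \<alpha>)) \<le> c0 * fact n powr (\<eta> - real N))"
    using small_forms[OF E fL A ode tr ABC S \<alpha> a b \<eta>(1), of N] by blast
  obtain C0 where C0: "C0 > 0" "\<forall>(P :: int poly) V H U1 U2. P \<noteq> 0 \<longrightarrow> degree P \<le> \<delta> \<longrightarrow>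
    (\<forall>i. \<bar>real_of_int (coeff P i)\<bar> \<le> H) \<longrightarrow> 1 \<le> H \<longrightarrow> 1 \<le> U1 \<longrightarrow>
    (\<forall>p. degree p \<le> N \<longrightarrow> p \<in> cpoly_vs.span V) \<longrightarrow>
    (\<forall>r\<in>V. degree r \<le> N \<and> (\<forall>i. sized U1 (coeff r i)) \<and> norm (poly r (eval_fps f \<alpha>)) \<le> U2) \<longrightarrow>
    1 \<le> C0 * (H ^ (N - \<delta> + 1) * U1 ^ \<delta>) ^ (d - 1) *
      (norm (poly (map_poly of_int P) (eval_fps f \<alpha>)) * (H ^ (N - \<delta>) * U1 ^ \<delta>) + U2 * (H ^ (N - \<delta> + 1) * U1 ^ (\<delta> - 1)))"
    using determinant_inequality[OF \<delta> N\<delta>, of "eval_fps f \<alpha>"] by blast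
  define K where "K = C0 * c0 ^ (\<delta> * d)"
  have K: "K > 0" unfolding K_def using C0(1) c0(1) by simp
  have h: "h \<ge> 0" unfolding h_def using \<eta>(1) by simp
  obtain c where c: "c > 0" "\<forall>H p. 1 \<le> H \<longrightarrow> 0 \<le> p \<longrightarrow>
    (\<forall>n\<ge>n0. 1 \<le> K * (p * (H powr real (m * d - 1) * fact n powr h) + H powr real (m * d) * fact n powr (- w))) \<longrightarrow>
    c * H powr (- (real (m * d - 1) + real (m * d) * h * (1 + \<eta>) / w)) \<le> p"
    using optimal_index[OF K \<eta>(2)[folded w_def] h, of "real (m * d)" \<eta> n0 "real (m * d - 1)"] \<eta>(1) by auto
  have "c * H powr (- (\<mu> d \<delta> + \<epsilon>)) \<le> norm (poly (map_poly of_int P) (eval_fps f \<alpha>))"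
    if H: "1 \<le> H" and P: "P \<noteq> 0" "degree P \<le> \<delta>" "\<forall>i. \<bar>real_of_int (coeff P i)\<bar> \<le> H"
    for H and P :: "int poly"
  proof -
    define p where "p = norm (poly (map_poly of_int P) (eval_fps f \<alpha>))"
    have p0: "0 \<le> p" by (simp add: p_def)
    have "1 \<le> K * (p * (H powr real (m * d - 1) * fact n powr h) + H powr real (m * d) * fact n powr (- w))"
      if n: "n \<ge> n0" for n
    proof -
      define u where "u = (fact n :: real)"
      define U where "U = c0 * u powr (1 + \<eta>)"
      have u: "u \<ge> 1" by (simp add: u_def)
      have upow: "(u powr x) ^ k = u powr (x * real k)" for x k
        using u by (simp add: powr_realpow[symmetric] powr_powr)
      have U1: "1 \<le> U"
        unfolding U_def u_def using mult_mono[of 1 c0 1 "fact n powr (1 + \<eta>)"] c0(1) fact_powr_ge_1[of "1 + \<eta>" n] \<eta>(1) by simp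
      obtain V where V: "\<forall>P. degree P \<le> N \<longrightarrow> P \<in> cpoly_vs.span V"
        "\<forall>r\<in>V. degree r \<le> N \<and> (\<forall>i. sized U (coeff r i)) \<and> norm (poly r (eval_fps f \<alpha>)) \<le> c0 * u powr (\<eta> - real N)"
        using c0(2) n unfolding U_def u_def by blast
      have "1 \<le> C0 * (H ^ (N - \<delta> + 1) * U ^ \<delta>) ^ (d - 1) *
        (p * (H ^ (N - \<delta>) * U ^ \<delta>) + c0 * u powr (\<eta> - real N) * (H ^ (N - \<delta> + 1) * U ^ (\<delta> - 1)))"
        unfolding p_def by (rule C0(2)[rule_format]) (use P H U1 V in auto)
      also have "\<dots> = C0 * (p * ((H ^ m * U ^ \<delta>) ^ (d - 1) * (H ^ (N - \<delta>) * U ^ \<delta>)) +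
          c0 * u powr (\<eta> - real N) * ((H ^ m * U ^ \<delta>) ^ (d - 1) * (H ^ m * U ^ (\<delta> - 1))))"
        by (simp add: m_def algebra_simps)
      finally have ineq: "1 \<le> C0 * (p * ((H ^ m * U ^ \<delta>) ^ (d - 1) * (H ^ (N - \<delta>) * U ^ \<delta>)) +
          c0 * u powr (\<eta> - real N) * ((H ^ m * U ^ \<delta>) ^ (d - 1) * (H ^ m * U ^ (\<delta> - 1))))" .
      have e1: "(H ^ m * U ^ \<delta>) ^ (d - 1) * (H ^ (N - \<delta>) * U ^ \<delta>) = H ^ (m * d - 1) * U ^ (\<delta> * d)"
      proof -
        have "m * (d - 1) + (N - \<delta>) = m * d - 1" "\<delta> * (d - 1) + \<delta> = \<delta> * d"
          using d1 unfolding m_def by (cases d; simp)+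
        then show ?thesis by (simp only: power_products)
      qed
      have e2: "(H ^ m * U ^ \<delta>) ^ (d - 1) * (H ^ m * U ^ (\<delta> - 1)) = H ^ (m * d) * U ^ (\<delta> * d - 1)"
      proof -
        have "m * (d - 1) + m = m * d" "\<delta> * (d - 1) + (\<delta> - 1) = \<delta> * d - 1"
          using d1 \<delta> by (cases d; simp)+
        then show ?thesis by (simp only: power_products)
      qed
      have e3: "U ^ (\<delta> * d) = c0 ^ (\<delta> * d) * u powr h"
        unfolding U_def h_def power_mult_distrib upow by (simp only: mult.commute)
      have e4: "c0 * u powr (\<eta> - real N) * (H ^ (m * d) * U ^ (\<delta> * d - 1)) = c0 ^ (\<delta> * d) * (H ^ (m * d) * u powr (- w))"
      proof -
        have dd: "\<delta> * d = Suc (\<delta> * d - 1)" using \<delta> d1 by simp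
        have r: "real (\<delta> * d - 1) = real (\<delta> * d) - 1" using \<delta> d1 by (subst of_nat_diff) auto
        have "U ^ (\<delta> * d - 1) = c0 ^ (\<delta> * d - 1) * u powr ((real (\<delta> * d) - 1) * (1 + \<eta>))"
          unfolding U_def power_mult_distrib upow r by (simp only: mult.commute)
        moreover have "u powr (\<eta> - real N) * u powr ((real (\<delta> * d) - 1) * (1 + \<eta>)) = u powr (- w)"
          unfolding powr_add[symmetric] w_def by (rule arg_cong[of _ _ "(powr) u"]) (simp add: algebra_simps)
        moreover have "c0 ^ (\<delta> * d) = c0 * c0 ^ (\<delta> * d - 1)" by (subst dd) simp
        moreover have "c0 * x * (q * (k * z)) = (c0 * k) * (q * (x * z))" for x q k z :: real by (simp only: mult_ac)
        ultimately show ?thesis by simp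
      qed
      have "C0 * (p * (H ^ (m * d - 1) * (c0 ^ (\<delta> * d) * u powr h)) + c0 ^ (\<delta> * d) * (H ^ (m * d) * u powr (- w)))
        = K * (p * (H ^ (m * d - 1) * u powr h) + H ^ (m * d) * u powr (- w))"
        unfolding K_def by (simp only: distrib_left mult_ac)
      with ineq have ineq': "1 \<le> K * (p * (H ^ (m * d - 1) * u powr h) + H ^ (m * d) * u powr (- w))"
        unfolding e1 e2 e3 e4 by (rule ord_le_eq_trans)
      have "0 < H" using H by simp
      then show ?thesis using ineq' unfolding u_def by (simp only: powr_realpow)
    qed
    then have "c * H powr (- (real (m * d - 1) + real (m * d) * h * (1 + \<eta>) / w)) \<le> p"
      using c(2) H p0 by blast
    moreover have "H powr (- (\<mu> d \<delta> + \<epsilon>)) \<le> H powr (- (real (m * d - 1) + real (m * d) * h * (1 + \<eta>) / w))"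
      using H \<eta>(3) unfolding \<mu>_def N_def[symmetric] w_def h_def by (intro powr_mono) auto
    ultimately show ?thesis unfolding p_def using c(1) mult_left_mono[of "H powr (- (\<mu> d \<delta> + \<epsilon>))" _ c] by (meson less_imp_le order.trans)
  qed
  then show ?thesis using c(1) by blast
qed

end

section \<open>Reduction from an arbitrary number field\<close>

theorem theorem2:
  fixes K :: "complex set" and f :: "complex fps" and A B C :: "complex poly"
    and \<alpha> :: complex and d \<delta> :: nat and \<epsilon> :: real
  assumes "number_field K" and "\<forall>x\<in>K. algebraic x"
    and "\<forall>n. fps_nth f n \<in> K"
    and "E_function f"
    and "\<forall>i. coeff A i \<in> K" and "\<forall>i. coeff B i \<in> K" and "\<forall>i. coeff C i \<in> K"
    and "A \<noteq> 0"
    and "fps_of_poly A * fps_deriv f = fps_of_poly B * f + fps_of_poly C"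
    and "transcendental_series f"
    and "algebraic \<alpha>" and "\<alpha> * poly A \<alpha> \<noteq> 0"
    and "d = field_degree (adjoin K \<alpha>)"
    and "\<epsilon> > 0" and "\<delta> \<ge> 1"
  shows "\<exists>c>0. \<forall>H::real. H \<ge> 1 \<longrightarrow>
    (\<forall>P::int poly. P \<noteq> 0 \<and> degree P \<le> \<delta> \<and> real_of_int (poly_height P) \<le> H \<longrightarrow>
       norm (poly (map_poly of_int P) (eval_fps f \<alpha>)) > c / H powr (\<mu> d \<delta> + \<epsilon>))"
proof -
  obtain \<theta> g where \<theta>: "order_gen \<theta> g" "adjoin K \<alpha> = rat_adjoin \<theta>"
    using adjoin_eq_rat_adjoin[OF assms(1,2,11)] by blast
  interpret og: order_gen \<theta> g by (rule \<theta>(1))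
  have d: "d = og.d" using assms(13) \<theta>(2) og.field_degree_rat_adjoin by simp
  have "insert \<alpha> K \<subseteq> adjoin K \<alpha>" unfolding adjoin_def by (rule hull_subset)
  then have KL: "K \<subseteq> rat_adjoin \<theta>" and \<alpha>L: "\<alpha> \<in> rat_adjoin \<theta>" unfolding \<theta>(2) by auto
  have K: "is_subfield K" using assms(1) unfolding number_field_def by simp
  have tr: "transcendental_fps f"
    by (rule transcendental_fps_descent[OF K _ _ assms(10)]) (use assms(2,3) in auto)
  define X where "X = insert \<alpha> (insert 0 ((coeff A ` {..degree A}) \<union> (coeff B ` {..degree B}) \<union> (coeff C ` {..degree C})))"
  have "coeff Q l \<in> insert 0 (coeff Q ` {..degree Q})" for Q :: "complex poly" and l
    by (cases "l \<le> degree Q") (auto simp: coeff_eq_0)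
  then have X: "coeff A l \<in> X" "coeff B l \<in> X" "coeff C l \<in> X" for l
    unfolding X_def by blast+
  have "X \<subseteq> insert \<alpha> K" unfolding X_def using assms(5-7) subfield_closed(1)[OF K] by auto
  then have XL: "X \<subseteq> rat_adjoin \<theta>" "\<And>x. x \<in> X \<Longrightarrow> algebraic x" using KL \<alpha>L assms(2,11) by auto
  have "finite X" unfolding X_def by simp
  then obtain D :: nat and T where D: "D \<ge> 1" "T \<ge> 1" "\<forall>x\<in>X. og.sized T (of_nat D * x)"
    using og.common_size[OF _ XL] by blast
  have ode: "fps_of_poly (smult (of_nat D) A) * fps_deriv f = fps_of_poly (smult (of_nat D) B) * f + fps_of_poly (smult (of_nat D) C)"
  proof -
    have "fps_const (of_nat D) * (fps_of_poly A * fps_deriv f) = fps_const (of_nat D) * (fps_of_poly B * f + fps_of_poly C)"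
      using assms(9) by simp
    then show ?thesis by (simp only: fps_of_poly_smult distrib_left mult.assoc)
  qed
  have nz: "smult (of_nat D) A \<noteq> 0" "poly (smult (of_nat D) A) \<alpha> \<noteq> 0" "\<alpha> \<noteq> 0" using assms(8,12) D(1) by auto
  have szX: "og.sized T (coeff (smult (of_nat D) A) l)" "og.sized T (coeff (smult (of_nat D) B) l)"
    "og.sized T (coeff (smult (of_nat D) C) l)" for l
    using D(3) X by auto
  have sz\<alpha>: "og.sized T (of_nat D * \<alpha>)" using D(3) by (simp add: X_def)
  have fL: "fps_nth f n \<in> rat_adjoin \<theta>" for n using assms(3) KL by auto
  obtain c where c: "c > 0" "\<forall>H (P :: int poly). 1 \<le> H \<longrightarrow> P \<noteq> 0 \<longrightarrow> degree P \<le> \<delta> \<longrightarrow>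
    (\<forall>i. \<bar>real_of_int (coeff P i)\<bar> \<le> H) \<longrightarrow>
    c * H powr (- (\<mu> og.d \<delta> + \<epsilon>)) \<le> norm (poly (map_poly of_int P) (eval_fps f \<alpha>))"
    using og.lower_bound[OF assms(4) fL nz(1) ode tr szX D(2) nz(3) nz(2) sz\<alpha> D(2,1) assms(14,15)] by blast
  \<comment> \<open>Halving the constant makes the inequality strict.\<close>
  have "norm (poly (map_poly of_int P) (eval_fps f \<alpha>)) > c / 2 / H powr (\<mu> d \<delta> + \<epsilon>)"
    if H: "H \<ge> 1" and P: "P \<noteq> 0" "degree P \<le> \<delta>" "real_of_int (poly_height P) \<le> H" for H and P :: "int poly"
  proof -
    have "\<bar>real_of_int (coeff P i)\<bar> \<le> H" for i
    proof (cases "i \<le> degree P")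
      case True
      then have "\<bar>coeff P i\<bar> \<le> poly_height P" unfolding poly_height_def by (intro Max_ge) auto
      then show ?thesis using P(3) by linarith
    qed (use H in \<open>simp add: coeff_eq_0\<close>)
    then have "c * H powr (- (\<mu> d \<delta> + \<epsilon>)) \<le> norm (poly (map_poly of_int P) (eval_fps f \<alpha>))"
      using c(2) H P(1,2) unfolding d by blast
    moreover have "c / 2 / H powr (\<mu> d \<delta> + \<epsilon>) < c * H powr (- (\<mu> d \<delta> + \<epsilon>))"
      unfolding powr_minus divide_inverse[symmetric, of c] using c(1) H by (intro divide_strict_right_mono) auto
    ultimately show ?thesis by linarith
  qed
  then show ?thesis using c(1) by (intro exI[of _ "c / 2"]) auto
qed

end
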